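(* Let $\alpha,\beta\ge-\tfrac12$. Assume $\{a_j\}_{j\in\mathbb Z}$ is a $\rho$-lacunary sequence in $(0,\infty)$ with $\rho>1$ and $\{b_j\}_{j\in\mathbb Z}$ is a bounded sequence of real numbers. For every $N=(N_1,N_2)\in\mathbb Z^2$ with $N_1<N_2$, the operator $S_{\{a_j\},N}^{\{b_j\}}(\{W_t^{(\alpha,\beta)}\}_{t>0})$ is bounded from $\ell^p(\mathbb N_0,w)$ into itself for every $1<p<\infty$ and $w\in A_p(\mathbb N_0)$, and from $\ell^1(\mathbb N_0,w)$ into $\ell^{1,\infty}(\mathbb N_0,w)$ for every $w\in A_1(\mathbb N_0)$. Moreover, for every $1<p<\infty$ and $w\in A_p(\mathbb N_0)$, $$\sup_{N_1<N_2}\big\|S_{\{a_j\},N}^{\{b_j\}}(\{W_t^{(\alpha,\beta)}\}_{t>0})\big\|_{\ell^p(\mathbb N_0,w)\to\ell^p(\mathbb N_0,w)}<\infty,$$ and for every $w\in A_1(\mathbb N_0)$, $$\sup_{N_1<N_2}\big\|S_{\{a_j\},N}^{\{b_j\}}(\{W_t^{(\alpha,\beta)}\}_{t>0})\big\|_{\ell^1(\mathbb N_0,w)\to\ell^{1,\infty}(\mathbb N_0,w)}<\infty.$$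
   Context: Let $\alpha,\beta>-1$, $d\mu_{\alpha,\beta}(x)=(1-x)^\alpha(1+x)^\beta dx$ on $(-1,1)$, $P_n^{(\alpha,\beta)}$ the Jacobi polynomials, and $p_n^{(\alpha,\beta)}$ their positive multiples forming an orthonormal basis of $L^2((-1,1),\mu_{\alpha,\beta})$. The discrete Jacobi heat semigroup is $W_t^{(\alpha,\beta)}=e^{tJ^{(\alpha,\beta)}}$, with $J^{(\alpha,\beta)}$ the Jacobi matrix satisfying $J^{(\alpha,\beta)}(\{p_n^{(\alpha,\beta)}(x)\}_n)(n)=(x-1)p_n^{(\alpha,\beta)}(x)$; explicitly $W_t^{(\alpha,\beta)}f(n)=\sum_{m\ge0}f(m)K_t^{(\alpha,\beta)}(n,m)$, $K_t^{(\alpha,\beta)}(n,m)=\int_{-1}^1e^{-t(1-x)}p_n^{(\alpha,\beta)}(x)p_m^{(\alpha,\beta)}(x)d\mu_{\alpha,\beta}(x)$. $\{a_j\}$ is $\rho$-lacunary if $a_{j+1}/a_j\ge\rho$ for all $j\in\mathbb Z$. For $N=(N_1,N_2)$, $N_1<N_2$: $S_{\{a_j\},N}^{\{b_j\}}(\{W_t^{(\alpha,\beta)}\})(f)=\sum_{j=N_1}^{N_2}b_j(W_{a_{j+1}}^{(\alpha,\beta)}f-W_{a_j}^{(\alpha,\beta)}f)$. $A_p(\mathbb N_0)$ ($1<p<\infty$): positive $w$ with $\sup_{0\le n\le m}(m-n+1)^{-p}(\sum_{k=n}^mw_k)(\sum_{k=n}^mw_k^{-1/(p-1)})^{p-1}<\infty$;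 $A_1(\mathbb N_0)$: $\sup_{0\le n\le m}(m-n+1)^{-1}(\sum_{k=n}^mw_k)\max_{n\le k\le m}w_k^{-1}<\infty$. $\ell^p(\mathbb N_0,w)$: weighted $\ell^p$; $\ell^{1,\infty}(\mathbb N_0,w)$: weighted weak-$\ell^1$. *)

theory Defs
  imports "HOL-Analysis.Analysis"
begin

definition jacobiP :: "real \<Rightarrow> real \<Rightarrow> nat \<Rightarrow> real \<Rightarrow> real" where
  "jacobiP al be n x =
     (\<Sum>s=0..n. ((real n + al) gchoose (n - s)) * ((real n + be) gchoose s)
                 * ((x - 1) / 2) ^ s * ((x + 1) / 2) ^ (n - s))"

definition jacobi_weight :: "real \<Rightarrow> real \<Rightarrow> real \<Rightarrow> real" where
  "jacobi_weight al be x = (1 - x) powr al * (1 + x) powr be"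

definition jacobi_L2norm :: "real \<Rightarrow> real \<Rightarrow> nat \<Rightarrow> real" where
  "jacobi_L2norm al be n =
     sqrt (LINT x:{-1<..<1}|lborel. (jacobiP al be n x)\<^sup>2 * jacobi_weight al be x)"

definition jacobi_p :: "real \<Rightarrow> real \<Rightarrow> nat \<Rightarrow> real \<Rightarrow> real" where
  "jacobi_p al be n x = jacobiP al be n x / jacobi_L2norm al be n"

definition jacobi_heat_kernel :: "real \<Rightarrow> real \<Rightarrow> real \<Rightarrow> nat \<Rightarrow> nat \<Rightarrow> real" where
  "jacobi_heat_kernel al be t n m =
     (LINT x:{-1<..<1}|lborel.
        exp (- t * (1 - x)) * jacobi_p al be n x * jacobi_p al be m x * jacobi_weight al be x)"

definition jacobi_heat :: "real \<Rightarrow> real \<Rightarrow> real \<Rightarrow> (nat \<Rightarrow> real) \<Rightarrow> nat \<Rightarrow> real" where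
  "jacobi_heat al be t f n = (\<Sum>m. f m * jacobi_heat_kernel al be t n m)"

definition S_op :: "real \<Rightarrow> real \<Rightarrow> (int \<Rightarrow> real) \<Rightarrow> (int \<Rightarrow> real) \<Rightarrow> int \<Rightarrow> int
                    \<Rightarrow> (nat \<Rightarrow> real) \<Rightarrow> nat \<Rightarrow> real" where
  "S_op al be a b N1 N2 f n =
     (\<Sum>j\<in>{N1..N2}. b j * (jacobi_heat al be (a (j + 1)) f n - jacobi_heat al be (a j) f n))"

definition lacunary :: "real \<Rightarrow> (int \<Rightarrow> real) \<Rightarrow> bool" where
  "lacunary \<rho> a \<longleftrightarrow> (\<forall>j. a (j + 1) / a j \<ge> \<rho>)"

definition Ap_weight :: "real \<Rightarrow> (nat \<Rightarrow> real) \<Rightarrow> bool" where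
  "Ap_weight p w \<longleftrightarrow> (\<forall>k. w k > 0) \<and>
     (\<exists>C. \<forall>n m. n \<le> m \<longrightarrow>
        (\<Sum>k=n..m. w k) * (\<Sum>k=n..m. w k powr (-1 / (p - 1))) powr (p - 1)
          / real (m - n + 1) powr p \<le> C)"

definition A1_weight :: "(nat \<Rightarrow> real) \<Rightarrow> bool" where
  "A1_weight w \<longleftrightarrow> (\<forall>k. w k > 0) \<and>
     (\<exists>C. \<forall>n m. n \<le> m \<longrightarrow>
        (\<Sum>k=n..m. w k) * (MAX k\<in>{n..m}. 1 / w k) / real (m - n + 1) \<le> C)"

definition in_lp :: "real \<Rightarrow> (nat \<Rightarrow> real) \<Rightarrow> (nat \<Rightarrow> real) \<Rightarrow> bool" where
  "in_lp p w f \<longleftrightarrow> summable (\<lambda>n. \<bar>f n\<bar> powr p * w n)"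

definition lp_norm :: "real \<Rightarrow> (nat \<Rightarrow> real) \<Rightarrow> (nat \<Rightarrow> real) \<Rightarrow> real" where
  "lp_norm p w f = (\<Sum>n. \<bar>f n\<bar> powr p * w n) powr (1 / p)"

definition weak_l1_norm :: "(nat \<Rightarrow> real) \<Rightarrow> (nat \<Rightarrow> real) \<Rightarrow> ennreal" where
  "weak_l1_norm w g =
     (SUP s\<in>{0<..}. ennreal s * (\<Sum>\<^sub>\<infinity> n\<in>{n. s < \<bar>g n\<bar>}. ennreal (w n)))"

end

(* The derivative in t of the heat kernel K_t(n,m) is -k_t(n,m), where k_t(n,m) is the integral of
   (1-x) exp(-t(1-x)) p_n(x) p_m(x). Commuting multiplication by a function of x twice with the
   Jacobi differential operator, whose eigenvalues satisfy l_n - l_m = (n-m)(n+m+al+be+1), turns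
   Sonin-type pointwise bounds for p_n into
     |k_t(n,m)| <= C / (sqrt t (t + (n-m)^2)),
   and a unit step in n gains a factor 1/sqrt t + 1/n. Both majorants are dominated by the
   t-derivative of an increasing bounded function (an arctangent), so telescoping along any
   increasing a_j bounds the kernel of S by a total variation, uniformly in N: it has size 1/|n-m|
   and is Hoelder continuous of order 1/2 as long as |n-m| is at most a multiple of min(n,n').
   Where |n-m| is comparable to n+m the size bound is that of a Hardy operator, and a Lipschitz cutoff
   separates the two regimes. The multiplier of S is bounded by sup |b_j|, which gives the l^2 bound.
   The A_1 weak type then comes from a Calderon-Zygmund decomposition, the A_p bound from pairing the oscillation of Tf on dyadic intervals with the
   w-weighted maximal function of the dual function and from Muckenhoupt's theorem. *)

theory Submission
  imports Defs
begin

section \<open>Jacobi polynomials\<close>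

text \<open>The endpoint x = 1 decides everything: on x \<le> 1/2 the factor exp(-t(1-x)) is at most
  exp(-t/2) and orthonormality suffices, so pointwise bounds for p_n are proved on [1/2, 1) only.
  There al \<ge> -1/2 fixes the sign of the leading term in the derivative of Sonin's function.

  Derivatives cost no new estimates: p_n' is sqrt(l_n) times a normalised polynomial with parameters
  (al + 1, be + 1), so each bound is proved for general parameters and reused with shifted ones.

  The obstacle to Lipschitz regularity is small t. A unit step in n is bounded by a quantity of
  order 1/t as t tends to 0, which has no bounded primitive. Its geometric mean with the size bound
  is of order t^(-3/4) and has one; this is the origin of the exponent 1/2 and of the fourth root of
  t inside the arctangent.

  All operator bounds are proved for f supported in m < R and summed over n < N. The sums are then
  finite, so a part of the left-hand side may be absorbed, and the limits in R and N are taken only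
  at the end.\<close>

lemma jacobiP_0 [simp]: "jacobiP al be 0 x = 1"
  by (simp add: jacobiP_def)

lemma gbinomial_step: "(a - real k) * (a gchoose k) = real (Suc k) * (a gchoose Suc k)" for a :: real
  using gbinomial_mult_1[of a k] by (simp add: algebra_simps)

text \<open>Given through the raised parameters instead of term by term: the shift to
  \<open>(al + 1, be + 1)\<close> is what later carries norms and pointwise bounds over to
  derivatives.\<close>

definition jacobiD :: "real \<Rightarrow> real \<Rightarrow> nat \<Rightarrow> real \<Rightarrow> real" where
  "jacobiD al be n x = (case n of 0 \<Rightarrow> 0 | Suc k \<Rightarrow> (real n + al + be + 1) / 2 * jacobiP (al + 1) (be + 1) k x)"

lemma jacobiP_alt:
  "jacobiP al be n x = (\<Sum>s\<le>n. ((real n + al) gchoose (n - s)) * ((real n + be) gchoose s)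
                 * ((x - 1) / 2) ^ s * ((x + 1) / 2) ^ (n - s))"
  unfolding jacobiP_def by (simp add: atLeast0AtMost)

lemma jacobiP_raw_deriv:
  "(jacobiP al be n has_real_derivative
     (\<Sum>s\<le>n. ((real n + al) gchoose (n - s)) * ((real n + be) gchoose s) / 2
        * (real s * ((x - 1) / 2) ^ (s - 1) * ((x + 1) / 2) ^ (n - s)
           + real (n - s) * ((x - 1) / 2) ^ s * ((x + 1) / 2) ^ (n - s - 1)))) (at x)"
proof -
  have "((\<lambda>x. \<Sum>s\<le>n. ((real n + al) gchoose (n - s)) * ((real n + be) gchoose s)
                 * ((x - 1) / 2) ^ s * ((x + 1) / 2) ^ (n - s)) has_real_derivative
     (\<Sum>s\<le>n. ((real n + al) gchoose (n - s)) * ((real n + be) gchoose s) / 2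
        * (real s * ((x - 1) / 2) ^ (s - 1) * ((x + 1) / 2) ^ (n - s)
           + real (n - s) * ((x - 1) / 2) ^ s * ((x + 1) / 2) ^ (n - s - 1)))) (at x)"
    by (intro DERIV_sum) (rule derivative_eq_intros refl | simp add: field_simps)+
  then show ?thesis unfolding jacobiP_alt[abs_def] .
qed

lemma sum_shift_lower:
  fixes c :: "nat \<Rightarrow> real"
  shows "(\<Sum>s\<le>Suc k. real s * c s) = (\<Sum>s\<le>k. real (Suc s) * c (Suc s))"
  by (subst sum.atMost_Suc_shift) simp

text \<open>Differentiating one power lowers s, differentiating the other lowers n - s.
  \<open>gbinomial_step\<close> brings both sums to the same products
  \<open>A (k - s) * B s\<close>, and the two coefficients add up to a + b - k, which no longer
  depends on s.\<close>

lemma jacobiP_deriv: "(jacobiP al be n has_real_derivative jacobiD al be n x) (at x)"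
proof (cases n)
  case 0
  then show ?thesis by (simp add: jacobiD_def jacobiP_0[abs_def])
next
  case (Suc k)
  define u v where "u = (x - 1) / 2" and "v = (x + 1) / 2"
  define a b where "a = real n + al" and "b = real n + be"
  define A B where "A j = a gchoose j" and "B j = b gchoose j" for j
  have A: "(a - real j) * A j = real (Suc j) * A (Suc j)" for j unfolding A_def by (rule gbinomial_step)
  have B: "(b - real j) * B j = real (Suc j) * B (Suc j)" for j unfolding B_def by (rule gbinomial_step)
  have "(\<Sum>s\<le>n. A (n - s) * B s / 2 * (real s * u ^ (s - 1) * v ^ (n - s) + real (n - s) * u ^ s * v ^ (n - s - 1)))
     = (\<Sum>s\<le>Suc k. real s * (A (Suc k - s) * B s / 2 * u ^ (s - 1) * v ^ (Suc k - s)))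
       + (\<Sum>s\<le>Suc k. A (Suc k - s) * B s / 2 * (real (Suc k - s) * u ^ s * v ^ (k - s)))"
    unfolding Suc sum.distrib[symmetric] by (intro sum.cong) (auto simp: algebra_simps)
  also have "(\<Sum>s\<le>Suc k. real s * (A (Suc k - s) * B s / 2 * u ^ (s - 1) * v ^ (Suc k - s)))
     = (\<Sum>s\<le>k. A (k - s) / 2 * (real (Suc s) * B (Suc s)) * u ^ s * v ^ (k - s))"
    unfolding sum_shift_lower by (intro sum.cong) auto
  also have "\<dots> = (\<Sum>s\<le>k. A (k - s) / 2 * ((b - real s) * B s) * u ^ s * v ^ (k - s))" unfolding B ..
  also have "(\<Sum>s\<le>Suc k. A (Suc k - s) * B s / 2 * (real (Suc k - s) * u ^ s * v ^ (k - s)))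
     = (\<Sum>s\<le>k. (real (Suc (k - s)) * A (Suc (k - s))) * B s / 2 * u ^ s * v ^ (k - s))"
    by (auto simp: Suc_diff_le intro!: sum.cong)
  also have "\<dots> = (\<Sum>s\<le>k. ((a - real (k - s)) * A (k - s)) * B s / 2 * u ^ s * v ^ (k - s))" unfolding A ..
  also have "(\<Sum>s\<le>k. A (k - s) / 2 * ((b - real s) * B s) * u ^ s * v ^ (k - s)) + \<dots>
     = (\<Sum>s\<le>k. (a + b - real k) / 2 * (A (k - s) * B s * u ^ s * v ^ (k - s)))"
    unfolding sum.distrib[symmetric] by (intro sum.cong) (auto simp: of_nat_diff field_simps)
  also have "\<dots> = jacobiD al be n x"
    unfolding jacobiD_def Suc jacobiP_alt A_def B_def a_def b_def u_def v_def
    by (simp add: sum_distrib_left add_ac)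
  finally show ?thesis
    using jacobiP_raw_deriv[of al be n x] unfolding A_def B_def a_def b_def u_def v_def by simp
qed

text \<open>Up to sign this is the adjoint of differentiation between the two weighted spaces. In
  the variables u and v the binomial factors turn into Suc k - s and s, whose sum is constant.
  Composed with the derivative formula it yields the Jacobi equation.\<close>

lemma jacobiP_lowering:
  "(1 - x\<^sup>2) * jacobiD (al + 1) (be + 1) k x + (be - al - (al + be + 2) * x) * jacobiP (al + 1) (be + 1) k x
     = - 2 * real (Suc k) * jacobiP al be (Suc k) x"
proof -
  define u v where "u = (x - 1) / 2" and "v = (x + 1) / 2"
  define a b where "a = real (Suc k) + al" and "b = real (Suc k) + be"
  define A B where "A j = a gchoose j" and "B j = b gchoose j" for j
  have A: "(a - real j) * A j = real (Suc j) * A (Suc j)" for j unfolding A_def by (rule gbinomial_step)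
  have B: "(b - real j) * B j = real (Suc j) * B (Suc j)" for j unfolding B_def by (rule gbinomial_step)
  have eqs: "real k + (al + 1) = a" "real k + (be + 1) = b" unfolding a_def b_def by auto
  have D: "jacobiD (al + 1) (be + 1) k x = (\<Sum>s\<le>k. A (k - s) * B s / 2 * 
      (real s * u ^ (s - 1) * v ^ (k - s) + real (k - s) * u ^ s * v ^ (k - s - 1)))"
    using DERIV_unique[OF jacobiP_deriv jacobiP_raw_deriv, of "al + 1" "be + 1" k x] unfolding eqs
    by (simp add: A_def B_def u_def v_def)
  have P: "jacobiP (al + 1) (be + 1) k x = (\<Sum>s\<le>k. A (k - s) * B s * u ^ s * v ^ (k - s))"
    unfolding jacobiP_alt eqs by (simp add: A_def B_def u_def v_def)
  have pu: "u * (real s * u ^ (s - 1)) = real s * u ^ s" for s by (cases s) auto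
  have pv: "v * (real s * v ^ (s - 1)) = real s * v ^ s" for s by (cases s) auto
  have "4 * u * v * jacobiD (al + 1) (be + 1) k x + 2 * ((be + 1) * u + (al + 1) * v) * jacobiP (al + 1) (be + 1) k x
     = (\<Sum>s\<le>k. 2 * (((a - real (k - s)) * A (k - s)) * B s * u ^ s * v ^ Suc (k - s)
           + A (k - s) * ((b - real s) * B s) * u ^ Suc s * v ^ (k - s)))"
    unfolding D P sum_distrib_left sum.distrib[symmetric]
  proof (rule sum.cong)
    fix s assume "s \<in> {..k}"
    then have ks: "real (k - s) = real k - real s" by simp
    have "4 * u * v * (A (k - s) * B s / 2 * (real s * u ^ (s - 1) * v ^ (k - s) + real (k - s) * u ^ s * v ^ (k - s - 1)))
       = 2 * A (k - s) * B s * (u * (real s * u ^ (s - 1)) * v ^ Suc (k - s) + u ^ Suc s * (v * (real (k - s) * v ^ (k - s - 1))))"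
      by (simp add: algebra_simps)
    also have "\<dots> = 2 * A (k - s) * B s * (real s * u ^ s * v ^ Suc (k - s) + u ^ Suc s * (real (k - s) * v ^ (k - s)))"
      unfolding pu pv ..
    finally show "4 * u * v * (A (k - s) * B s / 2 * (real s * u ^ (s - 1) * v ^ (k - s) + real (k - s) * u ^ s * v ^ (k - s - 1)))
       + 2 * ((be + 1) * u + (al + 1) * v) * (A (k - s) * B s * u ^ s * v ^ (k - s))
       = 2 * (((a - real (k - s)) * A (k - s)) * B s * u ^ s * v ^ Suc (k - s)
           + A (k - s) * ((b - real s) * B s) * u ^ Suc s * v ^ (k - s))"
      unfolding ks a_def b_def by (simp add: algebra_simps)
  qed simp
  also have "\<dots> = 2 * ((\<Sum>s\<le>k. real (Suc k - s) * (A (Suc k - s) * B s * u ^ s * v ^ (Suc k - s)))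
         + (\<Sum>s\<le>k. real (Suc s) * (A (Suc k - Suc s) * B (Suc s) * u ^ Suc s * v ^ (Suc k - Suc s))))"
    unfolding A B sum_distrib_left[symmetric] sum.distrib by (auto simp: Suc_diff_le mult_ac intro!: sum.cong)
  also have "(\<Sum>s\<le>k. real (Suc s) * (A (Suc k - Suc s) * B (Suc s) * u ^ Suc s * v ^ (Suc k - Suc s)))
     = (\<Sum>s\<le>Suc k. real s * (A (Suc k - s) * B s * u ^ s * v ^ (Suc k - s)))"
    by (rule sum_shift_lower[symmetric])
  also have "(\<Sum>s\<le>k. real (Suc k - s) * (A (Suc k - s) * B s * u ^ s * v ^ (Suc k - s)))
     = (\<Sum>s\<le>Suc k. real (Suc k - s) * (A (Suc k - s) * B s * u ^ s * v ^ (Suc k - s)))" by simp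
  also have "\<dots> + (\<Sum>s\<le>Suc k. real s * (A (Suc k - s) * B s * u ^ s * v ^ (Suc k - s)))
     = real (Suc k) * (\<Sum>s\<le>Suc k. A (Suc k - s) * B s * u ^ s * v ^ (Suc k - s))"
    unfolding sum.distrib[symmetric] sum_distrib_left by (intro sum.cong) (auto simp: of_nat_diff algebra_simps)
  also have "(\<Sum>s\<le>Suc k. A (Suc k - s) * B s * u ^ s * v ^ (Suc k - s)) = jacobiP al be (Suc k) x"
    unfolding jacobiP_alt A_def B_def a_def b_def u_def v_def ..
  finally have "4 * u * v * jacobiD (al + 1) (be + 1) k x + 2 * ((be + 1) * u + (al + 1) * v) * jacobiP (al + 1) (be + 1) k x
     = 2 * (real (Suc k) * jacobiP al be (Suc k) x)" .
  moreover have "4 * u * v = - (1 - x\<^sup>2)" "2 * ((be + 1) * u + (al + 1) * v) = - (be - al - (al + be + 2) * x)"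
    unfolding u_def v_def by (auto simp: field_simps power2_eq_square)
  ultimately show ?thesis by (simp only: mult_minus_left)
qed

text \<open>Consecutive degrees are compared in this form because the remainder carries the factor 1
  - x, which gains a power of 1/t against the heat factor. Since v - u = 1, inserting v - u makes
  all terms homogeneous of degree n + 1 in u and v, and coefficients can be compared.\<close>

lemma jacobiP_contiguous:
  assumes al: "al > -1"
  shows "(real n + 1) * jacobiP al be (Suc n) x = (real n + al + 1) * jacobiP al be n x
     - (real n + (al + be) / 2 + 1) * (1 - x) * jacobiP (al + 1) be n x"
proof -
  define u v where "u = (x - 1) / 2" and "v = (x + 1) / 2"
  define a b where "a = real n + al" and "b = real n + be"
  define A B where "A j = a gchoose j" and "B j = b gchoose j" for j
  define A' B' where "A' j = (a + 1) gchoose j" and "B' j = (b + 1) gchoose j" for j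
  have a0: "0 < a + 1" unfolding a_def using al by simp
  define c where "c s = A (n - s) * B s" for s
  define d where "d s = A' (n - s) * B s" for s
  have P: "jacobiP al be n x = (\<Sum>s\<le>n. c s * u ^ s * v ^ (n - s))"
    unfolding jacobiP_alt c_def A_def B_def a_def b_def u_def v_def ..
  have Q: "jacobiP (al + 1) be n x = (\<Sum>s\<le>n. d s * u ^ s * v ^ (n - s))"
    unfolding jacobiP_alt d_def A'_def B_def a_def b_def u_def v_def by (simp add: add_ac)
  have R: "jacobiP al be (Suc n) x = (\<Sum>s\<le>Suc n. A' (Suc n - s) * B' s * u ^ s * v ^ (Suc n - s))"
    unfolding jacobiP_alt A'_def B'_def a_def b_def u_def v_def by (simp add: add_ac)
  have uv: "v - u = 1" "1 - x = - 2 * u" unfolding u_def v_def by (auto simp: field_simps)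
  have shift: "u * (\<Sum>s\<le>n. f s * u ^ s * v ^ (n - s)) = (\<Sum>s\<le>Suc n. (if s = 0 then 0 else f (s - 1)) * u ^ s * v ^ (Suc n - s))"
    for f by (subst sum.atMost_Suc_shift) (simp add: sum_distrib_left mult_ac)
  have up: "v * (\<Sum>s\<le>n. f s * u ^ s * v ^ (n - s)) = (\<Sum>s\<le>Suc n. (if s = Suc n then 0 else f s) * u ^ s * v ^ (Suc n - s))"
    for f by (auto simp: sum_distrib_left Suc_diff_le mult_ac intro!: sum.cong)
  have "(a + 1) * (v * jacobiP al be n x) - (a + 1) * (u * jacobiP al be n x) + (a + b + 2) * (u * jacobiP (al + 1) be n x)
     = (\<Sum>s\<le>Suc n. ((a + 1) * (if s = Suc n then 0 else c s) - (a + 1) * (if s = 0 then 0 else c (s - 1))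
           + (a + b + 2) * (if s = 0 then 0 else d (s - 1))) * u ^ s * v ^ (Suc n - s))"
    unfolding P Q unfolding shift up unfolding sum_distrib_left sum_subtractf[symmetric] sum.distrib[symmetric]
    by (intro sum.cong) (auto simp: algebra_simps)
  also have "\<dots> = (\<Sum>s\<le>Suc n. (real n + 1) * (A' (Suc n - s) * B' s * u ^ s * v ^ (Suc n - s)))"
  proof (rule sum.cong)
    fix s assume "s \<in> {..Suc n}"
    then have s: "s \<le> Suc n" by simp
    have g1: "(a + 1) * A j = real (Suc j) * A' (Suc j)" for j
      unfolding A_def A'_def using gbinomial_absorption[of j "a + 1"] by simp
    have g2: "(a + 1 - real j) * A' j = (a + 1) * A j" for j
      using g1[of j] gbinomial_step[of "a + 1" j] unfolding A'_def A_def by simp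
    have h1: "(b + 1) * B j = real (Suc j) * B' (Suc j)" for j
      unfolding B_def B'_def using gbinomial_absorption[of j "b + 1"] by simp
    have h2: "(b - real j) * B j = real (Suc j) * B (Suc j)" for j unfolding B_def by (rule gbinomial_step)
    have "(a + 1) * (if s = Suc n then 0 else c s) - (a + 1) * (if s = 0 then 0 else c (s - 1))
           + (a + b + 2) * (if s = 0 then 0 else d (s - 1)) = (real n + 1) * (A' (Suc n - s) * B' s)"
    proof (cases s)
      case 0
      then show ?thesis using g1[of n] by (simp add: c_def B_def B'_def)
    next
      case (Suc j)
      have j: "j \<le> n" using s Suc by simp
      have t1: "(a + 1) * (if s = Suc n then 0 else A (n - s)) = real (n - j) * A' (n - j)"
        using g1[of "n - s"] Suc j by (cases "j = n") (auto simp: Suc_diff_Suc)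
      have t2: "(a + 1) * A (n - j) = (a + 1 - real (n - j)) * A' (n - j)" by (rule g2[symmetric])
      have nj: "real (n - j) = real n - real j" using j by simp
      \<comment> \<open>Multiplying by j + 1 allows B at j + 1 and \<open>B'\<close> at j + 1 both
        to be expressed through B at j without dividing.\<close>
      have "real (Suc j) * ((a + 1) * (if s = Suc n then 0 else c s) - (a + 1) * (if s = 0 then 0 else c (s - 1))
           + (a + b + 2) * (if s = 0 then 0 else d (s - 1)))
        = ((a + 1) * (if s = Suc n then 0 else A (n - s))) * (real (Suc j) * B (Suc j)) 
          - real (Suc j) * ((a + 1) * A (n - j)) * B j + real (Suc j) * (a + b + 2) * A' (n - j) * B j"
        using Suc by (simp add: c_def d_def algebra_simps)
      also have "\<dots> = A' (n - j) * B j * (real (n - j) * (b - real j) - real (Suc j) * (a + 1 - real (n - j)) + real (Suc j) * (a + b + 2))"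
        unfolding t1 t2 h2[symmetric] by (simp add: algebra_simps)
      also have "\<dots> = A' (n - j) * B j * ((real n + 1) * (b + 1))"
        unfolding nj by (simp add: algebra_simps)
      also have "\<dots> = (real n + 1) * A' (n - j) * ((b + 1) * B j)" by simp
      also have "\<dots> = real (Suc j) * ((real n + 1) * (A' (Suc n - s) * B' s))"
        unfolding h1 using Suc by simp
      finally show ?thesis by (subst (asm) mult_left_cancel) auto
    qed
    then show "((a + 1) * (if s = Suc n then 0 else c s) - (a + 1) * (if s = 0 then 0 else c (s - 1))
           + (a + b + 2) * (if s = 0 then 0 else d (s - 1))) * u ^ s * v ^ (Suc n - s)
       = (real n + 1) * (A' (Suc n - s) * B' s * u ^ s * v ^ (Suc n - s))" by (simp add: mult_ac)
  qed simp
  also have "\<dots> = (real n + 1) * jacobiP al be (Suc n) x" unfolding R by (simp only: sum_distrib_left)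
  finally have H: "(a + 1) * ((v - u) * jacobiP al be n x) + (a + b + 2) * (u * jacobiP (al + 1) be n x)
     = (real n + 1) * jacobiP al be (Suc n) x" by (simp add: algebra_simps)
  have "(a + b + 2) * u = - ((real n + (al + be) / 2 + 1) * (1 - x))" unfolding uv a_def b_def by (simp add: field_simps)
  then have "(a + b + 2) * (u * jacobiP (al + 1) be n x) = - ((real n + (al + be) / 2 + 1) * (1 - x)) * jacobiP (al + 1) be n x"
    by (metis mult.assoc)
  then show ?thesis using H unfolding uv(1) a_def by simp
qed

section \<open>Integration against the Jacobi weight\<close>

definition jint :: "real \<Rightarrow> real \<Rightarrow> (real \<Rightarrow> real) \<Rightarrow> real" where
  "jint al be f = (LINT x:{-1<..<1}|lborel. f x * jacobi_weight al be x)"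

lemma jacobi_weight_nonneg: "0 \<le> jacobi_weight al be x"
  unfolding jacobi_weight_def by simp

lemma jacobi_weight_pos: "-1 < x \<Longrightarrow> x < 1 \<Longrightarrow> 0 < jacobi_weight al be x"
  unfolding jacobi_weight_def by simp

text \<open>The substitution t = (1 - x) / 2 turns the weight into the Beta integrand times 2 powr
  (al + be).\<close>

lemma jacobi_weight_integrable:
  assumes "-1 < al" "-1 < be"
  shows "set_integrable lborel {-1<..<1} (jacobi_weight al be)"
proof -
  define g where "g t = indicator {0..1} t * (t powr al * (1 - t) powr be)" for t :: real
  have "integrable lborel g"
    using integrable_Beta[of "al + 1" "be + 1"] assms unfolding set_integrable_def g_def by simp
  then have "integrable lborel (\<lambda>x. g (1 / 2 + (- 1 / 2) * x))"
    by (subst lborel_integrable_real_affine_iff) auto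
  then have "integrable lborel (\<lambda>x. 2 powr (al + be) * g (1 / 2 + (- 1 / 2) * x))"
    by (rule integrable_mult_right)
  also have "(\<lambda>x. 2 powr (al + be) * g (1 / 2 + (- 1 / 2) * x)) = (\<lambda>x. indicator {-1..1} x *\<^sub>R jacobi_weight al be x)"
  proof
    fix x :: real
    show "2 powr (al + be) * g (1 / 2 + (- 1 / 2) * x) = indicator {-1..1} x *\<^sub>R jacobi_weight al be x"
    proof (cases "x \<in> {-1..1}")
      case True
      have e: "1 / 2 + (- 1 / 2) * x = (1 - x) / 2" "1 - (1 - x) / 2 = (1 + x) / 2" by (auto simp: field_simps)
      have "(1 - x) / 2 \<in> {0..1}" using True by auto
      then show ?thesis using True unfolding g_def jacobi_weight_def e
        by (simp add: powr_divide powr_add)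
    next
      case False
      then have "1 / 2 + (- 1 / 2) * x \<notin> {0..1}" by auto
      then show ?thesis using False unfolding g_def by simp
    qed
  qed
  finally have "set_integrable lborel {-1..1} (jacobi_weight al be)" unfolding set_integrable_def .
  then show ?thesis by (rule set_integrable_subset) auto
qed

lemma jint_integrable:
  assumes "-1 < al" "-1 < be" and f: "continuous_on {-1..1} f"
  shows "set_integrable lborel {-1<..<1} (\<lambda>x. f x * jacobi_weight al be x)"
proof -
  have "compact (f ` {-1..1})" using f by (intro compact_continuous_image) auto
  then obtain B where B: "\<And>x. x \<in> {-1..1} \<Longrightarrow> \<bar>f x\<bar> \<le> B"
    by (metis bounded_iff compact_imp_bounded image_eqI real_norm_def)
  have cont: "continuous_on {-1<..<1} (\<lambda>x. f x * jacobi_weight al be x)"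
    unfolding jacobi_weight_def
    by (intro continuous_intros continuous_on_subset[OF f]) auto
  show ?thesis
  proof (rule set_integrable_bound)
    show "set_integrable lborel {-1<..<1} (\<lambda>x. B * jacobi_weight al be x)"
      using jacobi_weight_integrable[OF assms(1,2)] by (rule set_integrable_mult_right)
    show "set_borel_measurable lborel {-1<..<1} (\<lambda>x. f x * jacobi_weight al be x)"
      using borel_measurable_continuous_on_indicator[OF _ cont] unfolding set_borel_measurable_def by simp
    show "AE x in lborel. x \<in> {-1<..<1} \<longrightarrow> norm (f x * jacobi_weight al be x) \<le> norm (B * jacobi_weight al be x)"
    proof (intro AE_I2 impI)
      fix x :: real assume "x \<in> {-1<..<1}"
      then have "\<bar>f x\<bar> \<le> B" by (intro B) auto
      then show "norm (f x * jacobi_weight al be x) \<le> norm (B * jacobi_weight al be x)"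
        using jacobi_weight_nonneg[of al be x] by (simp add: abs_mult mult_right_mono)
    qed
  qed
qed

locale jacobi_params =
  fixes al be :: real
  assumes al: "-1 < al" and be: "-1 < be"
begin

abbreviation "J \<equiv> jint al be"

lemma jint_add: "continuous_on {-1..1} f \<Longrightarrow> continuous_on {-1..1} g \<Longrightarrow> J (\<lambda>x. f x + g x) = J f + J g"
  unfolding jint_def distrib_right using jint_integrable[OF al be] by (intro set_integral_add)

lemma jint_diff: "continuous_on {-1..1} f \<Longrightarrow> continuous_on {-1..1} g \<Longrightarrow> J (\<lambda>x. f x - g x) = J f - J g"
  unfolding jint_def left_diff_distrib using jint_integrable[OF al be] by (intro set_integral_diff)

lemma jint_cmult: "J (\<lambda>x. c * f x) = c * J f"
  unfolding jint_def mult.assoc by (rule set_integral_mult_right)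

lemma jint_cong: "(\<And>x. -1 < x \<Longrightarrow> x < 1 \<Longrightarrow> f x = g x) \<Longrightarrow> J f = J g"
  unfolding jint_def by (intro set_lebesgue_integral_cong) auto

lemma jint_mono:
  assumes "continuous_on {-1..1} f" "continuous_on {-1..1} g" "\<And>x. -1 < x \<Longrightarrow> x < 1 \<Longrightarrow> f x \<le> g x"
  shows "J f \<le> J g"
  unfolding jint_def using assms jint_integrable[OF al be] 
  by (intro set_integral_mono mult_right_mono jacobi_weight_nonneg) auto

lemma jint_nonneg: "continuous_on {-1..1} f \<Longrightarrow> (\<And>x. -1 < x \<Longrightarrow> x < 1 \<Longrightarrow> 0 \<le> f x) \<Longrightarrow> 0 \<le> J f"
  using jint_mono[of "\<lambda>_. 0" f] by (simp add: jint_def[of al be "\<lambda>_. 0"] set_lebesgue_integral_def)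

lemma jint_abs:
  assumes "continuous_on {-1..1} f" "continuous_on {-1..1} g" "\<And>x. -1 < x \<Longrightarrow> x < 1 \<Longrightarrow> \<bar>f x\<bar> \<le> g x"
  shows "\<bar>J f\<bar> \<le> J g"
proof -
  have "J f \<le> J g" using assms by (intro jint_mono) (auto simp: abs_le_iff)
  moreover have "- J f \<le> J g"
    using jint_mono[of "\<lambda>x. (-1) * f x" g] assms unfolding jint_cmult
    by (auto intro!: continuous_intros simp: abs_le_iff)
  ultimately show ?thesis by simp
qed

lemma jint_sum: "finite I \<Longrightarrow> (\<And>i. i \<in> I \<Longrightarrow> continuous_on {-1..1} (f i)) \<Longrightarrow> J (\<lambda>x. \<Sum>i\<in>I. f i x) = (\<Sum>i\<in>I. J (f i))"
proof (induction I rule: finite_induct)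
  case empty
  then show ?case by (simp add: jint_def set_lebesgue_integral_def)
next
  case (insert i I)
  then show ?case by (simp add: jint_add continuous_on_sum)
qed

lemma jint_one_pos: "0 < J (\<lambda>_. 1)"
proof -
  have "0 \<le> J (\<lambda>_. 1)" by (intro jint_nonneg) auto
  moreover have "J (\<lambda>_. 1) \<noteq> 0"
  proof
    assume "J (\<lambda>_. 1) = 0"
    then have "(\<integral>x. indicator {-1<..<1} x * jacobi_weight al be x \<partial>lborel) = 0"
      by (simp add: jint_def set_lebesgue_integral_def)
    then have "AE x in lborel. indicator {-1<..<1} x * jacobi_weight al be x = 0"
      using jacobi_weight_integrable[OF al be] jacobi_weight_nonneg[of al be]
      by (subst (asm) integral_nonneg_eq_0_iff_AE) (auto simp: set_integrable_def)
    then have "AE x in lborel. x \<notin> {-1<..<1::real}"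
    proof (rule AE_mp, intro AE_I2 impI)
      fix x assume "indicator {-1<..<1} x * jacobi_weight al be x = 0"
      then show "x \<notin> {-1<..<1::real}" using jacobi_weight_pos[of x al be] by auto
    qed
    then have "emeasure lborel {-1<..<1::real} = 0"
      by (subst (asm) AE_iff_measurable[where N="{-1<..<1}"]) auto
    then show False by simp
  qed
  ultimately show ?thesis by simp
qed

text \<open>The first-order coefficient of the Jacobi operator: (1 - x^2) times the logarithmic
  derivative of (1 - x) powr (al + 1) * (1 + x) powr (be + 1).\<close>

definition hcoef :: "real \<Rightarrow> real" where
  "hcoef x = be - al - (al + be + 2) * x"

lemma continuous_hcoef [continuous_intros]: "continuous_on S hcoef"
  unfolding hcoef_def by (intro continuous_intros)

text \<open>The integrand times the weight is the derivative of \<open>\<Phi>\<close>, and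
  \<open>\<Phi>\<close> vanishes at both endpoints because al and be exceed -1. Orthogonality,
  norms, moments and the commutator identity are all instances with different f.\<close>

lemma jint_by_parts:
  assumes f: "\<And>x. -1 \<le> x \<Longrightarrow> x \<le> 1 \<Longrightarrow> (f has_real_derivative f' x) (at x)"
    and f': "continuous_on {-1..1} f'"
  shows "J (\<lambda>x. (1 - x\<^sup>2) * f' x + hcoef x * f x) = 0"
proof -
  have fc: "continuous_on {-1..1} f"
    using f by (intro continuous_at_imp_continuous_on ballI DERIV_isCont) auto
  define \<Phi> where "\<Phi> x = (1 - x) powr (al + 1) * (1 + x) powr (be + 1) * f x" for x
  have "((\<lambda>x. ((1 - x\<^sup>2) * f' x + hcoef x * f x) * jacobi_weight al be x) has_integral (\<Phi> 1 - \<Phi> (-1))) {-1..1}"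
  proof (rule fundamental_theorem_of_calculus_interior)
    show "continuous_on {-1..1} \<Phi>"
      unfolding \<Phi>_def using al be by (intro continuous_intros fc continuous_on_powr') auto
    fix x :: real assume x: "x \<in> {-1<..<1}"
    have "(\<Phi> has_real_derivative
       (-((al + 1) * (1 - x) powr (al + 1 - 1)) * (1 + x) powr (be + 1) + (be + 1) * (1 + x) powr (be + 1 - 1) * (1 - x) powr (al + 1)) * f x
        + (1 - x) powr (al + 1) * (1 + x) powr (be + 1) * f' x) (at x)"
      unfolding \<Phi>_def using x f[of x]
      by (auto intro!: derivative_eq_intros simp: algebra_simps)
    also have "(-((al + 1) * (1 - x) powr (al + 1 - 1)) * (1 + x) powr (be + 1) + (be + 1) * (1 + x) powr (be + 1 - 1) * (1 - x) powr (al + 1)) * f x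
        + (1 - x) powr (al + 1) * (1 + x) powr (be + 1) * f' x
      = ((1 - x\<^sup>2) * f' x + hcoef x * f x) * jacobi_weight al be x"
      using x unfolding jacobi_weight_def hcoef_def by (simp add: powr_add algebra_simps power2_eq_square)
    finally show "(\<Phi> has_vector_derivative ((1 - x\<^sup>2) * f' x + hcoef x * f x) * jacobi_weight al be x) (at x)"
      by (simp add: has_real_derivative_iff_has_vector_derivative)
  qed simp
  moreover have "\<Phi> 1 = 0" "\<Phi> (-1) = 0" unfolding \<Phi>_def by auto
  ultimately have "((\<lambda>x. ((1 - x\<^sup>2) * f' x + hcoef x * f x) * jacobi_weight al be x) has_integral 0) {-1<..<1}"
    by (simp add: has_integral_Icc_iff_Ioo)
  moreover have "set_integrable lborel {-1<..<1} (\<lambda>x. ((1 - x\<^sup>2) * f' x + hcoef x * f x) * jacobi_weight al be x)"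
    by (intro jint_integrable al be continuous_intros f' fc)
  ultimately show ?thesis unfolding jint_def
    by (metis set_borel_integral_eq_integral(2) integral_unique)
qed

end

lemma jint_shift: 
  assumes "-1 < al" "-1 < be"
  shows "jint (al + 1) (be + 1) f = jint al be (\<lambda>x. (1 - x\<^sup>2) * f x)"
  unfolding jint_def by (intro set_lebesgue_integral_cong)
    (auto simp: jacobi_weight_def powr_add power2_eq_square algebra_simps)

lemma jint_shift_left: 
  assumes "-1 < al" "-1 < be"
  shows "jint (al + 1) be f = jint al be (\<lambda>x. (1 - x) * f x)"
  unfolding jint_def by (intro set_lebesgue_integral_cong)
    (auto simp: jacobi_weight_def powr_add algebra_simps)

lemma continuous_jacobiP [continuous_intros]: "continuous_on S (jacobiP al be n)"
  by (intro continuous_at_imp_continuous_on ballI DERIV_isCont[OF jacobiP_deriv])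

lemma jacobiP_deriv' [derivative_intros]:
  "(g has_real_derivative g') (at x) \<Longrightarrow> ((\<lambda>x. jacobiP al be n (g x)) has_real_derivative jacobiD al be n (g x) * g') (at x)"
  using DERIV_chain2[OF jacobiP_deriv] by blast

definition jacobiDD :: "real \<Rightarrow> real \<Rightarrow> nat \<Rightarrow> real \<Rightarrow> real" where
  "jacobiDD al be n x = (case n of 0 \<Rightarrow> 0 | Suc k \<Rightarrow> (real n + al + be + 1) / 2 * jacobiD (al + 1) (be + 1) k x)"

lemma jacobiD_0 [simp]: "jacobiD al be 0 x = 0" and jacobiDD_0 [simp]: "jacobiDD al be 0 x = 0"
  by (simp_all add: jacobiD_def jacobiDD_def)

lemma jacobiD_Suc: "jacobiD al be (Suc k) x = (real (Suc k) + al + be + 1) / 2 * jacobiP (al + 1) (be + 1) k x"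
  and jacobiDD_Suc: "jacobiDD al be (Suc k) x = (real (Suc k) + al + be + 1) / 2 * jacobiD (al + 1) (be + 1) k x"
  by (simp_all add: jacobiD_def jacobiDD_def)

lemma jacobiD_deriv: "(jacobiD al be n has_real_derivative jacobiDD al be n x) (at x)"
proof (cases n)
  case 0
  then show ?thesis by (simp add: jacobiD_0[abs_def])
next
  case (Suc k)
  show ?thesis unfolding Suc jacobiD_Suc[abs_def] jacobiDD_Suc by (intro DERIV_cmult jacobiP_deriv)
qed

lemma continuous_jacobiD [continuous_intros]: "continuous_on S (jacobiD al be n)"
  by (intro continuous_at_imp_continuous_on ballI DERIV_isCont[OF jacobiD_deriv])

lemma continuous_jacobiDD [continuous_intros]: "continuous_on S (jacobiDD al be n)"
  by (cases n) (auto simp: jacobiDD_def[abs_def] intro!: continuous_intros)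

section \<open>The Jacobi equation, orthogonality and norms\<close>

definition jlam :: "real \<Rightarrow> real \<Rightarrow> nat \<Rightarrow> real" where
  "jlam al be n = real n * (real n + al + be + 1)"

context jacobi_params
begin

lemma jacobi_ode: "(1 - x\<^sup>2) * jacobiDD al be n x + hcoef x * jacobiD al be n x = - jlam al be n * jacobiP al be n x"
proof (cases n)
  case (Suc k)
  define c where "c = real (Suc k) + al + be + 1"
  have "(1 - x\<^sup>2) * jacobiDD al be n x + hcoef x * jacobiD al be n x
    = c / 2 * ((1 - x\<^sup>2) * jacobiD (al + 1) (be + 1) k x + hcoef x * jacobiP (al + 1) (be + 1) k x)"
    unfolding Suc jacobiD_Suc[of al be] jacobiDD_Suc[of al be] c_def[symmetric] by (simp add: field_simps)
  also have "\<dots> = c / 2 * (- 2 * real (Suc k) * jacobiP al be (Suc k) x)"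
    unfolding hcoef_def jacobiP_lowering ..
  also have "\<dots> = - (real (Suc k) * c) * jacobiP al be (Suc k) x"
  proof -
    have "c / 2 * (- 2 * N * p) = - (N * c) * p" for N p :: real by (simp add: field_simps)
    then show ?thesis .
  qed
  finally show ?thesis unfolding jlam_def Suc c_def .
qed (simp add: jlam_def)

text \<open>Self-adjointness: the field P_n' P_m - P_n P_m' has weighted divergence (l_m - l_n) P_n
  P_m, and the eigenvalues differ because n + m + al + be + 1 is positive for n \<noteq> m.\<close>

lemma jacobiP_orth:
  assumes s: "0 \<le> al + be + 1" and nm: "n \<noteq> m"
  shows "J (\<lambda>x. jacobiP al be n x * jacobiP al be m x) = 0"
proof -
  let ?P = "jacobiP al be" and ?D = "jacobiD al be" and ?DD = "jacobiDD al be" and ?l = "jlam al be"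
  have "J (\<lambda>x. (1 - x\<^sup>2) * (?DD n x * ?P m x - ?P n x * ?DD m x) + hcoef x * (?D n x * ?P m x - ?P n x * ?D m x)) = 0"
    by (rule jint_by_parts)
      (auto intro!: continuous_intros derivative_eq_intros jacobiP_deriv jacobiD_deriv simp: algebra_simps)
  also have "(\<lambda>x. (1 - x\<^sup>2) * (?DD n x * ?P m x - ?P n x * ?DD m x) + hcoef x * (?D n x * ?P m x - ?P n x * ?D m x))
     = (\<lambda>x. ((1 - x\<^sup>2) * ?DD n x + hcoef x * ?D n x) * ?P m x - ?P n x * ((1 - x\<^sup>2) * ?DD m x + hcoef x * ?D m x))"
    by (auto simp: algebra_simps)
  also have "\<dots> = (\<lambda>x. (?l m - ?l n) * (?P n x * ?P m x))" unfolding jacobi_ode by (auto simp: algebra_simps)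
  finally have "(?l m - ?l n) * J (\<lambda>x. ?P n x * ?P m x) = 0" unfolding jint_cmult .
  moreover have "?l m - ?l n = (real m - real n) * (real m + real n + (al + be + 1))"
    unfolding jlam_def by (simp add: algebra_simps)
  moreover have "real m - real n \<noteq> 0" "real m + real n + (al + be + 1) \<noteq> 0"
    using nm s by auto
  ultimately show ?thesis by simp
qed

definition hn :: "nat \<Rightarrow> real" where
  "hn n = J (\<lambda>x. (jacobiP al be n x)\<^sup>2)"

text \<open>By parts with f = P_n P_n' and the Jacobi equation. It serves twice: for the recursion
  of the norms and for the total integral of Sonin's function.\<close>

lemma energy_identity: "J (\<lambda>x. (1 - x\<^sup>2) * (jacobiD al be n x)\<^sup>2) = jlam al be n * hn n"
proof -
  let ?P = "jacobiP al be" and ?D = "jacobiD al be" and ?DD = "jacobiDD al be" and ?l = "jlam al be"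
  have "J (\<lambda>x. (1 - x\<^sup>2) * (?D n x * ?D n x + ?P n x * ?DD n x) + hcoef x * (?P n x * ?D n x)) = 0"
    by (rule jint_by_parts)
      (auto intro!: continuous_intros derivative_eq_intros jacobiP_deriv jacobiD_deriv simp: algebra_simps)
  also have "(\<lambda>x. (1 - x\<^sup>2) * (?D n x * ?D n x + ?P n x * ?DD n x) + hcoef x * (?P n x * ?D n x))
     = (\<lambda>x. (1 - x\<^sup>2) * (?D n x)\<^sup>2 + ?P n x * ((1 - x\<^sup>2) * ?DD n x + hcoef x * ?D n x))"
    by (auto simp: algebra_simps power2_eq_square)
  also have "\<dots> = (\<lambda>x. (1 - x\<^sup>2) * (?D n x)\<^sup>2 - ?l n * (?P n x)\<^sup>2)"
    unfolding jacobi_ode by (auto simp: algebra_simps power2_eq_square)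
  also have "J \<dots> = J (\<lambda>x. (1 - x\<^sup>2) * (?D n x)\<^sup>2) - ?l n * hn n"
    unfolding hn_def by (subst jint_diff) (auto intro!: continuous_intros simp: jint_cmult)
  finally show ?thesis by simp
qed

end

lemma jacobi_params_shift: "jacobi_params al be \<Longrightarrow> jacobi_params (al + 1) (be + 1)"
  "jacobi_params al be \<Longrightarrow> jacobi_params (al + 1) be"
  by (auto simp: jacobi_params_def)

abbreviation "hnorm \<equiv> jacobi_params.hn"

context jacobi_params
begin

text \<open>The derivative is a multiple of the raised polynomial, so the energy identity compares
  the norms at the two parameter pairs.\<close>

lemma hn_Suc:
  assumes s: "0 \<le> al + be + 1"
  shows "hn (Suc k) = (real (Suc k) + al + be + 1) / (4 * real (Suc k)) * hnorm (al + 1) (be + 1) k"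
proof -
  define c where "c = real (Suc k) + al + be + 1"
  have c: "0 < c" unfolding c_def using s by linarith
  interpret T: jacobi_params "al + 1" "be + 1" using jacobi_params_shift(1)[OF jacobi_params_axioms] .
  have "J (\<lambda>x. (1 - x\<^sup>2) * (jacobiD al be (Suc k) x)\<^sup>2) = J (\<lambda>x. (c / 2)\<^sup>2 * ((1 - x\<^sup>2) * (jacobiP (al + 1) (be + 1) k x)\<^sup>2))"
    unfolding jacobiD_Suc c_def[symmetric] by (intro jint_cong) (simp add: power_mult_distrib power_divide)
  also have "\<dots> = (c / 2)\<^sup>2 * T.hn k" unfolding T.hn_def jint_shift[OF al be] jint_cmult ..
  finally have "(c / 2)\<^sup>2 * T.hn k = real (Suc k) * c * hn (Suc k)"
    unfolding energy_identity jlam_def c_def by (simp add: add_ac)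
  then have "c * (c * T.hn k) = c * (4 * real (Suc k) * hn (Suc k))" by (simp add: power2_eq_square field_simps)
  then have "c * T.hn k = 4 * real (Suc k) * hn (Suc k)" using c by simp
  then show ?thesis unfolding c_def[symmetric] by (simp add: field_simps)
qed

lemma hn_0: "hn 0 = J (\<lambda>_. 1)"
  unfolding hn_def by simp

text \<open>By parts with f = 1 and f = x. These moments stand in for Gamma function values in the
  base cases of the norm quotients.\<close>

lemma jint_moments:
  "(al + be + 2) * J (\<lambda>x. x) = (be - al) * J (\<lambda>_. 1)"
  "(al + be + 3) * J (\<lambda>x. x\<^sup>2) = J (\<lambda>_. 1) + (be - al) * J (\<lambda>x. x)"
proof -
  have "J (\<lambda>x. (1 - x\<^sup>2) * 0 + hcoef x * 1) = 0"
    by (rule jint_by_parts) (auto intro!: derivative_eq_intros)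
  also have "(\<lambda>x. (1 - x\<^sup>2) * 0 + hcoef x * 1) = (\<lambda>x. (be - al) * 1 - (al + be + 2) * x)"
    unfolding hcoef_def by auto
  also have "J \<dots> = (be - al) * J (\<lambda>_. 1) - (al + be + 2) * J (\<lambda>x. x)"
    by (subst jint_diff) (simp_all only: jint_cmult, auto intro!: continuous_intros)
  finally show 1: "(al + be + 2) * J (\<lambda>x. x) = (be - al) * J (\<lambda>_. 1)" by simp
  have "J (\<lambda>x. (1 - x\<^sup>2) * 1 + hcoef x * x) = 0"
    by (rule jint_by_parts) (auto intro!: derivative_eq_intros)
  also have "(\<lambda>x. (1 - x\<^sup>2) * 1 + hcoef x * x) = (\<lambda>x. (1 + (be - al) * x) - (al + be + 3) * x\<^sup>2)"
    unfolding hcoef_def by (auto simp: algebra_simps power2_eq_square)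
  also have "J \<dots> = J (\<lambda>_. 1) + (be - al) * J (\<lambda>x. x) - (al + be + 3) * J (\<lambda>x. x\<^sup>2)"
    by (subst jint_diff, (intro continuous_intros)+, subst jint_add, (intro continuous_intros)+) (simp only: jint_cmult)
  finally show "(al + be + 3) * J (\<lambda>x. x\<^sup>2) = J (\<lambda>_. 1) + (be - al) * J (\<lambda>x. x)" by simp
qed

lemma jint_one_shift:
  "(al + be + 2) * (al + be + 3) * jint (al + 1) (be + 1) (\<lambda>_. 1) = 4 * (al + 1) * (be + 1) * J (\<lambda>_. 1)"
proof -
  have "jint (al + 1) (be + 1) (\<lambda>_. 1) = J (\<lambda>x. 1 - x\<^sup>2)" unfolding jint_shift[OF al be] by simp
  also have "\<dots> = J (\<lambda>_. 1) - J (\<lambda>x. x\<^sup>2)" by (intro jint_diff continuous_intros)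
  finally have e: "jint (al + 1) (be + 1) (\<lambda>_. 1) = J (\<lambda>_. 1) - J (\<lambda>x. x\<^sup>2)" .
  define m0 m1 m2 where "m0 = J (\<lambda>_. 1)" and "m1 = J (\<lambda>x. x)" and "m2 = J (\<lambda>x. x\<^sup>2)"
  have h: "(al + be + 2) * m1 = (be - al) * m0" "(al + be + 3) * m2 = m0 + (be - al) * m1"
    unfolding m0_def m1_def m2_def by (rule jint_moments)+
  have "(al + be + 2) * (al + be + 3) * (m0 - m2) = (al + be + 2) * (al + be + 3) * m0 - (al + be + 2) * ((al + be + 3) * m2)"
    by (simp add: algebra_simps)
  also have "\<dots> = (al + be + 2) * (al + be + 3) * m0 - (al + be + 2) * m0 - (be - al) * ((al + be + 2) * m1)"
    unfolding h(2) by (simp add: algebra_simps)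
  also have "\<dots> = 4 * (al + 1) * (be + 1) * m0" unfolding h(1) by (simp add: algebra_simps)
  finally show ?thesis unfolding e m0_def m2_def .
qed

lemma jint_one_shift_left: "(al + be + 2) * jint (al + 1) be (\<lambda>_. 1) = 2 * (al + 1) * J (\<lambda>_. 1)"
proof -
  have "jint (al + 1) be (\<lambda>_. 1) = J (\<lambda>x. 1 - x)" unfolding jint_shift_left[OF al be] by simp
  also have "\<dots> = J (\<lambda>_. 1) - J (\<lambda>x. x)" by (intro jint_diff continuous_intros)
  finally have e: "jint (al + 1) be (\<lambda>_. 1) = J (\<lambda>_. 1) - J (\<lambda>x. x)" .
  show ?thesis unfolding e right_diff_distrib jint_moments(1) by (simp add: algebra_simps)
qed

end

text \<open>The quotient of consecutive norms is rational in n. \<open>hn_Suc\<close> moves both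
  norms to raised parameters and lower degree, which drives the induction over all parameters at
  once; degree 0 is settled by the moments.\<close>

lemma hn_ratio:
  assumes "jacobi_params al be" "0 \<le> al + be + 1"
  shows "(2 * real n + al + be + 3) * (real n + 1) * (real n + al + be + 1) * hnorm al be (Suc n)
     = (2 * real n + al + be + 1) * (real n + al + 1) * (real n + be + 1) * hnorm al be n"
  using assms
proof (induction n arbitrary: al be)
  case 0
  interpret jacobi_params al be by fact
  interpret T: jacobi_params "al + 1" "be + 1" using jacobi_params_shift(1)[OF jacobi_params_axioms] .
  have h1: "4 * hn (Suc 0) = (al + be + 2) * T.hn 0" using hn_Suc[OF 0(2), of 0] by (simp add: add_ac)
  have "(al + be + 3) * (4 * hn (Suc 0)) = 4 * ((al + 1) * (be + 1) * hn 0)"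
    unfolding h1 T.hn_0 hn_0 using jint_one_shift by (simp add: mult_ac)
  then have "(al + be + 3) * hn (Suc 0) = (al + 1) * (be + 1) * hn 0" by simp
  then show ?case by (metis (no_types, lifting) add_0 mult.assoc mult.left_commute mult_1 mult_zero_right of_nat_0)
next
  case (Suc n)
  interpret jacobi_params al be by fact
  interpret T: jacobi_params "al + 1" "be + 1" using jacobi_params_shift(1)[OF jacobi_params_axioms] .
  define s where "s = al + be + 1"
  define r where "r = real n"
  have r: "0 \<le> r" "real (Suc n) = r + 1" "real (Suc (Suc n)) = r + 2" unfolding r_def by auto
  have IH: "(2 * r + s + 4) * (r + 1) * (r + s + 2) * T.hn (Suc n) = (2 * r + s + 2) * (r + al + 2) * (r + be + 2) * T.hn n"
    using Suc.IH[OF T.jacobi_params_axioms] Suc.prems(2) unfolding s_def r_def by (simp add: add_ac)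
  have a: "4 * (r + 2) * hn (Suc (Suc n)) = (r + s + 2) * T.hn (Suc n)"
    using hn_Suc[OF Suc.prems(2), of "Suc n"] r unfolding s_def by (simp add: field_simps)
  have b: "4 * (r + 1) * hn (Suc n) = (r + s + 1) * T.hn n"
    using hn_Suc[OF Suc.prems(2), of n] r unfolding s_def by (simp add: field_simps)
  have "4 * (r + 1) * ((2 * r + s + 4) * (r + 2) * (r + s + 1) * hn (Suc (Suc n)))
     = (2 * r + s + 4) * (r + 1) * (r + s + 1) * (4 * (r + 2) * hn (Suc (Suc n)))" by algebra
  also have "\<dots> = (r + s + 1) * ((2 * r + s + 4) * (r + 1) * (r + s + 2) * T.hn (Suc n))"
    unfolding a by (simp add: mult_ac)
  also have "\<dots> = (2 * r + s + 2) * (r + al + 2) * (r + be + 2) * ((r + s + 1) * T.hn n)"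
    unfolding IH by (simp add: mult_ac)
  also have "\<dots> = 4 * (r + 1) * ((2 * r + s + 2) * (r + al + 2) * (r + be + 2) * hn (Suc n))"
    unfolding b[symmetric] by (simp add: mult_ac)
  finally have "(2 * r + s + 4) * (r + 2) * (r + s + 1) * hn (Suc (Suc n)) = (2 * r + s + 2) * (r + al + 2) * (r + be + 2) * hn (Suc n)"
    using r by (subst (asm) mult_left_cancel) auto
  then show ?case unfolding r s_def by (simp add: algebra_simps)
qed

text \<open>The same induction as in \<open>hn_ratio\<close>. Raising al alone is what occurs in the
  remainder of \<open>jacobiP_contiguous\<close>.\<close>

lemma hn_left_ratio:
  assumes "jacobi_params al be" "0 \<le> al + be + 1"
  shows "hnorm (al + 1) be n * (2 * real n + al + be + 2) * (real n + al + be + 1)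
     = 2 * (2 * real n + al + be + 1) * (real n + al + 1) * hnorm al be n"
  using assms
proof (induction n arbitrary: al be)
  case 0
  interpret jacobi_params al be by fact
  interpret L: jacobi_params "al + 1" be using jacobi_params_shift(2)[OF jacobi_params_axioms] .
  have "(al + be + 2) * L.hn 0 = 2 * (al + 1) * hn 0" unfolding L.hn_0 hn_0 by (rule jint_one_shift_left)
  then show ?case by (simp add: algebra_simps)
next
  case (Suc n)
  interpret jacobi_params al be by fact
  interpret T: jacobi_params "al + 1" "be + 1" using jacobi_params_shift(1)[OF jacobi_params_axioms] .
  interpret L: jacobi_params "al + 1" be using jacobi_params_shift(2)[OF jacobi_params_axioms] .
  define s where "s = al + be + 1"
  define r where "r = real n"
  define H where "H = hnorm (al + 1 + 1) (be + 1) n"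
  have r: "0 \<le> r" "real (Suc n) = r + 1" unfolding r_def by auto
  have IH: "H * (2 * r + s + 3) * (r + s + 2) = 2 * (2 * r + s + 2) * (r + al + 2) * T.hn n"
    using Suc.IH[OF T.jacobi_params_axioms] Suc.prems(2) unfolding s_def r_def H_def by (simp add: add_ac)
  have a: "4 * (r + 1) * L.hn (Suc n) = (r + s + 2) * H"
    using L.hn_Suc[of n] Suc.prems(2) r unfolding s_def H_def by (simp add: field_simps)
  have b: "4 * (r + 1) * hn (Suc n) = (r + s + 1) * T.hn n"
    using hn_Suc[OF Suc.prems(2), of n] r unfolding s_def by (simp add: field_simps)
  have "4 * (r + 1) * (L.hn (Suc n) * (2 * r + s + 3) * (r + s + 1)) = (4 * (r + 1) * L.hn (Suc n)) * (2 * r + s + 3) * (r + s + 1)"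
    by (simp add: mult_ac)
  also have "\<dots> = (r + s + 1) * (H * (2 * r + s + 3) * (r + s + 2))" unfolding a by (simp add: mult_ac)
  also have "\<dots> = 2 * (2 * r + s + 2) * (r + al + 2) * ((r + s + 1) * T.hn n)" unfolding IH by (simp add: mult_ac)
  also have "\<dots> = 4 * (r + 1) * (2 * (2 * r + s + 2) * (r + al + 2) * hn (Suc n))" unfolding b[symmetric] by (simp add: mult_ac)
  finally have "L.hn (Suc n) * (2 * r + s + 3) * (r + s + 1) = 2 * (2 * r + s + 2) * (r + al + 2) * hn (Suc n)"
    using r by (subst (asm) mult_left_cancel) auto
  then show ?case unfolding r s_def by (simp add: algebra_simps)
qed

lemma hn_pos:
  assumes "jacobi_params al be" "0 \<le> al + be + 1"
  shows "0 < hnorm al be n"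
  using assms
proof (induction n arbitrary: al be)
  case 0
  interpret jacobi_params al be by fact
  show ?case unfolding hn_0 by (rule jint_one_pos)
next
  case (Suc n)
  interpret jacobi_params al be by fact
  show ?case unfolding hn_Suc[OF Suc.prems(2)]
    using Suc.IH[OF jacobi_params_shift(1)[OF Suc.prems(1)]] Suc.prems(2) by simp
qed

section \<open>Uniform bounds for orthonormal Jacobi polynomials\<close>

locale jacobi_half =
  fixes al be :: real
  assumes al_half: "-1/2 \<le> al" and be_half: "-1/2 \<le> be"

sublocale jacobi_half \<subseteq> jacobi_params
  by unfold_locales (use al_half be_half in auto)

context jacobi_half
begin

lemma ab_nonneg: "0 \<le> al + be + 1" using al_half be_half by linarith

abbreviation "P \<equiv> jacobiP al be"
abbreviation "D \<equiv> jacobiD al be"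
abbreviation "l \<equiv> jlam al be"

text \<open>(1 - x^2) times the logarithmic derivative of the weight \<open>gw\<close> below, that
  is \<open>hcoef\<close> with both exponents lowered by 1/2.\<close>

definition qf :: "real \<Rightarrow> real" where
  "qf x = (be - al) - (al + be + 1) * x"

lemma hcoef_qf: "hcoef x = qf x - x"
  unfolding hcoef_def qf_def by (simp add: algebra_simps)

text \<open>Sonin's function: its derivative contains no \<open>P\<^sub>n P\<^sub>n'\<close> term, hence has a sign wherever \<open>qf\<close> does.\<close>

definition Fs :: "nat \<Rightarrow> real \<Rightarrow> real" where
  "Fs n x = l n * (P n x)\<^sup>2 + (1 - x\<^sup>2) * (D n x)\<^sup>2"

lemma l_nonneg: "0 \<le> l n"
  unfolding jlam_def using ab_nonneg by (intro mult_nonneg_nonneg) auto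

lemma l_ge: "1 \<le> n \<Longrightarrow> (real n)\<^sup>2 \<le> l n"
  unfolding jlam_def power2_eq_square using ab_nonneg by (intro mult_left_mono) auto

lemma Fs_nonneg: "\<bar>x\<bar> \<le> 1 \<Longrightarrow> 0 \<le> Fs n x"
  unfolding Fs_def using l_nonneg by (intro add_nonneg_nonneg mult_nonneg_nonneg) (auto simp: abs_square_le_1)

lemma Fs_deriv: "(Fs n has_real_derivative - 2 * qf x * (D n x)\<^sup>2) (at x)"
proof -
  have "(Fs n has_real_derivative l n * (2 * P n x * D n x) + ((1 - x\<^sup>2) * (2 * D n x * jacobiDD al be n x) - 2 * x * (D n x)\<^sup>2)) (at x)"
    unfolding Fs_def[abs_def]
    by (auto intro!: derivative_eq_intros jacobiP_deriv jacobiD_deriv simp: algebra_simps)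
  also have "l n * (2 * P n x * D n x) + ((1 - x\<^sup>2) * (2 * D n x * jacobiDD al be n x) - 2 * x * (D n x)\<^sup>2)
    = 2 * D n x * (l n * P n x + ((1 - x\<^sup>2) * jacobiDD al be n x + hcoef x * D n x)) - 2 * (hcoef x + x) * (D n x)\<^sup>2"
    by (simp add: algebra_simps power2_eq_square)
  also have "\<dots> = - 2 * qf x * (D n x)\<^sup>2"
    unfolding jacobi_ode by (simp add: hcoef_qf)
  finally show ?thesis .
qed

lemma D_sq_le_Fs: "0 \<le> x \<Longrightarrow> x < 1 \<Longrightarrow> (D n x)\<^sup>2 \<le> Fs n x / (1 - x)"
proof -
  assume x: "0 \<le> x" "x < 1"
  have "(1 - x) * (D n x)\<^sup>2 \<le> (1 - x\<^sup>2) * (D n x)\<^sup>2"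
    using x by (intro mult_right_mono) (auto simp: power2_eq_square mult_left_le)
  also have "\<dots> \<le> Fs n x" unfolding Fs_def using l_nonneg by simp
  finally show ?thesis using x by (simp add: field_simps)
qed

text \<open>Expansion at the endpoint 1: the constant term is nonnegative because al \<ge> -1/2, and
  the other term vanishes there.\<close>

lemma qf_eq: "- 2 * qf x = 2 * (2 * al + 1) - 2 * (al + be + 1) * (1 - x)"
  unfolding qf_def by (simp add: algebra_simps)

text \<open>Sonin's function can decrease towards 1 only at the relative rate c = 2 (al + be + 1),
  because (1 - y) P'^2 is at most \<open>Fs\<close>. Hence exp (c x) times \<open>Fs\<close>
  increases up to the endpoint, where \<open>Fs\<close> equals l_n P_n(1)^2.\<close>

lemma P_sq_le_one:
  assumes x: "0 \<le> x" "x \<le> 1"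
  shows "(P n x)\<^sup>2 \<le> exp (2 * (al + be + 1)) * (P n 1)\<^sup>2"
proof (cases "n = 0")
  case False
  define c where "c = 2 * (al + be + 1)"
  have c: "0 \<le> c" unfolding c_def using ab_nonneg by simp
  have "exp (c * x) * Fs n x \<le> exp (c * 1) * Fs n 1"
  proof (rule DERIV_nonneg_imp_nondecreasing[OF x(2)])
    fix y assume y: "x \<le> y" "y \<le> 1"
    have "(1 - y) * (D n y)\<^sup>2 \<le> Fs n y"
    proof -
      have "(1 - y) * (D n y)\<^sup>2 \<le> (1 - y\<^sup>2) * (D n y)\<^sup>2"
        using x y by (intro mult_right_mono) (auto simp: power2_eq_square mult_left_le)
      also have "\<dots> \<le> Fs n y" unfolding Fs_def using l_nonneg by simp
      finally show ?thesis .
    qed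
    then have "c * ((1 - y) * (D n y)\<^sup>2) \<le> c * Fs n y" using c by (rule mult_left_mono)
    moreover have "0 \<le> 2 * (2 * al + 1) * (D n y)\<^sup>2" using al_half by (intro mult_nonneg_nonneg) auto
    ultimately have "0 \<le> c * Fs n y + - 2 * qf y * (D n y)\<^sup>2"
      unfolding qf_eq c_def[symmetric] by (simp add: left_diff_distrib mult.assoc)
    then have "0 \<le> exp (c * y) * (c * Fs n y + - 2 * qf y * (D n y)\<^sup>2)" by simp
    moreover have "((\<lambda>x. exp (c * x) * Fs n x) has_real_derivative exp (c * y) * (c * Fs n y + - 2 * qf y * (D n y)\<^sup>2)) (at y)"
      by (auto intro!: derivative_eq_intros Fs_deriv simp: algebra_simps)
    ultimately show "\<exists>y'. ((\<lambda>x. exp (c * x) * Fs n x) has_real_derivative y') (at y) \<and> 0 \<le> y'" by blast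
  qed
  moreover have "1 * Fs n x \<le> exp (c * x) * Fs n x"
    using x c Fs_nonneg[of x n] by (intro mult_right_mono) auto
  ultimately have "Fs n x \<le> exp c * Fs n 1" by simp
  moreover have "Fs n 1 = l n * (P n 1)\<^sup>2" unfolding Fs_def by simp
  moreover have "l n * (P n x)\<^sup>2 \<le> Fs n x"
    unfolding Fs_def using x by (simp add: power2_eq_square mult_le_one)
  ultimately have "l n * (P n x)\<^sup>2 \<le> l n * (exp c * (P n 1)\<^sup>2)" by (simp add: mult_ac)
  moreover have "0 < l n" using l_ge[of n] False by (auto intro: less_le_trans[of _ "(real n)\<^sup>2"])
  ultimately show ?thesis unfolding c_def by simp
qed (use ab_nonneg in simp)

lemma jacobi_half_shift: "jacobi_half (al + 1) (be + 1)" "jacobi_half (al + 1) be"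
  by unfold_locales (use al_half be_half in auto)

text \<open>The square root of the constant in \<open>P_sq_le_one\<close> at the parameters (al + 1,
  be + 1).\<close>

definition kap :: real where "kap = exp (al + be + 3)"

lemma kap_ge: "1 \<le> kap" unfolding kap_def using ab_nonneg by simp

lemma D_le_one:
  assumes x: "0 \<le> x" "x \<le> 1"
  shows "\<bar>D n x\<bar> \<le> kap * l n * \<bar>P n 1\<bar>"
proof (cases n)
  case (Suc k)
  interpret T: jacobi_half "al + 1" "be + 1" by (rule jacobi_half_shift)
  define c where "c = (real (Suc k) + al + be + 1) / 2"
  have sq: "(D n x)\<^sup>2 \<le> kap\<^sup>2 * (D n 1)\<^sup>2"
  proof -
    have "(D n x)\<^sup>2 = c\<^sup>2 * (jacobiP (al + 1) (be + 1) k x)\<^sup>2"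
      unfolding Suc jacobiD_Suc c_def by (rule power_mult_distrib)
    also have "\<dots> \<le> c\<^sup>2 * (exp (2 * (al + 1 + (be + 1) + 1)) * (jacobiP (al + 1) (be + 1) k 1)\<^sup>2)"
      by (intro mult_left_mono T.P_sq_le_one x) auto
    also have "\<dots> = exp (2 * (al + be + 3)) * (D n 1)\<^sup>2"
      unfolding Suc jacobiD_Suc c_def[symmetric] by (simp add: power_mult_distrib add_ac)
    also have "exp (2 * (al + be + 3)) = kap\<^sup>2" by (simp only: kap_def exp_double)
    finally show ?thesis .
  qed
  \<comment> \<open>At x = 1 the second-order term drops out, so the Jacobi equation determines
    P_n'(1) from P_n(1).\<close>
  have "hcoef 1 * D n 1 = - l n * P n 1" using jacobi_ode[of 1 n] by simp
  then have D1: "2 * (al + 1) * D n 1 = l n * P n 1" unfolding hcoef_def by (simp add: algebra_simps)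
  have "1 * \<bar>D n 1\<bar> \<le> 2 * (al + 1) * \<bar>D n 1\<bar>" using al_half by (intro mult_right_mono) auto
  also have "\<dots> = \<bar>2 * (al + 1) * D n 1\<bar>" using al by (simp add: abs_mult)
  also have "\<dots> = l n * \<bar>P n 1\<bar>" unfolding D1 using l_nonneg by (simp add: abs_mult)
  finally have D1': "\<bar>D n 1\<bar> \<le> l n * \<bar>P n 1\<bar>" by simp
  have "\<bar>D n x\<bar> \<le> kap * \<bar>D n 1\<bar>"
  proof (rule power2_le_imp_le)
    show "\<bar>D n x\<bar>\<^sup>2 \<le> (kap * \<bar>D n 1\<bar>)\<^sup>2" using sq by (simp add: power_mult_distrib)
  qed (use kap_ge in auto)
  also have "\<dots> \<le> kap * (l n * \<bar>P n 1\<bar>)" using D1' kap_ge by (intro mult_left_mono) auto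
  finally show ?thesis by simp
qed (use kap_ge l_nonneg in simp)

text \<open>The distance 1 / (2 kap l_n) from the endpoint is chosen so that, by the mean value
  theorem and \<open>D_le_one\<close>, P_n changes by at most half of its endpoint value.\<close>

lemma P_one_le:
  assumes n: "1 \<le> l n"
  shows "(P n 1)\<^sup>2 \<le> 4 * (P n (1 - 1 / (2 * kap * l n)))\<^sup>2"
proof -
  define y where "y = 1 - 1 / (2 * kap * l n)"
  have pos: "1 \<le> kap * l n" using mult_mono[OF kap_ge n] kap_ge by simp
  have y: "0 \<le> y" "y < 1" unfolding y_def using pos by (auto simp: field_simps)
  obtain z where z: "y < z" "z < 1" "P n 1 - P n y = (1 - y) * D n z"
    using MVT2[OF y(2), of "P n" "D n"] jacobiP_deriv by blast
  have "\<bar>P n 1 - P n y\<bar> = (1 - y) * \<bar>D n z\<bar>" unfolding z(3) using y by (simp add: abs_mult)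
  also have "\<dots> \<le> (1 - y) * (kap * l n * \<bar>P n 1\<bar>)" using y z by (intro mult_left_mono D_le_one) auto
  also have "\<dots> = \<bar>P n 1\<bar> / 2" unfolding y_def using pos n kap_ge by (simp add: field_simps)
  finally have "\<bar>P n 1\<bar> \<le> 2 * \<bar>P n y\<bar>" by linarith
  then have "\<bar>P n 1\<bar>\<^sup>2 \<le> (2 * \<bar>P n y\<bar>)\<^sup>2" by (intro power_mono) auto
  then show ?thesis unfolding y_def by (simp add: power_mult_distrib)
qed

text \<open>The relative growth rate of \<open>Fs\<close> is at most c / (1 - z), so approaching 1
  costs a bounded factor as long as 1 - x shrinks by a bounded factor. This bridges the gap between
  the edge of the bulk and the point in \<open>P_one_le\<close>.\<close>

lemma Fs_growth:
  assumes x: "0 \<le> x" "x \<le> y" "y < 1"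
  shows "(1 - y) powr (2 * (2 * al + 1)) * Fs n y \<le> (1 - x) powr (2 * (2 * al + 1)) * Fs n x"
proof -
  define c where "c = 2 * (2 * al + 1)"
  have c: "0 \<le> c" unfolding c_def using al_half by simp
  show ?thesis unfolding c_def[symmetric]
  proof (rule DERIV_nonpos_imp_nonincreasing[OF x(2)])
    fix z assume z: "x \<le> z" "z \<le> y"
    then have z1: "0 \<le> z" "z < 1" using x by auto
    have "- 2 * qf z * (D n z)\<^sup>2 \<le> c * (D n z)\<^sup>2"
      unfolding qf_eq c_def using ab_nonneg z1 by (intro mult_right_mono) auto
    also have "\<dots> \<le> c * (Fs n z / (1 - z))" using c z1 by (intro mult_left_mono D_sq_le_Fs) auto
    finally have "(1 - z) powr c * (- 2 * qf z * (D n z)\<^sup>2 - c * (Fs n z / (1 - z))) \<le> 0"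
      by (intro mult_nonneg_nonpos) auto
    moreover have "((\<lambda>x. (1 - x) powr c * Fs n x) has_real_derivative
       (1 - z) powr c * (- 2 * qf z * (D n z)\<^sup>2 - c * (Fs n z / (1 - z)))) (at z)"
      using z1 by (auto intro!: derivative_eq_intros Fs_deriv simp: algebra_simps powr_diff)
    ultimately show "\<exists>y. ((\<lambda>x. (1 - x) powr c * Fs n x) has_real_derivative y) (at z) \<and> y \<le> 0" by blast
  qed
qed

text \<open>sqrt (1 - x^2) times the Jacobi weight: the normalisation under which p_n^2 stays
  bounded in the oscillatory range.\<close>

definition gw :: "real \<Rightarrow> real" where
  "gw x = (1 - x) powr (al + 1/2) * (1 + x) powr (be + 1/2)"

lemma gw_pos: "-1 < x \<Longrightarrow> x < 1 \<Longrightarrow> 0 < gw x"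
  unfolding gw_def by simp

lemma gw_deriv:
  assumes "-1 < x" "x < 1"
  shows "(gw has_real_derivative gw x * qf x / (1 - x\<^sup>2)) (at x)"
proof -
  have "(gw has_real_derivative gw x * (- (al + 1/2) / (1 - x) + (be + 1/2) / (1 + x))) (at x)"
  proof -
    have 1: "((\<lambda>x. (1 - x) powr a) has_real_derivative (1 - x) powr a * (- a / (1 - x))) (at x)" for a
      using assms by (auto intro!: derivative_eq_intros simp: powr_diff)
    have 2: "((\<lambda>x. (1 + x) powr a) has_real_derivative (1 + x) powr a * (a / (1 + x))) (at x)" for a
      using assms by (auto intro!: derivative_eq_intros simp: powr_diff)
    show ?thesis unfolding gw_def[abs_def]
      by (rule DERIV_cong[OF DERIV_mult[OF 1 2]]) (simp add: algebra_simps)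
  qed
  also have "- (al + 1/2) / (1 - x) + (be + 1/2) / (1 + x) = qf x / ((1 - x) * (1 + x))"
    using assms unfolding qf_def by (simp add: divide_simps) (simp add: algebra_simps)
  also have "(1 - x) * (1 + x) = 1 - x\<^sup>2" by (simp add: algebra_simps power2_eq_square)
  finally show ?thesis by simp
qed

definition Es :: "nat \<Rightarrow> real \<Rightarrow> real" where
  "Es n x = gw x * (Fs n x + qf x * (P n x * D n x))"

text \<open>Adding the term \<open>gw qf P D\<close> to the weighted Sonin function cancels its leading
  derivative \<open>gw' (\<lambda> P\<^sup>2 - (1 - x\<^sup>2) P'\<^sup>2)\<close>; what is left is of relative size \<open>\<lambda>\<^sup>-\<^sup>1\<^sup>/\<^sup>2 (1 - x)\<^sup>-\<^sup>3\<^sup>/\<^sup>2\<close>.\<close>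

lemma Es_deriv:
  assumes "-1 < x" "x < 1"
  shows "(Es n has_real_derivative gw x * (P n x * D n x) * (qf x * x / (1 - x\<^sup>2) - (al + be + 1))) (at x)"
proof -
  have x2: "1 - x\<^sup>2 > 0" using assms by (simp add: abs_square_less_1)
  have "(Es n has_real_derivative gw x * qf x / (1 - x\<^sup>2) * (Fs n x + qf x * (P n x * D n x))
     + gw x * (- 2 * qf x * (D n x)\<^sup>2 + (- (al + be + 1) * (P n x * D n x) + qf x * ((D n x)\<^sup>2 + P n x * jacobiDD al be n x)))) (at x)"
  proof -
    have qd: "(qf has_real_derivative - (al + be + 1)) (at x)"
      unfolding qf_def[abs_def] by (auto intro!: derivative_eq_intros)
    show ?thesis unfolding Es_def[abs_def]
      by (rule DERIV_cong[OF DERIV_mult[OF gw_deriv[OF assms] DERIV_add[OF Fs_deriv DERIV_mult[OF qd DERIV_mult[OF jacobiP_deriv jacobiD_deriv]]]]])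
        (simp add: algebra_simps power2_eq_square)
  qed
  also have "jacobiDD al be n x = (- l n * P n x - hcoef x * D n x) / (1 - x\<^sup>2)"
    using jacobi_ode[of x n] x2 by (simp add: field_simps)
  also have "gw x * qf x / (1 - x\<^sup>2) * (Fs n x + qf x * (P n x * D n x))
     + gw x * (- 2 * qf x * (D n x)\<^sup>2 + (- (al + be + 1) * (P n x * D n x) + qf x * ((D n x)\<^sup>2 + P n x * ((- l n * P n x - hcoef x * D n x) / (1 - x\<^sup>2)))))
     = gw x * (P n x * D n x) * (qf x * x / (1 - x\<^sup>2) - (al + be + 1))"
  proof -
    define X where "X = 1 - x\<^sup>2"
    have X: "X \<noteq> 0" using x2 unfolding X_def by simp
    show ?thesis unfolding Fs_def hcoef_qf X_def[symmetric] using X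
      by (simp add: field_simps power2_eq_square)
  qed
  finally show ?thesis .
qed

text \<open>Half of it dominates both |qf| on [0, 1] and al + be + 1; the added 1 makes it a safe
  denominator.\<close>

definition C1 :: real where "C1 = 2 * (\<bar>be - al\<bar> + (al + be + 1)) + 1"

lemma C1_ge: "1 \<le> C1" unfolding C1_def using add_nonneg_nonneg[OF abs_ge_zero[of "be - al"] ab_nonneg] by simp

lemma qf_le: "0 \<le> x \<Longrightarrow> x \<le> 1 \<Longrightarrow> \<bar>qf x\<bar> \<le> C1 / 2"
proof -
  assume x: "0 \<le> x" "x \<le> 1"
  have "\<bar>qf x\<bar> \<le> \<bar>be - al\<bar> + \<bar>(al + be + 1) * x\<bar>" unfolding qf_def by (rule abs_triangle_ineq4)
  moreover have "\<bar>(al + be + 1) * x\<bar> \<le> (al + be + 1) * 1"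
    using x ab_nonneg unfolding abs_mult by (intro mult_mono) auto
  moreover define m where "m = \<bar>be - al\<bar>"
  ultimately show ?thesis unfolding C1_def m_def[symmetric] by simp
qed

lemma rem_le:
  assumes x: "0 \<le> x" "x < 1"
  shows "\<bar>qf x * x / (1 - x\<^sup>2) - (al + be + 1)\<bar> \<le> C1 / (1 - x)"
proof -
  have "\<bar>qf x * x / (1 - x\<^sup>2)\<bar> \<le> C1 / 2 * 1 / (1 - x)"
    unfolding abs_mult abs_divide using x qf_le[of x] C1_ge
    by (intro frac_le mult_mono) (auto simp: power2_eq_square mult_left_le abs_square_le_1[unfolded power2_eq_square] mult_le_one)
  moreover have "al + be + 1 \<le> C1 / 2 / (1 - x)"
  proof -
    have "al + be + 1 \<le> C1 / 2 / 1" unfolding C1_def by simp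
    also have "\<dots> \<le> C1 / 2 / (1 - x)" using x C1_ge by (intro divide_left_mono) auto
    finally show ?thesis .
  qed
  moreover have "C1 / 2 * 1 / (1 - x) + C1 / 2 / (1 - x) = C1 / (1 - x)"
  proof -
    have "c / 2 * 1 / k + c / 2 / k = c / k" for c k :: real by (simp add: field_simps)
    then show ?thesis .
  qed
  moreover have "\<bar>qf x * x / (1 - x\<^sup>2) - (al + be + 1)\<bar> \<le> \<bar>qf x * x / (1 - x\<^sup>2)\<bar> + (al + be + 1)"
    using abs_triangle_ineq4[of "qf x * x / (1 - x\<^sup>2)" "al + be + 1"] ab_nonneg by simp
  ultimately show ?thesis by linarith
qed

text \<open>Arithmetic-geometric mean on the two summands of \<open>Fs\<close>, with 1 - x^2
  weakened to 1 - x in the second.\<close>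

lemma PD_le:
  assumes x: "0 \<le> x" "x < 1" and n: "0 < l n"
  shows "\<bar>P n x * D n x\<bar> \<le> Fs n x / (2 * (sqrt (l n) * sqrt (1 - x)))"
proof -
  have "2 * (sqrt (l n) * sqrt (1 - x)) * \<bar>P n x * D n x\<bar> = 2 * (sqrt (l n) * \<bar>P n x\<bar>) * (sqrt (1 - x) * \<bar>D n x\<bar>)"
    by (simp add: abs_mult)
  also have "\<dots> \<le> (sqrt (l n) * \<bar>P n x\<bar>)\<^sup>2 + (sqrt (1 - x) * \<bar>D n x\<bar>)\<^sup>2" by (rule sum_squares_bound)
  also have "\<dots> = l n * (P n x)\<^sup>2 + (1 - x) * (D n x)\<^sup>2" using x n by (simp add: power_mult_distrib)
  also have "\<dots> \<le> Fs n x"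
    unfolding Fs_def using x by (intro add_mono mult_right_mono) (auto simp: power2_eq_square mult_left_le)
  finally show ?thesis using x n by (simp add: field_simps)
qed

text \<open>In the bulk l_n (1 - x) \<ge> C1^2 the correction term is at most C1/2 * Fs / (2 C1) =
  Fs / 4, so it cannot spoil positivity.\<close>

lemma bulk_Es:
  assumes x: "0 \<le> x" "x < 1" and n: "C1\<^sup>2 \<le> l n * (1 - x)"
  shows "gw x * Fs n x / 2 \<le> Es n x" "Es n x \<le> 3 / 2 * (gw x * Fs n x)"
proof -
  have ln: "0 < l n" 
  proof -
    have "0 < C1\<^sup>2" using C1_ge by simp
    then have "0 < l n * (1 - x)" using n by linarith
    then show ?thesis using x by (simp add: zero_less_mult_iff)
  qed
  have sq: "C1 \<le> sqrt (l n) * sqrt (1 - x)"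
    using n C1_ge by (simp add: real_le_rsqrt flip: real_sqrt_mult)
  have "\<bar>qf x * (P n x * D n x)\<bar> \<le> C1 / 2 * (Fs n x / (2 * (sqrt (l n) * sqrt (1 - x))))"
    unfolding abs_mult[of "qf x"] using x ln C1_ge by (intro mult_mono qf_le PD_le) auto
  also have "\<dots> \<le> C1 / 2 * (Fs n x / (2 * C1))"
    using C1_ge x sq ln Fs_nonneg[of x n] by (intro mult_left_mono divide_left_mono) (auto intro!: mult_pos_pos)
  also have "\<dots> = Fs n x / 4" using C1_ge by simp
  finally have H: "\<bar>qf x * (P n x * D n x)\<bar> \<le> Fs n x / 4" .
  have F0: "0 \<le> Fs n x" using x by (intro Fs_nonneg) auto
  have g: "0 \<le> gw x" using gw_pos[of x] x by simp
  have "gw x * (Fs n x / 2) \<le> gw x * (Fs n x + qf x * (P n x * D n x))"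
    using H F0 g by (intro mult_left_mono) auto
  then show "gw x * Fs n x / 2 \<le> Es n x" unfolding Es_def by simp
  have "gw x * (Fs n x + qf x * (P n x * D n x)) \<le> gw x * (3 / 2 * Fs n x)"
    using H F0 g by (intro mult_left_mono) auto
  then show "Es n x \<le> 3 / 2 * (gw x * Fs n x)" unfolding Es_def by simp
qed

text \<open>The relative derivative of \<open>Es\<close> is at most C1 l^(-1/2) (1 - z)^(-3/2). Its
  primitive \<open>\<psi>\<close> stays below 2 in the bulk, so \<open>Es\<close> grows at most by
  exp 2; the factor 3 is the quotient of the comparison constants 3/2 and 1/2 in
  \<open>bulk_Es\<close>.\<close>

lemma bulk_growth:
  assumes x: "0 \<le> x" "x \<le> y" "y < 1" and n: "C1\<^sup>2 \<le> l n * (1 - y)"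
  shows "gw y * Fs n y \<le> 3 * exp 2 * (gw x * Fs n x)"
proof -
  have ln: "0 < l n" 
  proof -
    have "0 < C1\<^sup>2" using C1_ge by simp
    then have "0 < l n * (1 - y)" using n by linarith
    then show ?thesis using x by (simp add: zero_less_mult_iff)
  qed
  have nz: "C1\<^sup>2 \<le> l n * (1 - z)" if "z \<le> y" for z
    using n that ln by (intro order_trans[OF n] mult_left_mono) auto
  define \<psi> where "\<psi> z = 2 * C1 / (sqrt (l n) * sqrt (1 - z))" for z
  have "exp (- \<psi> y) * Es n y \<le> exp (- \<psi> x) * Es n x"
  proof (rule DERIV_nonpos_imp_nonincreasing[OF x(2)])
    fix z assume "x \<le> z" "z \<le> y"
    then have z: "0 \<le> z" "z < 1" "z \<le> y" using x by auto
    define d where "d = C1 / (sqrt (l n) * sqrt (1 - z) * (1 - z))"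
    have d0: "0 \<le> d" unfolding d_def using C1_ge ln z by (intro divide_nonneg_nonneg mult_nonneg_nonneg) auto
    define e where "e = gw z * (P n z * D n z) * (qf z * z / (1 - z\<^sup>2) - (al + be + 1))"
    have "e \<le> \<bar>gw z\<bar> * \<bar>P n z * D n z\<bar> * \<bar>qf z * z / (1 - z\<^sup>2) - (al + be + 1)\<bar>"
      unfolding e_def by (metis abs_ge_self abs_mult)
    also have "\<dots> \<le> gw z * (Fs n z / (2 * (sqrt (l n) * sqrt (1 - z)))) * (C1 / (1 - z))"
      using z gw_pos[of z] ln C1_ge PD_le[OF z(1,2) ln] rem_le[OF z(1,2)] Fs_nonneg[of z n]
      by (intro mult_mono) (auto intro!: mult_nonneg_nonneg)
    also have "\<dots> = d * (gw z * Fs n z / 2)" unfolding d_def using z ln by (simp add: field_simps)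
    also have "\<dots> \<le> d * Es n z" using d0 z nz by (intro mult_left_mono bulk_Es) auto
    finally have "exp (- \<psi> z) * (e - d * Es n z) \<le> 0" by (intro mult_nonneg_nonpos) auto
    moreover have "((\<lambda>z. exp (- \<psi> z) * Es n z) has_real_derivative exp (- \<psi> z) * (e - d * Es n z)) (at z)"
    proof -
      have "(\<psi> has_real_derivative d) (at z)"
      proof -
        have "(\<psi> has_real_derivative 2 * C1 * (- ((sqrt (l n) * (- (inverse (sqrt (1 - z)) / 2))) / (sqrt (l n) * sqrt (1 - z))\<^sup>2))) (at z)"
          unfolding \<psi>_def[abs_def] using z ln by (auto intro!: derivative_eq_intros simp: power2_eq_square)
        also have "2 * C1 * (- ((sqrt (l n) * (- (inverse (sqrt (1 - z)) / 2))) / (sqrt (l n) * sqrt (1 - z))\<^sup>2)) = d"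
        proof -
          define a b where "a = sqrt (l n)" and "b = sqrt (1 - z)"
          have ab: "0 < a" "0 < b" "1 - z = b * b" unfolding a_def b_def using ln z by auto
          show ?thesis unfolding d_def a_def[symmetric] b_def[symmetric] ab(3) using ab(1,2)
            by (simp add: field_simps power2_eq_square)
        qed
        finally show ?thesis .
      qed
      then show ?thesis unfolding e_def using z
        by (auto intro!: derivative_eq_intros Es_deriv simp: algebra_simps)
    qed
    ultimately show "\<exists>y. ((\<lambda>z. exp (- \<psi> z) * Es n z) has_real_derivative y) (at z) \<and> y \<le> 0" by blast
  qed
  moreover have "\<psi> y \<le> 2"
  proof -
    have "C1 \<le> sqrt (l n) * sqrt (1 - y)" using n C1_ge by (simp add: real_le_rsqrt flip: real_sqrt_mult)
    then show ?thesis unfolding \<psi>_def using C1_ge ln x by (simp add: divide_le_eq)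
  qed
  moreover have "0 \<le> \<psi> x" unfolding \<psi>_def using C1_ge ln x by simp
  moreover have Enn: "0 \<le> Es n z" if z: "0 \<le> z" "z \<le> y" for z
  proof -
    have "0 \<le> gw z * Fs n z / 2" using z x gw_pos[of z] Fs_nonneg[of z n] by simp
    also have "\<dots> \<le> Es n z" using z x nz by (intro bulk_Es) auto
    finally show ?thesis .
  qed
  ultimately have "exp (-2) * Es n y \<le> Es n x"
  proof -
    assume a: "exp (- \<psi> y) * Es n y \<le> exp (- \<psi> x) * Es n x" "\<psi> y \<le> 2" "0 \<le> \<psi> x"
    have Ey: "0 \<le> Es n y" and Ex: "0 \<le> Es n x" using Enn x by auto
    have "exp (-2) * Es n y \<le> exp (- \<psi> y) * Es n y" using a Ey by (intro mult_right_mono) auto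
    also have "\<dots> \<le> exp (- \<psi> x) * Es n x" by (rule a)
    also have "\<dots> \<le> 1 * Es n x" using a Ex by (intro mult_right_mono) auto
    finally show ?thesis by simp
  qed
  then have "Es n y \<le> exp 2 * Es n x" by (simp add: exp_minus field_simps)
  moreover have "gw y * Fs n y / 2 \<le> Es n y" using x n by (intro bulk_Es) auto
  moreover have "exp 2 * Es n x \<le> exp 2 * (3 / 2 * (gw x * Fs n x))"
    using x nz by (intro mult_left_mono bulk_Es) auto
  ultimately show ?thesis by linarith
qed

end

section \<open>Normalised polynomials and their pointwise bound near 1\<close>

lemma jacobi_L2norm_eq: "jacobi_params al be \<Longrightarrow> jacobi_L2norm al be n = sqrt (hnorm al be n)"
  by (simp add: jacobi_L2norm_def jacobi_params.hn_def jint_def)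

context jacobi_half
begin

abbreviation "p \<equiv> jacobi_p al be"

lemma hn_pos': "0 < hn n"
  by (rule hn_pos[OF jacobi_params_axioms ab_nonneg])

lemma p_eq: "p n x = P n x / sqrt (hn n)"
  unfolding jacobi_p_def jacobi_L2norm_eq[OF jacobi_params_axioms] ..

lemma p_sq: "(p n x)\<^sup>2 = (P n x)\<^sup>2 / hn n"
  unfolding p_eq using hn_pos'[of n] by (simp add: power_divide)

lemma continuous_p [continuous_intros]: "continuous_on S (p n)"
  unfolding p_eq[abs_def] using hn_pos'[of n] by (intro continuous_intros) auto

lemma p_orthonormal: "J (\<lambda>x. p n x * p m x) = (if n = m then 1 else 0)"
proof -
  have "J (\<lambda>x. p n x * p m x) = J (\<lambda>x. 1 / (sqrt (hn n) * sqrt (hn m)) * (P n x * P m x))"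
    unfolding p_eq by (intro jint_cong) simp
  also have "\<dots> = 1 / (sqrt (hn n) * sqrt (hn m)) * J (\<lambda>x. P n x * P m x)" by (rule jint_cmult)
  also have "\<dots> = (if n = m then 1 else 0)"
    using jacobiP_orth[OF ab_nonneg, of n m] hn_pos'[of n] hn_def[of n] by (auto simp: power2_eq_square)
  finally show ?thesis .
qed

lemma Fs_integral: "J (Fs n) = 2 * l n * hn n"
proof -
  have "J (Fs n) = J (\<lambda>x. l n * (P n x)\<^sup>2) + J (\<lambda>x. (1 - x\<^sup>2) * (D n x)\<^sup>2)"
    unfolding Fs_def[abs_def] by (intro jint_add continuous_intros)
  also have "J (\<lambda>x. l n * (P n x)\<^sup>2) = l n * hn n" unfolding jint_cmult hn_def ..
  finally show ?thesis unfolding energy_identity by simp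
qed

lemma continuous_Fs: "continuous_on S (Fs n)"
  unfolding Fs_def[abs_def] by (intro continuous_intros)

lemma gw_le_weight:
  assumes "-1 < x" "x < 1"
  shows "gw x \<le> jacobi_weight al be x"
proof -
  have "gw x = jacobi_weight al be x * (sqrt (1 - x) * sqrt (1 + x))"
    unfolding gw_def jacobi_weight_def using assms by (simp add: powr_add powr_half_sqrt)
  also have "sqrt (1 - x) * sqrt (1 + x) = sqrt (1 - x\<^sup>2)"
    by (simp add: power2_eq_square algebra_simps flip: real_sqrt_mult)
  also have "jacobi_weight al be x * sqrt (1 - x\<^sup>2) \<le> jacobi_weight al be x * 1"
    by (intro mult_left_mono jacobi_weight_nonneg) simp
  finally show ?thesis by simp
qed

text \<open>The value at y is controlled by the value at every x in [0, 1/2]. Averaging over this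
  interval of length 1/2 brings in the total integral 2 l_n h_n of \<open>Fs\<close>, so the
  constant is 2 * (3 exp 2) * 2.\<close>

lemma bulk_bound:
  assumes y: "1/2 \<le> y" "y < 1" and n: "C1\<^sup>2 \<le> l n * (1 - y)"
  shows "gw y * Fs n y \<le> 12 * exp 2 * (l n * hn n)"
proof -
  define G where "G = gw y * Fs n y"
  have G0: "0 \<le> G" unfolding G_def using gw_pos[of y] Fs_nonneg[of y n] y by auto
  define I where "I = (LINT x:{-1<..<1}|lborel. indicator {0..1/2::real} x * G)"
  have half: "G / 2 = I"
  proof -
    have "(LINT x:{-1<..<1}|lborel. indicator {0..1/2::real} x * G) = (\<integral>x. indicator {0..1/2::real} x * G \<partial>lborel)"
      unfolding set_lebesgue_integral_def by (intro Bochner_Integration.integral_cong) (auto simp: indicator_def)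
    also have "\<dots> = G / 2" by simp
    finally show ?thesis unfolding I_def by simp
  qed
  have "I \<le> (LINT x:{-1<..<1}|lborel. 3 * exp 2 * Fs n x * jacobi_weight al be x)"
    unfolding I_def
  proof (rule set_integral_mono)
    show "set_integrable lborel {-1<..<1} (\<lambda>x. indicator {0..1/2::real} x * G)"
      unfolding set_integrable_def
    proof -
      have "(\<lambda>x. indicator {-1<..<1} x *\<^sub>R (indicator {0..1/2::real} x * G)) = (\<lambda>x. indicator {0..1/2} x * G)"
        by (auto simp: indicator_def)
      moreover have "integrable lborel (indicat_real {0..1/2::real})"
        by (rule integrable_real_indicator) (simp, rule emeasure_bounded_finite, simp)
      ultimately show "integrable lborel (\<lambda>x. indicator {-1<..<1} x *\<^sub>R (indicator {0..1/2::real} x * G))" by simp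
    qed
    show "set_integrable lborel {-1<..<1} (\<lambda>x. 3 * exp 2 * Fs n x * jacobi_weight al be x)"
      using al be by (intro jint_integrable continuous_intros continuous_Fs)
    fix x :: real assume x: "x \<in> {-1<..<1}"
    have W: "0 \<le> jacobi_weight al be x" and F: "0 \<le> Fs n x"
      using x jacobi_weight_nonneg Fs_nonneg[of x n] by auto
    show "indicator {0..1/2::real} x * G \<le> 3 * exp 2 * Fs n x * jacobi_weight al be x"
    proof (cases "x \<in> {0..1/2}")
      case True
      have "G \<le> 3 * exp 2 * (gw x * Fs n x)" unfolding G_def using True y n by (intro bulk_growth) auto
      also have "\<dots> \<le> 3 * exp 2 * (jacobi_weight al be x * Fs n x)"
        using x F by (intro mult_left_mono mult_right_mono gw_le_weight) auto
      finally show ?thesis using True by (simp add: mult_ac)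
    next
      case False
      then show ?thesis using W F by simp
    qed
  qed
  also have "\<dots> = J (\<lambda>x. 3 * exp 2 * Fs n x)" unfolding jint_def ..
  also have "\<dots> = 6 * exp 2 * (l n * hn n)" unfolding jint_cmult Fs_integral by simp
  finally have "G \<le> 12 * exp 2 * (l n * hn n)" using half by linarith
  then show ?thesis unfolding G_def .
qed

lemma gw_ge: "0 \<le> x \<Longrightarrow> x < 1 \<Longrightarrow> (1 - x) powr (al + 1/2) \<le> gw x"
proof -
  assume x: "0 \<le> x" "x < 1"
  have "(1 - x) powr (al + 1/2) * 1 \<le> (1 - x) powr (al + 1/2) * (1 + x) powr (be + 1/2)"
    using x be_half by (intro mult_left_mono ge_one_powr_ge_zero) auto
  then show ?thesis unfolding gw_def by simp
qed

lemma P_sq_bound_large: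
  obtains C where "0 \<le> C" "\<And>n (x::real). 2 * C1\<^sup>2 \<le> l n \<Longrightarrow> 1/2 \<le> x \<Longrightarrow> x < 1 \<Longrightarrow> (P n x)\<^sup>2 * (1 - x) powr (al + 1/2) \<le> C * hn n"
proof
  define c where "c = 2 * (2 * al + 1)"
  define M where "M = exp (2 * (al + be + 1)) * 4 * (2 * kap * C1\<^sup>2) powr c * 12 * exp 2"
  have e1: "1 \<le> C1\<^sup>2" using C1_ge by simp
  show "0 \<le> 12 * exp 2 + M" unfolding M_def by simp
  fix n and x :: real assume l: "2 * C1\<^sup>2 \<le> l n" and x: "1/2 \<le> x" "x < 1"
  have l1: "2 \<le> l n" using l e1 by linarith
  define h where "h = l n * hn n"
  have h: "0 < h" unfolding h_def using l1 hn_pos'[of n] by simp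
  show "(P n x)\<^sup>2 * (1 - x) powr (al + 1/2) \<le> (12 * exp 2 + M) * hn n"
  proof (cases "C1\<^sup>2 \<le> l n * (1 - x)")
    case True
    have "l n * ((P n x)\<^sup>2 * (1 - x) powr (al + 1/2)) = (1 - x) powr (al + 1/2) * (l n * (P n x)\<^sup>2)" by simp
    also have "\<dots> \<le> gw x * Fs n x"
      using x l1 gw_pos[of x] by (intro mult_mono gw_ge) (auto simp: Fs_def power2_eq_square mult_le_one)
    also have "\<dots> \<le> 12 * exp 2 * (l n * hn n)" by (rule bulk_bound[OF x True])
    finally have "l n * ((P n x)\<^sup>2 * (1 - x) powr (al + 1/2)) \<le> l n * (12 * exp 2 * hn n)" by (simp add: mult_ac)
    then have "(P n x)\<^sup>2 * (1 - x) powr (al + 1/2) \<le> 12 * exp 2 * hn n" using l1 by simp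
    also have "\<dots> \<le> (12 * exp 2 + M) * hn n"
      using hn_pos'[of n] unfolding M_def by (intro mult_right_mono) auto
    finally show ?thesis .
  next
    case False
    \<comment> \<open>Beyond the edge y of the bulk a chain of comparisons is used: x to the
      endpoint 1, from there to z, and from z back to y by \<open>Fs_growth\<close>. The quotient (1
      - y) / (1 - z) is the constant 2 kap C1^2, so each link costs a factor independent of
      n.\<close>
    define y where "y = 1 - C1\<^sup>2 / l n"
    define z where "z = 1 - 1 / (2 * kap * l n)"
    have y: "1/2 \<le> y" "y < 1" "l n * (1 - y) = C1\<^sup>2" unfolding y_def using l l1 e1 by (auto simp: field_simps)
    have xy: "1 - x \<le> 1 - y" using False l1 unfolding y_def by (simp add: field_simps)
    have kl: "1 \<le> kap * l n" using mult_mono[OF kap_ge, of 1 "l n"] kap_ge l1 by simp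
    have zy: "y \<le> z"
    proof -
      have "1 / (2 * kap * l n) \<le> 1 / l n" using kap_ge l1 by (intro divide_left_mono) auto
      also have "\<dots> \<le> C1\<^sup>2 / l n" using e1 l1 by (intro divide_right_mono) auto
      finally show ?thesis unfolding y_def z_def by simp
    qed
    have z: "z < 1" unfolding z_def using kap_ge l1 by simp
    have zz: "1 - z = 1 / (2 * kap * l n)" unfolding z_def by simp
    have c0: "0 \<le> c" unfolding c_def using al_half by simp
    have "(1 - z) powr c * Fs n z \<le> (1 - y) powr c * Fs n y"
      unfolding c_def using y zy z by (intro Fs_growth) auto
    then have "Fs n z \<le> ((1 - y) / (1 - z)) powr c * Fs n y"
      using y z zy by (simp add: powr_divide field_simps)
    also have "(1 - y) / (1 - z) = 2 * kap * C1\<^sup>2" unfolding zz y_def using l1 kap_ge by (simp add: field_simps)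
    finally have Fz: "Fs n z \<le> (2 * kap * C1\<^sup>2) powr c * Fs n y" .
    have g: "(1 - x) powr (al + 1/2) \<le> gw y"
    proof -
      have "(1 - x) powr (al + 1/2) \<le> (1 - y) powr (al + 1/2)" using x xy al_half by (intro powr_mono2) auto
      also have "\<dots> \<le> gw y" using y by (intro gw_ge) auto
      finally show ?thesis .
    qed
    have "(P n x)\<^sup>2 \<le> exp (2 * (al + be + 1)) * (P n 1)\<^sup>2" using x by (intro P_sq_le_one) auto
    also have "\<dots> \<le> exp (2 * (al + be + 1)) * (4 * (P n z)\<^sup>2)"
      unfolding z_def using l1 by (intro mult_left_mono P_one_le) auto
    finally have "l n * (P n x)\<^sup>2 \<le> l n * (exp (2 * (al + be + 1)) * (4 * (P n z)\<^sup>2))"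
      using l1 by (intro mult_left_mono) auto
    also have "\<dots> = exp (2 * (al + be + 1)) * (4 * (l n * (P n z)\<^sup>2))" by simp
    also have "\<dots> \<le> exp (2 * (al + be + 1)) * (4 * Fs n z)"
      using z zy y by (intro mult_left_mono) (auto simp: Fs_def power2_eq_square mult_le_one)
    also have "\<dots> \<le> exp (2 * (al + be + 1)) * (4 * ((2 * kap * C1\<^sup>2) powr c * Fs n y))"
      using Fz by (intro mult_left_mono) auto
    finally have lP: "l n * (P n x)\<^sup>2 \<le> exp (2 * (al + be + 1)) * (4 * ((2 * kap * C1\<^sup>2) powr c * Fs n y))" .
    have "l n * (P n x)\<^sup>2 * (1 - x) powr (al + 1/2)
      \<le> exp (2 * (al + be + 1)) * (4 * ((2 * kap * C1\<^sup>2) powr c * Fs n y)) * gw y"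
      using y Fs_nonneg[of y n] by (intro mult_mono[OF lP g]) auto
    also have "\<dots> = exp (2 * (al + be + 1)) * 4 * (2 * kap * C1\<^sup>2) powr c * (gw y * Fs n y)" by simp
    also have "\<dots> \<le> exp (2 * (al + be + 1)) * 4 * (2 * kap * C1\<^sup>2) powr c * (12 * exp 2 * (l n * hn n))"
      using y by (intro mult_left_mono bulk_bound) auto
    also have "\<dots> = l n * (M * hn n)" unfolding M_def by simp
    finally have "l n * ((P n x)\<^sup>2 * (1 - x) powr (al + 1/2)) \<le> l n * (M * hn n)" by (simp add: mult_ac)
    then have "(P n x)\<^sup>2 * (1 - x) powr (al + 1/2) \<le> M * hn n" using l1 by simp
    also have "\<dots> \<le> (12 * exp 2 + M) * hn n"
      using hn_pos'[of n] by (intro mult_right_mono) auto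
    finally show ?thesis .
  qed
qed

lemma p_sq_bound:
  obtains C where "0 \<le> C" "\<And>n x. 1/2 \<le> x \<Longrightarrow> x < 1 \<Longrightarrow> (p n x)\<^sup>2 * (1 - x) powr (al + 1/2) \<le> C"
proof -
  obtain C where C: "0 \<le> C" "\<And>n x. 2 * C1\<^sup>2 \<le> l n \<Longrightarrow> 1/2 \<le> x \<Longrightarrow> x < 1 \<Longrightarrow> (P n x)\<^sup>2 * (1 - x) powr (al + 1/2) \<le> C * hn n"
    using P_sq_bound_large by blast
  \<comment> \<open>The bound for large eigenvalues leaves out finitely many degrees; each of them
    is bounded by compactness, and (1 - x) powr (al + 1/2) is at most 1.\<close>
  have "\<exists>B. \<forall>x\<in>{-1..1}. (p n x)\<^sup>2 \<le> B" for n
  proof -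
    have "compact ((\<lambda>x. (p n x)\<^sup>2) ` {-1..1})" by (intro compact_continuous_image continuous_intros) auto
    then show ?thesis by (metis bounded_iff compact_imp_bounded image_eqI real_norm_def abs_le_D1)
  qed
  then obtain B where B: "\<And>n x. x \<in> {-1..1} \<Longrightarrow> (p n x)\<^sup>2 \<le> B n" by metis
  obtain N :: nat where N: "2 * C1\<^sup>2 \<le> real N" using real_arch_simple by blast
  have B0: "0 \<le> B n" for n using B[of 0 n] by (auto intro: order_trans[of _ "(p n 0)\<^sup>2"])
  show thesis
  proof
    show "0 \<le> C + (\<Sum>n\<le>N. B n)" using C B0 by (simp add: sum_nonneg)
    fix n x assume x: "1/2 \<le> x" "x < (1::real)"
    show "(p n x)\<^sup>2 * (1 - x) powr (al + 1/2) \<le> C + (\<Sum>n\<le>N. B n)"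
    proof (cases "n \<le> N")
      case True
      have "(p n x)\<^sup>2 * (1 - x) powr (al + 1/2) \<le> B n * 1"
        using x al_half B0 by (intro mult_mono B powr_le1) auto
      also have "\<dots> \<le> (\<Sum>n\<le>N. B n)" using True B0 by (simp, intro member_le_sum) auto
      finally show ?thesis using C by simp
    next
      case False
      then have "1 \<le> n" by simp
      have "real N \<le> real n * 1" using False by simp
      also have "\<dots> \<le> real n * real n" using \<open>1 \<le> n\<close> by (intro mult_left_mono) auto
      also have "\<dots> \<le> l n" using l_ge[OF \<open>1 \<le> n\<close>] by (simp add: power2_eq_square)
      finally have "(P n x)\<^sup>2 * (1 - x) powr (al + 1/2) \<le> C * hn n" using N x by (intro C) auto
      then have "(p n x)\<^sup>2 * (1 - x) powr (al + 1/2) \<le> C" unfolding p_sq using hn_pos'[of n] by (simp add: field_simps)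
      then show ?thesis using B0 by (simp add: add_increasing2 sum_nonneg)
    qed
  qed
qed

end

section \<open>Heat kernel estimates\<close>

lemma exp_minus_le_inverse: "0 \<le> u \<Longrightarrow> exp (- u) \<le> 1 / (1 + u)" for u :: real
  using exp_ge_add_one_self[of u] by (simp add: exp_minus field_simps)

text \<open>The parameters (-1/2, 0) make the weight (1 - x) powr (-1/2), the size of p_n^2 times
  the Jacobi weight near 1. In r = sqrt (1 - x) the primitive is an arctangent. The absolute value
  keeps the denominator positive for every real x.\<close>

lemma jint_arctan:
  assumes s: "0 < s"
  shows "jint (-1/2) 0 (\<lambda>x. 1 / (1 + s * \<bar>1 - x\<bar>)) \<le> pi / sqrt s"
proof -
  define \<Phi> where "\<Phi> x = - (2 / sqrt s) * arctan (sqrt (s * (1 - x)))" for x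
  have "((\<lambda>x. 1 / (1 + s * \<bar>1 - x\<bar>) * jacobi_weight (-1/2) 0 x) has_integral (\<Phi> 1 - \<Phi> (-1))) {-1..1}"
  proof (rule fundamental_theorem_of_calculus_interior)
    show "continuous_on {-1..1} \<Phi>" unfolding \<Phi>_def by (intro continuous_intros)
    fix x :: real assume x: "x \<in> {-1<..<1}"
    define r where "r = sqrt (1 - x)"
    have r: "0 < r" "1 - x = r * r" unfolding r_def using x by auto
    have pos: "0 < s * (1 - x)" using s x by simp
    have d1: "((\<lambda>x. sqrt (s * (1 - x))) has_real_derivative (inverse (sqrt (s * (1 - x))) / 2) * (- s)) (at x)"
      by (rule DERIV_chain2[where f=sqrt and g="\<lambda>x. s * (1 - x)", OF DERIV_real_sqrt[OF pos]]) (auto intro!: derivative_eq_intros)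
    have "(\<Phi> has_real_derivative - (2 / sqrt s) * (inverse (1 + (sqrt (s * (1 - x)))\<^sup>2) * (inverse (sqrt (s * (1 - x))) / 2 * (- s)))) (at x)"
      unfolding \<Phi>_def[abs_def] by (intro DERIV_cmult DERIV_chain2[OF DERIV_arctan d1])
    also have "- (2 / sqrt s) * (inverse (1 + (sqrt (s * (1 - x)))\<^sup>2) * (inverse (sqrt (s * (1 - x))) / 2 * (- s)))
       = 1 / (1 + s * (1 - x)) * (1 / r)"
    proof -
      have alg: "- (2 / a) * (inverse (1 + (a * r)\<^sup>2) * (inverse (a * r) / 2 * (- (a * a)))) = 1 / (1 + a * a * (r * r)) * (1 / r)"
        if "0 < a" for a :: real
      proof -
        define Q where "Q = 1 + a * a * (r * r)"
        have "0 \<le> a * a * (r * r)" by simp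
        then have Q: "0 < Q" unfolding Q_def by linarith
        have "1 + (a * r)\<^sup>2 = Q" unfolding Q_def by (simp add: power2_eq_square mult_ac)
        then show ?thesis using that r(1) Q unfolding Q_def[symmetric] by (simp add: field_simps)
      qed
      have "sqrt (s * (1 - x)) = sqrt s * r" unfolding r_def by (rule real_sqrt_mult)
      then show ?thesis using alg[of "sqrt s"] s unfolding r(2)[symmetric] by simp
    qed
    also have "\<dots> = 1 / (1 + s * \<bar>1 - x\<bar>) * jacobi_weight (-1/2) 0 x"
    proof -
      have "(1 - x) powr (-1/2) = 1 / r" using x unfolding r_def by (simp add: powr_minus powr_half_sqrt inverse_eq_divide)
      then show ?thesis using x unfolding jacobi_weight_def by simp
    qed
    finally show "(\<Phi> has_vector_derivative 1 / (1 + s * \<bar>1 - x\<bar>) * jacobi_weight (-1/2) 0 x) (at x)"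
      by (simp add: has_real_derivative_iff_has_vector_derivative)
  qed simp
  then have "((\<lambda>x. 1 / (1 + s * \<bar>1 - x\<bar>) * jacobi_weight (-1/2) 0 x) has_integral (\<Phi> 1 - \<Phi> (-1))) {-1<..<1}"
    by (simp add: has_integral_Icc_iff_Ioo)
  moreover have "set_integrable lborel {-1<..<1} (\<lambda>x. 1 / (1 + s * \<bar>1 - x\<bar>) * jacobi_weight (-1/2) 0 x)"
  proof (intro jint_integrable continuous_intros ballI)
    fix x :: real
    have "0 \<le> s * \<bar>1 - x\<bar>" using s by simp
    then show "1 + s * \<bar>1 - x\<bar> \<noteq> 0" by linarith
  qed auto
  ultimately have "jint (-1/2) 0 (\<lambda>x. 1 / (1 + s * \<bar>1 - x\<bar>)) = \<Phi> 1 - \<Phi> (-1)"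
    unfolding jint_def by (metis set_borel_integral_eq_integral(2) integral_unique)
  also have "\<dots> = 2 / sqrt s * arctan (sqrt (s * 2))" unfolding \<Phi>_def by simp
  also have "\<dots> \<le> 2 / sqrt s * (pi / 2)" using s arctan_ubound by (intro mult_left_mono) (auto intro: less_imp_le)
  finally show ?thesis by simp
qed

context jacobi_half
begin

text \<open>On x \<le> 1/2 the exponential is at most exp (-s/2) and the total mass is 1. On x > 1/2
  the pointwise bound reduces the measure to (1 - x) powr (-1/2), and exp (-u) \<le> 1 / (1 + u)
  leads to \<open>jint_arctan\<close>.\<close>

theorem heat_diagonal:
  obtains C where "0 < C" "\<And>n s. 0 < s \<Longrightarrow> J (\<lambda>x. exp (- s * (1 - x)) * (p n x)\<^sup>2) \<le> C / sqrt s"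
proof -
  obtain C where C: "0 \<le> C" "\<And>n x. 1/2 \<le> x \<Longrightarrow> x < 1 \<Longrightarrow> (p n x)\<^sup>2 * (1 - x) powr (al + 1/2) \<le> C"
    using p_sq_bound by blast
  define M where "M = C * 2 powr \<bar>be\<bar>"
  have M: "0 \<le> M" unfolding M_def using C by simp
  show thesis
  proof
    show "0 < 1 + M * pi" using M by (intro add_pos_nonneg) auto
    fix n and s :: real assume s: "0 < s"
    have int1: "set_integrable lborel {-1<..<1} (\<lambda>x. exp (- s / 2) * (p n x)\<^sup>2 * jacobi_weight al be x)"
      using al be by (intro jint_integrable continuous_intros)
    have int2: "set_integrable lborel {-1<..<1} (\<lambda>x. M * (1 / (1 + s * \<bar>1 - x\<bar>)) * jacobi_weight (-1/2) 0 x)"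
    proof (intro jint_integrable continuous_intros ballI)
      fix x :: real
      have "0 \<le> s * \<bar>1 - x\<bar>" using s by simp
      then show "1 + s * \<bar>1 - x\<bar> \<noteq> 0" by linarith
    qed auto
    have "J (\<lambda>x. exp (- s * (1 - x)) * (p n x)\<^sup>2) \<le> (LINT x:{-1<..<1}|lborel. 
       exp (- s / 2) * (p n x)\<^sup>2 * jacobi_weight al be x + M * (1 / (1 + s * \<bar>1 - x\<bar>)) * jacobi_weight (-1/2) 0 x)"
      unfolding jint_def
    proof (rule set_integral_mono)
      show "set_integrable lborel {-1<..<1} (\<lambda>x. exp (- s * (1 - x)) * (p n x)\<^sup>2 * jacobi_weight al be x)"
        using al be by (intro jint_integrable continuous_intros)
      show "set_integrable lborel {-1<..<1} (\<lambda>x. 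
         exp (- s / 2) * (p n x)\<^sup>2 * jacobi_weight al be x + M * (1 / (1 + s * \<bar>1 - x\<bar>)) * jacobi_weight (-1/2) 0 x)"
        by (rule set_integral_add(1)[OF int1 int2])
      fix x :: real assume x: "x \<in> {-1<..<1}"
      have A0: "0 \<le> exp (- s / 2) * (p n x)\<^sup>2 * jacobi_weight al be x" using jacobi_weight_nonneg by simp
      have B0: "0 \<le> M * (1 / (1 + s * \<bar>1 - x\<bar>)) * jacobi_weight (-1/2) 0 x"
        using jacobi_weight_nonneg M s by (intro mult_nonneg_nonneg divide_nonneg_nonneg) auto
      show "exp (- s * (1 - x)) * (p n x)\<^sup>2 * jacobi_weight al be x
        \<le> exp (- s / 2) * (p n x)\<^sup>2 * jacobi_weight al be x + M * (1 / (1 + s * \<bar>1 - x\<bar>)) * jacobi_weight (-1/2) 0 x"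
      proof (cases "x \<le> 1/2")
        case True
        have "s * (1/2) \<le> s * (1 - x)" using True s by (intro mult_left_mono) auto
        then have "exp (- s * (1 - x)) * ((p n x)\<^sup>2 * jacobi_weight al be x) \<le> exp (- s / 2) * ((p n x)\<^sup>2 * jacobi_weight al be x)"
          using jacobi_weight_nonneg by (intro mult_right_mono) auto
        then show ?thesis using B0 by (simp add: mult.assoc)
      next
        case False
        then have x: "1/2 \<le> x" "x < 1" using x by auto
        have b1: "(1 + x) powr be \<le> 2 powr \<bar>be\<bar>"
        proof -
          have "(1 + x) powr be \<le> (1 + x) powr \<bar>be\<bar>" using x by (intro powr_mono) auto
          also have "\<dots> \<le> 2 powr \<bar>be\<bar>" using x by (intro powr_mono2) auto
          finally show ?thesis .
        qed
        have p1: "(p n x)\<^sup>2 * (1 - x) powr al = ((p n x)\<^sup>2 * (1 - x) powr (al + 1/2)) * (1 - x) powr (-1/2)"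
          using x by (simp add: mult.assoc flip: powr_add)
        have p2: "(p n x)\<^sup>2 * (1 - x) powr al \<le> C * (1 - x) powr (-1/2)"
          unfolding p1 using C(2)[OF x] by (rule mult_right_mono) simp
        have "((p n x)\<^sup>2 * (1 - x) powr al) * (1 + x) powr be \<le> (C * (1 - x) powr (-1/2)) * 2 powr \<bar>be\<bar>"
          using C(1) by (intro mult_mono[OF p2 b1]) auto
        then have k: "(p n x)\<^sup>2 * jacobi_weight al be x \<le> M * jacobi_weight (-1/2) 0 x"
          unfolding jacobi_weight_def M_def using x by (simp add: mult_ac)
        have "exp (- s * (1 - x)) * ((p n x)\<^sup>2 * jacobi_weight al be x) \<le> 1 / (1 + s * \<bar>1 - x\<bar>) * (M * jacobi_weight (-1/2) 0 x)"
          using x s jacobi_weight_nonneg exp_minus_le_inverse[of "s * (1 - x)"] by (intro mult_mono[OF _ k]) auto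
        then show ?thesis using A0 by (simp add: mult_ac)
      qed
    qed
    also have "\<dots> = exp (- s / 2) * J (\<lambda>x. (p n x)\<^sup>2) + M * jint (-1/2) 0 (\<lambda>x. 1 / (1 + s * \<bar>1 - x\<bar>))"
      unfolding set_integral_add(2)[OF int1 int2] unfolding jint_def mult.assoc by (simp only: set_integral_mult_right)
    also have "J (\<lambda>x. (p n x)\<^sup>2) = 1" using p_orthonormal[of n n] by (simp add: power2_eq_square)
    also have "exp (- s / 2) * 1 + M * jint (-1/2) 0 (\<lambda>x. 1 / (1 + s * \<bar>1 - x\<bar>)) \<le> 1 / sqrt s + M * (pi / sqrt s)"
    proof (intro add_mono mult_left_mono M jint_arctan s)
      have "sqrt s \<le> exp (s / 2)"
      proof (rule real_le_lsqrt)
        have "s \<le> exp s" using exp_ge_add_one_self[of s] by linarith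
        also have "exp s = (exp (s / 2))\<^sup>2" using exp_double[of "s / 2"] by simp
        finally show "s \<le> (exp (s / 2))\<^sup>2" .
      qed (use s in auto)
      then show "exp (- s / 2) * 1 \<le> 1 / sqrt s" using s by (simp add: exp_minus field_simps)
    qed
    also have "\<dots> = (1 + M * pi) / sqrt s" by (simp add: add_divide_distrib)
    finally show "J (\<lambda>x. exp (- s * (1 - x)) * (p n x)\<^sup>2) \<le> (1 + M * pi) / sqrt s" .
  qed
qed

end

section \<open>Bilinear estimates, derivatives and the commutator identity\<close>

context jacobi_params
begin

text \<open>The parameter d in 2 |u v| \<le> d u^2 + v^2 / d is optimised. If one of the two
  integrals vanishes no optimum exists, and the explicit values (b + 1) / c and c / (a + 1) give the
  contradiction.\<close>

lemma jint_Cauchy_Schwarz: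
  assumes "continuous_on {-1..1} e" "continuous_on {-1..1} u" "continuous_on {-1..1} v" and e: "\<And>x. 0 \<le> e x"
  shows "J (\<lambda>x. e x * \<bar>u x * v x\<bar>) \<le> sqrt (J (\<lambda>x. e x * (u x)\<^sup>2)) * sqrt (J (\<lambda>x. e x * (v x)\<^sup>2))"
proof -
  define a b c where "a = J (\<lambda>x. e x * (u x)\<^sup>2)" and "b = J (\<lambda>x. e x * (v x)\<^sup>2)" and "c = J (\<lambda>x. e x * \<bar>u x * v x\<bar>)"
  have a0: "0 \<le> a" and b0: "0 \<le> b" and c0: "0 \<le> c" unfolding a_def b_def c_def
    using assms by (auto intro!: jint_nonneg continuous_intros)
  have am: "2 * c \<le> d * a + b / d" if d: "0 < d" for d
  proof -
    have "2 * c = J (\<lambda>x. 2 * (e x * \<bar>u x * v x\<bar>))" unfolding c_def jint_cmult ..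
    also have "\<dots> \<le> J (\<lambda>x. d * (e x * (u x)\<^sup>2) + (1 / d) * (e x * (v x)\<^sup>2))"
    proof (rule jint_mono)
      fix x
      have "2 * (sqrt d * \<bar>u x\<bar>) * (\<bar>v x\<bar> / sqrt d) \<le> (sqrt d * \<bar>u x\<bar>)\<^sup>2 + (\<bar>v x\<bar> / sqrt d)\<^sup>2" by (rule sum_squares_bound)
      then have "2 * \<bar>u x * v x\<bar> \<le> d * (u x)\<^sup>2 + (1 / d) * (v x)\<^sup>2"
        using d by (simp add: power_mult_distrib power_divide abs_mult)
      from mult_left_mono[OF this e[of x]]
      show "2 * (e x * \<bar>u x * v x\<bar>) \<le> d * (e x * (u x)\<^sup>2) + 1 / d * (e x * (v x)\<^sup>2)" by (simp add: algebra_simps)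
    qed (use assms d in \<open>auto intro!: continuous_intros\<close>)
    also have "\<dots> = d * a + 1 / d * b"
      unfolding a_def b_def using assms by (subst jint_add) (auto intro!: continuous_intros simp only: jint_cmult)
    finally show ?thesis by simp
  qed
  show ?thesis
  proof (cases "0 < a \<and> 0 < b")
    case True
    define d where "d = sqrt b / sqrt a"
    have "2 * c \<le> d * a + b / d" using True unfolding d_def by (intro am) auto
    also have "\<dots> = 2 * (sqrt a * sqrt b)"
    proof -
      define x y where "x = sqrt a" and "y = sqrt b"
      have xy: "0 < x" "0 < y" "a = x * x" "b = y * y" unfolding x_def y_def using True by auto
      show ?thesis unfolding d_def x_def[symmetric] y_def[symmetric] xy(3,4) using xy(1,2) by (simp add: field_simps)
    qed
    finally show ?thesis unfolding a_def b_def c_def by simp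
  next
    case False
    have "c \<le> 0"
    proof (rule ccontr)
      assume "\<not> c \<le> 0"
      then have c: "0 < c" by simp
      show False
      proof (cases "a = 0")
        case True
        have "2 * c \<le> b / ((b + 1) / c)" using am[of "(b + 1) / c"] c b0 True by simp
        also have "\<dots> = b / (b + 1) * c" by simp
        also have "\<dots> \<le> 1 * c" using b0 c by (intro mult_right_mono) auto
        finally show False using c by simp
      next
        case F: False
        then have "b = 0" using False a0 b0 by auto
        then have "2 * c \<le> c / (a + 1) * a" using am[of "c / (a + 1)"] c a0 by simp
        also have "\<dots> = a / (a + 1) * c" by simp
        also have "\<dots> \<le> 1 * c" using a0 c by (intro mult_right_mono) auto
        finally show False using c by simp
      qed
    qed
    then show ?thesis using a0 b0 unfolding a_def b_def c_def by (auto intro: order_trans)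
  qed
qed

lemma jint_bilinear_bound:
  assumes cont: "continuous_on {-1..1} \<Phi>" "continuous_on {-1..1} u" "continuous_on {-1..1} v"
    and \<Phi>: "\<And>x. -1 < x \<Longrightarrow> x < 1 \<Longrightarrow> \<bar>\<Phi> x\<bar> \<le> A * exp (- s * (1 - x))" and A: "0 \<le> A"
    and U: "J (\<lambda>x. exp (- s * (1 - x)) * (u x)\<^sup>2) \<le> U" and V: "J (\<lambda>x. exp (- s * (1 - x)) * (v x)\<^sup>2) \<le> V"
  shows "\<bar>J (\<lambda>x. \<Phi> x * (u x * v x))\<bar> \<le> A * (sqrt U * sqrt V)"
proof -
  have "\<bar>J (\<lambda>x. \<Phi> x * (u x * v x))\<bar> \<le> J (\<lambda>x. A * (exp (- s * (1 - x)) * \<bar>u x * v x\<bar>))"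
  proof (rule jint_abs)
    fix x :: real assume x: "-1 < x" "x < 1"
    show "\<bar>\<Phi> x * (u x * v x)\<bar> \<le> A * (exp (- s * (1 - x)) * \<bar>u x * v x\<bar>)"
      using mult_right_mono[OF \<Phi>[OF x], of "\<bar>u x * v x\<bar>"] by (simp add: abs_mult mult.assoc)
  qed (intro continuous_intros cont)+
  also have "\<dots> = A * J (\<lambda>x. exp (- s * (1 - x)) * \<bar>u x * v x\<bar>)" by (rule jint_cmult)
  also have "\<dots> \<le> A * (sqrt (J (\<lambda>x. exp (- s * (1 - x)) * (u x)\<^sup>2)) * sqrt (J (\<lambda>x. exp (- s * (1 - x)) * (v x)\<^sup>2)))"
    using A cont by (intro mult_left_mono jint_Cauchy_Schwarz) (auto intro!: continuous_intros)
  also have "\<dots> \<le> A * (sqrt U * sqrt V)"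
  proof -
    have "0 \<le> U" by (rule order_trans[OF jint_nonneg U]) (auto intro!: continuous_intros cont)
    then show ?thesis
      using A U V by (intro mult_left_mono mult_mono real_sqrt_le_mono) (auto intro!: jint_nonneg continuous_intros cont)
  qed
  finally show ?thesis .
qed

end

context jacobi_half
begin

definition pd :: "nat \<Rightarrow> real \<Rightarrow> real" where "pd n x = D n x / sqrt (hn n)"
definition pdd :: "nat \<Rightarrow> real \<Rightarrow> real" where "pdd n x = jacobiDD al be n x / sqrt (hn n)"

lemma p_deriv: "(p n has_real_derivative pd n x) (at x)"
  unfolding p_eq[abs_def] pd_def by (rule DERIV_cdivide[OF jacobiP_deriv])

lemma pd_deriv: "(pd n has_real_derivative pdd n x) (at x)"
  unfolding pdd_def pd_def[abs_def] by (rule DERIV_cdivide[OF jacobiD_deriv])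

lemma continuous_pd [continuous_intros]: "continuous_on S (pd n)"
  unfolding pd_def[abs_def] using hn_pos'[of n] by (intro continuous_intros) auto

lemma continuous_pdd [continuous_intros]: "continuous_on S (pdd n)"
  unfolding pdd_def[abs_def] using hn_pos'[of n] by (intro continuous_intros) auto

lemma p_ode: "(1 - x\<^sup>2) * pdd n x + hcoef x * pd n x = - l n * p n x"
proof -
  have "(1 - x\<^sup>2) * pdd n x + hcoef x * pd n x = ((1 - x\<^sup>2) * jacobiDD al be n x + hcoef x * D n x) / sqrt (hn n)"
    unfolding pd_def pdd_def by (simp add: add_divide_distrib)
  then show ?thesis unfolding jacobi_ode p_eq by simp
qed

lemma pd_0 [simp]: "pd 0 x = 0" by (simp add: pd_def)

text \<open>\<open>hn_Suc\<close> is exactly what makes the constant equal to sqrt (l_n); every heat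
  estimate for normalised polynomials thereby transfers to their derivatives.\<close>

lemma pd_Suc: "pd (Suc k) x = sqrt (l (Suc k)) * jacobi_p (al + 1) (be + 1) k x"
proof -
  interpret T: jacobi_half "al + 1" "be + 1" by (rule jacobi_half_shift)
  define c where "c = real (Suc k) + al + be + 1"
  define N where "N = real (Suc k)"
  define H where "H = T.hn k"
  have pos: "0 < c" "0 < N" "0 < H" unfolding c_def N_def H_def using ab_nonneg T.hn_pos' by auto
  have h: "hn (Suc k) = c / (4 * N) * H" unfolding hn_Suc[OF ab_nonneg] c_def N_def H_def ..
  have l: "l (Suc k) = N * c" unfolding jlam_def c_def N_def ..
  have "c / 2 / sqrt (c / (4 * N) * H) = sqrt (N * c) / sqrt H"
  proof -
    have "c / (4 * N) = (c / 2)\<^sup>2 / (N * c)" using pos by (simp add: power2_eq_square)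
    then have "sqrt (c / (4 * N) * H) = (c / 2) / sqrt (N * c) * sqrt H"
      using pos by (simp add: real_sqrt_mult real_sqrt_divide)
    then show ?thesis using pos by (simp add: field_simps)
  qed
  moreover have "c / 2 * v / sqrt (c / (4 * N) * H) = c / 2 / sqrt (c / (4 * N) * H) * v" 
    "sqrt (N * c) * (v / sqrt H) = sqrt (N * c) / sqrt H * v" for v by simp_all
  ultimately show ?thesis unfolding pd_def jacobiD_Suc T.p_eq h l c_def[symmetric] H_def[symmetric] by metis
qed

text \<open>Two integrations by parts at once: with \<open>X = \<lambda>\<^sub>n - \<lambda>\<^sub>m\<close> the vector field
  \<open>2 (1 - x\<^sup>2) F' p\<^sub>n' p\<^sub>m' - X F (p\<^sub>n' p\<^sub>m - p\<^sub>n p\<^sub>m') + (\<lambda>\<^sub>n + \<lambda>\<^sub>m) F' p\<^sub>n p\<^sub>m\<close>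
  has weighted divergence \<open>X\<^sup>2 F p\<^sub>n p\<^sub>m\<close> minus the two terms on the right.\<close>

lemma double_commutator:
  assumes F: "\<And>x. -1 \<le> x \<Longrightarrow> x \<le> 1 \<Longrightarrow> (F has_real_derivative F1 x) (at x)"
    and F1: "\<And>x. -1 \<le> x \<Longrightarrow> x \<le> 1 \<Longrightarrow> (F1 has_real_derivative F2 x) (at x)"
    and F2: "continuous_on {-1..1} F2"
  shows "(l n - l m)\<^sup>2 * J (\<lambda>x. F x * (p n x * p m x))
     = (l n + l m) * J (\<lambda>x. (- (1 - x\<^sup>2) * F2 x - hcoef x * F1 x) * (p n x * p m x))
       + 2 * J (\<lambda>x. (- (1 - x\<^sup>2) * F2 x + (2 * x + hcoef x) * F1 x) * ((1 - x\<^sup>2) * (pd n x * pd m x)))"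
proof -
  have Fc: "continuous_on {-1..1} F" and F1c: "continuous_on {-1..1} F1"
    using F F1 by (auto intro!: continuous_at_imp_continuous_on DERIV_isCont)
  define X where "X = l n - l m"
  define Y where "Y = l n + l m"
  define f where "f x = 2 * ((1 - x\<^sup>2) * F1 x * (pd n x * pd m x)) - X * (F x * (pd n x * p m x - p n x * pd m x)) + Y * (F1 x * (p n x * p m x))" for x
  define f' where "f' x = 2 * ((- 2 * x * F1 x + (1 - x\<^sup>2) * F2 x) * (pd n x * pd m x) + (1 - x\<^sup>2) * F1 x * (pdd n x * pd m x + pd n x * pdd m x))
     - X * (F1 x * (pd n x * p m x - p n x * pd m x) + F x * (pdd n x * p m x - p n x * pdd m x))
     + Y * (F2 x * (p n x * p m x) + F1 x * (pd n x * p m x + p n x * pd m x))" for x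
  define a b c where "a x = F x * (p n x * p m x)" and "b x = (- (1 - x\<^sup>2) * F2 x - hcoef x * F1 x) * (p n x * p m x)"
    and "c x = (- (1 - x\<^sup>2) * F2 x + (2 * x + hcoef x) * F1 x) * ((1 - x\<^sup>2) * (pd n x * pd m x))" for x
  have "J (\<lambda>x. (1 - x\<^sup>2) * f' x + hcoef x * f x) = 0"
  proof (rule jint_by_parts)
    show "continuous_on {-1..1} f'" unfolding f'_def by (intro continuous_intros Fc F1c F2)
    fix x :: real assume "-1 \<le> x" "x \<le> 1"
    then show "(f has_real_derivative f' x) (at x)"
      unfolding f_def[abs_def] f'_def
      by (auto intro!: derivative_eq_intros F F1 p_deriv pd_deriv simp: algebra_simps)
  qed
  also have "(\<lambda>x. (1 - x\<^sup>2) * f' x + hcoef x * f x) = (\<lambda>x. X\<^sup>2 * a x - Y * b x - 2 * c x)"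
  proof
    fix x :: real
    define w where "w = 1 - x\<^sup>2"
    have on: "w * pdd n x = - l n * p n x - hcoef x * pd n x" and om: "w * pdd m x = - l m * p m x - hcoef x * pd m x"
      unfolding w_def using p_ode[of x n] p_ode[of x m] by auto
    have "w * f' x + hcoef x * f x = 2 * (w * (- 2 * x * F1 x + w * F2 x) * (pd n x * pd m x) + w * F1 x * ((w * pdd n x) * pd m x + pd n x * (w * pdd m x)))
     - X * (w * F1 x * (pd n x * p m x - p n x * pd m x) + F x * ((w * pdd n x) * p m x - p n x * (w * pdd m x)))
     + Y * (w * F2 x * (p n x * p m x) + w * F1 x * (pd n x * p m x + p n x * pd m x))
     + hcoef x * (2 * (w * F1 x * (pd n x * pd m x)) - X * (F x * (pd n x * p m x - p n x * pd m x)) + Y * (F1 x * (p n x * p m x)))"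
      unfolding f_def f'_def w_def[symmetric] by (simp add: algebra_simps)
    also have "\<dots> = X\<^sup>2 * a x - Y * b x - 2 * c x"
      unfolding on om a_def b_def c_def w_def[symmetric] X_def Y_def by (simp add: algebra_simps power2_eq_square)
    finally show "(1 - x\<^sup>2) * f' x + hcoef x * f x = X\<^sup>2 * a x - Y * b x - 2 * c x" unfolding w_def .
  qed
  also have "J \<dots> = X\<^sup>2 * J a - Y * J b - 2 * J c"
  proof -
    have ca: "continuous_on {-1..1} a" "continuous_on {-1..1} b" "continuous_on {-1..1} c"
      unfolding a_def b_def c_def by (intro continuous_intros Fc F1c F2)+
    have "J (\<lambda>x. X\<^sup>2 * a x - Y * b x - 2 * c x) = J (\<lambda>x. X\<^sup>2 * a x - Y * b x) - J (\<lambda>x. 2 * c x)"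
      by (intro jint_diff continuous_intros ca)
    also have "J (\<lambda>x. X\<^sup>2 * a x - Y * b x) = J (\<lambda>x. X\<^sup>2 * a x) - J (\<lambda>x. Y * b x)"
      by (intro jint_diff continuous_intros ca)
    finally show ?thesis unfolding jint_cmult .
  qed
  finally show ?thesis unfolding X_def Y_def a_def b_def c_def by simp
qed

end

section \<open>Size of the differentiated heat kernel\<close>

lemma exp_half_bounds:
  assumes "0 \<le> (u::real)"
  shows "u * exp (- u) \<le> 2 * exp (- (u / 2))" "(1 + u) * exp (- u) \<le> 2 * exp (- (u / 2))"
    "(u\<^sup>2 + 2 * u) * exp (- u) \<le> 12 * exp (- (u / 2))"
proof -
  have e: "1 + u / 2 + (u / 2)\<^sup>2 / 2 \<le> exp (u / 2)" using assms by (intro exp_lower_Taylor_quadratic) auto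
  have s: "exp (- (u / 2)) = exp (u / 2) * exp (- u)" by (simp flip: exp_add)
  have sq: "0 \<le> (u / 2)\<^sup>2" by simp
  have "u \<le> 2 * exp (u / 2)" "1 + u \<le> 2 * exp (u / 2)" using e sq by linarith+
  moreover have "u\<^sup>2 + 2 * u \<le> 12 * exp (u / 2)"
  proof -
    have "(u / 2)\<^sup>2 = u\<^sup>2 / 4" by (simp add: power_divide)
    then show ?thesis using e assms sq by linarith
  qed
  ultimately show "u * exp (- u) \<le> 2 * exp (- (u / 2))" "(1 + u) * exp (- u) \<le> 2 * exp (- (u / 2))"
    "(u\<^sup>2 + 2 * u) * exp (- u) \<le> 12 * exp (- (u / 2))"
    unfolding s mult.assoc[symmetric] by (auto intro: mult_right_mono)
qed

context jacobi_half
begin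

definition ker :: "real \<Rightarrow> nat \<Rightarrow> nat \<Rightarrow> real" where
  "ker t n m = J (\<lambda>x. ((1 - x) * exp (- t * (1 - x))) * (p n x * p m x))"

definition Fh :: "real \<Rightarrow> real \<Rightarrow> real" where "Fh t x = (1 - x) * exp (- t * (1 - x))"
definition Fh1 :: "real \<Rightarrow> real \<Rightarrow> real" where "Fh1 t x = (t * (1 - x) - 1) * exp (- t * (1 - x))"
definition Fh2 :: "real \<Rightarrow> real \<Rightarrow> real" where "Fh2 t x = t * (t * (1 - x) - 2) * exp (- t * (1 - x))"
text \<open>The Jacobi operator applied to \<open>Fh t\<close>, with reversed sign.
  \<open>HF\<close> is the companion coefficient of p_n' p_m' in \<open>double_commutator\<close>.
  In both, the second derivative meets the factor 1 - x^2, so that its extra power of t is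
  harmless.\<close>

definition LF :: "real \<Rightarrow> real \<Rightarrow> real" where "LF t x = - (1 - x\<^sup>2) * Fh2 t x - hcoef x * Fh1 t x"
definition HF :: "real \<Rightarrow> real \<Rightarrow> real" where "HF t x = - (1 - x\<^sup>2) * Fh2 t x + (2 * x + hcoef x) * Fh1 t x"
definition AA :: real where "AA = 24 + 2 * (\<bar>be - al\<bar> + (al + be + 2) + 2)"

lemma AA_pos: "0 < AA" unfolding AA_def using add_nonneg_nonneg[OF abs_ge_zero[of "be - al"] ab_nonneg] by simp

lemma continuous_F [continuous_intros]: "continuous_on S (Fh t)" "continuous_on S (Fh1 t)" "continuous_on S (Fh2 t)"
  unfolding Fh_def[abs_def] Fh1_def[abs_def] Fh2_def[abs_def] by (intro continuous_intros)+

lemma continuous_LF [continuous_intros]: "continuous_on S (LF t)" "continuous_on S (HF t)"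
  unfolding LF_def[abs_def] HF_def[abs_def] by (intro continuous_intros)+

lemma Fh_deriv: "(Fh t has_real_derivative Fh1 t x) (at x)" "(Fh1 t has_real_derivative Fh2 t x) (at x)"
  unfolding Fh_def[abs_def] Fh1_def[abs_def] Fh2_def
  by (auto intro!: derivative_eq_intros simp: algebra_simps)

lemma hcoef_le: "-1 < x \<Longrightarrow> x < 1 \<Longrightarrow> \<bar>hcoef x\<bar> \<le> \<bar>be - al\<bar> + (al + be + 2)"
proof -
  assume x: "-1 < x" "x < 1"
  have "\<bar>hcoef x\<bar> \<le> \<bar>be - al\<bar> + \<bar>(al + be + 2) * x\<bar>" unfolding hcoef_def by (rule abs_triangle_ineq4)
  moreover have "\<bar>(al + be + 2) * x\<bar> \<le> (al + be + 2) * 1"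
    using x ab_nonneg unfolding abs_mult by (intro mult_mono) auto
  ultimately show ?thesis by (simp add: algebra_simps)
qed

text \<open>Every power of u = t (1 - x) is absorbed into one half of the exponential; for this
  reason the heat integrals are taken at time t/2 from here on.\<close>

lemma F_bounds:
  assumes t: "0 < t" and x: "-1 < x" "x < 1"
  shows "\<bar>Fh t x\<bar> \<le> 2 / t * exp (- (t / 2) * (1 - x))" 
    "\<bar>LF t x\<bar> \<le> AA * exp (- (t / 2) * (1 - x))" "\<bar>HF t x\<bar> \<le> AA * exp (- (t / 2) * (1 - x))"
proof -
  define u where "u = t * (1 - x)"
  define E where "E = exp (- (u / 2))"
  have u: "0 \<le> u" unfolding u_def using t x by simp
  have E: "exp (- (t / 2) * (1 - x)) = E" "exp (- t * (1 - x)) = exp (- u)" unfolding E_def u_def by (simp_all add: field_simps)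
  have E0: "0 \<le> E" unfolding E_def by simp
  have "t * \<bar>Fh t x\<bar> = u * exp (- u)" unfolding Fh_def E u_def using t x by (simp add: abs_mult)
  also have "\<dots> \<le> 2 * E" unfolding E_def by (rule exp_half_bounds[OF u])
  finally show "\<bar>Fh t x\<bar> \<le> 2 / t * exp (- (t / 2) * (1 - x))" unfolding E using t by (simp add: field_simps)
  have F1: "\<bar>Fh1 t x\<bar> \<le> 2 * E"
  proof -
    have "\<bar>Fh1 t x\<bar> \<le> (1 + u) * exp (- u)"
      unfolding Fh1_def E u_def[symmetric] abs_mult using u by (intro mult_mono) auto
    also have "\<dots> \<le> 2 * E" unfolding E_def by (rule exp_half_bounds[OF u])
    finally show ?thesis .
  qed
  have F2: "\<bar>(1 - x\<^sup>2) * Fh2 t x\<bar> \<le> 24 * E"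
  proof -
    have "(1 - x\<^sup>2) * Fh2 t x = (1 + x) * (u * ((u - 2) * exp (- u)))"
      unfolding Fh2_def E u_def[symmetric] by (simp add: u_def power2_eq_square algebra_simps)
    then have "\<bar>(1 - x\<^sup>2) * Fh2 t x\<bar> = (1 + x) * (u * (\<bar>u - 2\<bar> * exp (- u)))"
      using x u by (simp add: abs_mult)
    also have "\<dots> \<le> 2 * (u * ((u + 2) * exp (- u)))"
      using x u by (intro mult_mono mult_left_mono mult_right_mono mult_nonneg_nonneg) auto
    also have "\<dots> = 2 * ((u\<^sup>2 + 2 * u) * exp (- u))" by (simp add: algebra_simps power2_eq_square)
    also have "\<dots> \<le> 2 * (12 * E)" unfolding E_def using exp_half_bounds(3)[OF u] by (intro mult_left_mono) auto
    finally show ?thesis by simp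
  qed
  define H where "H = \<bar>be - al\<bar> + (al + be + 2)"
  have h: "\<bar>hcoef x\<bar> \<le> H" unfolding H_def by (rule hcoef_le[OF x])
  have H0: "0 \<le> H" using h by linarith
  have AA: "AA = 24 + 2 * (H + 2)" unfolding AA_def H_def by simp
  have "\<bar>LF t x\<bar> \<le> \<bar>(1 - x\<^sup>2) * Fh2 t x\<bar> + \<bar>hcoef x * Fh1 t x\<bar>" unfolding LF_def by linarith
  also have "\<dots> \<le> 24 * E + H * (2 * E)"
    unfolding abs_mult[of "hcoef x"] using F2 h F1 H0 by (intro add_mono mult_mono) auto
  also have "\<dots> \<le> AA * E" unfolding AA using E0 by (simp add: algebra_simps)
  finally show "\<bar>LF t x\<bar> \<le> AA * exp (- (t / 2) * (1 - x))" unfolding E .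
  have "\<bar>HF t x\<bar> \<le> \<bar>(1 - x\<^sup>2) * Fh2 t x\<bar> + \<bar>(2 * x + hcoef x) * Fh1 t x\<bar>" unfolding HF_def by linarith
  also have "\<dots> \<le> 24 * E + (H + 2) * (2 * E)"
    unfolding abs_mult[of "2 * x + hcoef x"] using F2 h F1 H0 x by (intro add_mono mult_mono) auto
  also have "\<dots> = AA * E" unfolding AA by (simp add: algebra_simps)
  finally show "\<bar>HF t x\<bar> \<le> AA * exp (- (t / 2) * (1 - x))" unfolding E .
qed

lemma heat_bounds:
  obtains C where "0 < C" "\<And>n s. 0 < s \<Longrightarrow> J (\<lambda>x. exp (- s * (1 - x)) * (p n x)\<^sup>2) \<le> C / sqrt s"
    "\<And>n s. 0 < s \<Longrightarrow> jint (al + 1) (be + 1) (\<lambda>x. exp (- s * (1 - x)) * (pd n x)\<^sup>2) \<le> l n * (C / sqrt s)"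
proof -
  interpret T: jacobi_half "al + 1" "be + 1" by (rule jacobi_half_shift)
  obtain C1 where C1: "0 < C1" "\<And>n s. 0 < s \<Longrightarrow> J (\<lambda>x. exp (- s * (1 - x)) * (p n x)\<^sup>2) \<le> C1 / sqrt s"
    using heat_diagonal by blast
  obtain C2 where C2: "0 < C2" "\<And>n s. 0 < s \<Longrightarrow> T.J (\<lambda>x. exp (- s * (1 - x)) * (T.p n x)\<^sup>2) \<le> C2 / sqrt s"
    using T.heat_diagonal by blast
  show thesis
  proof
    show "0 < C1 + C2" using C1 C2 by simp
    fix n and s :: real assume s: "0 < s"
    have m: "C1 / sqrt s \<le> (C1 + C2) / sqrt s" "C2 / sqrt s \<le> (C1 + C2) / sqrt s"
      using C1 C2 s by (auto intro!: divide_right_mono)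
    show "J (\<lambda>x. exp (- s * (1 - x)) * (p n x)\<^sup>2) \<le> (C1 + C2) / sqrt s"
      using C1(2)[OF s] m(1) by (rule order_trans)
    show "T.J (\<lambda>x. exp (- s * (1 - x)) * (pd n x)\<^sup>2) \<le> l n * ((C1 + C2) / sqrt s)"
    proof (cases n)
      case 0
      then show ?thesis by (simp add: jint_def set_lebesgue_integral_def jlam_def)
    next
      case (Suc k)
      have "T.J (\<lambda>x. exp (- s * (1 - x)) * (pd n x)\<^sup>2) = T.J (\<lambda>x. l n * (exp (- s * (1 - x)) * (T.p k x)\<^sup>2))"
        unfolding Suc pd_Suc using l_nonneg by (intro T.jint_cong) (simp add: power_mult_distrib)
      also have "\<dots> = l n * T.J (\<lambda>x. exp (- s * (1 - x)) * (T.p k x)\<^sup>2)" by (rule T.jint_cmult)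
      also have "\<dots> \<le> l n * ((C1 + C2) / sqrt s)"
        using l_nonneg C2(2)[OF s, of k] m(2) by (intro mult_left_mono) auto
      finally show ?thesis .
    qed
  qed
qed

lemma l_diff: "l n - l m = (real n - real m) * (real n + real m + al + be + 1)"
  unfolding jlam_def by (simp add: algebra_simps)

lemma l_sum_le: "l n + l m \<le> (real n + real m + al + be + 1)\<^sup>2"
proof -
  define s where "s = al + be + 1"
  have s: "0 \<le> s" unfolding s_def by (rule ab_nonneg)
  have "(real n + real m + s)\<^sup>2 - (real n * (real n + s) + real m * (real m + s)) = real n * (2 * real m) + s * (real n + real m) + s * s"
    by (simp add: algebra_simps power2_eq_square)
  moreover have "0 \<le> real n * (2 * real m) + s * (real n + real m) + s * s" using s by simp
  ultimately have "real n * (real n + s) + real m * (real m + s) \<le> (real n + real m + s)\<^sup>2" by linarith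
  then show ?thesis unfolding jlam_def s_def by (simp add: add.assoc)
qed

lemma ker_identity:
  "(l n - l m)\<^sup>2 * ker t n m = (l n + l m) * J (\<lambda>x. LF t x * (p n x * p m x))
      + 2 * jint (al + 1) (be + 1) (\<lambda>x. HF t x * (pd n x * pd m x))"
proof -
  have "(l n - l m)\<^sup>2 * J (\<lambda>x. Fh t x * (p n x * p m x))
     = (l n + l m) * J (\<lambda>x. (- (1 - x\<^sup>2) * Fh2 t x - hcoef x * Fh1 t x) * (p n x * p m x))
       + 2 * J (\<lambda>x. (- (1 - x\<^sup>2) * Fh2 t x + (2 * x + hcoef x) * Fh1 t x) * ((1 - x\<^sup>2) * (pd n x * pd m x)))"
    by (intro double_commutator Fh_deriv continuous_intros)
  also have "J (\<lambda>x. (- (1 - x\<^sup>2) * Fh2 t x + (2 * x + hcoef x) * Fh1 t x) * ((1 - x\<^sup>2) * (pd n x * pd m x)))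
     = jint (al + 1) (be + 1) (\<lambda>x. HF t x * (pd n x * pd m x))"
    unfolding jint_shift[OF al be] HF_def by (intro jint_cong) (simp add: mult_ac)
  finally show ?thesis unfolding ker_def Fh_def LF_def .
qed

lemma sqrt_half: "0 < t \<Longrightarrow> C / sqrt (t / 2) = sqrt 2 * C / sqrt t"
  by (simp add: real_sqrt_divide)

text \<open>The bound of order 1/t for \<open>Fh\<close> accounts for the summand t, the commutator
  identity for (n - m)^2. With Y = n + m + al + be + 1 one has l_n - l_m = (n - m) Y and l_n + l_m
  \<le> Y^2, so Y^2 cancels from the identity.\<close>

theorem ker_size:
  obtains C where "0 < C" "\<And>t n m. 0 < t \<Longrightarrow> \<bar>ker t n m\<bar> * (t + (real n - real m)\<^sup>2) \<le> C / sqrt t"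
proof -
  interpret T: jacobi_half "al + 1" "be + 1" by (rule jacobi_half_shift)
  obtain C where C: "0 < C" "\<And>n s. 0 < s \<Longrightarrow> J (\<lambda>x. exp (- s * (1 - x)) * (p n x)\<^sup>2) \<le> C / sqrt s"
    "\<And>n s. 0 < s \<Longrightarrow> T.J (\<lambda>x. exp (- s * (1 - x)) * (pd n x)\<^sup>2) \<le> l n * (C / sqrt s)"
    using heat_bounds by blast
  define c where "c = sqrt 2 * C"
  have c: "0 < c" unfolding c_def using C by simp
  show thesis
  proof
    show "0 < 2 * c + 2 * AA * c" using c AA_pos by (intro add_pos_pos mult_pos_pos) auto
    fix t :: real and n m assume t: "0 < t"
    have t2: "0 < t / 2" using t by simp
    define K where "K = c / sqrt t"
    have K: "0 < K" unfolding K_def using c t by simp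
    have K2: "C / sqrt (t / 2) = K" unfolding K_def c_def by (rule sqrt_half[OF t])
    have b1: "J (\<lambda>x. exp (- (t / 2) * (1 - x)) * (p n x)\<^sup>2) \<le> K" for n using C(2)[OF t2] unfolding K2 .
    have b2: "T.J (\<lambda>x. exp (- (t / 2) * (1 - x)) * (pd n x)\<^sup>2) \<le> l n * K" for n using C(3)[OF t2] unfolding K2 .
    have "\<bar>J (\<lambda>x. Fh t x * (p n x * p m x))\<bar> \<le> 2 / t * (sqrt K * sqrt K)"
      using t F_bounds(1)[OF t] by (intro jint_bilinear_bound[where s="t / 2"] b1 continuous_intros) auto
    then have 1: "t * \<bar>ker t n m\<bar> \<le> 2 * K" unfolding ker_def Fh_def using t K by (simp add: field_simps)
    define Y where "Y = real n + real m + al + be + 1"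
    have Y: "0 \<le> Y" unfolding Y_def using ab_nonneg by linarith
    have i1: "\<bar>J (\<lambda>x. LF t x * (p n x * p m x))\<bar> \<le> AA * (sqrt K * sqrt K)"
      using AA_pos F_bounds(2)[OF t] by (intro jint_bilinear_bound[where s="t / 2"] b1 continuous_intros) auto
    have i2: "\<bar>T.J (\<lambda>x. HF t x * (pd n x * pd m x))\<bar> \<le> AA * (sqrt (l n * K) * sqrt (l m * K))"
      using AA_pos F_bounds(3)[OF t] by (intro T.jint_bilinear_bound[where s="t / 2"] b2 continuous_intros) auto
    have i3: "2 * (sqrt (l n * K) * sqrt (l m * K)) \<le> (l n + l m) * K"
    proof -
      have "2 * sqrt (l n) * sqrt (l m) \<le> (sqrt (l n))\<^sup>2 + (sqrt (l m))\<^sup>2" by (rule sum_squares_bound)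
      then have "(2 * sqrt (l n) * sqrt (l m)) * K \<le> (l n + l m) * K" using l_nonneg K by (intro mult_right_mono) auto
      moreover have "sqrt (l n * K) * sqrt (l m * K) = sqrt (l n) * sqrt (l m) * (sqrt K * sqrt K)"
        by (simp only: real_sqrt_mult mult_ac)
      moreover have "sqrt K * sqrt K = K" using K by simp
      ultimately show ?thesis by simp
    qed
    have "(l n - l m)\<^sup>2 * \<bar>ker t n m\<bar> = \<bar>(l n - l m)\<^sup>2 * ker t n m\<bar>" by (simp add: abs_mult)
    also have "\<dots> \<le> \<bar>(l n + l m) * J (\<lambda>x. LF t x * (p n x * p m x))\<bar> + \<bar>2 * T.J (\<lambda>x. HF t x * (pd n x * pd m x))\<bar>"
      unfolding ker_identity by (rule abs_triangle_ineq)
    also have "\<dots> \<le> (l n + l m) * (AA * (sqrt K * sqrt K)) + 2 * (AA * (sqrt (l n * K) * sqrt (l m * K)))"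
      unfolding abs_mult using l_nonneg i1 i2 by (intro add_mono mult_mono) auto
    also have "\<dots> = AA * ((l n + l m) * K + 2 * (sqrt (l n * K) * sqrt (l m * K)))" using K by (simp add: algebra_simps)
    also have "\<dots> \<le> AA * (2 * Y\<^sup>2 * K)"
    proof (intro mult_left_mono)
      have "(l n + l m) * K \<le> Y\<^sup>2 * K" unfolding Y_def using K by (intro mult_right_mono l_sum_le) auto
      then show "(l n + l m) * K + 2 * (sqrt (l n * K) * sqrt (l m * K)) \<le> 2 * Y\<^sup>2 * K" using i3 by linarith
    qed (use AA_pos in auto)
    finally have H: "((real n - real m) * Y)\<^sup>2 * \<bar>ker t n m\<bar> \<le> Y\<^sup>2 * (2 * AA * K)"
      unfolding l_diff Y_def by (simp add: mult_ac)
    have 2: "(real n - real m)\<^sup>2 * \<bar>ker t n m\<bar> \<le> 2 * AA * K"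
    \<comment> \<open>Y vanishes only if n = m = 0 and al + be + 1 = 0, and then n - m vanishes as
      well.\<close>
    proof (cases "Y = 0")
      case True
      then have "real n + real m \<le> 0" unfolding Y_def using ab_nonneg by linarith
      then have "n = 0" "m = 0" by linarith+
      then show ?thesis using AA_pos K by simp
    next
      case False
      then have "0 < Y\<^sup>2" by simp
      moreover have "Y\<^sup>2 * ((real n - real m)\<^sup>2 * \<bar>ker t n m\<bar>) \<le> Y\<^sup>2 * (2 * AA * K)"
        using H by (simp add: power_mult_distrib mult_ac)
      ultimately show ?thesis by simp
    qed
    have "\<bar>ker t n m\<bar> * (t + (real n - real m)\<^sup>2) \<le> 2 * K + 2 * AA * K"
      using 1 2 by (simp add: algebra_simps)
    also have "\<dots> = (2 * c + 2 * AA * c) / sqrt t" unfolding K_def by (simp add: add_divide_distrib)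
    finally show "\<bar>ker t n m\<bar> * (t + (real n - real m)\<^sup>2) \<le> (2 * c + 2 * AA * c) / sqrt t" .
  qed
qed

end

section \<open>Unit steps of the polynomials and of the kernel\<close>

context jacobi_half
begin

text \<open>This is \<open>jacobiP_contiguous\<close> after normalisation. The square
  \<open>\<rho>\<close> of the coefficient of p_n is rational in n with limit 1, hence the 1/n for
  e; the norm quotients keep c bounded.\<close>

lemma p_Suc_expansion:
  obtains C where "0 < C" "\<And>n. 1 \<le> n \<Longrightarrow> \<exists>e c. \<bar>e\<bar> \<le> C / real n \<and> \<bar>c\<bar> \<le> C \<and>
      (\<forall>x. p (Suc n) x - p n x = e * p n x - c * ((1 - x) * jacobi_p (al + 1) be n x))"
proof -
  interpret L: jacobi_half "al + 1" be by (rule jacobi_half_shift)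
  define s where "s = al + be + 1"
  have s: "0 \<le> s" unfolding s_def by (rule ab_nonneg)
  define A B where "A = al + 1" and "B = be + 1"
  have AB: "1 / 2 \<le> A" "1 / 2 \<le> B" unfolding A_def B_def using al_half be_half by auto
  \<comment> \<open>The coefficients of a u2 k - d u b as a polynomial in r. Its cubic terms cancel
    against a cubic denominator, which is where the decay 1/r of e comes from.\<close>
  define q2 q1 q0 where "q2 = (s + 2) + 2 * s + 2 * A - s - 2 * B - 2"
    and "q1 = (s + 2) * s + A * (s + 2) + 2 * A * s - s * B - s - 2 * B" and "q0 = A * (s + 2) * s - s * B"
  define Q where "Q = \<bar>q2\<bar> + \<bar>q1\<bar> + \<bar>q0\<bar>"
  show thesis
  proof
    show "0 < Q + (s + 2)" unfolding Q_def using s by simp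
    fix n :: nat assume n: "1 \<le> n"
    define r where "r = real n"
    have r: "1 \<le> r" unfolding r_def using n by simp
    define h h' hL where "h = hn n" and "h' = hn (Suc n)" and "hL = L.hn n"
    have pos: "0 < h" "0 < h'" "0 < hL" unfolding h_def h'_def hL_def by (rule hn_pos' L.hn_pos')+
    define a b d k u u1 u2 where "a = r + A" and "b = r + B" and "d = r + 1" and "k = r + s"
      and "u = 2 * r + s" and "u1 = 2 * r + s + 1" and "u2 = 2 * r + s + 2"
    note atoms = a_def b_def d_def k_def u_def u1_def u2_def
    have den: "0 < a" "0 < b" "0 < d" "0 < k" "0 < u" "0 < u1" "0 < u2" unfolding atoms using r s AB by auto
    have hr: "u2 * d * k * h' = u * a * b * h"
      using hn_ratio[OF jacobi_params_axioms ab_nonneg, of n]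
      unfolding atoms r_def s_def A_def B_def h_def h'_def by (simp add: add_ac)
    have hl: "hL * u1 * k = 2 * u * a * h"
      using hn_left_ratio[OF jacobi_params_axioms ab_nonneg, of n]
      unfolding atoms r_def s_def A_def h_def hL_def by (simp add: add_ac)
    define k1 k2 where "k1 = a / (d * sqrt h')" and "k2 = u1 / 2 / (d * sqrt h')"
    define e where "e = k1 * sqrt h - 1"
    define c where "c = k2 * sqrt hL"
    have exp: "p (Suc n) x - p n x = e * p n x - c * ((1 - x) * L.p n x)" for x
    proof -
      have P: "d * P (Suc n) x = a * P n x - u1 / 2 * (1 - x) * L.P n x"
        using jacobiP_contiguous[of al n be x] al unfolding atoms r_def A_def s_def by (simp add: field_simps)
      have "P (Suc n) x = (a * P n x - u1 / 2 * (1 - x) * L.P n x) / d"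
        using den P by (simp add: field_simps)
      then have "p (Suc n) x = (a * P n x - u1 / 2 * (1 - x) * L.P n x) / (d * sqrt h')"
        unfolding p_eq h'_def by simp
      also have "\<dots> = k1 * P n x - k2 * ((1 - x) * L.P n x)"
        unfolding k1_def k2_def by (simp add: diff_divide_distrib)
      also have "P n x = sqrt h * p n x" unfolding p_eq h_def using hn_pos'[of n] by simp
      also have "L.P n x = sqrt hL * L.p n x" unfolding L.p_eq hL_def using L.hn_pos'[of n] by simp
      finally show ?thesis unfolding e_def c_def by (simp add: algebra_simps)
    qed
    define \<rho> where "\<rho> = (k1 * sqrt h)\<^sup>2"
    have h_eq: "h = u2 * d * k * h' / (u * a * b)"
      using hr den by (simp add: nonzero_eq_divide_eq mult_ac)
    have \<rho>: "\<rho> = a * u2 * k / (d * u * b)"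
    proof -
      have "\<rho> = a\<^sup>2 * h / (d\<^sup>2 * h')"
        unfolding \<rho>_def k1_def using pos by (simp add: power_divide power_mult_distrib)
      also have "\<dots> = a * u2 * k / (d * u * b)"
        unfolding h_eq using den pos by (simp add: power2_eq_square field_simps)
      finally show ?thesis .
    qed
    have e_le: "\<bar>e\<bar> \<le> Q / r"
    proof -
      define z where "z = k1 * sqrt h"
      have z: "0 \<le> z" unfolding z_def k1_def using den pos by simp
      \<comment> \<open>The square roots disappear through |z - 1| \<le> |z^2 - 1|, valid for z
        \<ge> 0.\<close>
      have "\<bar>z - 1\<bar> * 1 \<le> \<bar>z - 1\<bar> * (z + 1)" using z by (intro mult_left_mono) auto
      also have "\<dots> = \<bar>\<rho> - 1\<bar>"
      proof -
        have "\<rho> - 1 = (z - 1) * (z + 1)" unfolding \<rho>_def z_def[symmetric] by (simp add: power2_eq_square algebra_simps)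
        then show ?thesis using z by (simp add: abs_mult)
      qed
      also have "\<rho> - 1 = (q2 * r\<^sup>2 + q1 * r + q0) / (d * u * b)"
      proof -
        have "a * u2 * k - d * u * b = q2 * r\<^sup>2 + q1 * r + q0"
          unfolding atoms q2_def q1_def q0_def by (simp add: algebra_simps power2_eq_square)
        moreover have "\<rho> - 1 = (a * u2 * k - d * u * b) / (d * u * b)"
          unfolding \<rho> diff_divide_distrib using den by simp
        ultimately show ?thesis by simp
      qed
      also have "\<bar>\<dots>\<bar> \<le> (Q * r\<^sup>2) / (r * r * r)"
        unfolding abs_divide
      proof (rule frac_le)
        have "\<bar>q2 * r\<^sup>2 + q1 * r + q0\<bar> \<le> \<bar>q2\<bar> * r\<^sup>2 + \<bar>q1\<bar> * r + \<bar>q0\<bar> * 1"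
          using r by (intro order_trans[OF abs_triangle_ineq] add_mono) (auto simp: abs_mult)
        also have "\<dots> \<le> \<bar>q2\<bar> * r\<^sup>2 + \<bar>q1\<bar> * r\<^sup>2 + \<bar>q0\<bar> * r\<^sup>2"
          using r by (intro add_mono mult_left_mono) (auto simp: power2_eq_square mult_ge1_I)
        finally show "\<bar>q2 * r\<^sup>2 + q1 * r + q0\<bar> \<le> Q * r\<^sup>2" unfolding Q_def by (simp add: algebra_simps)
        have "r * r * r \<le> d * u * b" unfolding atoms using r s AB by (intro mult_mono) auto
        then show "r * r * r \<le> \<bar>d * u * b\<bar>" by simp
      qed (use r in \<open>auto simp: Q_def\<close>)
      also have "\<dots> = Q / r" using r by (simp add: power2_eq_square)
      finally show ?thesis unfolding e_def z_def by simp
    qed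
    have c_le: "\<bar>c\<bar> \<le> s + 2"
    proof (rule power2_le_imp_le)
      have hLe: "hL = 2 * u2 * d * h' / (u1 * b)"
      proof -
        have "hL = 2 * u * a * h / (u1 * k)" using hl den by (simp add: nonzero_eq_divide_eq mult_ac)
        also have "\<dots> = 2 * u2 * d * h' / (u1 * b)"
          unfolding h_eq using den by (simp add: field_simps)
        finally show ?thesis .
      qed
      have "\<bar>c\<bar>\<^sup>2 = (u1 / 2)\<^sup>2 * hL / (d\<^sup>2 * h')"
        unfolding c_def k2_def using pos by (simp add: power_divide power_mult_distrib)
      also have "\<dots> = u1 * u2 / (2 * d * b)"
        unfolding hLe using den pos by (simp add: power2_eq_square field_simps)
      also have "\<dots> \<le> ((s + 2) * d) * ((s + 2) * d) / (2 * d * (d / 2))"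
      proof (intro frac_le mult_mono mult_left_mono)
        have "0 \<le> s * r" using r s by simp
        then show "u1 \<le> (s + 2) * d" "u2 \<le> (s + 2) * d" unfolding atoms by (auto simp: algebra_simps)
        show "d / 2 \<le> b" unfolding atoms using r AB by simp
      qed (use den s in auto)
      also have "\<dots> = (s + 2)\<^sup>2" using den by (simp add: power2_eq_square)
      finally show "\<bar>c\<bar>\<^sup>2 \<le> (s + 2)\<^sup>2" .
    qed (use s in auto)
    have "Q / r \<le> (Q + (s + 2)) / real n" unfolding r_def[symmetric] using s r by (intro divide_right_mono) auto
    moreover have "s + 2 \<le> Q + (s + 2)" unfolding Q_def by simp
    ultimately show "\<exists>e c. \<bar>e\<bar> \<le> (Q + (s + 2)) / real n \<and> \<bar>c\<bar> \<le> Q + (s + 2) \<and>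
      (\<forall>x. p (Suc n) x - p n x = e * p n x - c * ((1 - x) * L.p n x))"
      using e_le c_le exp by (intro exI[of _ e] exI[of _ c]) auto
  qed
qed

text \<open>The term with e contributes 1/n^2. In the term with c one factor 1 - x turns the measure
  into that of (al + 1, be), the other is absorbed by the exponential and gives 1/s. For n = 0 the
  summand 1 / (n + 1)^2 equals 1 and a crude bound is enough.\<close>

theorem diff_bound:
  obtains C where "0 < C" "\<And>n s. 0 < s \<Longrightarrow>
     J (\<lambda>x. exp (- s * (1 - x)) * (p (Suc n) x - p n x)\<^sup>2) \<le> C * (1 / s + 1 / (real n + 1)\<^sup>2) / sqrt s"
proof -
  interpret L: jacobi_half "al + 1" be by (rule jacobi_half_shift)
  obtain C1 where C1: "0 < C1" "\<And>n s. 0 < s \<Longrightarrow> J (\<lambda>x. exp (- s * (1 - x)) * (p n x)\<^sup>2) \<le> C1 / sqrt s"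
    using heat_diagonal by blast
  obtain C2 where C2: "0 < C2" "\<And>n s. 0 < s \<Longrightarrow> L.J (\<lambda>x. exp (- s * (1 - x)) * (L.p n x)\<^sup>2) \<le> C2 / sqrt s"
    using L.heat_diagonal by blast
  obtain C3 where C3: "0 < C3" "\<And>n. 1 \<le> n \<Longrightarrow> \<exists>e c. \<bar>e\<bar> \<le> C3 / real n \<and> \<bar>c\<bar> \<le> C3 \<and>
      (\<forall>x. p (Suc n) x - p n x = e * p n x - c * ((1 - x) * L.p n x))"
    using p_Suc_expansion by blast
  define D where "D = 4 * C1 + 8 * C3\<^sup>2 * C1 + 4 * C3\<^sup>2 * sqrt 2 * C2"
  have D: "4 * C1 \<le> D" "8 * C3\<^sup>2 * C1 \<le> D" "4 * C3\<^sup>2 * sqrt 2 * C2 \<le> D"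
    unfolding D_def using C1 C2 by auto
  show thesis
  proof
    show "0 < D" using D(1) C1 by linarith
    fix n and s :: real assume s: "0 < s"
    define w where "w x = exp (- s * (1 - x))" for x
    have wc: "continuous_on S w" for S unfolding w_def[abs_def] by (intro continuous_intros)
    have w0: "0 \<le> w x" for x unfolding w_def by simp
    have rs: "0 < sqrt s" using s by simp
    show "J (\<lambda>x. exp (- s * (1 - x)) * (p (Suc n) x - p n x)\<^sup>2) \<le> D * (1 / s + 1 / (real n + 1)\<^sup>2) / sqrt s"
    proof (cases "n = 0")
      case True
      have "J (\<lambda>x. w x * (p (Suc n) x - p n x)\<^sup>2) \<le> J (\<lambda>x. 2 * (w x * (p (Suc n) x)\<^sup>2) + 2 * (w x * (p n x)\<^sup>2))"
      proof (rule jint_mono)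
        fix x
        have "(p (Suc n) x - p n x)\<^sup>2 \<le> 2 * (p (Suc n) x)\<^sup>2 + 2 * (p n x)\<^sup>2"
          using zero_le_power2[of "p (Suc n) x + p n x"] by (simp add: power2_eq_square algebra_simps)
        from mult_left_mono[OF this w0[of x]]
        show "w x * (p (Suc n) x - p n x)\<^sup>2 \<le> 2 * (w x * (p (Suc n) x)\<^sup>2) + 2 * (w x * (p n x)\<^sup>2)"
          by (simp add: algebra_simps)
      qed (intro continuous_intros wc)+
      also have "\<dots> = 2 * J (\<lambda>x. w x * (p (Suc n) x)\<^sup>2) + 2 * J (\<lambda>x. w x * (p n x)\<^sup>2)"
        by (subst jint_add, (intro continuous_intros wc)+) (simp only: jint_cmult)
      also have "\<dots> \<le> 2 * (C1 / sqrt s) + 2 * (C1 / sqrt s)"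
        unfolding w_def using s by (intro add_mono mult_left_mono C1) auto
      also have "\<dots> = 4 * C1 * 1 / sqrt s" by simp
      also have "\<dots> \<le> D * (1 / s + 1 / (real n + 1)\<^sup>2) / sqrt s"
        using D(1) C1 rs s True by (intro divide_right_mono mult_mono) auto
      finally show ?thesis unfolding w_def .
    next
      case False
      then have n: "1 \<le> n" by simp
      obtain e c where ec: "\<bar>e\<bar> \<le> C3 / real n" "\<bar>c\<bar> \<le> C3"
        "\<And>x. p (Suc n) x - p n x = e * p n x - c * ((1 - x) * L.p n x)"
        using C3(2)[OF n] by blast
      have e2: "e\<^sup>2 \<le> 4 * C3\<^sup>2 / (real n + 1)\<^sup>2"
      proof -
        have "\<bar>e\<bar> \<le> C3 / ((real n + 1) / 2)"
          using n C3 by (intro order_trans[OF ec(1)] divide_left_mono) auto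
        then have "\<bar>e\<bar>\<^sup>2 \<le> (C3 / ((real n + 1) / 2))\<^sup>2" by (intro power_mono) auto
        then show ?thesis by (simp add: power_divide power_mult_distrib mult.commute)
      qed
      have c2: "c\<^sup>2 \<le> C3\<^sup>2" using ec(2) by (metis abs_ge_zero power2_abs power_mono)
      have "J (\<lambda>x. w x * (p (Suc n) x - p n x)\<^sup>2) \<le> J (\<lambda>x. 2 * e\<^sup>2 * (w x * (p n x)\<^sup>2) + 2 * c\<^sup>2 * ((1 - x) * (w x * ((1 - x) * (L.p n x)\<^sup>2))))"
      proof (rule jint_mono)
        fix x
        have "(u - v)\<^sup>2 \<le> 2 * u\<^sup>2 + 2 * v\<^sup>2" for u v :: real
          using zero_le_power2[of "u + v"] by (simp add: power2_eq_square algebra_simps)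
        from mult_left_mono[OF this w0[of x]]
        have "w x * (e * p n x - c * ((1 - x) * L.p n x))\<^sup>2 \<le> w x * (2 * (e * p n x)\<^sup>2 + 2 * (c * ((1 - x) * L.p n x))\<^sup>2)" .
        then show "w x * (p (Suc n) x - p n x)\<^sup>2 \<le> 2 * e\<^sup>2 * (w x * (p n x)\<^sup>2) + 2 * c\<^sup>2 * ((1 - x) * (w x * ((1 - x) * (L.p n x)\<^sup>2)))"
          unfolding ec(3) by (simp add: power2_eq_square algebra_simps)
      qed (intro continuous_intros wc L.continuous_p)+
      also have "\<dots> = 2 * e\<^sup>2 * J (\<lambda>x. w x * (p n x)\<^sup>2) + 2 * c\<^sup>2 * J (\<lambda>x. (1 - x) * (w x * ((1 - x) * (L.p n x)\<^sup>2)))"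
        by (subst jint_add, (intro continuous_intros wc L.continuous_p)+) (simp only: jint_cmult)
      also have "J (\<lambda>x. (1 - x) * (w x * ((1 - x) * (L.p n x)\<^sup>2))) = L.J (\<lambda>x. w x * ((1 - x) * (L.p n x)\<^sup>2))"
        unfolding jint_shift_left[OF al be] ..
      also have "2 * e\<^sup>2 * J (\<lambda>x. w x * (p n x)\<^sup>2) + 2 * c\<^sup>2 * L.J (\<lambda>x. w x * ((1 - x) * (L.p n x)\<^sup>2))
         \<le> 2 * (4 * C3\<^sup>2 / (real n + 1)\<^sup>2) * (C1 / sqrt s) + 2 * C3\<^sup>2 * (2 / s * (sqrt 2 * C2 / sqrt s))"
      proof (intro add_mono mult_mono)
        show "J (\<lambda>x. w x * (p n x)\<^sup>2) \<le> C1 / sqrt s" unfolding w_def by (rule C1(2)[OF s])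
        have s2: "0 < s / 2" using s by simp
        have "L.J (\<lambda>x. w x * ((1 - x) * (L.p n x)\<^sup>2)) \<le> L.J (\<lambda>x. 2 / s * (exp (- (s / 2) * (1 - x)) * (L.p n x)\<^sup>2))"
        proof (rule L.jint_mono)
          fix x :: real assume x: "-1 < x" "x < 1"
          have "\<bar>Fh s x\<bar> \<le> 2 / s * exp (- (s / 2) * (1 - x))" by (rule F_bounds[OF s x])
          then have "(1 - x) * w x \<le> 2 / s * exp (- (s / 2) * (1 - x))" unfolding Fh_def w_def by linarith
          from mult_right_mono[OF this, of "(L.p n x)\<^sup>2"]
          show "w x * ((1 - x) * (L.p n x)\<^sup>2) \<le> 2 / s * (exp (- (s / 2) * (1 - x)) * (L.p n x)\<^sup>2)" by (simp add: mult_ac)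
        qed (intro continuous_intros wc L.continuous_p)+
        also have "\<dots> = 2 / s * L.J (\<lambda>x. exp (- (s / 2) * (1 - x)) * (L.p n x)\<^sup>2)" by (rule L.jint_cmult)
        also have "\<dots> \<le> 2 / s * (C2 / sqrt (s / 2))" using s C2(2)[OF s2] by (intro mult_left_mono) auto
        also have "C2 / sqrt (s / 2) = sqrt 2 * C2 / sqrt s" by (rule sqrt_half[OF s])
        finally show "L.J (\<lambda>x. w x * ((1 - x) * (L.p n x)\<^sup>2)) \<le> 2 / s * (sqrt 2 * C2 / sqrt s)" .
      qed (use e2 c2 C1 w0 in \<open>auto intro!: jint_nonneg L.jint_nonneg continuous_intros wc L.continuous_p\<close>)
      also have "\<dots> = (8 * C3\<^sup>2 * C1) * (1 / (real n + 1)\<^sup>2) / sqrt s + (4 * C3\<^sup>2 * sqrt 2 * C2) * (1 / s) / sqrt s" by simp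
      also have "\<dots> \<le> D * (1 / (real n + 1)\<^sup>2) / sqrt s + D * (1 / s) / sqrt s"
        using D s by (intro add_mono divide_right_mono mult_right_mono) auto
      also have "\<dots> = D * (1 / s + 1 / (real n + 1)\<^sup>2) / sqrt s" by (simp add: add_divide_distrib distrib_left)
      finally show ?thesis unfolding w_def .
    qed
  qed
qed

end

context jacobi_half
begin

text \<open>The identity \<open>ker_identity\<close> is differenced in n:
  \<open>X'^2 * \<Delta>\<close> is the increment of its right-hand side minus (X'^2 - X^2) times
  the old kernel. Each piece is at most a constant times \<open>Y^2 * \<kappa> * \<beta>\<close>,
  while X' = (n + 1 - m) Y, so Y^2 cancels again.\<close>

theorem unit_diff:
  obtains C where "0 < C" "\<And>t n m. 0 < t \<Longrightarrow> 1 \<le> n \<Longrightarrow> n \<noteq> m \<Longrightarrow>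
     \<bar>ker t (Suc n) m - ker t n m\<bar> * (t + (real n + 1 - real m)\<^sup>2) \<le> C / sqrt t * (1 / sqrt t + 1 / real n)"
proof -
  interpret T: jacobi_half "al + 1" "be + 1" by (rule jacobi_half_shift)
  obtain C1 where C1: "0 < C1" "\<And>n s. 0 < s \<Longrightarrow> J (\<lambda>x. exp (- s * (1 - x)) * (p n x)\<^sup>2) \<le> C1 / sqrt s"
    "\<And>n s. 0 < s \<Longrightarrow> T.J (\<lambda>x. exp (- s * (1 - x)) * (pd n x)\<^sup>2) \<le> l n * (C1 / sqrt s)"
    using heat_bounds by blast
  obtain C2 where C2: "0 < C2" "\<And>t n m. 0 < t \<Longrightarrow> \<bar>ker t n m\<bar> * (t + (real n - real m)\<^sup>2) \<le> C2 / sqrt t"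
    using ker_size by blast
  obtain C3 where C3: "0 < C3" "\<And>n s. 0 < s \<Longrightarrow>
     J (\<lambda>x. exp (- s * (1 - x)) * (p (Suc n) x - p n x)\<^sup>2) \<le> C3 * (1 / s + 1 / (real n + 1)\<^sup>2) / sqrt s"
    using diff_bound by blast
  obtain C4 where C4: "0 < C4" "\<And>n s. 0 < s \<Longrightarrow>
     T.J (\<lambda>x. exp (- s * (1 - x)) * (T.p (Suc n) x - T.p n x)\<^sup>2) \<le> C4 * (1 / s + 1 / (real n + 1)\<^sup>2) / sqrt s"
    using T.diff_bound by blast
  obtain C5 where C5: "0 < C5" "\<And>n s. 0 < s \<Longrightarrow> T.J (\<lambda>x. exp (- s * (1 - x)) * (T.p n x)\<^sup>2) \<le> C5 / sqrt s"
    using T.heat_diagonal by blast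
  define s where "s = al + be + 1"
  have s: "0 \<le> s" unfolding s_def by (rule ab_nonneg)
  define g1 g2 g3 where "g1 = sqrt 2 * C1" and "g2 = 2 * (sqrt 2 * C3)" and "g3 = 4 * (sqrt 2 * C4) + 8 * (1 + s) * (sqrt 2 * C5)"
  define G where "G = g1 + C2 + g2 + g3"
  have gpos: "0 \<le> g1" "0 \<le> g2" "0 \<le> g3" unfolding g1_def g2_def g3_def using C1 C3 C4 C5 s
    by (auto intro!: add_nonneg_nonneg mult_nonneg_nonneg)
  have G: "g1 \<le> G" "C2 \<le> G" "g2 \<le> G" "g3 \<le> G" "0 < G" unfolding G_def using gpos C2 by auto
  show thesis
  proof
    show "0 < (8 + 5 * AA) * G" using G AA_pos by (intro mult_pos_pos) auto
    fix t :: real and n m :: nat assume t: "0 < t" and n: "1 \<le> n" and nm: "n \<noteq> m"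
    have t2: "0 < t / 2" using t by simp
    define \<kappa> where "\<kappa> = G / sqrt t"
    have \<kappa>: "0 < \<kappa>" unfolding \<kappa>_def using G t by simp
    define \<beta> where "\<beta> = 1 / sqrt t + 1 / real n"
    have \<beta>: "0 < \<beta>" "1 / real n \<le> \<beta>" "1 / sqrt t \<le> \<beta>" unfolding \<beta>_def using t n by (auto intro!: add_pos_pos)
    have \<beta>2: "2 / t + 1 / (real n)\<^sup>2 \<le> 2 * \<beta>\<^sup>2"
    proof -
      have "(1 / sqrt t)\<^sup>2 + (1 / real n)\<^sup>2 \<le> \<beta>\<^sup>2" unfolding \<beta>_def power2_sum using t by simp
      moreover have "0 \<le> (1 / real n)\<^sup>2" by simp
      moreover have "2 / t + 1 / (real n)\<^sup>2 = 2 * (1 / sqrt t)\<^sup>2 + (1 / real n)\<^sup>2" using t by (simp add: power_divide)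
      ultimately show ?thesis by linarith
    qed
    define Y where "Y = real n + 1 + real m + s"
    have Y: "1 \<le> Y" "real n \<le> Y" unfolding Y_def using s by auto
    \<comment> \<open>Terms in which only a coefficient is differenced carry fewer powers of Y; this
      inequality supplies the missing factors \<open>Y * \<beta>\<close>.\<close>
    have Y\<beta>: "1 \<le> Y * \<beta>"
    proof -
      have "1 \<le> Y * (1 / real n)" using Y n by simp
      also have "\<dots> \<le> Y * \<beta>" using \<beta> Y by (intro mult_left_mono) auto
      finally show ?thesis .
    qed
    define w where "w x = exp (- (t / 2) * (1 - x))" for x
    have wc: "continuous_on S w" for S unfolding w_def[abs_def] by (intro continuous_intros)
    have w0: "0 \<le> w x" for x unfolding w_def by simp
    have rt: "0 < sqrt t" using t by simp
    have a: "J (\<lambda>x. w x * (p k x)\<^sup>2) \<le> \<kappa>" for k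
    proof -
      have "J (\<lambda>x. w x * (p k x)\<^sup>2) \<le> C1 / sqrt (t / 2)" unfolding w_def by (rule C1(2)[OF t2])
      also have "\<dots> = g1 / sqrt t" unfolding g1_def by (rule sqrt_half[OF t])
      also have "\<dots> \<le> \<kappa>" unfolding \<kappa>_def using G rt by (intro divide_right_mono) auto
      finally show ?thesis .
    qed
    have b: "J (\<lambda>x. w x * (p (Suc n) x - p n x)\<^sup>2) \<le> \<kappa> * \<beta>\<^sup>2"
    proof -
      have "J (\<lambda>x. w x * (p (Suc n) x - p n x)\<^sup>2) \<le> C3 * (1 / (t / 2) + 1 / (real n + 1)\<^sup>2) / sqrt (t / 2)"
        unfolding w_def by (rule C3(2)[OF t2])
      also have "\<dots> \<le> C3 * (2 * \<beta>\<^sup>2) / sqrt (t / 2)"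
      proof (intro divide_right_mono mult_left_mono)
        have "1 / (real n + 1)\<^sup>2 \<le> 1 / (real n)\<^sup>2" using n by (intro divide_left_mono power_mono mult_pos_pos) auto
        then show "1 / (t / 2) + 1 / (real n + 1)\<^sup>2 \<le> 2 * \<beta>\<^sup>2" using \<beta>2 by simp
      qed (use C3 t in auto)
      also have "\<dots> = g2 * \<beta>\<^sup>2 / sqrt t" unfolding g2_def sqrt_half[OF t] by simp
      also have "\<dots> \<le> \<kappa> * \<beta>\<^sup>2" unfolding \<kappa>_def using G rt by (simp add: divide_right_mono mult_right_mono)
      finally show ?thesis .
    qed
    have lY: "l (Suc n) \<le> Y\<^sup>2" "l m \<le> Y\<^sup>2" "l n + l m \<le> Y\<^sup>2"
    proof -
      have st: "l (Suc n) + l m \<le> Y\<^sup>2"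
        using l_sum_le[of "Suc n" m] unfolding Y_def s_def by (simp add: add_ac)
      then show "l (Suc n) \<le> Y\<^sup>2" "l m \<le> Y\<^sup>2" using l_nonneg[of "Suc n"] l_nonneg[of m] by linarith+
      have "0 \<le> l (Suc n) - l n" unfolding l_diff using ab_nonneg by simp
      then show "l n + l m \<le> Y\<^sup>2" using st by linarith
    qed
    have c: "T.J (\<lambda>x. w x * (pd m x)\<^sup>2) \<le> Y\<^sup>2 * \<kappa>"
    proof -
      have "T.J (\<lambda>x. w x * (pd m x)\<^sup>2) \<le> l m * (C1 / sqrt (t / 2))" unfolding w_def by (rule C1(3)[OF t2])
      also have "C1 / sqrt (t / 2) = g1 / sqrt t" unfolding g1_def by (rule sqrt_half[OF t])
      also have "l m * (g1 / sqrt t) \<le> Y\<^sup>2 * \<kappa>"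
        unfolding \<kappa>_def using G rt gpos lY l_nonneg by (intro mult_mono divide_right_mono) auto
      finally show ?thesis .
    qed
    have ln1: "l (Suc n) - l n = 2 * real n + 1 + s" unfolding l_diff s_def by simp
    \<comment> \<open>The derivatives differ in the raised polynomial and in the factor sqrt (l_n).
      The increment of the latter is bounded in n, because l_n increases by an amount linear in n
      while its root is itself at least of that order.\<close>
    have d: "T.J (\<lambda>x. w x * (pd (Suc n) x - pd n x)\<^sup>2) \<le> \<kappa> * Y\<^sup>2 * \<beta>\<^sup>2"
    proof -
      obtain k where k: "n = Suc k" using n by (cases n) auto
      define A where "A = sqrt (l (Suc n))"
      define D where "D = sqrt (l (Suc n)) - sqrt (l n)"
      have A2: "A\<^sup>2 \<le> Y\<^sup>2" unfolding A_def using lY l_nonneg by simp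
      have D2: "D\<^sup>2 \<le> 4 * (1 + s)"
      proof -
        define B where "B = sqrt (l n)"
        have B: "0 \<le> B" "B\<^sup>2 = l n" unfolding B_def using l_nonneg by auto
        have A: "0 < A" "A\<^sup>2 = (real n + 1) * (real n + 1 + s)"
        proof -
          have e: "l (Suc n) = (real n + 1) * (real n + 1 + s)" unfolding jlam_def s_def by (simp add: add_ac)
          show "A\<^sup>2 = (real n + 1) * (real n + 1 + s)" unfolding A_def e using s by (intro real_sqrt_pow2 mult_nonneg_nonneg) auto
          show "0 < A" unfolding A_def e using s by simp
        qed
        have D0: "0 \<le> D" unfolding D_def using ln1 s by simp
        have "D * A \<le> D * (A + B)" using D0 B by (intro mult_left_mono) auto
        also have "\<dots> = A\<^sup>2 - B\<^sup>2" unfolding D_def A_def[symmetric] B_def[symmetric] by (simp add: power2_eq_square algebra_simps)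
        also have "\<dots> = 2 * real n + 1 + s" using ln1 l_nonneg unfolding A_def B_def by simp
        finally have "(D * A)\<^sup>2 \<le> (2 * real n + 1 + s)\<^sup>2" using D0 A by (intro power_mono) auto
        also have "\<dots> \<le> (2 * (real n + 1 + s))\<^sup>2" using s by (intro power_mono) auto
        also have "\<dots> = 4 * (real n + 1 + s) * (real n + 1 + s)" by (simp add: power2_eq_square algebra_simps)
        also have "\<dots> \<le> 4 * ((1 + s) * (real n + 1)) * (real n + 1 + s)"
        proof -
          have "real n + 1 + s \<le> (1 + s) * (real n + 1)" using s by (simp add: algebra_simps)
          then show ?thesis using s by (intro mult_right_mono mult_left_mono) auto
        qed
        also have "\<dots> = 4 * (1 + s) * A\<^sup>2" unfolding A(2) by simp
        finally have "D\<^sup>2 * A\<^sup>2 \<le> 4 * (1 + s) * A\<^sup>2" by (simp add: power_mult_distrib)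
        then show ?thesis using A(1) by simp
      qed
      have "T.J (\<lambda>x. w x * (pd (Suc n) x - pd n x)\<^sup>2) \<le> T.J (\<lambda>x. 2 * A\<^sup>2 * (w x * (T.p (Suc k) x - T.p k x)\<^sup>2) + 2 * D\<^sup>2 * (w x * (T.p k x)\<^sup>2))"
      proof (rule T.jint_mono)
        fix x
        have e: "pd (Suc n) x - pd n x = A * (T.p (Suc k) x - T.p k x) + D * T.p k x"
          unfolding k pd_Suc A_def D_def by (simp add: algebra_simps)
        have "(u + v)\<^sup>2 \<le> 2 * u\<^sup>2 + 2 * v\<^sup>2" for u v :: real
          using zero_le_power2[of "u - v"] by (simp add: power2_eq_square algebra_simps)
        from mult_left_mono[OF this w0[of x]]
        have "w x * (A * (T.p (Suc k) x - T.p k x) + D * T.p k x)\<^sup>2 \<le> w x * (2 * (A * (T.p (Suc k) x - T.p k x))\<^sup>2 + 2 * (D * T.p k x)\<^sup>2)" .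
        then show "w x * (pd (Suc n) x - pd n x)\<^sup>2 \<le> 2 * A\<^sup>2 * (w x * (T.p (Suc k) x - T.p k x)\<^sup>2) + 2 * D\<^sup>2 * (w x * (T.p k x)\<^sup>2)"
          unfolding e by (simp add: power_mult_distrib distrib_left mult_ac)
      qed (intro continuous_intros wc T.continuous_p)+
      also have "\<dots> = 2 * A\<^sup>2 * T.J (\<lambda>x. w x * (T.p (Suc k) x - T.p k x)\<^sup>2) + 2 * D\<^sup>2 * T.J (\<lambda>x. w x * (T.p k x)\<^sup>2)"
        by (subst T.jint_add, (intro continuous_intros wc T.continuous_p)+) (simp only: T.jint_cmult)
      also have "\<dots> \<le> 2 * Y\<^sup>2 * (2 * (sqrt 2 * C4) * \<beta>\<^sup>2 / sqrt t) + 2 * (4 * (1 + s)) * (sqrt 2 * C5 / sqrt t)"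
      proof (intro add_mono mult_mono)
        have kn: "real k + 1 = real n" using k by simp
        have "T.J (\<lambda>x. w x * (T.p (Suc k) x - T.p k x)\<^sup>2) \<le> C4 * (1 / (t / 2) + 1 / (real n)\<^sup>2) / sqrt (t / 2)"
          using C4(2)[OF t2, of k] unfolding w_def kn .
        also have "\<dots> \<le> C4 * (2 * \<beta>\<^sup>2) / sqrt (t / 2)"
          using \<beta>2 C4 t by (intro divide_right_mono mult_left_mono) auto
        also have "\<dots> = 2 * (sqrt 2 * C4) * \<beta>\<^sup>2 / sqrt t" unfolding sqrt_half[OF t] by simp
        finally show "T.J (\<lambda>x. w x * (T.p (Suc k) x - T.p k x)\<^sup>2) \<le> 2 * (sqrt 2 * C4) * \<beta>\<^sup>2 / sqrt t" .
        show "T.J (\<lambda>x. w x * (T.p k x)\<^sup>2) \<le> sqrt 2 * C5 / sqrt t"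
          using C5(2)[OF t2, of k] unfolding w_def sqrt_half[OF t] .
      qed (use A2 D2 s in \<open>auto intro!: T.jint_nonneg continuous_intros wc T.continuous_p mult_nonneg_nonneg simp: w0\<close>)
      also have "\<dots> \<le> 2 * Y\<^sup>2 * (2 * (sqrt 2 * C4) * \<beta>\<^sup>2 / sqrt t) + 2 * (4 * (1 + s)) * (sqrt 2 * C5 / sqrt t) * (Y\<^sup>2 * \<beta>\<^sup>2)"
      proof -
        have "1 \<le> (Y * \<beta>)\<^sup>2" using Y\<beta> by simp
        then have "2 * (4 * (1 + s)) * (sqrt 2 * C5 / sqrt t) * 1 \<le> 2 * (4 * (1 + s)) * (sqrt 2 * C5 / sqrt t) * (Y\<^sup>2 * \<beta>\<^sup>2)"
          using s C5 rt by (intro mult_left_mono) (auto simp: power_mult_distrib)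
        then show ?thesis by simp
      qed
      also have "\<dots> = g3 / sqrt t * (Y\<^sup>2 * \<beta>\<^sup>2)" unfolding g3_def using rt by (simp add: field_simps)
      also have "\<dots> \<le> \<kappa> * (Y\<^sup>2 * \<beta>\<^sup>2)" unfolding \<kappa>_def using G rt by (intro mult_right_mono divide_right_mono) auto
      finally show ?thesis by (simp add: mult.assoc)
    qed
    have sq\<kappa>: "sqrt (\<kappa> * \<beta>\<^sup>2) * sqrt \<kappa> = \<kappa> * \<beta>" "sqrt \<kappa> * sqrt \<kappa> = \<kappa>" "sqrt (\<kappa> * Y\<^sup>2 * \<beta>\<^sup>2) * sqrt (Y\<^sup>2 * \<kappa>) = \<kappa> * Y\<^sup>2 * \<beta>"
    proof -
      have k: "sqrt \<kappa> * sqrt \<kappa> = \<kappa>" using \<kappa> by simp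
      show "sqrt \<kappa> * sqrt \<kappa> = \<kappa>" by (rule k)
      show "sqrt (\<kappa> * \<beta>\<^sup>2) * sqrt \<kappa> = \<kappa> * \<beta>" using \<beta> k by (simp add: real_sqrt_mult)
      have "sqrt (\<kappa> * Y\<^sup>2 * \<beta>\<^sup>2) * sqrt (Y\<^sup>2 * \<kappa>) = (sqrt \<kappa> * sqrt \<kappa>) * (Y * Y) * \<beta>"
        using \<beta> Y by (simp add: real_sqrt_mult)
      then show "sqrt (\<kappa> * Y\<^sup>2 * \<beta>\<^sup>2) * sqrt (Y\<^sup>2 * \<kappa>) = \<kappa> * Y\<^sup>2 * \<beta>" unfolding k by (simp add: power2_eq_square)
    qed
    define \<Delta> where "\<Delta> = ker t (Suc n) m - ker t n m"
    have jd: "J (\<lambda>x. \<Phi> x * (u x * v x)) - J (\<lambda>x. \<Phi> x * (u' x * v x)) = J (\<lambda>x. \<Phi> x * ((u x - u' x) * v x))"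
      if "continuous_on {-1..1} \<Phi>" "continuous_on {-1..1} u" "continuous_on {-1..1} u'" "continuous_on {-1..1} v" for \<Phi> u u' v
      using that by (subst jint_diff[symmetric]) (auto intro!: continuous_intros jint_cong simp: algebra_simps)
    have jdT: "T.J (\<lambda>x. \<Phi> x * (u x * v x)) - T.J (\<lambda>x. \<Phi> x * (u' x * v x)) = T.J (\<lambda>x. \<Phi> x * ((u x - u' x) * v x))"
      if "continuous_on {-1..1} \<Phi>" "continuous_on {-1..1} u" "continuous_on {-1..1} u'" "continuous_on {-1..1} v" for \<Phi> u u' v
      using that by (subst T.jint_diff[symmetric]) (auto intro!: continuous_intros T.jint_cong simp: algebra_simps)
    have 1: "t * \<bar>\<Delta>\<bar> \<le> 2 * \<kappa> * \<beta>"
    proof -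
      have "\<Delta> = J (\<lambda>x. Fh t x * ((p (Suc n) x - p n x) * p m x))"
        unfolding \<Delta>_def ker_def Fh_def by (intro jd continuous_intros)
      also have "\<bar>\<dots>\<bar> \<le> 2 / t * (sqrt (\<kappa> * \<beta>\<^sup>2) * sqrt \<kappa>)"
        using t F_bounds(1)[OF t] a b unfolding w_def
        by (intro jint_bilinear_bound[where s="t / 2"] continuous_intros) auto
      finally show ?thesis unfolding sq\<kappa> using t by (simp add: field_simps)
    qed
    have i1: "\<bar>J (\<lambda>x. LF t x * (p (Suc n) x * p m x))\<bar> \<le> AA * \<kappa>"
    proof -
      have "\<bar>J (\<lambda>x. LF t x * (p (Suc n) x * p m x))\<bar> \<le> AA * (sqrt \<kappa> * sqrt \<kappa>)"
        using AA_pos F_bounds(2)[OF t] a unfolding w_def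
        by (intro jint_bilinear_bound[where s="t / 2"] continuous_intros) auto
      then show ?thesis unfolding sq\<kappa> .
    qed
    have i2: "\<bar>J (\<lambda>x. LF t x * ((p (Suc n) x - p n x) * p m x))\<bar> \<le> AA * (\<kappa> * \<beta>)"
    proof -
      have "\<bar>J (\<lambda>x. LF t x * ((p (Suc n) x - p n x) * p m x))\<bar> \<le> AA * (sqrt (\<kappa> * \<beta>\<^sup>2) * sqrt \<kappa>)"
        using AA_pos F_bounds(2)[OF t] a b unfolding w_def
        by (intro jint_bilinear_bound[where s="t / 2"] continuous_intros) auto
      then show ?thesis unfolding sq\<kappa> .
    qed
    have i3: "\<bar>T.J (\<lambda>x. HF t x * ((pd (Suc n) x - pd n x) * pd m x))\<bar> \<le> AA * (\<kappa> * Y\<^sup>2 * \<beta>)"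
    proof -
      have "\<bar>T.J (\<lambda>x. HF t x * ((pd (Suc n) x - pd n x) * pd m x))\<bar> \<le> AA * (sqrt (\<kappa> * Y\<^sup>2 * \<beta>\<^sup>2) * sqrt (Y\<^sup>2 * \<kappa>))"
        using AA_pos F_bounds(3)[OF t] c d unfolding w_def
        by (intro T.jint_bilinear_bound[where s="t / 2"] continuous_intros) auto
      then show ?thesis unfolding sq\<kappa> .
    qed
    define R where "R k = (l k + l m) * J (\<lambda>x. LF t x * (p k x * p m x)) + 2 * T.J (\<lambda>x. HF t x * (pd k x * pd m x))" for k
    have Rid: "(l k - l m)\<^sup>2 * ker t k m = R k" for k unfolding R_def by (rule ker_identity)
    have Rd: "\<bar>R (Suc n) - R n\<bar> \<le> 5 * AA * (\<kappa> * Y\<^sup>2 * \<beta>)"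
    proof -
      have "R (Suc n) - R n = (l (Suc n) - l n) * J (\<lambda>x. LF t x * (p (Suc n) x * p m x))
         + (l n + l m) * (J (\<lambda>x. LF t x * (p (Suc n) x * p m x)) - J (\<lambda>x. LF t x * (p n x * p m x)))
         + 2 * (T.J (\<lambda>x. HF t x * (pd (Suc n) x * pd m x)) - T.J (\<lambda>x. HF t x * (pd n x * pd m x)))"
        unfolding R_def by (simp add: algebra_simps)
      also have "J (\<lambda>x. LF t x * (p (Suc n) x * p m x)) - J (\<lambda>x. LF t x * (p n x * p m x)) = J (\<lambda>x. LF t x * ((p (Suc n) x - p n x) * p m x))"
        by (intro jd continuous_intros)
      also have "T.J (\<lambda>x. HF t x * (pd (Suc n) x * pd m x)) - T.J (\<lambda>x. HF t x * (pd n x * pd m x)) = T.J (\<lambda>x. HF t x * ((pd (Suc n) x - pd n x) * pd m x))"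
        by (intro jdT continuous_intros)
      finally have "\<bar>R (Suc n) - R n\<bar> \<le> \<bar>(l (Suc n) - l n) * J (\<lambda>x. LF t x * (p (Suc n) x * p m x))\<bar>
         + \<bar>(l n + l m) * J (\<lambda>x. LF t x * ((p (Suc n) x - p n x) * p m x))\<bar>
         + \<bar>2 * T.J (\<lambda>x. HF t x * ((pd (Suc n) x - pd n x) * pd m x))\<bar>" by linarith
      also have "\<dots> \<le> (2 * Y) * (AA * \<kappa>) + Y\<^sup>2 * (AA * (\<kappa> * \<beta>)) + 2 * (AA * (\<kappa> * Y\<^sup>2 * \<beta>))"
        unfolding abs_mult
      proof (intro add_mono mult_mono i1 i2 i3)
        show "\<bar>l (Suc n) - l n\<bar> \<le> 2 * Y" unfolding ln1 Y_def using s by simp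
        show "\<bar>l n + l m\<bar> \<le> Y\<^sup>2" using lY(3) l_nonneg[of n] l_nonneg[of m] by simp
      qed (use Y in auto)
      also have "(2 * Y) * (AA * \<kappa>) \<le> 2 * AA * (\<kappa> * Y\<^sup>2 * \<beta>)"
      proof -
        have "(2 * Y * AA * \<kappa>) * 1 \<le> (2 * Y * AA * \<kappa>) * (Y * \<beta>)"
          using Y\<beta> Y AA_pos \<kappa> by (intro mult_left_mono) auto
        then show ?thesis by (simp add: power2_eq_square mult_ac)
      qed
      finally show ?thesis by (simp add: mult_ac)
    qed
    define dd where "dd = \<bar>real n - real m\<bar>"
    have dd: "1 \<le> dd" unfolding dd_def using nm by linarith
    define X' X where "X' = l (Suc n) - l m" and "X = l n - l m"
    have X'e: "X' = (real n + 1 - real m) * Y" unfolding X'_def l_diff Y_def s_def by (simp add: add_ac)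
    have Xe: "X = (real n - real m) * (Y - 1)" unfolding X_def l_diff Y_def s_def by (simp add: add_ac)
    have Xd: "\<bar>X'\<^sup>2 - X\<^sup>2\<bar> \<le> 6 * dd * Y\<^sup>2"
    proof -
      have "X'\<^sup>2 - X\<^sup>2 = (X' - X) * (X' + X)" by (simp add: power2_eq_square algebra_simps)
      then have "\<bar>X'\<^sup>2 - X\<^sup>2\<bar> = \<bar>X' - X\<bar> * \<bar>X' + X\<bar>" by (simp only: abs_mult)
      also have "\<dots> \<le> (2 * Y) * (3 * dd * Y)"
      proof (rule mult_mono)
        have "X' - X = 2 * real n + 1 + s" unfolding X'_def X_def using ln1 by simp
        then show "\<bar>X' - X\<bar> \<le> 2 * Y" unfolding Y_def using s by simp
        have "\<bar>X'\<bar> \<le> (dd + 1) * Y" unfolding X'e abs_mult dd_def using Y by (intro mult_mono) auto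
        moreover have "\<bar>X\<bar> \<le> dd * Y" unfolding Xe abs_mult dd_def using Y by (intro mult_mono) auto
        ultimately have "\<bar>X' + X\<bar> \<le> (dd + 1) * Y + dd * Y" by linarith
        also have "\<dots> \<le> 3 * dd * Y" using dd Y by (simp add: algebra_simps)
        finally show "\<bar>X' + X\<bar> \<le> 3 * dd * Y" .
      qed (use Y in auto)
      finally show ?thesis by (simp add: power2_eq_square mult_ac)
    qed
    \<comment> \<open>From t + dd^2 \<ge> dd * sqrt t the size bound yields a gain 1 / sqrt t, which
      is part of \<open>\<beta>\<close>.\<close>
    have e: "dd * \<bar>ker t n m\<bar> \<le> \<kappa> * \<beta>"
    proof -
      have k: "\<bar>ker t n m\<bar> * (t + dd\<^sup>2) \<le> \<kappa>"
      proof -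
        have "\<bar>ker t n m\<bar> * (t + dd\<^sup>2) \<le> C2 / sqrt t" unfolding dd_def using C2(2)[OF t, of n m] by simp
        also have "\<dots> \<le> \<kappa>" unfolding \<kappa>_def using G rt by (intro divide_right_mono) auto
        finally show ?thesis .
      qed
      have "dd * sqrt t \<le> t + dd\<^sup>2"
      proof -
        have "2 * dd * sqrt t \<le> dd\<^sup>2 + (sqrt t)\<^sup>2" by (rule sum_squares_bound)
        moreover have "0 \<le> dd * sqrt t" using dd rt by simp
        moreover have "(sqrt t)\<^sup>2 = t" using t by simp
        ultimately show ?thesis by linarith
      qed
      then have "\<bar>ker t n m\<bar> * (dd * sqrt t) \<le> \<bar>ker t n m\<bar> * (t + dd\<^sup>2)" by (intro mult_left_mono) auto
      then have "dd * \<bar>ker t n m\<bar> * sqrt t \<le> \<kappa>" using k by (simp add: mult_ac)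
      then have "dd * \<bar>ker t n m\<bar> \<le> \<kappa> * (1 / sqrt t)" using rt by (simp add: field_simps)
      also have "\<dots> \<le> \<kappa> * \<beta>" using \<beta> \<kappa> by (intro mult_left_mono) auto
      finally show ?thesis .
    qed
    have "X'\<^sup>2 * \<Delta> = (R (Suc n) - R n) - (X'\<^sup>2 - X\<^sup>2) * ker t n m"
      unfolding \<Delta>_def Rid[symmetric] X'_def X_def by (simp add: algebra_simps)
    then have "X'\<^sup>2 * \<bar>\<Delta>\<bar> \<le> \<bar>R (Suc n) - R n\<bar> + \<bar>X'\<^sup>2 - X\<^sup>2\<bar> * \<bar>ker t n m\<bar>"
      by (metis abs_mult abs_of_nonneg abs_triangle_ineq4 zero_le_power2)
    also have "\<dots> \<le> 5 * AA * (\<kappa> * Y\<^sup>2 * \<beta>) + 6 * dd * Y\<^sup>2 * \<bar>ker t n m\<bar>"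
      by (intro add_mono Rd mult_right_mono Xd) auto
    also have "6 * dd * Y\<^sup>2 * \<bar>ker t n m\<bar> \<le> 6 * Y\<^sup>2 * (\<kappa> * \<beta>)"
      using mult_left_mono[OF e, of "6 * Y\<^sup>2"] by (simp add: mult_ac)
    finally have "Y\<^sup>2 * ((real n + 1 - real m)\<^sup>2 * \<bar>\<Delta>\<bar>) \<le> Y\<^sup>2 * ((5 * AA + 6) * (\<kappa> * \<beta>))"
      unfolding X'e by (simp add: power_mult_distrib distrib_left distrib_right mult_ac)
    then have 2: "(real n + 1 - real m)\<^sup>2 * \<bar>\<Delta>\<bar> \<le> (5 * AA + 6) * (\<kappa> * \<beta>)"
      using Y by (simp add: mult_le_cancel_left)
    have "\<bar>\<Delta>\<bar> * (t + (real n + 1 - real m)\<^sup>2) \<le> (8 + 5 * AA) * (\<kappa> * \<beta>)"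
      using 1 2 by (simp add: algebra_simps)
    also have "\<dots> = (8 + 5 * AA) * G / sqrt t * \<beta>" unfolding \<kappa>_def by simp
    finally show "\<bar>ker t (Suc n) m - ker t n m\<bar> * (t + (real n + 1 - real m)\<^sup>2) \<le> (8 + 5 * AA) * G / sqrt t * (1 / sqrt t + 1 / real n)"
      unfolding \<Delta>_def \<beta>_def .
  qed
qed

end

section \<open>Maximal functions and Muckenhoupt weights\<close>

text \<open>The hypothesis is multiplied by l powr (p - 2) and integrated over l > 0. The integral
  of l powr (p - 1) up to u is u powr p / p, and p - 2 > -1 keeps the right-hand side integrable at
  0.\<close>

lemma layer_cake_sum:
  fixes u v w :: "'a \<Rightarrow> real"
  assumes fin: "finite A" and p: "1 < p" and u: "\<And>n. n \<in> A \<Longrightarrow> 0 \<le> u n"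
    and H: "\<And>l. 0 < l \<Longrightarrow> l * (\<Sum>n\<in>{n\<in>A. l < u n}. w n) \<le> (\<Sum>n\<in>{n\<in>A. l < u n}. v n)"
  shows "(\<Sum>n\<in>A. u n powr p * w n) \<le> p / (p - 1) * (\<Sum>n\<in>A. u n powr (p - 1) * v n)"
proof -
  have base: "((\<lambda>l. if l \<in> {0<..<c} then l powr q else 0) has_integral (c powr (q + 1) / (q + 1))) UNIV"
    if "q > -1" "c \<ge> 0" for q c :: real
    using has_integral_powr_from_0[OF that]
    by (simp only: has_integral_Icc_iff_Ioo has_integral_restrict_UNIV)
  have 1: "((\<lambda>l. \<Sum>n\<in>A. (if l \<in> {0<..<u n} then l powr (p - 1) else 0) * w n)
      has_integral (\<Sum>n\<in>A. u n powr p / p * w n)) UNIV"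
    using base[of "p - 1"] p u by (intro has_integral_sum fin has_integral_mult_left) auto
  have 2: "((\<lambda>l. \<Sum>n\<in>A. (if l \<in> {0<..<u n} then l powr (p - 2) else 0) * v n)
      has_integral (\<Sum>n\<in>A. u n powr (p - 1) / (p - 1) * v n)) UNIV"
    using base[of "p - 2"] p u by (intro has_integral_sum fin has_integral_mult_left) auto
  have "(\<Sum>n\<in>A. u n powr p / p * w n) \<le> (\<Sum>n\<in>A. u n powr (p - 1) / (p - 1) * v n)"
  proof (rule has_integral_le[OF 1 2])
    fix l :: real
    show "(\<Sum>n\<in>A. (if l \<in> {0<..<u n} then l powr (p - 1) else 0) * w n)
        \<le> (\<Sum>n\<in>A. (if l \<in> {0<..<u n} then l powr (p - 2) else 0) * v n)"
    proof (cases "0 < l")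
      case True
      have a: "(\<Sum>n\<in>A. (if l \<in> {0<..<u n} then c else 0) * f n) = c * (\<Sum>n\<in>{n\<in>A. l < u n}. f n)"
        for c and f :: "'a \<Rightarrow> real"
        using True fin by (simp add: sum_distrib_left sum.inter_filter if_distrib[of "\<lambda>x. x * _"] if_distrib[of "\<lambda>x. _ * x"] cong: if_cong)
      have "l powr (p - 1) = l powr (p - 2) * l"
        using True by (simp add: powr_diff power2_eq_square)
      then have "l powr (p - 1) * (\<Sum>n\<in>{n\<in>A. l < u n}. w n)
          \<le> l powr (p - 2) * (\<Sum>n\<in>{n\<in>A. l < u n}. v n)"
        using H[OF True] by (simp add: mult.assoc mult_left_mono)
      then show ?thesis unfolding a .
    qed auto
  qed
  then have "(\<Sum>n\<in>A. u n powr p * w n) / p \<le> (\<Sum>n\<in>A. u n powr (p - 1) * v n) / (p - 1)"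
    by (simp add: sum_divide_distrib)
  then show ?thesis using p by (simp add: field_simps)
qed

section \<open>One-sided maximal functions by the rising sun lemma\<close>

lemma rising_sun_left:
  fixes x :: "nat \<Rightarrow> real"
  shows "0 \<le> (\<Sum>n\<in>{n\<in>{..<N}. \<exists>a\<le>n. 0 < (\<Sum>k=a..n. x k)}. x n)"
proof -
  define E where "E = (\<lambda>n. \<exists>a\<le>n. 0 < (\<Sum>k=a..n. x k))"
  have S: "(\<Sum>n\<in>{n\<in>{..<Suc M}. E n}. x n) = (\<Sum>n\<in>{n\<in>{..<M}. E n}. x n) + (if E M then x M else 0)" for M
  proof -
    have "{n\<in>{..<Suc M}. E n} = (if E M then insert M {n\<in>{..<M}. E n} else {n\<in>{..<M}. E n})"
      by (auto simp: less_Suc_eq)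
    then show ?thesis by simp
  qed
  \<comment> \<open>Strengthened for the induction: the sum over the set dominates every tail ending
    before N, and the empty tail a = N gives the lemma. If the new point lies outside
    \<open>E\<close>, all new tails are nonpositive by the definition of \<open>E\<close>.\<close>
  have "\<forall>a\<le>N. (\<Sum>k=a..<N. x k) \<le> (\<Sum>n\<in>{n\<in>{..<N}. E n}. x n)"
  proof (induction N)
    case (Suc N)
    have eq: "(\<Sum>k=a..<Suc N. x k) = (\<Sum>k=a..<N. x k) + x N" if "a \<le> N" for a
      using that by simp
    show ?case
    proof (cases "E N")
      case True
      then obtain a0 where "a0 \<le> N" "0 < (\<Sum>k=a0..<Suc N. x k)"
        unfolding E_def by (auto simp: atLeastLessThanSuc_atLeastAtMost)
      then show ?thesis using Suc True eq S by (fastforce simp: le_Suc_eq)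
    next
      case False
      have "(\<Sum>k=a..<Suc N. x k) \<le> 0" if "a \<le> N" for a
        using False that unfolding E_def by (force simp: atLeastLessThanSuc_atLeastAtMost)
      moreover have "0 \<le> (\<Sum>n\<in>{n\<in>{..<N}. E n}. x n)" using Suc by force
      ultimately show ?thesis using False S by (force simp: le_Suc_eq)
    qed
  qed simp
  then show ?thesis unfolding E_def using order_refl[of N] by fastforce
qed

lemma rising_sun_right:
  fixes x :: "nat \<Rightarrow> real"
  shows "0 \<le> (\<Sum>n\<in>{n\<in>{..<N}. \<exists>b\<in>{n..<N}. 0 < (\<Sum>k=n..b. x k)}. x n)"
proof -
  define y where "y k = x (N - Suc k)" for k
  have refl: "(\<Sum>k=a..n. y k) = (\<Sum>k=N - Suc n..N - Suc a. x k)" if "a \<le> n" "n < N" for a n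
    unfolding y_def using that
    by (intro sum.reindex_bij_witness[of _ "\<lambda>k. N - Suc k" "\<lambda>k. N - Suc k"]) auto
  have iff: "(\<exists>a\<le>n. 0 < (\<Sum>k=a..n. y k)) \<longleftrightarrow> (\<exists>b\<in>{N - Suc n..<N}. 0 < (\<Sum>k=N - Suc n..b. x k))"
    if "n < N" for n
  proof
    assume "\<exists>a\<le>n. 0 < (\<Sum>k=a..n. y k)"
    then obtain a where "a \<le> n" "0 < (\<Sum>k=a..n. y k)" by blast
    with that show "\<exists>b\<in>{N - Suc n..<N}. 0 < (\<Sum>k=N - Suc n..b. x k)"
      by (intro bexI[of _ "N - Suc a"]) (auto simp: refl)
  next
    assume "\<exists>b\<in>{N - Suc n..<N}. 0 < (\<Sum>k=N - Suc n..b. x k)"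
    then obtain b where "b \<in> {N - Suc n..<N}" "0 < (\<Sum>k=N - Suc n..b. x k)" by blast
    with that show "\<exists>a\<le>n. 0 < (\<Sum>k=a..n. y k)"
      by (intro exI[of _ "N - Suc b"]) (auto simp: refl)
  qed
  define R where "R m \<longleftrightarrow> (\<exists>b\<in>{m..<N}. 0 < (\<Sum>k=m..b. x k))" for m
  have "{n\<in>{..<N}. \<exists>a\<le>n. 0 < (\<Sum>k=a..n. y k)} = {n\<in>{..<N}. R (N - Suc n)}"
    using iff unfolding R_def by auto
  moreover have "(\<Sum>n\<in>{n\<in>{..<N}. R (N - Suc n)}. y n) = (\<Sum>n\<in>{n\<in>{..<N}. R n}. x n)"
    by (rule sum.reindex_bij_witness[of _ "\<lambda>k. N - Suc k" "\<lambda>k. N - Suc k"])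
       (auto simp: y_def Suc_diff_Suc)
  ultimately show ?thesis using rising_sun_left[where N=N and x=y] unfolding R_def by simp
qed

definition avg :: "(nat \<Rightarrow> real) \<Rightarrow> (nat \<Rightarrow> real) \<Rightarrow> nat \<Rightarrow> nat \<Rightarrow> real" where
  "avg w u a b = (\<Sum>k=a..b. u k * w k) / (\<Sum>k=a..b. w k)"

definition maxl :: "(nat \<Rightarrow> real) \<Rightarrow> (nat \<Rightarrow> real) \<Rightarrow> nat \<Rightarrow> real" where
  "maxl w u n = Max ((\<lambda>a. avg w u a n) ` {..n})"

definition maxr :: "nat \<Rightarrow> (nat \<Rightarrow> real) \<Rightarrow> (nat \<Rightarrow> real) \<Rightarrow> nat \<Rightarrow> real" where
  "maxr N w u n = Max ((\<lambda>b. avg w u n b) ` {n..<N})"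

text \<open>A sum rather than a maximum of the one-sided functions: an interval containing n is
  split at n, and the sum dominates its average; weak and strong bounds follow by addition.\<close>

definition maxf :: "nat \<Rightarrow> (nat \<Rightarrow> real) \<Rightarrow> (nat \<Rightarrow> real) \<Rightarrow> nat \<Rightarrow> real" where
  "maxf N w u n = maxl w u n + maxr N w u n"

lemma sum_pos_Icc: "(\<And>k. 0 < w k) \<Longrightarrow> a \<le> b \<Longrightarrow> 0 < (\<Sum>k=a..b. w k :: real)" for a b :: nat
  by (intro sum_pos) auto

lemma maxl_ge: "a \<le> n \<Longrightarrow> avg w u a n \<le> maxl w u n"
  unfolding maxl_def by (intro Max_ge) auto

lemma maxr_ge: "n \<le> b \<Longrightarrow> b < N \<Longrightarrow> avg w u n b \<le> maxr N w u n"
  unfolding maxr_def by (intro Max_ge) auto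

lemma avg_nonneg: "(\<And>k. 0 < w k) \<Longrightarrow> (\<And>k. 0 \<le> u k) \<Longrightarrow> 0 \<le> avg w u a b"
  unfolding avg_def by (intro divide_nonneg_nonneg sum_nonneg mult_nonneg_nonneg) (auto intro: less_imp_le)

lemma maxl_nonneg: "(\<And>k. 0 < w k) \<Longrightarrow> (\<And>k. 0 \<le> u k) \<Longrightarrow> 0 \<le> maxl w u n"
  using maxl_ge[of n n w u] avg_nonneg[of w u n n] by force

lemma maxr_nonneg: "(\<And>k. 0 < w k) \<Longrightarrow> (\<And>k. 0 \<le> u k) \<Longrightarrow> n < N \<Longrightarrow> 0 \<le> maxr N w u n"
  using maxr_ge[of n n N w u] avg_nonneg[of w u n n] by force

lemma maxf_nonneg: "(\<And>k. 0 < w k) \<Longrightarrow> (\<And>k. 0 \<le> u k) \<Longrightarrow> n < N \<Longrightarrow> 0 \<le> maxf N w u n"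
  unfolding maxf_def using maxl_nonneg maxr_nonneg by (auto intro!: add_nonneg_nonneg)

lemma maxl_obtain:
  obtains a where "a \<le> n" "maxl w u n = avg w u a n"
proof -
  have "maxl w u n \<in> (\<lambda>a. avg w u a n) ` {..n}" unfolding maxl_def by (intro Max_in) auto
  then show ?thesis using that by auto
qed

lemma maxr_obtain:
  assumes "n < N"
  obtains b where "n \<le> b" "b < N" "maxr N w u n = avg w u n b"
proof -
  have "maxr N w u n \<in> (\<lambda>b. avg w u n b) ` {n..<N}" unfolding maxr_def using assms by (intro Max_in) auto
  then show ?thesis using that by auto
qed

lemma sum_le_maxf:
  assumes w: "\<And>k. 0 < w k" and u: "\<And>k. 0 \<le> u k" and n: "a \<le> n" "n \<le> b" "b < N"
  shows "(\<Sum>k=a..b. u k * w k) \<le> maxf N w u n * (\<Sum>k=a..b. w k)"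
proof -
  have l: "(\<Sum>k=a..n. u k * w k) \<le> maxl w u n * (\<Sum>k=a..n. w k)"
    using maxl_ge[of a n w u] n sum_pos_Icc[OF w, of a n] unfolding avg_def by (simp add: field_simps w)
  have r: "(\<Sum>k=n..b. u k * w k) \<le> maxr N w u n * (\<Sum>k=n..b. w k)"
    using maxr_ge[of n b N w u] n sum_pos_Icc[OF w, of n b] unfolding avg_def by (simp add: field_simps w)
  have "(\<Sum>k=a..b. u k * w k) \<le> (\<Sum>k=a..n. u k * w k) + (\<Sum>k=n..b. u k * w k)"
    using n w u by (subst sum.union_inter[symmetric]) 
      (auto intro!: sum_mono2 order_trans[OF _ add_increasing2] sum_nonneg mult_nonneg_nonneg less_imp_le[OF w])
  also have "\<dots> \<le> maxl w u n * (\<Sum>k=a..b. w k) + maxr N w u n * (\<Sum>k=a..b. w k)"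
    using n w u by (intro add_mono order_trans[OF l] order_trans[OF r] mult_left_mono sum_mono2 maxl_nonneg maxr_nonneg)
      (auto intro: less_imp_le)
  finally show ?thesis unfolding maxf_def by (simp add: algebra_simps)
qed

text \<open>An average exceeds l exactly when (u - l) w has positive sum over the interval, so the
  rising sun lemma applies directly. The resulting constant is 1 for every positive weight.\<close>

lemma maxl_weak:
  assumes w: "\<And>k. 0 < w k"
  shows "l * (\<Sum>n\<in>{n\<in>{..<N}. l < maxl w u n}. w n) \<le> (\<Sum>n\<in>{n\<in>{..<N}. l < maxl w u n}. u n * w n)"
proof -
  have "l < maxl w u n \<longleftrightarrow> (\<exists>a\<le>n. 0 < (\<Sum>k=a..n. u k * w k - l * w k))" for n
  proof -
    have "l < maxl w u n \<longleftrightarrow> (\<exists>a\<le>n. l < avg w u a n)"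
      unfolding maxl_def by (subst Max_gr_iff) auto
    also have "\<dots> \<longleftrightarrow> (\<exists>a\<le>n. 0 < (\<Sum>k=a..n. u k * w k - l * w k))"
      using sum_pos_Icc[OF w] unfolding avg_def sum_subtractf sum_distrib_left[symmetric]
      by (auto simp: field_simps w)
    finally show ?thesis .
  qed
  then show ?thesis using rising_sun_left[where N=N and x="\<lambda>k. u k * w k - l * w k"]
    by (simp add: sum_subtractf sum_distrib_left)
qed

lemma maxr_weak:
  assumes w: "\<And>k. 0 < w k"
  shows "l * (\<Sum>n\<in>{n\<in>{..<N}. l < maxr N w u n}. w n) \<le> (\<Sum>n\<in>{n\<in>{..<N}. l < maxr N w u n}. u n * w n)"
proof -
  have "l < maxr N w u n \<longleftrightarrow> (\<exists>b\<in>{n..<N}. 0 < (\<Sum>k=n..b. u k * w k - l * w k))" if "n < N" for n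
  proof -
    have "l < maxr N w u n \<longleftrightarrow> (\<exists>b\<in>{n..<N}. l < avg w u n b)"
      unfolding maxr_def using that by (subst Max_gr_iff) auto
    also have "\<dots> \<longleftrightarrow> (\<exists>b\<in>{n..<N}. 0 < (\<Sum>k=n..b. u k * w k - l * w k))"
      using sum_pos_Icc[OF w] unfolding avg_def sum_subtractf sum_distrib_left[symmetric]
      by (auto simp: field_simps w)
    finally show ?thesis .
  qed
  then have "{n\<in>{..<N}. l < maxr N w u n} = {n\<in>{..<N}. \<exists>b\<in>{n..<N}. 0 < (\<Sum>k=n..b. u k * w k - l * w k)}"
    by auto
  then show ?thesis using rising_sun_right[where N=N and x="\<lambda>k. u k * w k - l * w k"]
    by (simp add: sum_subtractf sum_distrib_left)
qed

lemma maxf_weak: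
  assumes w: "\<And>k. 0 < w k" and u: "\<And>k. 0 \<le> u k" and l: "0 < l"
  shows "l * (\<Sum>n\<in>{n\<in>{..<N}. l < maxf N w u n}. w n) \<le> 4 * (\<Sum>n<N. u n * w n)"
proof -
  let ?L = "{n\<in>{..<N}. l / 2 < maxl w u n}" and ?R = "{n\<in>{..<N}. l / 2 < maxr N w u n}"
  have "(\<Sum>n\<in>{n\<in>{..<N}. l < maxf N w u n}. w n) \<le> (\<Sum>n\<in>?L \<union> ?R. w n)"
    by (intro sum_mono2) (auto simp: maxf_def less_imp_le[OF w])
  also have "\<dots> \<le> (\<Sum>n\<in>?L. w n) + (\<Sum>n\<in>?R. w n)"
    using sum_nonneg[of "?L \<inter> ?R" w] w by (subst sum_Un) (auto intro: less_imp_le)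
  finally have "l * (\<Sum>n\<in>{n\<in>{..<N}. l < maxf N w u n}. w n) \<le> 2 * (l / 2 * (\<Sum>n\<in>?L. w n) + l / 2 * (\<Sum>n\<in>?R. w n))"
    using mult_left_mono[OF _ less_imp_le[OF l]] by (fastforce simp: distrib_left)
  also have "\<dots> \<le> 2 * ((\<Sum>n\<in>?L. u n * w n) + (\<Sum>n\<in>?R. u n * w n))"
    using maxl_weak[where w=w and l="l / 2" and N=N and u=u, OF w] maxr_weak[where w=w and l="l / 2" and N=N and u=u, OF w] by simp
  also have "\<dots> \<le> 2 * ((\<Sum>n<N. u n * w n) + (\<Sum>n<N. u n * w n))"
    by (intro mult_left_mono add_mono sum_mono2 mult_nonneg_nonneg less_imp_le[OF w] u) auto
  finally show ?thesis by simp
qed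

text \<open>Young's inequality with an explicit free parameter; the two cases say which of a and d b
  is larger.\<close>

lemma young_powr_mult:
  fixes a b d p :: real
  assumes "0 \<le> a" "0 \<le> b" "0 < d" "1 < p"
  shows "b powr (p - 1) * a \<le> d * b powr p + d powr (1 - p) * a powr p"
proof (cases "a \<le> d * b")
  case True
  have "b powr (p - 1) * a \<le> b powr (p - 1) * (d * b)" using True by (intro mult_left_mono) auto
  also have "\<dots> = d * b powr p" using assms by (cases "b = 0") (auto simp: powr_diff)
  finally show ?thesis by (smt (verit) powr_ge_zero mult_nonneg_nonneg)
next
  case False
  then have "b \<le> a / d" using assms by (simp add: field_simps)
  then have "b powr (p - 1) * a \<le> (a / d) powr (p - 1) * a" using assms by (intro mult_right_mono powr_mono2) auto
  also have "\<dots> = d powr (1 - p) * a powr p"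
  proof -
    have "d powr (1 - p) = inverse (d powr (p - 1))" by (simp flip: powr_minus)
    then show ?thesis using False assms
      by (cases "a = 0") (auto simp: powr_divide powr_diff field_simps)
  qed
  finally show ?thesis using assms by (smt (verit) powr_ge_zero mult_nonneg_nonneg)
qed

text \<open>After the layer cake inequality, Young's inequality with parameter 1 / (2 c) turns the
  mixed sum into half of the left-hand side, which is finite and can be absorbed.\<close>

lemma strong_from_weak:
  fixes u v w :: "'a \<Rightarrow> real"
  assumes fin: "finite A" and p: "1 < p" and u: "\<And>n. n \<in> A \<Longrightarrow> 0 \<le> u n"
    and v: "\<And>n. n \<in> A \<Longrightarrow> 0 \<le> v n" and w: "\<And>n. n \<in> A \<Longrightarrow> 0 \<le> w n"
    and H: "\<And>l. 0 < l \<Longrightarrow> l * (\<Sum>n\<in>{n\<in>A. l < u n}. w n) \<le> (\<Sum>n\<in>{n\<in>A. l < u n}. v n * w n)"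
  shows "(\<Sum>n\<in>A. u n powr p * w n) \<le> (2 * (p / (p - 1))) powr p * (\<Sum>n\<in>A. v n powr p * w n)"
proof -
  define c where "c = p / (p - 1)"
  have c: "c > 0" using p unfolding c_def by simp
  let ?S = "\<Sum>n\<in>A. u n powr p * w n" and ?V = "\<Sum>n\<in>A. v n powr p * w n"
  have "?S \<le> c * (\<Sum>n\<in>A. u n powr (p - 1) * (v n * w n))"
    unfolding c_def using layer_cake_sum[OF fin p u H] by simp
  also have "\<dots> \<le> c * (\<Sum>n\<in>A. 1 / (2 * c) * (u n powr p * w n) + (1 / (2 * c)) powr (1 - p) * (v n powr p * w n))"
  proof (intro mult_left_mono sum_mono)
    fix n assume n: "n \<in> A"
    show "u n powr (p - 1) * (v n * w n) \<le> 1 / (2 * c) * (u n powr p * w n) + (1 / (2 * c)) powr (1 - p) * (v n powr p * w n)"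
      using mult_right_mono[OF young_powr_mult[OF v[OF n] u[OF n], of "1 / (2 * c)" p] w[OF n]] c p
      by (simp add: algebra_simps)
  qed (use c in auto)
  also have "\<dots> = ?S / 2 + c * (1 / (2 * c)) powr (1 - p) * ?V"
    using c by (simp add: sum.distrib distrib_left flip: sum_distrib_left sum_divide_distrib)
  finally have "?S \<le> 2 * c * (1 / (2 * c)) powr (1 - p) * ?V" by simp
  also have "2 * c * (1 / (2 * c)) powr (1 - p) = (2 * c) powr p"
    using c by (simp add: powr_divide powr_diff field_simps)
  finally show ?thesis unfolding c_def .
qed

lemma powr_add_le:
  fixes x y p :: real
  assumes "0 \<le> x" "0 \<le> y" "0 \<le> p"
  shows "(x + y) powr p \<le> 2 powr p * (x powr p + y powr p)"
proof -
  have "(x + y) powr p \<le> (2 * max x y) powr p" using assms by (intro powr_mono2) auto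
  also have "\<dots> = 2 powr p * (max x y) powr p" using assms by (intro powr_mult) 
  also have "\<dots> \<le> 2 powr p * (x powr p + y powr p)" by (intro mult_left_mono) (auto simp: max_def)
  finally show ?thesis .
qed

text \<open>The constant is uniform in the weight: \<open>muckenhoupt\<close> uses this both for w
  and for the dual weight, and duality arguments use it for w in the conjugate exponent.\<close>

lemma maxf_strong:
  assumes p: "1 < p"
  obtains C where "0 < C" "\<And>N w u. (\<And>k. 0 < w k) \<Longrightarrow> (\<And>k. 0 \<le> u k) \<Longrightarrow>
    (\<Sum>n<N. maxf N w u n powr p * w n) \<le> C * (\<Sum>n<N. u n powr p * w n)"
proof
  define C where "C = 2 powr p * (2 * (2 * (p / (p - 1))) powr p)"
  show "0 < C" unfolding C_def using p by simp
  fix N and w u :: "nat \<Rightarrow> real" assume w: "\<And>k. 0 < w k" and u: "\<And>k. 0 \<le> u k"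
  note wl = less_imp_le[OF w]
  have L: "(\<Sum>n<N. maxl w u n powr p * w n) \<le> (2 * (p / (p - 1))) powr p * (\<Sum>n<N. u n powr p * w n)"
    using p by (rule strong_from_weak[OF finite_lessThan]) (use u wl w maxl_nonneg in \<open>auto intro!: maxl_weak[OF w, simplified]\<close>)
  have R: "(\<Sum>n<N. maxr N w u n powr p * w n) \<le> (2 * (p / (p - 1))) powr p * (\<Sum>n<N. u n powr p * w n)"
    using p by (rule strong_from_weak[OF finite_lessThan]) (use u wl w maxr_nonneg in \<open>auto intro!: maxr_weak[OF w, simplified]\<close>)
  have "(\<Sum>n<N. maxf N w u n powr p * w n)
      \<le> (\<Sum>n<N. 2 powr p * (maxl w u n powr p * w n + maxr N w u n powr p * w n))"
  proof (intro sum_mono)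
    fix n assume "n \<in> {..<N}"
    then show "maxf N w u n powr p * w n \<le> 2 powr p * (maxl w u n powr p * w n + maxr N w u n powr p * w n)"
      using mult_right_mono[OF powr_add_le[of "maxl w u n" "maxr N w u n" p] wl[of n]] p w u
      by (auto simp: maxf_def maxl_nonneg maxr_nonneg algebra_simps)
  qed
  also have "\<dots> = 2 powr p * ((\<Sum>n<N. maxl w u n powr p * w n) + (\<Sum>n<N. maxr N w u n powr p * w n))"
    by (simp only: sum.distrib flip: sum_distrib_left)
  also have "\<dots> \<le> C * (\<Sum>n<N. u n powr p * w n)"
    unfolding C_def using mult_left_mono[OF add_mono[OF L R], of "2 powr p"] by (simp add: algebra_simps)
  finally show "(\<Sum>n<N. maxf N w u n powr p * w n) \<le> C * (\<Sum>n<N. u n powr p * w n)" .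
qed

section \<open>A_p weights and Muckenhoupt's theorem\<close>

lemma Ap_weight_pos: "Ap_weight p w \<Longrightarrow> 0 < w k"
  unfolding Ap_weight_def by blast

lemma Ap_weight_bound:
  assumes "Ap_weight p w"
  obtains A where "0 < A"
    "\<And>a b. a \<le> b \<Longrightarrow> (\<Sum>k=a..b. w k) * (\<Sum>k=a..b. w k powr (-1 / (p - 1))) powr (p - 1)
        \<le> A * real (b - a + 1) powr p"
proof -
  from assms obtain C where C: "\<And>n m. n \<le> m \<Longrightarrow>
        (\<Sum>k=n..m. w k) * (\<Sum>k=n..m. w k powr (-1 / (p - 1))) powr (p - 1)
          / real (m - n + 1) powr p \<le> C"
    unfolding Ap_weight_def by blast
  show thesis
  proof
    show "0 < max C 1" by simp
    fix a b :: nat assume "a \<le> b"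
    then have "(\<Sum>k=a..b. w k) * (\<Sum>k=a..b. w k powr (-1 / (p - 1))) powr (p - 1)
        \<le> C * real (b - a + 1) powr p"
      using C[of a b] by (simp add: divide_le_eq split: if_splits)
    also have "\<dots> \<le> max C 1 * real (b - a + 1) powr p" by (intro mult_right_mono) auto
    finally show "(\<Sum>k=a..b. w k) * (\<Sum>k=a..b. w k powr (-1 / (p - 1))) powr (p - 1)
        \<le> max C 1 * real (b - a + 1) powr p" .
  qed
qed

text \<open>The tangent to the convex function x powr p at c, read off from Young's
  inequality.\<close>

lemma powr_tangent:
  fixes x c p :: real
  assumes "0 \<le> x" "0 \<le> c" "1 < p"
  shows "p * x * c powr (p - 1) - (p - 1) * c powr p \<le> x powr p"
proof -
  define q where "q = p / (p - 1)"
  have pq: "1 / p + 1 / q = 1" "1 < q" "(p - 1) * q = p" "1 / q = (p - 1) / p" 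
    using assms unfolding q_def by (auto simp: field_simps)
  have "x * c powr (p - 1) \<le> x powr p / p + (c powr (p - 1)) powr q / q"
    using assms pq by (intro Youngs_inequality) auto
  also have "(c powr (p - 1)) powr q / q = c powr p * (1 / q)" by (simp add: powr_powr pq(3))
  finally show ?thesis using assms unfolding pq(4) by (simp add: field_simps)
qed

text \<open>Hoelder's inequality against the dual weight \<open>\<sigma>\<close>, followed by the
  A_p condition. It is obtained by summing tangent inequalities for f / \<sigma> at the single point
  c = s / S, the \<sigma>-average of f / \<sigma>.\<close>

lemma Ap_sum_powr_le:
  fixes f w :: "nat \<Rightarrow> real" and p A L :: real
  assumes p: "1 < p" and w: "\<And>k. 0 < w k" and f: "\<And>k. 0 \<le> f k" and ab: "a \<le> (b::nat)"
    and A: "(\<Sum>k=a..b. w k) * (\<Sum>k=a..b. w k powr (-1 / (p - 1))) powr (p - 1) \<le> A * L powr p"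
    and L: "0 < L"
  shows "(\<Sum>k=a..b. f k) powr p * (\<Sum>k=a..b. w k) \<le> A * L powr p * (\<Sum>k=a..b. f k powr p * w k)"
proof -
  define \<sigma> where "\<sigma> k = w k powr (-1 / (p - 1))" for k
  have \<sigma>: "0 < \<sigma> k" for k unfolding \<sigma>_def using w[of k] by simp
  have w\<sigma>: "\<sigma> k powr (1 - p) = w k" for k
    proof -
    have "-1 / (p - 1) * (1 - p) = 1" using p by (simp add: field_simps)
    then show ?thesis unfolding \<sigma>_def powr_powr using w[of k] by simp
  qed
  define s where "s = (\<Sum>k=a..b. f k)"
  define S where "S = (\<Sum>k=a..b. \<sigma> k)"
  define c where "c = s / S"
  have s: "0 \<le> s" unfolding s_def using f by (intro sum_nonneg) auto
  have S: "0 < S" unfolding S_def using \<sigma> ab by (rule sum_pos_Icc)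
  have c: "0 \<le> c" unfolding c_def using s S by simp
  have "(\<Sum>k=a..b. p * f k * c powr (p - 1) - (p - 1) * c powr p * \<sigma> k) \<le> (\<Sum>k=a..b. f k powr p * w k)"
  proof (rule sum_mono)
    fix k
    have "(p * (f k / \<sigma> k) * c powr (p - 1) - (p - 1) * c powr p) * \<sigma> k \<le> (f k / \<sigma> k) powr p * \<sigma> k"
      using c p f[of k] \<sigma>[of k] by (intro mult_right_mono powr_tangent) auto
    also have "\<dots> = f k powr p * w k"
      using \<sigma>[of k] f[of k] by (simp add: powr_divide powr_diff flip: w\<sigma>)
    finally show "p * f k * c powr (p - 1) - (p - 1) * c powr p * \<sigma> k \<le> f k powr p * w k"
      using \<sigma>[of k] by (simp add: algebra_simps)
  qed
  also have "(\<Sum>k=a..b. p * f k * c powr (p - 1) - (p - 1) * c powr p * \<sigma> k)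
      = p * s * c powr (p - 1) - (p - 1) * c powr p * S"
    unfolding s_def S_def by (simp add: sum_subtractf sum_distrib_left sum_distrib_right mult_ac)
  also have "\<dots> = s powr p / S powr (p - 1)"
    using s S p by (cases "s = 0") (auto simp: c_def powr_divide powr_diff field_simps)
  finally have H: "s powr p \<le> S powr (p - 1) * (\<Sum>k=a..b. f k powr p * w k)"
    using S by (simp add: field_simps)
  have "s powr p * (\<Sum>k=a..b. w k) \<le> S powr (p - 1) * (\<Sum>k=a..b. f k powr p * w k) * (\<Sum>k=a..b. w k)"
    using w by (intro mult_right_mono H sum_nonneg) (auto intro: less_imp_le)
  also have "\<dots> = ((\<Sum>k=a..b. w k) * S powr (p - 1)) * (\<Sum>k=a..b. f k powr p * w k)" by simp
  also have "\<dots> \<le> A * L powr p * (\<Sum>k=a..b. f k powr p * w k)"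
    using A w unfolding S_def \<sigma>_def by (intro mult_right_mono sum_nonneg mult_nonneg_nonneg less_imp_le[OF w]) auto
  finally show ?thesis unfolding s_def .
qed

text \<open>The preceding inequality is tested on the indicator of E. A set filling half of an
  interval carries a fixed share of its w-mass, and the half is responsible for 2 powr p.\<close>

lemma Ap_subset:
  assumes p: "1 < p" and Ap: "Ap_weight p w"
  obtains C where "0 < C" "\<And>E a b. a \<le> b \<Longrightarrow> E \<subseteq> {a..b} \<Longrightarrow> b - a + 1 \<le> 2 * card E \<Longrightarrow>
     (\<Sum>k=a..b. w k) \<le> C * (\<Sum>k\<in>E. w k)"
proof -
  obtain A where A: "0 < A" "\<And>a b. a \<le> b \<Longrightarrow> (\<Sum>k=a..b. w k) * (\<Sum>k=a..b. w k powr (-1 / (p - 1))) powr (p - 1)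
        \<le> A * real (b - a + 1) powr p"
    using Ap_weight_bound[OF Ap] by blast
  note w = Ap_weight_pos[OF Ap]
  show thesis
  proof
    show "0 < A * 2 powr p" using A by simp
    fix E and a b :: nat assume ab: "a \<le> b" and E: "E \<subseteq> {a..b}" "b - a + 1 \<le> 2 * card E"
    define f where "f k = (if k \<in> E then 1 else 0 :: real)" for k
    have eq: "(\<Sum>k=a..b. f k) = real (card E)" "(\<Sum>k=a..b. f k powr p * w k) = (\<Sum>k\<in>E. w k)"
      using E(1) unfolding f_def
      by (simp_all add: if_distrib[of "\<lambda>x. x powr _"] if_distrib[of "\<lambda>x. x * _"] sum.inter_restrict[symmetric] Int_absorb1 
          Int_absorb2 cong: if_cong)
    have L: "real (b - a + 1) powr p \<le> 2 powr p * real (card E) powr p"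
      using E(2) p by (subst powr_mult[symmetric]) (auto intro!: powr_mono2)
    have "real (card E) powr p * (\<Sum>k=a..b. w k) \<le> A * real (b - a + 1) powr p * (\<Sum>k\<in>E. w k)"
      using Ap_sum_powr_le[where p=p and w=w and f=f and a=a and b=b and A=A and L="real (b - a + 1)", OF p w _ ab A(2)[OF ab]]
      unfolding eq by (auto simp: f_def)
    also have "\<dots> \<le> A * (2 powr p * real (card E) powr p) * (\<Sum>k\<in>E. w k)"
      using L A w by (intro mult_right_mono mult_left_mono sum_nonneg) (auto intro: less_imp_le)
    finally show "(\<Sum>k=a..b. w k) \<le> A * 2 powr p * (\<Sum>k\<in>E. w k)"
      using E(2) by (cases "card E = 0") (auto simp: field_simps)
  qed
qed

abbreviation (input) hl :: "nat \<Rightarrow> (nat \<Rightarrow> real) \<Rightarrow> nat \<Rightarrow> real" where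
  "hl N f \<equiv> maxf N (\<lambda>_. 1) f"

lemma sum_le_hl:
  assumes "\<And>k. 0 \<le> f k" "a \<le> n" "n \<le> b" "b < N"
  shows "(\<Sum>k=a..b. f k) \<le> hl N f n * real (b - a + 1)"
  using sum_le_maxf[of "\<lambda>_. 1" f a n b N] assms by (simp add: Suc_diff_le)

text \<open>Lerner's argument. An unweighted average of f is bounded by the power 1 / (p - 1) of the
  w-maximal function of H, where H is the (p - 1)-th power of the \<sigma>-maximal function of f /
  \<sigma>, divided by w. The weight-uniform maximal theorem is then applied for w in exponent q and
  for \<sigma> in exponent p.\<close>

theorem muckenhoupt:
  assumes p: "1 < p" and Ap: "Ap_weight p w"
  obtains C where "0 < C" "\<And>N f. (\<And>k. 0 \<le> f k) \<Longrightarrow>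
     (\<Sum>n<N. hl N f n powr p * w n) \<le> C * (\<Sum>n<N. f n powr p * w n)"
proof -
  obtain A where A: "0 < A" "\<And>a b. a \<le> b \<Longrightarrow> (\<Sum>k=a..b. w k) * (\<Sum>k=a..b. w k powr (-1 / (p - 1))) powr (p - 1)
        \<le> A * real (b - a + 1) powr p"
    using Ap_weight_bound[OF Ap] by blast
  note w = Ap_weight_pos[OF Ap]
  define q where "q = p / (p - 1)"
  have q: "1 < q" "(p - 1) * q = p" "1 - q = -1 / (p - 1)" using p unfolding q_def by (auto simp: field_simps)
  define \<sigma> where "\<sigma> k = w k powr (-1 / (p - 1))" for k
  have \<sigma>: "0 < \<sigma> k" for k unfolding \<sigma>_def using w[of k] by simp
  have w\<sigma>: "\<sigma> k powr (1 - p) = w k" for k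
    proof -
    have "-1 / (p - 1) * (1 - p) = 1" using p by (simp add: field_simps)
    then show ?thesis unfolding \<sigma>_def powr_powr using w[of k] by simp
  qed
  obtain C1 where C1: "0 < C1" "\<And>N w u. (\<And>k. 0 < w k) \<Longrightarrow> (\<And>k. 0 \<le> u k) \<Longrightarrow>
    (\<Sum>n<N. maxf N w u n powr q * w n) \<le> C1 * (\<Sum>n<N. u n powr q * w n)"
    using maxf_strong[OF q(1)] by blast
  obtain C2 where C2: "0 < C2" "\<And>N w u. (\<And>k. 0 < w k) \<Longrightarrow> (\<And>k. 0 \<le> u k) \<Longrightarrow>
    (\<Sum>n<N. maxf N w u n powr p * w n) \<le> C2 * (\<Sum>n<N. u n powr p * w n)"
    using maxf_strong[OF p] by blast
  show thesis
  proof
    let ?C = "2 powr p * 2 * A powr q * C1 * C2"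
    show "0 < ?C" using A C1 C2 by simp
    fix N and f :: "nat \<Rightarrow> real" assume f: "\<And>k. 0 \<le> f k"
    define F where "F k = f k / \<sigma> k" for k
    have F: "0 \<le> F k" for k unfolding F_def using f \<sigma> by (simp add: less_imp_le)
    define G where "G = maxf N \<sigma> F"
    have G: "0 \<le> G k" if "k < N" for k unfolding G_def using that \<sigma> F by (intro maxf_nonneg)
    define H where "H k = (if k < N then G k powr (p - 1) / w k else 0)" for k
    have H: "0 \<le> H k" for k unfolding H_def using less_imp_le[OF w[of k]] by auto
    define M where "M = maxf N w H"
    have M: "0 \<le> M k" if "k < N" for k unfolding M_def using that w H by (intro maxf_nonneg)
    have key: "avg (\<lambda>_. 1) f a b powr p \<le> (A * M n) powr q" if n: "a \<le> n" "n \<le> b" "b < N" for a n b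
    proof -
      define s where "s = (\<Sum>k=a..b. f k)"
      define S where "S = (\<Sum>k=a..b. \<sigma> k)"
      define L where "L = real (b - a + 1)"
      have s: "0 \<le> s" unfolding s_def using f by (intro sum_nonneg) auto
      have S: "0 < S" unfolding S_def using \<sigma> n by (intro sum_pos_Icc) auto
      have L: "0 < L" unfolding L_def by simp
      have cardL: "real (card {a..b}) = L" using n by (simp add: L_def Suc_diff_le)
      have av: "avg (\<lambda>_. 1) f a b = s / L" unfolding avg_def s_def using cardL by simp
      \<comment> \<open>Every k in [a, b] sees the whole interval, so G k \<ge> s / S. Summing over
        k turns this pointwise bound into the w-sum of H over the interval, which M n controls; the
        A_p condition then removes S.\<close>
      have "s powr (p - 1) \<le> S powr (p - 1) * (H k * w k)" if k: "k \<in> {a..b}" for k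
      proof -
        have "s = (\<Sum>k=a..b. F k * \<sigma> k)" unfolding s_def F_def using \<sigma> by (simp add: less_imp_neq[symmetric])
        also have "\<dots> \<le> G k * S" unfolding G_def S_def using k n F \<sigma> by (intro sum_le_maxf) auto
        finally have "s powr (p - 1) \<le> (G k * S) powr (p - 1)" using s p by (intro powr_mono2) auto
        also have "\<dots> = S powr (p - 1) * (H k * w k)" 
          using k n G[of k] S w[of k] by (simp add: powr_mult H_def)
        finally show ?thesis .
      qed
      then have "(\<Sum>k=a..b. s powr (p - 1)) \<le> (\<Sum>k=a..b. S powr (p - 1) * (H k * w k))" by (rule sum_mono)
      then have "L * s powr (p - 1) \<le> S powr (p - 1) * (\<Sum>k=a..b. H k * w k)"
        unfolding sum_constant cardL by (simp add: sum_distrib_left)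
      also have "\<dots> \<le> S powr (p - 1) * (M n * (\<Sum>k=a..b. w k))"
        unfolding M_def using n w H by (intro mult_left_mono sum_le_maxf) auto
      also have "\<dots> = ((\<Sum>k=a..b. w k) * S powr (p - 1)) * M n" by simp
      also have "\<dots> \<le> (A * L powr p) * M n"
        using A(2)[of a b] n M[of n] unfolding S_def \<sigma>_def L_def by (intro mult_right_mono) auto
      finally have "s powr (p - 1) \<le> A * M n * L powr (p - 1)"
        using L by (simp add: powr_diff field_simps)
      then have "(s / L) powr (p - 1) \<le> A * M n"
        using L s by (simp add: powr_divide field_simps)
      then have "((s / L) powr (p - 1)) powr q \<le> (A * M n) powr q" using q by (intro powr_mono2) auto
      then show ?thesis unfolding av by (simp add: powr_powr q(2))
    qed
    have "(\<Sum>n<N. hl N f n powr p * w n) \<le> (\<Sum>n<N. 2 powr p * 2 * A powr q * (M n powr q * w n))"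
    proof (rule sum_mono)
      fix n assume n: "n \<in> {..<N}"
      obtain a where a: "a \<le> n" "maxl (\<lambda>_. 1) f n = avg (\<lambda>_. 1) f a n" using maxl_obtain by blast
      obtain b where b: "n \<le> b" "b < N" "maxr N (\<lambda>_. 1) f n = avg (\<lambda>_. 1) f n b" using maxr_obtain n by blast
      have "hl N f n powr p \<le> 2 powr p * ((maxl (\<lambda>_. 1) f n) powr p + (maxr N (\<lambda>_. 1) f n) powr p)"
        unfolding maxf_def using n f p by (intro powr_add_le maxl_nonneg maxr_nonneg) auto
      also have "\<dots> \<le> 2 powr p * ((A * M n) powr q + (A * M n) powr q)"
        unfolding a(2) b(3) using a b n by (intro mult_left_mono add_mono key) auto
      also have "\<dots> = 2 powr p * 2 * A powr q * M n powr q"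
        using A M[of n] n by (simp add: powr_mult)
      finally show "hl N f n powr p * w n \<le> 2 powr p * 2 * A powr q * (M n powr q * w n)"
        using w[of n] by (simp add: mult_right_mono flip: mult.assoc)
    qed
    also have "\<dots> = 2 powr p * 2 * A powr q * (\<Sum>n<N. M n powr q * w n)" by (simp add: sum_distrib_left)
    also have "\<dots> \<le> 2 powr p * 2 * A powr q * (C1 * (\<Sum>n<N. H n powr q * w n))"
      unfolding M_def using C1(2)[of w H N] w H A by (intro mult_left_mono) auto
    also have "(\<Sum>n<N. H n powr q * w n) = (\<Sum>n<N. G n powr p * \<sigma> n)"
    proof (rule sum.cong)
      fix n assume "n \<in> {..<N}"
      then have "H n powr q = G n powr p / w n powr q" 
        unfolding H_def using less_imp_le[OF w[of n]] by (simp add: powr_divide powr_powr q(2))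
      moreover have "\<sigma> n = w n / w n powr q" unfolding \<sigma>_def q(3)[symmetric] using w[of n] by (simp add: powr_diff)
      ultimately show "H n powr q * w n = G n powr p * \<sigma> n" by simp
    qed simp
    also have "\<dots> \<le> C2 * (\<Sum>n<N. F n powr p * \<sigma> n)" unfolding G_def using \<sigma> F by (intro C2) auto
    also have "(\<Sum>n<N. F n powr p * \<sigma> n) = (\<Sum>n<N. f n powr p * w n)"
    proof (rule sum.cong)
      fix n
      show "F n powr p * \<sigma> n = f n powr p * w n"
        unfolding F_def using f[of n] less_imp_le[OF \<sigma>[of n]] \<sigma>[of n] by (simp add: powr_divide powr_diff flip: w\<sigma>)
    qed simp
    finally show "(\<Sum>n<N. hl N f n powr p * w n) \<le> ?C * (\<Sum>n<N. f n powr p * w n)"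
      using A C1 C2 by (simp add: mult_ac mult_left_mono)
  qed
qed

section \<open>Calderon-Zygmund operators on the natural numbers\<close>

definition dyad :: "nat \<Rightarrow> nat \<Rightarrow> nat set" where
  "dyad i k = {k * 2 ^ i..<Suc k * 2 ^ i}"

lemma finite_dyad [simp]: "finite (dyad i k)"
  by (simp add: dyad_def)

lemma card_dyad [simp]: "card (dyad i k) = 2 ^ i"
  by (simp add: dyad_def)

lemma dyad_0 [simp]: "dyad 0 k = {k}"
  by (auto simp: dyad_def)

lemma dyad_zero_right [simp]: "dyad i 0 = {..<2 ^ i}"
  by (auto simp: dyad_def)

lemma dyad_nonempty [simp]: "dyad i k \<noteq> {}"
  using card_dyad[of i k] by (metis card.empty power_not_zero zero_neq_numeral)

lemma dyad_Suc: "dyad (Suc i) k = dyad i (2 * k) \<union> dyad i (Suc (2 * k))"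
  by (auto simp: dyad_def algebra_simps)

lemma dyad_children_disjoint: "dyad i (2 * k) \<inter> dyad i (Suc (2 * k)) = {}"
  by (auto simp: dyad_def)

lemma dyad_subset_parent: "dyad i k \<subseteq> dyad (Suc i) (k div 2)"
  by (cases "even k") (auto simp: dyad_Suc elim!: evenE oddE)

lemma mem_dyad_iff: "n \<in> dyad i k \<longleftrightarrow> n div 2 ^ i = k"
proof -
  have "n div 2 ^ i = k \<longleftrightarrow> k * 2 ^ i \<le> n \<and> n < Suc k * 2 ^ i"
    by (metis div_nat_eqI dividend_less_times_div div_times_less_eq_dividend mult.commute
        mult_Suc_right mult_Suc zero_less_numeral zero_less_power)
  then show ?thesis by (simp add: dyad_def)
qed

lemma dyad_Icc: "dyad i k = {k * 2 ^ i..Suc k * 2 ^ i - 1}"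
  unfolding dyad_def using atLeastLessThanSuc_atLeastAtMost[of "k * 2 ^ i" "Suc k * 2 ^ i - 1"] by simp

text \<open>Existence of the maximal proper dyadic subintervals with property S: the parent of a
  selected interval is the top interval or fails S. This serves both the oscillation argument and
  the Calderon-Zygmund decomposition.\<close>

lemma dyadic_stopping:
  fixes S :: "nat \<Rightarrow> nat \<Rightarrow> bool"
  obtains F where "finite F" 
    "\<And>j l. (j, l) \<in> F \<Longrightarrow> j < i \<and> S j l \<and> dyad j l \<subseteq> dyad i k \<and> (Suc j = i \<or> \<not> S (Suc j) (l div 2))"
    "disjoint_family_on (\<lambda>(j, l). dyad j l) F"
    "\<And>n j. n \<in> dyad i k \<Longrightarrow> j < i \<Longrightarrow> S j (n div 2 ^ j) \<Longrightarrow> n \<in> (\<Union>(j, l)\<in>F. dyad j l)"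
proof -
  \<comment> \<open>Two generation bounds are carried: i is the generation of the ambient interval,
    while i' bounds the selected ones, so i' = Suc i admits the ambient interval itself. In that
    form the families of the two children can be joined.\<close>
  define G where "G i' i k F \<longleftrightarrow> finite F \<and> 
    (\<forall>j l. (j, l) \<in> F \<longrightarrow> j < i' \<and> S j l \<and> dyad j l \<subseteq> dyad i k \<and> (Suc j = i' \<or> \<not> S (Suc j) (l div 2))) \<and>
    disjoint_family_on (\<lambda>(j, l). dyad j l) F \<and>
    (\<forall>n j. n \<in> dyad i k \<longrightarrow> j < i' \<longrightarrow> S j (n div 2 ^ j) \<longrightarrow> n \<in> (\<Union>(j, l)\<in>F. dyad j l))"
    for i' i k F
  have "\<exists>F. G i i k F"
  proof (induction i arbitrary: k)
    case 0
    then show ?case by (intro exI[of _ "{}"]) (auto simp: G_def disjoint_family_on_def)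
  next
    case (Suc i)
    have step: "\<exists>F. G (Suc i) i k F" for k
    proof (cases "S i k")
      case True
      then show ?thesis by (intro exI[of _ "{(i, k)}"]) (auto simp: G_def disjoint_family_on_def)
    next
      case False
      obtain F where F: "G i i k F" using Suc.IH[of k] by blast
      have par: "\<not> S (Suc j) (l div 2)" if "(j, l) \<in> F" for j l
      proof (cases "Suc j = i")
        case True
        have "dyad j l \<subseteq> dyad i k" using F that unfolding G_def by blast
        moreover have "l * 2 ^ j \<in> dyad j l" by (simp add: mem_dyad_iff)
        ultimately have "l * 2 ^ j \<in> dyad i k" "l * 2 ^ j \<in> dyad i (l div 2)"
          using dyad_subset_parent[of j l] unfolding True by blast+
        then have "l div 2 = k" unfolding mem_dyad_iff by simp
        then show ?thesis using False True by simp
      next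
        case False
        then show ?thesis using F that unfolding G_def by blast
      qed
      have "j \<noteq> i" if "n \<in> dyad i k" "S j (n div 2 ^ j)" for n j
        using that False by (auto simp: mem_dyad_iff)
      then have "G (Suc i) i k F"
        using F par unfolding G_def less_Suc_eq by blast
      then show ?thesis by blast
    qed
    obtain F1 F2 where F1: "G (Suc i) i (2 * k) F1" and F2: "G (Suc i) i (Suc (2 * k)) F2"
      using step by blast
    have sub: "(j, l) \<in> F1 \<Longrightarrow> dyad j l \<subseteq> dyad i (2 * k)" "(j, l) \<in> F2 \<Longrightarrow> dyad j l \<subseteq> dyad i (Suc (2 * k))" for j l
      using F1 F2 unfolding G_def by blast+
    have dis: "disjoint_family_on (\<lambda>(j, l). dyad j l) F1" "disjoint_family_on (\<lambda>(j, l). dyad j l) F2"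
      using F1 F2 unfolding G_def by blast+
    have cross: "dyad j l \<inter> dyad j' l' = {}" if "(j, l) \<in> F1" "(j', l') \<in> F2" for j l j' l'
      using sub(1)[OF that(1)] sub(2)[OF that(2)] dyad_children_disjoint[of i k] by blast
    have "disjoint_family_on (\<lambda>(j, l). dyad j l) (F1 \<union> F2)"
      unfolding disjoint_family_on_def
    proof (intro ballI impI)
      fix x y assume xy: "x \<in> F1 \<union> F2" "y \<in> F1 \<union> F2" "x \<noteq> y"
      obtain j l j' l' where eq: "x = (j, l)" "y = (j', l')" by fastforce
      consider "x \<in> F1" "y \<in> F1" | "x \<in> F2" "y \<in> F2" | "x \<in> F1" "y \<in> F2" | "x \<in> F2" "y \<in> F1"
        using xy by blast
      then show "(case x of (j, l) \<Rightarrow> dyad j l) \<inter> (case y of (j, l) \<Rightarrow> dyad j l) = {}"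
      proof cases
        case 1 then show ?thesis using disjoint_family_onD[OF dis(1) _ _ xy(3)] by blast
      next
        case 2 then show ?thesis using disjoint_family_onD[OF dis(2) _ _ xy(3)] by blast
      next
        case 3 then show ?thesis unfolding eq using cross by simp
      next
        case 4 then show ?thesis unfolding eq using cross[of j' l' j l] by auto
      qed
    qed
    moreover have "finite (F1 \<union> F2)" using F1 F2 unfolding G_def by blast
    moreover have "j < Suc i \<and> S j l \<and> dyad j l \<subseteq> dyad (Suc i) k \<and> (Suc j = Suc i \<or> \<not> S (Suc j) (l div 2))"
      if "(j, l) \<in> F1 \<union> F2" for j l
      using that sub F1 F2 unfolding G_def dyad_Suc by blast
    moreover have "n \<in> (\<Union>(j, l)\<in>F1 \<union> F2. dyad j l)"
      if n: "n \<in> dyad (Suc i) k" "j < Suc i" "S j (n div 2 ^ j)" for n j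
    proof (cases "n \<in> dyad i (2 * k)")
      case True
      then have "n \<in> (\<Union>(j, l)\<in>F1. dyad j l)" using F1 n unfolding G_def by blast
      then show ?thesis by blast
    next
      case False
      then have "n \<in> (\<Union>(j, l)\<in>F2. dyad j l)" using F2 n unfolding G_def dyad_Suc by blast
      then show ?thesis by blast
    qed
    ultimately have "G (Suc i) (Suc i) k (F1 \<union> F2)" unfolding G_def by blast
    then show ?case by blast
  qed
  then obtain F where "G i i k F" by blast
  then show thesis using that[of F] unfolding G_def by blast
qed

lemma sum_disjoint_dyads:
  assumes "finite F" "disjoint_family_on (\<lambda>(j, l). dyad j l) F"
  shows "(\<Sum>n\<in>(\<Union>(j, l)\<in>F. dyad j l). f n) = (\<Sum>(j, l)\<in>F. \<Sum>n\<in>dyad j l. f n :: real)"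
proof -
  have "(\<Sum>n\<in>(\<Union>x\<in>F. (\<lambda>(j, l). dyad j l) x). f n) = (\<Sum>x\<in>F. \<Sum>n\<in>(\<lambda>(j, l). dyad j l) x. f n)"
    using assms by (intro sum.UNION_disjoint) (auto simp: disjoint_family_on_def)
  then show ?thesis by (simp add: split_beta)
qed

text \<open>Here \<open>c i k\<close> plays the role of a median of \<open>g\<close> on \<open>dyad i k\<close>. The induction stops at the
  maximal dyadic subintervals on which \<open>g\<close> has moved away from \<open>c i k\<close>; they fill at most a quarter of
  the interval, so by \<open>Wsub\<close> the error terms are absorbed by the \<open>w\<close>-measure of the rest.\<close>

lemma dyadic_oscillation_pairing:
  fixes w M h g :: "nat \<Rightarrow> real" and c :: "nat \<Rightarrow> nat \<Rightarrow> real"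
  assumes w: "\<And>k. 0 < w k" and h: "\<And>k. 0 \<le> h k" and M: "\<And>n. n < N \<Longrightarrow> 0 \<le> M n" and A: "0 \<le> A" and Cw: "0 \<le> Cw"
    and Wsub: "\<And>i k E. E \<subseteq> dyad i k \<Longrightarrow> 2 ^ i \<le> 2 * card E \<Longrightarrow> (\<Sum>n\<in>dyad i k. w n) \<le> Cw * (\<Sum>n\<in>E. w n)"
    and osc: "\<And>i k. dyad i k \<subseteq> {..<N} \<Longrightarrow> 
        16 * card {n\<in>dyad i k. A * Min (M ` dyad i k) < \<bar>g n - c i k\<bar>} \<le> 2 ^ i"
    and Q: "dyad i k \<subseteq> {..<N}"
  shows "(\<Sum>n\<in>dyad i k. (\<bar>g n - c i k\<bar> + A * Min (M ` dyad i k)) * (h n * w n))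
      \<le> 2 * A * Cw * (\<Sum>n\<in>dyad i k. M n * maxf N w h n * w n)"
  using Q
proof (induction i arbitrary: k rule: less_induct)
  case (less i)
  define \<mu> where "\<mu> j l = Min (M ` dyad j l)" for j l
  have \<mu>_le: "\<mu> j l \<le> M n" if "n \<in> dyad j l" for j l n
    unfolding \<mu>_def using that by simp
  have \<mu>_nonneg: "0 \<le> \<mu> j l" if "dyad j l \<subseteq> {..<N}" for j l
    unfolding \<mu>_def using that M by (subst Min_ge_iff) auto
  define Q where "Q = dyad i k"
  have Q: "Q \<subseteq> {..<N}" "finite Q" "card Q = 2 ^ i" using less.prems unfolding Q_def by auto
  define B where "B = {n\<in>Q. A * \<mu> i k < \<bar>g n - c i k\<bar>}"
  have B: "B \<subseteq> Q" "finite B" "16 * card B \<le> 2 ^ i"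
    using osc[OF less.prems] Q unfolding B_def \<mu>_def Q_def by auto
  \<comment> \<open>Stopping occurs at density above 1/4. The selected intervals then have total
    length at most 4 card B, a quarter of Q, while the parent being below the threshold leaves
    density at most 1/2 inside each of them.\<close>
  define S where "S j l \<longleftrightarrow> 2 ^ j < 4 * card (dyad j l \<inter> B)" for j l
  obtain F where F: "finite F" 
    "\<And>j l. (j, l) \<in> F \<Longrightarrow> j < i \<and> S j l \<and> dyad j l \<subseteq> dyad i k \<and> (Suc j = i \<or> \<not> S (Suc j) (l div 2))"
    "disjoint_family_on (\<lambda>(j, l). dyad j l) F"
    "\<And>n j. n \<in> dyad i k \<Longrightarrow> j < i \<Longrightarrow> S j (n div 2 ^ j) \<Longrightarrow> n \<in> (\<Union>(j, l)\<in>F. dyad j l)"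
    using dyadic_stopping[where S=S and i=i and k=k] by metis
  define O' where "O' = (\<Union>(j, l)\<in>F. dyad j l)"
  have O_sub: "O' \<subseteq> Q" unfolding O'_def Q_def using F(2) by fastforce
  have finO: "finite O'" using finite_subset[OF O_sub Q(2)] .
  have B_sub: "B \<subseteq> O'"
  proof
    fix n assume n: "n \<in> B"
    have "i \<noteq> 0"
    proof
      assume "i = 0"
      then have "card B = 0" using B(3) by simp
      then show False using n B(2) by auto
    qed
    moreover have "S 0 (n div 2 ^ 0)" using n B(2) by (simp add: S_def)
    ultimately show "n \<in> O'" using F(4)[of n 0] n B(1) unfolding O'_def Q_def by blast
  qed
  have cardO: "real (card O') \<le> 2 ^ i / 4"
  proof -
    have "real (card O') = (\<Sum>n\<in>O'. 1)" by simp
    also have "\<dots> = (\<Sum>(j, l)\<in>F. \<Sum>n\<in>dyad j l. 1)" unfolding O'_def by (rule sum_disjoint_dyads[OF F(1,3)])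
    also have "\<dots> \<le> (\<Sum>(j, l)\<in>F. \<Sum>n\<in>dyad j l. 4 * (if n \<in> B then 1 else 0))"
    proof (rule sum_mono, clarify)
      fix j l assume "(j, l) \<in> F"
      then have "S j l" using F(2) by blast
      then have "real (2 ^ j) < real (4 * card (dyad j l \<inter> B))" unfolding S_def by (subst of_nat_less_iff)
      then show "(\<Sum>n\<in>dyad j l. 1) \<le> (\<Sum>n\<in>dyad j l. 4 * (if n \<in> B then 1 else 0 :: real))"
        by (simp add: sum_distrib_left[symmetric] sum.inter_restrict[symmetric])
    qed
    also have "\<dots> = (\<Sum>n\<in>O'. 4 * (if n \<in> B then 1 else 0))"
      unfolding O'_def by (rule sum_disjoint_dyads[OF F(1,3), symmetric])
    also have "\<dots> = 4 * real (card B)"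
      using finO B_sub by (simp add: sum_distrib_left[symmetric] sum.inter_restrict[symmetric] Int_absorb1)
    also have "\<dots> \<le> 2 ^ i / 4"
    proof -
      have "real (16 * card B) \<le> real (2 ^ i)" using B(3) by (subst of_nat_le_iff)
      then show ?thesis by simp
    qed
    finally show ?thesis .
  qed
  define E where "E = Q - O'"
  have cardE: "2 ^ i \<le> 2 * card E"
  proof -
    have "card E = card Q - card O'" unfolding E_def using O_sub finO by (intro card_Diff_subset)
    moreover have "4 * card O' \<le> 2 ^ i"
    proof -
      have "real (4 * card O') \<le> real (2 ^ i)" using cardO by simp
      then show ?thesis by (subst (asm) of_nat_le_iff)
    qed
    ultimately show ?thesis using Q(3) by simp
  qed
  define X where "X = (\<lambda>j l n. (\<bar>g n - c j l\<bar> + A * \<mu> j l) * (h n * w n))"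
  have hw: "0 \<le> h n * w n" for n using h w by (simp add: less_imp_le)
  have on_E: "X i k n \<le> 2 * A * \<mu> i k * (h n * w n)" if "n \<in> E" for n
    unfolding X_def using that B_sub hw unfolding E_def B_def by (intro mult_right_mono) auto
  have on_P: "X i k n \<le> X j l n + 2 * A * \<mu> i k * (h n * w n)" if P: "(j, l) \<in> F" and n: "n \<in> dyad j l" for j l n
  proof -
    have PN: "dyad j l \<subseteq> {..<N}" using F(2)[OF P] less.prems by blast
    define B' where "B' = {n\<in>dyad j l. A * \<mu> j l < \<bar>g n - c j l\<bar>}"
    have B': "16 * card B' \<le> 2 ^ j" using osc[OF PN] unfolding B'_def \<mu>_def .
    have half: "2 * card (dyad j l \<inter> B) \<le> 2 ^ j"
    proof (cases "Suc j = i")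
      case True
      have "card (dyad j l \<inter> B) \<le> card B" using B(2) by (intro card_mono) auto
      with B(3) True[symmetric] show ?thesis by simp
    next
      case False
      then have "\<not> S (Suc j) (l div 2)" using F(2)[OF P] by blast
      moreover have "card (dyad j l \<inter> B) \<le> card (dyad (Suc j) (l div 2) \<inter> B)"
        using dyad_subset_parent[of j l] by (intro card_mono) auto
      ultimately show ?thesis unfolding S_def by simp
    qed
    \<comment> \<open>A point that is good for both intervals exists because 1/16 + 1/2 < 1;
      comparing g at this point links the two reference values.\<close>
    have "\<exists>m\<in>dyad j l. m \<notin> B' \<and> m \<notin> B"
    proof (rule ccontr)
      assume "\<not> ?thesis"
      then have "dyad j l \<subseteq> B' \<union> (dyad j l \<inter> B)" by blast
      then have "card (dyad j l) \<le> card (B' \<union> (dyad j l \<inter> B))" using B by (intro card_mono) (auto simp: B'_def)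
      also have "\<dots> \<le> card B' + card (dyad j l \<inter> B)" by (rule card_Un_le)
      finally have "2 ^ j \<le> card B' + card (dyad j l \<inter> B)" by simp
      moreover have "0 < (2::nat) ^ j" by simp
      ultimately show False using B' half by linarith
    qed
    then obtain m where m: "m \<in> dyad j l" "m \<notin> B'" "m \<notin> B" by blast
    have "m \<in> Q" using m(1) F(2)[OF P] unfolding Q_def by blast
    then have "\<bar>g m - c i k\<bar> \<le> A * \<mu> i k" "\<bar>g m - c j l\<bar> \<le> A * \<mu> j l"
      using m unfolding B_def B'_def by auto
    then have "\<bar>g n - c i k\<bar> + A * \<mu> i k \<le> (\<bar>g n - c j l\<bar> + A * \<mu> j l) + 2 * A * \<mu> i k" by linarith
    then have "X i k n \<le> ((\<bar>g n - c j l\<bar> + A * \<mu> j l) + 2 * A * \<mu> i k) * (h n * w n)"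
      unfolding X_def using hw by (rule mult_right_mono)
    then show ?thesis unfolding X_def by (simp add: algebra_simps)
  qed
  have split: "(\<Sum>n\<in>Q. f n) = (\<Sum>n\<in>E. f n) + (\<Sum>(j, l)\<in>F. \<Sum>n\<in>dyad j l. f n)" for f :: "nat \<Rightarrow> real"
    unfolding E_def sum_disjoint_dyads[OF F(1,3), symmetric] O'_def[symmetric]
    using O_sub Q(2) by (rule sum.subset_diff)
  define Z where "Z n = M n * maxf N w h n * w n" for n
  \<comment> \<open>t is the w-average of h over Q and lies below the maximal function at every
    point of Q. \<open>Wsub\<close> moves the w-mass of Q onto E, which is disjoint from the
    selected intervals, so in the recursion each point is charged only once.\<close>
  have Ksum: "\<mu> i k * (\<Sum>n\<in>Q. h n * w n) \<le> Cw * (\<Sum>n\<in>E. Z n)"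
  proof -
    define W where "W = (\<Sum>n\<in>Q. w n)"
    define t where "t = (\<Sum>n\<in>Q. h n * w n) / W"
    have W: "0 < W" unfolding W_def Q_def using w by (intro sum_pos) auto
    have t0: "0 \<le> t" unfolding t_def using W hw by (intro divide_nonneg_pos sum_nonneg) auto
    have t: "t \<le> maxf N w h n" if "n \<in> Q" for n
    proof -
      have "Suc k * 2 ^ i - 1 \<in> dyad i k"
      proof -
        define P where "P = (2::nat) ^ i"
        have "0 < P" unfolding P_def by simp
        then show ?thesis unfolding dyad_def P_def[symmetric] by auto
      qed
      then have "Suc k * 2 ^ i - 1 < N" using Q(1) unfolding Q_def by blast
      then have "(\<Sum>n\<in>Q. h n * w n) \<le> maxf N w h n * W"
        unfolding W_def Q_def dyad_Icc using that w h unfolding Q_def dyad_Icc by (intro sum_le_maxf) auto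
      then show ?thesis unfolding t_def using W by (simp add: field_simps)
    qed
    have "\<mu> i k * (\<Sum>n\<in>Q. h n * w n) = \<mu> i k * t * W" unfolding t_def using W by simp
    also have "\<dots> \<le> \<mu> i k * t * (Cw * (\<Sum>n\<in>E. w n))"
      unfolding W_def Q_def using t0 \<mu>_nonneg[OF less.prems] cardE unfolding E_def Q_def
      by (intro mult_left_mono Wsub) auto
    also have "\<dots> = Cw * (\<Sum>n\<in>E. \<mu> i k * t * w n)" by (simp add: sum_distrib_left mult_ac)
    also have "\<dots> \<le> Cw * (\<Sum>n\<in>E. Z n)"
      unfolding Z_def using t0 t \<mu>_le[of _ i k] \<mu>_nonneg[OF less.prems] w Q(1) M unfolding E_def Q_def
      by (intro mult_left_mono[OF _ Cw] sum_mono mult_right_mono mult_mono) (auto simp: less_imp_le)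
    finally show ?thesis .
  qed
  have "(\<Sum>n\<in>Q. X i k n) = (\<Sum>n\<in>E. X i k n) + (\<Sum>(j, l)\<in>F. \<Sum>n\<in>dyad j l. X i k n)" by (rule split)
  also have "\<dots> \<le> (\<Sum>n\<in>E. 2 * A * \<mu> i k * (h n * w n)) + 
      (\<Sum>(j, l)\<in>F. \<Sum>n\<in>dyad j l. X j l n + 2 * A * \<mu> i k * (h n * w n))"
    using on_E on_P by (intro add_mono sum_mono) (auto intro!: sum_mono)
  also have "\<dots> = 2 * A * \<mu> i k * (\<Sum>n\<in>Q. h n * w n) + (\<Sum>(j, l)\<in>F. \<Sum>n\<in>dyad j l. X j l n)"
    unfolding split by (simp add: sum.distrib sum_distrib_left split_beta algebra_simps)
  also have "\<dots> \<le> 2 * A * Cw * (\<Sum>n\<in>E. Z n) + (\<Sum>(j, l)\<in>F. 2 * A * Cw * (\<Sum>n\<in>dyad j l. Z n))"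
  proof (intro add_mono sum_mono, goal_cases)
    case 1
    then show ?case using mult_left_mono[OF Ksum, of "2 * A"] A by (simp add: mult_ac)
  next
    case (2 x)
    then show ?case using less.IH[of "fst x" "snd x"] F(2)[of "fst x" "snd x"] less.prems
      unfolding X_def Z_def \<mu>_def split_beta by (auto simp: split_beta)
  qed
  also have "\<dots> = 2 * A * Cw * (\<Sum>n\<in>Q. Z n)"
    unfolding split by (simp add: sum_distrib_left split_beta algebra_simps)
  finally show ?case unfolding Q_def X_def Z_def \<mu>_def .
qed

text \<open>The hypothesis is tested with h = |g| powr (p - 1), for which h powr q is |g| powr p.
  The w-maximal theorem in the conjugate exponent q then bounds the pairing by half of the left-hand
  side plus the term in M.\<close>

lemma pairing_imp_strong:
  fixes g h :: "nat \<Rightarrow> real"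
  assumes p: "1 < p"
  obtains C where "0 < C"
    "\<And>K N w g M. 0 < K \<Longrightarrow> (\<And>k. 0 < w k) \<Longrightarrow> (\<And>n. n < N \<Longrightarrow> 0 \<le> M n) \<Longrightarrow> 
       (\<And>h. (\<And>k. 0 \<le> h k) \<Longrightarrow> (\<Sum>n<N. \<bar>g n\<bar> * (h n * w n)) \<le> K * (\<Sum>n<N. M n * maxf N w h n * w n)) \<Longrightarrow>
       (\<Sum>n<N. \<bar>g n\<bar> powr p * w n) \<le> C * K powr p * (\<Sum>n<N. M n powr p * w n)"
proof -
  define q where "q = p / (p - 1)"
  have q: "1 < q" "(p - 1) * q = p" "1 / (p - 1) * p = q" using p unfolding q_def by (auto simp: field_simps)
  obtain C1 where C1: "0 < C1" "\<And>N w u. (\<And>k. 0 < w k) \<Longrightarrow> (\<And>k. 0 \<le> u k) \<Longrightarrow>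
    (\<Sum>n<N. maxf N w u n powr q * w n) \<le> C1 * (\<Sum>n<N. u n powr q * w n)"
    using maxf_strong[OF q(1)] by blast
  show thesis
  proof
    show "0 < 2 * (2 * C1) powr (p - 1)" using C1 by simp
    fix K :: real and N and w g M :: "nat \<Rightarrow> real"
    assume K: "0 < K" and w: "\<And>k. 0 < w k" and M: "\<And>n. n < N \<Longrightarrow> 0 \<le> M n"
      and H: "\<And>h. (\<And>k. 0 \<le> h k) \<Longrightarrow> (\<Sum>n<N. \<bar>g n\<bar> * (h n * w n)) \<le> K * (\<Sum>n<N. M n * maxf N w h n * w n)"
    define h where "h k = \<bar>g k\<bar> powr (p - 1)" for k
    have h: "0 \<le> h k" for k unfolding h_def by simp
    \<comment> \<open>Chosen so that K * d * C1 = 1/2, which lets half of \<open>Sg\<close> be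
      absorbed.\<close>
    define d where "d = 1 / (2 * K * C1)"
    have d: "0 < d" unfolding d_def using K C1 by simp
    define Sg where "Sg = (\<Sum>n<N. \<bar>g n\<bar> powr p * w n)"
    define SM where "SM = (\<Sum>n<N. M n powr p * w n)"
    have hg: "\<bar>g n\<bar> * h n = \<bar>g n\<bar> powr p" for n
      unfolding h_def by (cases "g n = 0") (auto simp: powr_diff)
    have hq: "h n powr q = \<bar>g n\<bar> powr p" for n
      unfolding h_def by (simp add: powr_powr q(2))
    have "Sg = (\<Sum>n<N. \<bar>g n\<bar> * (h n * w n))" unfolding Sg_def by (simp flip: hg add: mult_ac)
    also have "\<dots> \<le> K * (\<Sum>n<N. M n * maxf N w h n * w n)" by (rule H[OF h])
    also have "\<dots> \<le> K * (\<Sum>n<N. d * (maxf N w h n powr q * w n) + d powr (1 - p) * (M n powr p * w n))"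
    proof (intro mult_left_mono sum_mono)
      fix n assume n: "n \<in> {..<N}"
      define b where "b = maxf N w h n powr (1 / (p - 1))"
      have mx: "0 \<le> maxf N w h n" using n w h by (intro maxf_nonneg) auto
      have b: "0 \<le> b" "b powr (p - 1) = maxf N w h n" "b powr p = maxf N w h n powr q"
        unfolding b_def using p mx by (auto simp: powr_powr q(3)[symmetric])
      have "M n * maxf N w h n \<le> d * maxf N w h n powr q + d powr (1 - p) * M n powr p"
        using young_powr_mult[OF M[of n] b(1) d p] n unfolding b by (simp add: mult.commute)
      from mult_right_mono[OF this less_imp_le[OF w[of n]]]
      show "M n * maxf N w h n * w n \<le> d * (maxf N w h n powr q * w n) + d powr (1 - p) * (M n powr p * w n)"
        by (simp add: algebra_simps)
    qed (use K in auto)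
    also have "\<dots> = K * (d * (\<Sum>n<N. maxf N w h n powr q * w n) + d powr (1 - p) * SM)"
      unfolding SM_def by (simp only: sum.distrib sum_distrib_left)
    also have "\<dots> \<le> K * (d * (C1 * (\<Sum>n<N. h n powr q * w n)) + d powr (1 - p) * SM)"
      using K d by (intro mult_left_mono add_mono C1(2) w h) auto
    also have "\<dots> = Sg / 2 + K * d powr (1 - p) * SM"
      unfolding hq Sg_def[symmetric] d_def using K C1 by (simp add: field_simps)
    finally have "Sg \<le> 2 * (K * d powr (1 - p)) * SM" by simp
    also have "K * d powr (1 - p) = K powr p * (2 * C1) powr (p - 1)"
      unfolding d_def using K C1 by (simp add: powr_divide powr_mult powr_diff field_simps)
    finally show "Sg \<le> 2 * (2 * C1) powr (p - 1) * K powr p * SM" by (simp add: mult_ac)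
  qed
qed

text \<open>Exponent \<open>1/2\<close> leaves room for interpolating the size bound of the heat kernel with its
  unit differences; by symmetry only the first variable is mentioned.\<close>

definition hoelder_kernel :: "real \<Rightarrow> (nat \<Rightarrow> nat \<Rightarrow> real) \<Rightarrow> bool" where
  "hoelder_kernel C K \<longleftrightarrow> (\<forall>n m. K n m = K m n) \<and>
     (\<forall>n n' m. 2 * \<bar>real n - real n'\<bar> \<le> \<bar>real n - real m\<bar> \<longrightarrow>
       \<bar>K n m - K n' m\<bar> \<le> C * sqrt \<bar>real n - real n'\<bar> / (\<bar>real n - real m\<bar> * sqrt \<bar>real n - real m\<bar>))"

section \<open>Weak and strong type of truncated operators with Hoelder kernels\<close>

definition kop :: "nat \<Rightarrow> (nat \<Rightarrow> nat \<Rightarrow> real) \<Rightarrow> (nat \<Rightarrow> real) \<Rightarrow> nat \<Rightarrow> real" where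
  "kop R K f n = (\<Sum>m<R. K n m * f m)"

lemma dist_lt_Icc: "{n. \<bar>real y - real n\<bar> < real c} \<subseteq> {y - c..y + c}"
  by auto

lemma sum_UN_le:
  fixes w :: "'a \<Rightarrow> real"
  assumes "finite F" "\<And>x. x \<in> F \<Longrightarrow> finite (P x)" "\<And>n. 0 \<le> w n"
  shows "(\<Sum>n\<in>(\<Union>x\<in>F. P x). w n) \<le> (\<Sum>x\<in>F. \<Sum>n\<in>P x. w n)"
  using assms(1,2)
proof (induction rule: finite_induct)
  case (insert x F)
  have "(\<Sum>n\<in>P x \<union> (\<Union>x\<in>F. P x). w n) \<le> (\<Sum>n\<in>P x. w n) + (\<Sum>n\<in>(\<Union>x\<in>F. P x). w n)"
    using insert assms(3) by (subst sum_Un) (auto intro!: sum_nonneg)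
  then show ?case using insert by simp
qed simp

text \<open>Summation over rings of doubling radius. A ring contributes at most 5 A / sqrt l times
  the k-th power of r = 1 / sqrt 2, and r \<le> 3/4 bounds the geometric series by 20; the points at
  distance exactly l add 3.\<close>

lemma tail_sum:
  fixes u :: "nat \<Rightarrow> real"
  assumes X: "finite X" and u: "\<And>m. 0 \<le> u m" and l: "1 \<le> l"
    and A: "\<And>j. l \<le> j \<Longrightarrow> (\<Sum>m\<in>{m\<in>X. \<bar>real m - real y\<bar> \<le> real j}. u m) \<le> A * (2 * real j + 1)"
  shows "(\<Sum>m\<in>{m\<in>X. real l \<le> \<bar>real m - real y\<bar>}. u m / (\<bar>real m - real y\<bar> * sqrt \<bar>real m - real y\<bar>))
      \<le> 23 * A / sqrt (real l)"
proof -
  define r where "r = 1 / sqrt 2"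
  have r: "0 < r" "r \<le> 3 / 4" "r < 1"
  proof -
    have "4 / 3 \<le> sqrt 2" by (rule real_le_rsqrt) (simp add: power2_eq_square)
    then show "r \<le> 3 / 4" "r < 1" "0 < r" unfolding r_def by (auto simp: field_simps)
  qed
  have A0: "0 \<le> A"
  proof -
    have "0 \<le> (\<Sum>m\<in>{m\<in>X. \<bar>real m - real y\<bar> \<le> real l}. u m)" using u by (intro sum_nonneg) auto
    also have "\<dots> \<le> A * (2 * real l + 1)" by (rule A) simp
    finally show ?thesis by (simp add: zero_le_mult_iff)
  qed
  define D where "D m = \<bar>real m - real y\<bar>" for m
  define V where "V m = u m / (D m * sqrt (D m))" for m
  have V: "0 \<le> V m" for m unfolding V_def D_def using u by simp
  have l0: "0 < real l" using l by simp
  have T: "(\<Sum>m\<in>{m\<in>X. real l \<le> D m \<and> D m \<le> 2 ^ k * real l}. V m) \<le> 20 * A / sqrt (real l) * (1 - r ^ k) + 3 * A / sqrt (real l)" for k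
  proof (induction k)
    case 0
    have "(\<Sum>m\<in>{m\<in>X. real l \<le> D m \<and> D m \<le> 2 ^ 0 * real l}. V m)
      = (\<Sum>m\<in>{m\<in>X. real l \<le> D m \<and> D m \<le> real l}. u m / (real l * sqrt (real l)))"
      unfolding V_def by (intro sum.cong) auto
    also have "\<dots> \<le> (\<Sum>m\<in>{m\<in>X. D m \<le> real l}. u m / (real l * sqrt (real l)))"
      using X u by (intro sum_mono2) auto
    also have "\<dots> = (\<Sum>m\<in>{m\<in>X. D m \<le> real l}. u m) / (real l * sqrt (real l))" by (simp add: sum_divide_distrib)
    also have "\<dots> \<le> A * (2 * real l + 1) / (real l * sqrt (real l))"
      unfolding D_def by (intro divide_right_mono A) auto
    also have "\<dots> \<le> A * (3 * real l) / (real l * sqrt (real l))"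
      using l A0 by (intro divide_right_mono mult_left_mono) auto
    also have "\<dots> = 3 * A / sqrt (real l)" using l0 by simp
    finally show ?case by simp
  next
    case (Suc k)
    define j where "j = 2 ^ Suc k * l"
    define c where "c = 2 ^ k * real l"
    have c: "0 < c" unfolding c_def using l0 by simp
    have jc: "real j = 2 * c" unfolding j_def c_def by simp
    have lj: "l \<le> j" unfolding j_def by simp
    have c1: "1 \<le> c" unfolding c_def using l by (simp add: mult_ge1_I)
    have "(\<Sum>m\<in>{m\<in>X. real l \<le> D m \<and> D m \<le> 2 ^ Suc k * real l}. V m)
       \<le> (\<Sum>m\<in>{m\<in>X. real l \<le> D m \<and> D m \<le> c} \<union> {m\<in>X. c \<le> D m \<and> D m \<le> real j}. V m)"
      using X V by (intro sum_mono2) (auto simp: jc c_def)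
    also have "\<dots> \<le> (\<Sum>m\<in>{m\<in>X. real l \<le> D m \<and> D m \<le> c}. V m) + (\<Sum>m\<in>{m\<in>X. c \<le> D m \<and> D m \<le> real j}. V m)"
      using X V by (subst sum_Un) (auto intro!: sum_nonneg)
    also have "(\<Sum>m\<in>{m\<in>X. c \<le> D m \<and> D m \<le> real j}. V m) \<le> (\<Sum>m\<in>{m\<in>X. c \<le> D m \<and> D m \<le> real j}. u m / (c * sqrt c))"
      unfolding V_def using u c by (intro sum_mono divide_left_mono mult_mono) (auto intro!: mult_pos_pos)
    also have "\<dots> \<le> (\<Sum>m\<in>{m\<in>X. D m \<le> real j}. u m / (c * sqrt c))"
      using X u c by (intro sum_mono2) auto
    also have "\<dots> = (\<Sum>m\<in>{m\<in>X. D m \<le> real j}. u m) / (c * sqrt c)" by (simp add: sum_divide_distrib)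
    also have "\<dots> \<le> A * (2 * real j + 1) / (c * sqrt c)"
      unfolding D_def using c by (intro divide_right_mono A lj) auto
    also have "\<dots> \<le> A * (5 * c) / (c * sqrt c)"
      using c c1 A0 by (intro divide_right_mono mult_left_mono) (auto simp: jc)
    also have "\<dots> = 5 * A / sqrt c" using c by simp
    also have "\<dots> = 5 * A / sqrt (real l) * r ^ k"
      unfolding c_def r_def by (simp add: real_sqrt_mult real_sqrt_power power_divide)
    finally have "(\<Sum>m\<in>{m\<in>X. real l \<le> D m \<and> D m \<le> 2 ^ Suc k * real l}. V m)
      \<le> (20 * A / sqrt (real l) * (1 - r ^ k) + 3 * A / sqrt (real l)) + 5 * A / sqrt (real l) * r ^ k"
      using Suc.IH unfolding c_def by linarith
    also have "\<dots> \<le> 20 * A / sqrt (real l) * (1 - r ^ Suc k) + 3 * A / sqrt (real l)"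
    proof -
      have "5 * A / sqrt (real l) * r ^ k * (4 * r) \<le> 5 * A / sqrt (real l) * r ^ k * 3"
        using A0 l0 r by (intro mult_left_mono) auto
      note r4 = this
      define a where "a = A / sqrt (real l)"
      have eq: "20 * A / sqrt (real l) = 20 * a" "5 * A / sqrt (real l) = 5 * a" "3 * A / sqrt (real l) = 3 * a"
        unfolding a_def by simp_all
      show ?thesis using r4 unfolding eq by (simp add: algebra_simps)
    qed
    finally show ?case .
  qed
  obtain k :: nat where k: "\<And>m. m \<in> X \<Longrightarrow> D m \<le> 2 ^ k * real l"
  proof -
    define B where "B = (\<Sum>m\<in>X. D m)"
    obtain k where "B < 2 ^ k" using real_arch_pow[of 2 B] by auto
    have "D m \<le> 2 ^ k * real l" if "m \<in> X" for m
    proof -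
      have "D m \<le> B" unfolding B_def using X that by (intro member_le_sum) (auto simp: D_def)
      also have "\<dots> \<le> 2 ^ k * 1" using \<open>B < 2 ^ k\<close> by simp
      also have "\<dots> \<le> 2 ^ k * real l" using l by (intro mult_left_mono) auto
      finally show ?thesis .
    qed
    then show thesis by (rule that)
  qed
  have "{m\<in>X. real l \<le> D m} = {m\<in>X. real l \<le> D m \<and> D m \<le> 2 ^ k * real l}" using k by auto
  then have "(\<Sum>m\<in>{m\<in>X. real l \<le> D m}. V m) \<le> 20 * A / sqrt (real l) * (1 - r ^ k) + 3 * A / sqrt (real l)"
    using T[of k] by simp
  also have "\<dots> \<le> 20 * A / sqrt (real l) * 1 + 3 * A / sqrt (real l)"
    using A0 r by (intro add_right_mono mult_left_mono) auto
  finally show ?thesis unfolding V_def D_def by simp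
qed

lemma kop_extend:
  assumes "\<And>k. R \<le> k \<Longrightarrow> f k = 0" "R \<le> R'"
  shows "kop R' K f n = kop R K f n"
  unfolding kop_def using assms by (intro sum.mono_neutral_right) auto

lemma sum_lessThan_extend:
  fixes R R' :: nat
  assumes "\<And>k. R \<le> k \<Longrightarrow> F k = (0::real)" "R \<le> R'"
  shows "(\<Sum>k<R'. F k) = (\<Sum>k<R. F k)"
proof (rule sum.mono_neutral_right)
  show "\<forall>i\<in>{..<R'} - {..<R}. F i = 0" using assms(1) by auto
qed (use assms(2) in auto)

lemma hoelder_kernelD:
  assumes "hoelder_kernel C K" "2 * \<bar>real n - real n'\<bar> \<le> \<bar>real n - real m\<bar>"
  shows "\<bar>K n m - K n' m\<bar> \<le> C * sqrt \<bar>real n - real n'\<bar> / (\<bar>real n - real m\<bar> * sqrt \<bar>real n - real m\<bar>)"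
  using assms unfolding hoelder_kernel_def by blast

text \<open>The decomposition stops on unweighted averages of |f|, and A_1 converts such averages
  into sums against w, because the mean of w over an interval is at most A times each of its values.
  The constant collects the dilated intervals (5 A), the good part (8 B A) and the bad part (46 A C0
  (1 + A)).\<close>

theorem kop_weak_type:
  assumes C0: "0 \<le> C0" and B: "0 \<le> B" and w: "\<And>k. 0 < w k"
    and A1: "\<And>a b k. a \<le> k \<Longrightarrow> k \<le> b \<Longrightarrow> (\<Sum>k=a..b. w k) \<le> A * real (b - a + 1) * w k"
    and K: "hoelder_kernel C0 K"
    and L2: "\<And>f R N. (\<Sum>n<N. (kop R K f n)\<^sup>2 * w n) \<le> B * (\<Sum>n<R. (f n)\<^sup>2 * w n)"
    and fR: "\<And>k. R \<le> k \<Longrightarrow> f k = 0" and s: "0 < s"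
  shows "s * (\<Sum>n\<in>{n\<in>{..<N}. s < \<bar>kop R K f n\<bar>}. w n)
      \<le> (5 * A + 8 * B * A + 46 * A * C0 * (1 + A)) * (\<Sum>n<R. \<bar>f n\<bar> * w n)"
proof -
  note wl = less_imp_le[OF w]
  have A: "1 \<le> A" using A1[of 0 0 0] w[of 0] by simp
  \<comment> \<open>A top interval that contains the support of f and over which |f| has average at
    most s. It acts as the non-stopping parent of the largest selected intervals.\<close>
  obtain L where L: "R \<le> 2 ^ L" "(\<Sum>n<R. \<bar>f n\<bar>) \<le> s * 2 ^ L" "0 < L"
  proof -
    obtain i where i: "real R + (\<Sum>n<R. \<bar>f n\<bar>) / s + 1 < 2 ^ i" 
      using real_arch_pow[of 2 "real R + (\<Sum>n<R. \<bar>f n\<bar>) / s + 1"] by auto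
    have pos: "0 \<le> (\<Sum>n<R. \<bar>f n\<bar>) / s" using s by (intro divide_nonneg_pos sum_nonneg) auto
    have "real R \<le> 2 ^ i" using i pos by linarith
    then have "R \<le> 2 ^ i" using of_nat_le_iff[of R "2 ^ i", where 'a=real] by simp
    moreover have "(\<Sum>n<R. \<bar>f n\<bar>) / s \<le> 2 ^ i" using i by linarith
    then have "(\<Sum>n<R. \<bar>f n\<bar>) \<le> s * 2 ^ i" using s by (simp add: field_simps)
    moreover have "0 < i" using i pos by (cases i) auto
    ultimately show thesis by (rule that)
  qed
  define X where "X = {..<(2::nat) ^ L}"
  have X: "finite X" "X = dyad L 0" unfolding X_def by auto
  define \<Phi> where "\<Phi> = (\<Sum>n\<in>X. \<bar>f n\<bar> * w n)"
  have \<Phi>: "(\<Sum>n<R. \<bar>f n\<bar> * w n) = \<Phi>"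
    unfolding \<Phi>_def X_def using fR L(1) by (intro sum_lessThan_extend[symmetric]) auto
  have fX: "(\<Sum>n\<in>X. \<bar>f n\<bar>) = (\<Sum>n<R. \<bar>f n\<bar>)"
    unfolding X_def using fR L(1) by (intro sum_lessThan_extend) auto
  define S where "S j l \<longleftrightarrow> s * 2 ^ j < (\<Sum>n\<in>dyad j l. \<bar>f n\<bar>)" for j l
  obtain F where F: "finite F" 
    "\<And>j l. (j, l) \<in> F \<Longrightarrow> j < L \<and> S j l \<and> dyad j l \<subseteq> dyad L 0 \<and> (Suc j = L \<or> \<not> S (Suc j) (l div 2))"
    "disjoint_family_on (\<lambda>(j, l). dyad j l) F"
    "\<And>n j. n \<in> dyad L 0 \<Longrightarrow> j < L \<Longrightarrow> S j (n div 2 ^ j) \<Longrightarrow> n \<in> (\<Union>(j, l)\<in>F. dyad j l)"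
    using dyadic_stopping[where S=S and i=L and k=0] by metis
  define \<Omega> where "\<Omega> = (\<Union>(j, l)\<in>F. dyad j l)"
  have \<Omega>X: "\<Omega> \<subseteq> X" unfolding \<Omega>_def X using F(2) by fastforce
  have fin\<Omega>: "finite \<Omega>" using finite_subset[OF \<Omega>X X(1)] .
  have sum\<Omega>: "(\<Sum>n\<in>\<Omega>. v n) = (\<Sum>(j, l)\<in>F. \<Sum>n\<in>dyad j l. v n)" for v :: "nat \<Rightarrow> real"
    unfolding \<Omega>_def by (rule sum_disjoint_dyads[OF F(1,3)])
  have sumX: "(\<Sum>n\<in>X. v n) = (\<Sum>n\<in>X - \<Omega>. v n) + (\<Sum>(j, l)\<in>F. \<Sum>n\<in>dyad j l. v n)" for v :: "nat \<Rightarrow> real"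
    using sum.subset_diff[OF \<Omega>X X(1), of v] unfolding sum\<Omega> .
  define av where "av = (\<lambda>(j, l). (\<Sum>n\<in>dyad j l. f n) / 2 ^ j)"
  \<comment> \<open>The intervals of F are disjoint, so the choice has only one candidate, as
    \<open>g_P\<close> confirms.\<close>
  define g where "g n = (if n \<in> \<Omega> then av (SOME P. P \<in> F \<and> n \<in> (case P of (j, l) \<Rightarrow> dyad j l)) else f n)" for n
  have g_P: "g n = av (j, l)" if P: "(j, l) \<in> F" and n: "n \<in> dyad j l" for j l n
  proof -
    let ?P = "SOME P. P \<in> F \<and> n \<in> (case P of (j, l) \<Rightarrow> dyad j l)"
    have H: "?P \<in> F \<and> n \<in> (case ?P of (j, l) \<Rightarrow> dyad j l)"
      by (rule someI[of _ "(j, l)"]) (use P n in auto)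
    have "?P = (j, l)"
    proof (rule ccontr)
      assume "?P \<noteq> (j, l)"
      then have "(case ?P of (j, l) \<Rightarrow> dyad j l) \<inter> (case (j, l) of (j, l) \<Rightarrow> dyad j l) = {}"
        using H P by (intro disjoint_family_onD[OF F(3)]) auto
      with H n show False by auto
    qed
    moreover have "n \<in> \<Omega>" unfolding \<Omega>_def using P n by blast
    ultimately show ?thesis unfolding g_def by simp
  qed
  have g_out: "g n = f n" if "n \<notin> \<Omega>" for n using that unfolding g_def by simp
  have av_le: "\<bar>av (j, l)\<bar> \<le> (\<Sum>n\<in>dyad j l. \<bar>f n\<bar>) / 2 ^ j" for j l
    unfolding av_def by (simp add: divide_right_mono)
  have S_sum: "s * 2 ^ j < (\<Sum>n\<in>dyad j l. \<bar>f n\<bar>)" if "(j, l) \<in> F" for j l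
    using F(2)[OF that] unfolding S_def by blast
  have parent_sum: "(\<Sum>n\<in>dyad j l. \<bar>f n\<bar>) \<le> 2 * s * 2 ^ j" if P: "(j, l) \<in> F" for j l
  proof (cases "Suc j = L")
    case True
    have "(\<Sum>n\<in>dyad j l. \<bar>f n\<bar>) \<le> (\<Sum>n\<in>X. \<bar>f n\<bar>)"
      using F(2)[OF P] X by (intro sum_mono2) auto
    also have "\<dots> \<le> s * 2 ^ L" using fX L(2) by simp
    finally show ?thesis using True[symmetric] by simp
  next
    case False
    then have "\<not> S (Suc j) (l div 2)" using F(2)[OF P] by blast
    moreover have "(\<Sum>n\<in>dyad j l. \<bar>f n\<bar>) \<le> (\<Sum>n\<in>dyad (Suc j) (l div 2). \<bar>f n\<bar>)"
      using dyad_subset_parent[of j l] by (intro sum_mono2) auto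
    ultimately show ?thesis unfolding S_def by simp
  qed
  have g_le: "\<bar>g n\<bar> \<le> 2 * s" for n
  proof (cases "n \<in> \<Omega>")
    case True
    then obtain j l where P: "(j, l) \<in> F" "n \<in> dyad j l" unfolding \<Omega>_def by blast
    have "\<bar>g n\<bar> \<le> (\<Sum>n\<in>dyad j l. \<bar>f n\<bar>) / 2 ^ j" unfolding g_P[OF P] by (rule av_le)
    also have "\<dots> \<le> 2 * s" using parent_sum[OF P(1)] by (simp add: field_simps)
    finally show ?thesis .
  next
    case False
    show ?thesis
    proof (cases "n \<in> X")
      case True
      then have "\<not> S 0 (n div 2 ^ 0)" using F(4)[of n 0] False L(3) unfolding \<Omega>_def X by blast
      then show ?thesis using s by (simp add: S_def g_out[OF False])
    next
      case False': False
      then have "f n = 0" using fR L(1) unfolding X_def by auto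
      then show ?thesis using s by (simp add: g_out[OF False])
    qed
  qed
  have A1_dyad: "(\<Sum>n\<in>dyad j l. w n) \<le> A * 2 ^ j * w m" if "m \<in> dyad j l" for j l m
  proof -
    have "Suc l * 2 ^ j - 1 - l * 2 ^ j + 1 = 2 ^ j" by simp
    then show ?thesis using A1[of "l * 2 ^ j" m "Suc l * 2 ^ j - 1"] that unfolding dyad_Icc by auto
  qed
  have gw_P: "(\<Sum>n\<in>dyad j l. \<bar>g n\<bar> * w n) \<le> A * (\<Sum>n\<in>dyad j l. \<bar>f n\<bar> * w n)" if P: "(j, l) \<in> F" for j l
  proof -
    have "(\<Sum>n\<in>dyad j l. \<bar>g n\<bar> * w n) = \<bar>av (j, l)\<bar> * (\<Sum>n\<in>dyad j l. w n)"
      unfolding sum_distrib_left using g_P[OF P] by (intro sum.cong) auto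
    also have "\<dots> \<le> (\<Sum>n\<in>dyad j l. \<bar>f n\<bar>) / 2 ^ j * (\<Sum>n\<in>dyad j l. w n)"
      using wl by (intro mult_right_mono av_le sum_nonneg) auto
    also have "\<dots> = (\<Sum>m\<in>dyad j l. \<bar>f m\<bar> * ((\<Sum>n\<in>dyad j l. w n) / 2 ^ j))"
      unfolding sum_distrib_right[symmetric] by simp
    also have "\<dots> \<le> (\<Sum>m\<in>dyad j l. \<bar>f m\<bar> * (A * w m))"
      using A1_dyad by (intro sum_mono mult_left_mono) (auto simp: field_simps)
    finally show ?thesis by (simp add: sum_distrib_left mult_ac)
  qed
  have gw: "(\<Sum>n\<in>X. \<bar>g n\<bar> * w n) \<le> A * \<Phi>"
  proof -
    have "(\<Sum>n\<in>X - \<Omega>. \<bar>g n\<bar> * w n) = (\<Sum>n\<in>X - \<Omega>. \<bar>f n\<bar> * w n)" by (intro sum.cong) (auto simp: g_out)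
    also have "\<dots> \<le> A * (\<Sum>n\<in>X - \<Omega>. \<bar>f n\<bar> * w n)"
      using mult_right_mono[OF A, of "\<Sum>n\<in>X - \<Omega>. \<bar>f n\<bar> * w n"] wl by (simp add: sum_nonneg)
    finally have "(\<Sum>n\<in>X. \<bar>g n\<bar> * w n) \<le> A * (\<Sum>n\<in>X - \<Omega>. \<bar>f n\<bar> * w n) + (\<Sum>(j, l)\<in>F. A * (\<Sum>n\<in>dyad j l. \<bar>f n\<bar> * w n))"
      unfolding sumX using gw_P by (intro add_mono sum_mono) auto
    also have "\<dots> = A * \<Phi>" unfolding \<Phi>_def sumX by (simp add: sum_distrib_left split_beta distrib_left)
    finally show ?thesis .
  qed
  define b where "b n = f n - g n" for n
  have bw: "(\<Sum>n\<in>X. \<bar>b n\<bar> * w n) \<le> (1 + A) * \<Phi>"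
  proof -
    have "(\<Sum>n\<in>X. \<bar>b n\<bar> * w n) \<le> (\<Sum>n\<in>X. \<bar>f n\<bar> * w n + \<bar>g n\<bar> * w n)"
      unfolding b_def distrib_right[symmetric] using wl by (intro sum_mono mult_right_mono) auto
    also have "\<dots> \<le> \<Phi> + A * \<Phi>" unfolding sum.distrib \<Phi>_def[symmetric] using gw by simp
    finally show ?thesis by (simp add: algebra_simps)
  qed
  have b_mean: "(\<Sum>n\<in>dyad j l. b n) = 0" if P: "(j, l) \<in> F" for j l
  proof -
    have "(\<Sum>n\<in>dyad j l. g n) = (\<Sum>n\<in>dyad j l. av (j, l))" using g_P[OF P] by (intro sum.cong) auto
    then show ?thesis unfolding b_def sum_subtractf by (simp add: av_def)
  qed
  \<comment> \<open>Dilation about the left endpoint y instead of the centre: outside, |n - y| is at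
    least twice the length of the interval, which is the separation demanded by
    \<open>hoelder_kernel\<close>.\<close>
  define Ps where "Ps j l = {n. \<bar>real (l * 2 ^ j) - real n\<bar> < real (2 * 2 ^ j)}" for j l
  define \<Omega>s where "\<Omega>s = {n\<in>{..<N}. \<exists>(j, l)\<in>F. n \<in> Ps j l}"
  have finPs: "finite (Ps j l)" for j l
    unfolding Ps_def by (rule finite_subset[OF dist_lt_Icc]) simp
  have wPs: "s * (\<Sum>n\<in>Ps j l. w n) \<le> 5 * A * (\<Sum>n\<in>dyad j l. \<bar>f n\<bar> * w n)" if P: "(j, l) \<in> F" for j l
  proof -
    define y where "y = l * 2 ^ j"
    define h where "h = (2::nat) ^ j"
    have h: "1 \<le> h" unfolding h_def by simp
    have one: "(\<Sum>n\<in>Ps j l. w n) \<le> 5 * A * real h * w m" if m: "m \<in> dyad j l" for m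
    proof -
      have my: "y \<le> m" "m < y + h" using m unfolding dyad_def y_def h_def by auto
      have "(\<Sum>n\<in>Ps j l. w n) \<le> (\<Sum>n=y - 2 * h..y + 2 * h. w n)"
        unfolding Ps_def y_def h_def using wl by (intro sum_mono2 dist_lt_Icc) auto
      also have "\<dots> \<le> A * real (y + 2 * h - (y - 2 * h) + 1) * w m" using my by (intro A1) auto
      also have "\<dots> \<le> A * (5 * real h) * w m"
        using A wl h by (intro mult_right_mono mult_left_mono) auto
      finally show ?thesis by (simp add: mult_ac)
    qed
    have "(\<Sum>n\<in>Ps j l. w n) * (s * real h) \<le> (\<Sum>n\<in>Ps j l. w n) * (\<Sum>m\<in>dyad j l. \<bar>f m\<bar>)"
      using S_sum[OF P] wl unfolding h_def by (intro mult_left_mono sum_nonneg) auto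
    also have "\<dots> = (\<Sum>m\<in>dyad j l. \<bar>f m\<bar> * (\<Sum>n\<in>Ps j l. w n))" by (simp add: sum_distrib_left mult_ac)
    also have "\<dots> \<le> (\<Sum>m\<in>dyad j l. \<bar>f m\<bar> * (5 * A * real h * w m))"
      using one by (intro sum_mono mult_left_mono) auto
    also have "\<dots> = 5 * A * (\<Sum>m\<in>dyad j l. \<bar>f m\<bar> * w m) * real h" by (simp add: sum_distrib_left mult_ac)
    finally have "s * (\<Sum>n\<in>Ps j l. w n) * real h \<le> 5 * A * (\<Sum>m\<in>dyad j l. \<bar>f m\<bar> * w m) * real h"
      by (simp only: mult_ac)
    then show ?thesis using h by simp
  qed
  have w\<Omega>s: "s * (\<Sum>n\<in>\<Omega>s. w n) \<le> 5 * A * \<Phi>"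
  proof -
    have "(\<Sum>n\<in>\<Omega>s. w n) \<le> (\<Sum>n\<in>(\<Union>x\<in>F. case x of (j, l) \<Rightarrow> Ps j l). w n)"
      unfolding \<Omega>s_def using F(1) finPs wl by (intro sum_mono2) auto
    also have "\<dots> \<le> (\<Sum>x\<in>F. \<Sum>n\<in>(case x of (j, l) \<Rightarrow> Ps j l). w n)"
      using F(1) wl finPs by (intro sum_UN_le) auto
    finally have "s * (\<Sum>n\<in>\<Omega>s. w n) \<le> s * (\<Sum>x\<in>F. \<Sum>n\<in>(case x of (j, l) \<Rightarrow> Ps j l). w n)"
      using s by simp
    also have "\<dots> = (\<Sum>(j, l)\<in>F. s * (\<Sum>n\<in>Ps j l. w n))" by (simp add: sum_distrib_left split_beta)
    also have "\<dots> \<le> (\<Sum>(j, l)\<in>F. 5 * A * (\<Sum>n\<in>dyad j l. \<bar>f n\<bar> * w n))"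
      using wPs by (intro sum_mono) auto
    also have "\<dots> = 5 * A * (\<Sum>n\<in>\<Omega>. \<bar>f n\<bar> * w n)" unfolding sum\<Omega> by (simp add: sum_distrib_left split_beta)
    also have "\<dots> \<le> 5 * A * \<Phi>" unfolding \<Phi>_def using A \<Omega>X X(1) wl by (intro mult_left_mono sum_mono2) auto
    finally show ?thesis .
  qed
  \<comment> \<open>Since b has mean zero on each selected interval, the kernel value at the left
    endpoint may be subtracted.\<close>
  define Kb where "Kb j l n = (\<Sum>m\<in>dyad j l. \<bar>b m\<bar> * \<bar>K n m - K n (l * 2 ^ j)\<bar>)" for j l n
  have Tb: "\<bar>kop (2 ^ L) K b n\<bar> \<le> (\<Sum>(j, l)\<in>F. Kb j l n)" for n
  proof -
    have "kop (2 ^ L) K b n = (\<Sum>m\<in>X. K n m * b m)" unfolding kop_def X_def ..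
    also have "\<dots> = (\<Sum>(j, l)\<in>F. \<Sum>m\<in>dyad j l. K n m * b m)"
      unfolding sumX by (simp add: b_def g_out)
    also have "\<dots> = (\<Sum>(j, l)\<in>F. \<Sum>m\<in>dyad j l. (K n m - K n (l * 2 ^ j)) * b m)"
      using b_mean by (intro sum.cong) (auto simp: left_diff_distrib sum_subtractf simp flip: sum_distrib_left)
    also have "\<bar>\<dots>\<bar> \<le> (\<Sum>(j, l)\<in>F. Kb j l n)"
      unfolding Kb_def split_beta by (intro order_trans[OF sum_abs] sum_mono order_trans[OF sum_abs]) (auto simp: abs_mult mult.commute)
    finally show ?thesis .
  qed
  have KbP: "(\<Sum>n\<in>{..<N} - Ps j l. Kb j l n * w n) \<le> 23 * A * C0 * (\<Sum>m\<in>dyad j l. \<bar>b m\<bar> * w m)"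
    if P: "(j, l) \<in> F" for j l
  proof -
    define y where "y = l * 2 ^ j"
    define h where "h = (2::nat) ^ j"
    have h: "1 \<le> h" unfolding h_def by simp
    have one: "(\<Sum>n\<in>{..<N} - Ps j l. \<bar>K n m - K n y\<bar> * w n) \<le> 23 * A * C0 * w m" if m: "m \<in> dyad j l" for m
    proof -
      have my: "y \<le> m" "m < y + h" using m unfolding dyad_def y_def h_def by auto
      have set: "{..<N} - Ps j l = {n\<in>{..<N}. real (2 * h) \<le> \<bar>real n - real y\<bar>}"
        unfolding Ps_def h_def y_def by auto
      have "\<bar>K n m - K n y\<bar> \<le> C0 * sqrt (real h) * (1 / (\<bar>real n - real y\<bar> * sqrt \<bar>real n - real y\<bar>))"
        if n: "real (2 * h) \<le> \<bar>real n - real y\<bar>" for n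
      proof -
        have sy: "K n m = K m n" "K n y = K y n" using K unfolding hoelder_kernel_def by blast+
        have "\<bar>K y n - K m n\<bar> \<le> C0 * sqrt \<bar>real y - real m\<bar> / (\<bar>real y - real n\<bar> * sqrt \<bar>real y - real n\<bar>)"
          using my n by (intro hoelder_kernelD[OF K]) auto
        also have "\<dots> \<le> C0 * sqrt (real h) / (\<bar>real y - real n\<bar> * sqrt \<bar>real y - real n\<bar>)"
          using my C0 by (intro divide_right_mono mult_left_mono) auto
        finally show ?thesis unfolding sy by (simp add: abs_minus_commute)
      qed
      then have "(\<Sum>n\<in>{..<N} - Ps j l. \<bar>K n m - K n y\<bar> * w n) \<le>
        (\<Sum>n\<in>{n\<in>{..<N}. real (2 * h) \<le> \<bar>real n - real y\<bar>}. C0 * sqrt (real h) * (1 / (\<bar>real n - real y\<bar> * sqrt \<bar>real n - real y\<bar>)) * w n)"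
        unfolding set using wl by (intro sum_mono mult_right_mono) auto
      also have "\<dots> = C0 * sqrt (real h) * 
        (\<Sum>n\<in>{n\<in>{..<N}. real (2 * h) \<le> \<bar>real n - real y\<bar>}. w n / (\<bar>real n - real y\<bar> * sqrt \<bar>real n - real y\<bar>))"
        by (simp add: sum_distrib_left mult_ac)
      also have "\<dots> \<le> C0 * sqrt (real h) * (23 * (A * w m) / sqrt (real (2 * h)))"
      proof (intro mult_left_mono tail_sum)
        fix i assume i: "2 * h \<le> i"
        have "(\<Sum>n\<in>{n\<in>{..<N}. \<bar>real n - real y\<bar> \<le> real i}. w n) \<le> (\<Sum>n=y - i..y + i. w n)"
          using wl by (intro sum_mono2) auto
        also have "\<dots> \<le> A * real (y + i - (y - i) + 1) * w m" using my i by (intro A1) auto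
        also have "\<dots> \<le> A * (2 * real i + 1) * w m" using A wl by (intro mult_right_mono mult_left_mono) auto
        finally show "(\<Sum>n\<in>{n\<in>{..<N}. \<bar>real n - real y\<bar> \<le> real i}. w n) \<le> A * w m * (2 * real i + 1)"
          by (simp add: mult_ac)
      qed (use C0 wl h in auto)
      also have "\<dots> = 23 * A * C0 * w m * (sqrt (real h) / sqrt (real (2 * h)))" by simp
      also have "\<dots> \<le> 23 * A * C0 * w m * 1"
        using A C0 wl[of m] h by (intro mult_left_mono) (auto simp: divide_le_eq)
      finally show ?thesis by simp
    qed
    have "(\<Sum>n\<in>{..<N} - Ps j l. Kb j l n * w n) = (\<Sum>n\<in>{..<N} - Ps j l. \<Sum>m\<in>dyad j l. \<bar>b m\<bar> * (\<bar>K n m - K n y\<bar> * w n))"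
      unfolding Kb_def y_def by (simp only: sum_distrib_right mult.assoc)
    also have "\<dots> = (\<Sum>m\<in>dyad j l. \<bar>b m\<bar> * (\<Sum>n\<in>{..<N} - Ps j l. \<bar>K n m - K n y\<bar> * w n))"
      by (subst sum.swap) (simp add: sum_distrib_left)
    also have "\<dots> \<le> (\<Sum>m\<in>dyad j l. \<bar>b m\<bar> * (23 * A * C0 * w m))"
      using one by (intro sum_mono mult_left_mono) auto
    finally show ?thesis by (simp add: sum_distrib_left mult_ac)
  qed
  have Kb0: "0 \<le> Kb j l n" for j l n unfolding Kb_def by (intro sum_nonneg) auto
  have bad: "(\<Sum>n\<in>{..<N} - \<Omega>s. \<bar>kop (2 ^ L) K b n\<bar> * w n) \<le> 23 * A * C0 * ((1 + A) * \<Phi>)"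
  proof -
    have "(\<Sum>n\<in>{..<N} - \<Omega>s. \<bar>kop (2 ^ L) K b n\<bar> * w n) \<le> (\<Sum>n\<in>{..<N} - \<Omega>s. (\<Sum>(j, l)\<in>F. Kb j l n) * w n)"
      using Tb wl by (intro sum_mono mult_right_mono) auto
    also have "\<dots> = (\<Sum>(j, l)\<in>F. \<Sum>n\<in>{..<N} - \<Omega>s. Kb j l n * w n)"
      unfolding sum_distrib_right split_beta by (rule sum.swap)
    also have "\<dots> \<le> (\<Sum>(j, l)\<in>F. \<Sum>n\<in>{..<N} - Ps j l. Kb j l n * w n)"
    proof (rule sum_mono, clarify)
      fix j l assume "(j, l) \<in> F"
      then have "{..<N} - \<Omega>s \<subseteq> {..<N} - Ps j l" unfolding \<Omega>s_def by blast
      then show "(\<Sum>n\<in>{..<N} - \<Omega>s. Kb j l n * w n) \<le> (\<Sum>n\<in>{..<N} - Ps j l. Kb j l n * w n)"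
        using Kb0 wl by (intro sum_mono2) auto
    qed
    also have "\<dots> \<le> (\<Sum>(j, l)\<in>F. 23 * A * C0 * (\<Sum>m\<in>dyad j l. \<bar>b m\<bar> * w m))"
      using KbP by (intro sum_mono) auto
    also have "\<dots> = 23 * A * C0 * (\<Sum>n\<in>\<Omega>. \<bar>b n\<bar> * w n)" unfolding sum\<Omega> by (simp add: sum_distrib_left split_beta)
    also have "\<dots> \<le> 23 * A * C0 * (\<Sum>n\<in>X. \<bar>b n\<bar> * w n)"
      using A C0 \<Omega>X X(1) wl by (intro mult_left_mono sum_mono2) auto
    also have "\<dots> \<le> 23 * A * C0 * ((1 + A) * \<Phi>)" using bw A C0 by (intro mult_left_mono) auto
    finally show ?thesis .
  qed
  have good: "(\<Sum>n<N. (kop (2 ^ L) K g n)\<^sup>2 * w n) \<le> B * (2 * s * (A * \<Phi>))"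
  proof -
    have "(\<Sum>n<N. (kop (2 ^ L) K g n)\<^sup>2 * w n) \<le> B * (\<Sum>n\<in>X. (g n)\<^sup>2 * w n)" unfolding X_def by (rule L2)
    also have "\<dots> \<le> B * (\<Sum>n\<in>X. 2 * s * (\<bar>g n\<bar> * w n))"
    proof (intro mult_left_mono[OF _ B] sum_mono)
      fix n
      have "\<bar>g n\<bar> * \<bar>g n\<bar> * w n \<le> 2 * s * \<bar>g n\<bar> * w n" using g_le wl by (intro mult_right_mono) auto
      then show "(g n)\<^sup>2 * w n \<le> 2 * s * (\<bar>g n\<bar> * w n)" by (simp add: power2_eq_square mult_ac)
    qed
    also have "\<dots> = B * (2 * s * (\<Sum>n\<in>X. \<bar>g n\<bar> * w n))" by (simp add: sum_distrib_left)
    also have "\<dots> \<le> B * (2 * s * (A * \<Phi>))" using gw s B by (intro mult_left_mono) auto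
    finally show ?thesis .
  qed
  define G where "G = {n\<in>{..<N}. s / 2 < \<bar>kop (2 ^ L) K g n\<bar>}"
  define H where "H = {n\<in>{..<N} - \<Omega>s. s / 2 < \<bar>kop (2 ^ L) K b n\<bar>}"
  have wG: "s * (\<Sum>n\<in>G. w n) \<le> 8 * B * A * \<Phi>"
  proof -
    have "(s / 2)\<^sup>2 * (\<Sum>n\<in>G. w n) \<le> (\<Sum>n\<in>G. (kop (2 ^ L) K g n)\<^sup>2 * w n)"
      unfolding sum_distrib_left
    proof (intro sum_mono mult_right_mono wl)
      fix n assume "n \<in> G"
      then have "(s / 2)\<^sup>2 \<le> \<bar>kop (2 ^ L) K g n\<bar>\<^sup>2" using s unfolding G_def by (intro power_mono) auto
      then show "(s / 2)\<^sup>2 \<le> (kop (2 ^ L) K g n)\<^sup>2" by simp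
    qed
    also have "\<dots> \<le> (\<Sum>n<N. (kop (2 ^ L) K g n)\<^sup>2 * w n)" unfolding G_def using wl by (intro sum_mono2) auto
    also have "\<dots> \<le> B * (2 * s * (A * \<Phi>))" by (rule good)
    finally have "(s * (\<Sum>n\<in>G. w n)) * (s / 4) \<le> (8 * B * A * \<Phi>) * (s / 4)" by (simp add: power2_eq_square mult_ac)
    then show ?thesis using s by (metis mult_right_le_imp_le divide_pos_pos zero_less_numeral)
  qed
  have wH: "s * (\<Sum>n\<in>H. w n) \<le> 46 * A * C0 * (1 + A) * \<Phi>"
  proof -
    have "s / 2 * (\<Sum>n\<in>H. w n) \<le> (\<Sum>n\<in>H. \<bar>kop (2 ^ L) K b n\<bar> * w n)"
      unfolding sum_distrib_left by (intro sum_mono mult_right_mono wl) (auto simp: H_def)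
    also have "\<dots> \<le> (\<Sum>n\<in>{..<N} - \<Omega>s. \<bar>kop (2 ^ L) K b n\<bar> * w n)" unfolding H_def using wl by (intro sum_mono2) auto
    finally have "s * (\<Sum>n\<in>H. w n) \<le> 2 * (23 * A * C0 * ((1 + A) * \<Phi>))" using bad by linarith
    then show ?thesis by (simp add: mult_ac)
  qed
  have "{n\<in>{..<N}. s < \<bar>kop R K f n\<bar>} \<subseteq> \<Omega>s \<union> G \<union> H"
  proof
    fix n assume n: "n \<in> {n\<in>{..<N}. s < \<bar>kop R K f n\<bar>}"
    have "kop R K f n = kop (2 ^ L) K f n" using fR L(1) by (intro kop_extend[symmetric]) auto
    also have "\<dots> = kop (2 ^ L) K g n + kop (2 ^ L) K b n"
      unfolding kop_def b_def by (simp add: sum.distrib[symmetric] algebra_simps)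
    finally have "s / 2 < \<bar>kop (2 ^ L) K g n\<bar> \<or> s / 2 < \<bar>kop (2 ^ L) K b n\<bar>" using n by auto
    then show "n \<in> \<Omega>s \<union> G \<union> H" using n unfolding G_def H_def by auto
  qed
  then have "(\<Sum>n\<in>{n\<in>{..<N}. s < \<bar>kop R K f n\<bar>}. w n) \<le> (\<Sum>n\<in>\<Omega>s \<union> G \<union> H. w n)"
    using wl by (intro sum_mono2) (auto simp: \<Omega>s_def G_def H_def)
  also have "\<dots> \<le> (\<Sum>n\<in>\<Omega>s. w n) + (\<Sum>n\<in>G. w n) + (\<Sum>n\<in>H. w n)"
  proof -
    have un: "(\<Sum>n\<in>U \<union> V. w n) \<le> (\<Sum>n\<in>U. w n) + (\<Sum>n\<in>V. w n)" if "finite U" "finite V" for U V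
      using that wl by (subst sum_Un) (auto intro!: sum_nonneg)
    have fin: "finite \<Omega>s" "finite G" "finite H" unfolding \<Omega>s_def G_def H_def by auto
    show ?thesis using un[of "\<Omega>s \<union> G" H] un[of \<Omega>s G] fin by auto
  qed
  finally have "s * (\<Sum>n\<in>{n\<in>{..<N}. s < \<bar>kop R K f n\<bar>}. w n)
      \<le> s * ((\<Sum>n\<in>\<Omega>s. w n) + (\<Sum>n\<in>G. w n) + (\<Sum>n\<in>H. w n))" using s by (intro mult_left_mono) auto
  also have "\<dots> \<le> (5 * A + 8 * B * A + 46 * A * C0 * (1 + A)) * \<Phi>"
    using w\<Omega>s wG wH by (simp add: distrib_left distrib_right)
  finally show ?thesis unfolding \<Phi> .
qed

lemma hl_nonneg: "(\<And>k. 0 \<le> f k) \<Longrightarrow> n < N \<Longrightarrow> 0 \<le> hl N f n"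
  by (intro maxf_nonneg) auto

text \<open>On a dyadic interval, outside one sixteenth of its points, the image of f differs from a
  reference value by at most A times the minimum of the maximal function. This rests on the
  unweighted weak type; the weight enters through \<open>Ap_subset\<close>, the w-maximal function
  in the pairing, and \<open>muckenhoupt\<close>.\<close>

theorem kop_strong_type:
  assumes p: "1 < p" and Ap: "Ap_weight p w" and C0: "0 \<le> C0" and B: "0 \<le> B"
  obtains C where "0 < C" "\<And>K f R (N::nat). hoelder_kernel C0 K \<Longrightarrow> 
      (\<And>f R N. (\<Sum>n<N. (kop R K f n)\<^sup>2) \<le> B * (\<Sum>n<R. (f n)\<^sup>2)) \<Longrightarrow> (\<And>k. R \<le> k \<Longrightarrow> f k = 0) \<Longrightarrow>
      (\<Sum>n<N. \<bar>kop R K f n\<bar> powr p * w n) \<le> C * (\<Sum>n<R. \<bar>f n\<bar> powr p * w n)"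
proof -
  note w = Ap_weight_pos[OF Ap]
  define Cw where "Cw = 5 + 8 * B + 92 * C0"
  have Cw: "5 \<le> Cw" unfolding Cw_def using B C0 by simp
  \<comment> \<open>80 is 16 * 5: the near part of f has l^1 norm at most 5 times
    \<open>\<mu> * h\<close>, so by weak type with constant \<open>Cw\<close> the level
    \<open>80 * Cw * \<mu>\<close> is exceeded at no more than h / 16 points. The 23 C0 bounds the
    variation of the far part by \<open>tail_sum\<close>.\<close>
  define A where "A = 80 * Cw + 23 * C0"
  have A: "0 < A" unfolding A_def using Cw C0 by linarith
  obtain C1 where C1: "0 < C1" "\<And>E a b. a \<le> b \<Longrightarrow> E \<subseteq> {a..b} \<Longrightarrow> b - a + 1 \<le> 2 * card E \<Longrightarrow>
     (\<Sum>k=a..b. w k) \<le> C1 * (\<Sum>k\<in>E. w k)"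
    using Ap_subset[OF p Ap] by blast
  obtain C2 where C2: "0 < C2" "\<And>N f. (\<And>k. 0 \<le> f k) \<Longrightarrow>
     (\<Sum>n<N. hl N f n powr p * w n) \<le> C2 * (\<Sum>n<N. f n powr p * w n)"
    using muckenhoupt[OF p Ap] by blast
  obtain C3 where C3: "0 < C3" 
    "\<And>K N w g M. 0 < K \<Longrightarrow> (\<And>k. 0 < w k) \<Longrightarrow> (\<And>n. n < N \<Longrightarrow> 0 \<le> M n) \<Longrightarrow> 
       (\<And>h. (\<And>k. 0 \<le> h k) \<Longrightarrow> (\<Sum>n<N. \<bar>g n\<bar> * (h n * w n)) \<le> K * (\<Sum>n<N. M n * maxf N w h n * w n)) \<Longrightarrow>
       (\<Sum>n<N. \<bar>g n\<bar> powr p * w n) \<le> C3 * K powr p * (\<Sum>n<N. M n powr p * w n)"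
    using pairing_imp_strong[OF p] by blast
  show thesis
  proof
    let ?C = "C3 * (2 * A * C1) powr p * C2"
    show "0 < ?C" using A C1 C2 C3 by simp
    fix K and f :: "nat \<Rightarrow> real" and R N :: nat
    assume K: "hoelder_kernel C0 K"
      and L2: "\<And>f R N. (\<Sum>n<N. (kop R K f n)\<^sup>2) \<le> B * (\<Sum>n<R. (f n)\<^sup>2)" and fR: "\<And>k. R \<le> k \<Longrightarrow> f k = 0"
    obtain L where L: "R \<le> 2 ^ L" "N \<le> 2 ^ L"
    proof -
      have "R + N \<le> 2 ^ (R + N)" by (rule less_imp_le[OF less_exp])
      then show thesis using that[of "R + N"] by linarith
    qed
    define NN where "NN = (2::nat) ^ L"
    define M where "M = hl NN (\<lambda>k. \<bar>f k\<bar>)"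
    have M: "0 \<le> M n" if "n < NN" for n unfolding M_def using that by (intro hl_nonneg) auto
    define g where "g = kop NN K f"
    have eqg: "kop R K f n = g n" for n unfolding g_def NN_def using fR L(1) by (intro kop_extend[symmetric]) auto
    \<comment> \<open>In place of a median, the reference value is the far part of the operator
      evaluated at the left endpoint.\<close>
    define c where "c i k = (\<Sum>m\<in>{m\<in>{..<NN}. real (2 * 2 ^ i) \<le> \<bar>real m - real (k * 2 ^ i)\<bar>}. K (k * 2 ^ i) m * f m)" for i k
    have ball: "(\<Sum>m\<in>{m\<in>{..<NN}. \<bar>real m - real y\<bar> \<le> real j}. \<bar>f m\<bar>) \<le> M x * (2 * real j + 1)"
      if x: "x < NN" "\<bar>real x - real y\<bar> \<le> real j" for x y j
    proof -
      have "(\<Sum>m\<in>{m\<in>{..<NN}. \<bar>real m - real y\<bar> \<le> real j}. \<bar>f m\<bar>) \<le> (\<Sum>m=y - j..min (y + j) (NN - 1). \<bar>f m\<bar>)"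
        using x by (intro sum_mono2) auto
      also have "\<dots> \<le> M x * real (min (y + j) (NN - 1) - (y - j) + 1)"
        unfolding M_def using x by (intro sum_le_hl) (auto simp: abs_le_iff)
      also have "\<dots> \<le> M x * (2 * real j + 1)"
        using M[OF x(1)] by (intro mult_left_mono) auto
      finally show ?thesis .
    qed
    have osc: "16 * card {n\<in>dyad i k. A * Min (M ` dyad i k) < \<bar>g n - c i k\<bar>} \<le> 2 ^ i"
      if Q: "dyad i k \<subseteq> {..<NN}" for i k
    proof -
      define y where "y = k * 2 ^ i"
      define h where "h = (2::nat) ^ i"
      have h: "1 \<le> h" unfolding h_def by simp
      define \<mu> where "\<mu> = Min (M ` dyad i k)"
      have "\<mu> \<in> M ` dyad i k" unfolding \<mu>_def by (intro Min_in) auto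
      then obtain x where x: "x \<in> dyad i k" "\<mu> = M x" by blast
      have mem: "y \<le> n" "n < y + h" if "n \<in> dyad i k" for n
        using that unfolding dyad_def y_def h_def by auto
      have xN: "x < NN" using x Q by blast
      have \<mu>0: "0 \<le> \<mu>" unfolding x by (rule M[OF xN])
      have ball': "(\<Sum>m\<in>{m\<in>{..<NN}. \<bar>real m - real y\<bar> \<le> real j}. \<bar>f m\<bar>) \<le> \<mu> * (2 * real j + 1)" if "2 * h \<le> j" for j
        unfolding x using mem[OF x(1)] that xN by (intro ball) auto
      define f1 where "f1 m = (if m < NN \<and> \<bar>real m - real y\<bar> < real (2 * h) then f m else 0)" for m
      have f1: "(\<Sum>m<NN. \<bar>f1 m\<bar>) \<le> 5 * \<mu> * real h"
      proof -
        have "(\<Sum>m<NN. \<bar>f1 m\<bar>) = (\<Sum>m\<in>{m\<in>{..<NN}. \<bar>real m - real y\<bar> < real (2 * h)}. \<bar>f m\<bar>)"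
          unfolding f1_def by (intro sum.mono_neutral_cong_right) auto
        also have "\<dots> \<le> (\<Sum>m\<in>{m\<in>{..<NN}. \<bar>real m - real y\<bar> \<le> real (2 * h)}. \<bar>f m\<bar>)" by (intro sum_mono2) auto
        also have "\<dots> \<le> \<mu> * (2 * real (2 * h) + 1)" by (rule ball') simp
        also have "\<dots> \<le> \<mu> * (5 * real h)" using \<mu>0 h by (intro mult_left_mono) auto
        finally show ?thesis by simp
      qed
      have far: "\<bar>g n - c i k - kop NN K f1 n\<bar> \<le> 23 * C0 * \<mu>" if n: "n \<in> dyad i k" for n
      proof -
        define Y where "Y = {m\<in>{..<NN}. real (2 * h) \<le> \<bar>real m - real y\<bar>}"
        have "kop NN K f1 n + (\<Sum>m\<in>Y. K n m * f m) = g n"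
        proof -
          have "g n = (\<Sum>m\<in>Y. K n m * f m) + (\<Sum>m\<in>{..<NN} - Y. K n m * f m)"
            unfolding g_def kop_def Y_def by (rule sum.subset_diff[THEN trans]) (auto simp: add.commute)
          also have "(\<Sum>m\<in>{..<NN} - Y. K n m * f m) = kop NN K f1 n"
            unfolding kop_def f1_def Y_def by (intro sum.mono_neutral_cong_left) auto
          finally show ?thesis by simp
        qed
        moreover have "c i k = (\<Sum>m\<in>Y. K y m * f m)" unfolding c_def Y_def y_def h_def ..
        ultimately have "g n - c i k - kop NN K f1 n = (\<Sum>m\<in>Y. (K n m - K y m) * f m)"
          by (simp add: left_diff_distrib sum_subtractf)
        also have "\<bar>\<dots>\<bar> \<le> (\<Sum>m\<in>Y. \<bar>K n m - K y m\<bar> * \<bar>f m\<bar>)"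
          by (rule order_trans[OF sum_abs]) (simp add: abs_mult)
        also have "\<dots> \<le> (\<Sum>m\<in>Y. C0 * sqrt (real h) * (1 / (\<bar>real m - real y\<bar> * sqrt \<bar>real m - real y\<bar>)) * \<bar>f m\<bar>)"
        proof (intro sum_mono mult_right_mono)
          fix m assume m: "m \<in> Y"
          have "\<bar>K y m - K n m\<bar> \<le> C0 * sqrt \<bar>real y - real n\<bar> / (\<bar>real y - real m\<bar> * sqrt \<bar>real y - real m\<bar>)"
            using mem[OF n] m unfolding Y_def by (intro hoelder_kernelD[OF K]) auto
          also have "\<dots> \<le> C0 * sqrt (real h) / (\<bar>real y - real m\<bar> * sqrt \<bar>real y - real m\<bar>)"
            using mem[OF n] C0 by (intro divide_right_mono mult_left_mono) auto
          finally show "\<bar>K n m - K y m\<bar> \<le> C0 * sqrt (real h) * (1 / (\<bar>real m - real y\<bar> * sqrt \<bar>real m - real y\<bar>))"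
            by (simp add: abs_minus_commute)
        qed auto
        also have "\<dots> = C0 * sqrt (real h) * (\<Sum>m\<in>Y. \<bar>f m\<bar> / (\<bar>real m - real y\<bar> * sqrt \<bar>real m - real y\<bar>))"
          by (simp add: sum_distrib_left mult_ac)
        also have "\<dots> \<le> C0 * sqrt (real h) * (23 * \<mu> / sqrt (real (2 * h)))"
          unfolding Y_def using C0 h ball' by (intro mult_left_mono tail_sum) auto
        also have "\<dots> = 23 * C0 * \<mu> * (sqrt (real h) / sqrt (real (2 * h)))" by simp
        also have "\<dots> \<le> 23 * C0 * \<mu> * 1"
          using C0 \<mu>0 h by (intro mult_left_mono) (auto simp: divide_le_eq)
        finally show ?thesis by simp
      qed
      define Z where "Z = {n\<in>{..<NN}. 80 * Cw * \<mu> < \<bar>kop NN K f1 n\<bar>}"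
      have sub: "{n\<in>dyad i k. A * \<mu> < \<bar>g n - c i k\<bar>} \<subseteq> Z"
      proof
        fix n assume n: "n \<in> {n\<in>dyad i k. A * \<mu> < \<bar>g n - c i k\<bar>}"
        then have "80 * Cw * \<mu> + 23 * C0 * \<mu> < \<bar>g n - c i k\<bar>" unfolding A_def by (simp add: algebra_simps)
        then have "80 * Cw * \<mu> < \<bar>kop NN K f1 n\<bar>" using far[of n] n by auto
        then show "n \<in> Z" using n Q unfolding Z_def by auto
      qed
      have Z: "16 * card Z \<le> 2 ^ i"
      \<comment> \<open>The weak type estimate needs a positive level. If the level is zero, f
        vanishes near the interval and the near part is zero.\<close>
      proof (cases "\<mu> = 0")
        case True
        then have "(\<Sum>m<NN. \<bar>f1 m\<bar>) = 0" using f1 by (simp add: order_antisym sum_nonneg)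
        then have "f1 m = 0" if "m < NN" for m using that by (simp add: sum_nonneg_eq_0_iff)
        then have "kop NN K f1 n = 0" for n unfolding kop_def by simp
        then have "Z = {}" unfolding Z_def using True by auto
        then show ?thesis by simp
      next
        case False
        then have \<mu>: "0 < \<mu>" using \<mu>0 by simp
        define s where "s = 80 * Cw * \<mu>"
        have s: "0 < s" unfolding s_def using \<mu> Cw by simp
        have "s * (\<Sum>n\<in>{n\<in>{..<NN}. s < \<bar>kop NN K f1 n\<bar>}. 1)
          \<le> (5 * 1 + 8 * B * 1 + 46 * 1 * C0 * (1 + 1)) * (\<Sum>n<NN. \<bar>f1 n\<bar> * 1)"
          using C0 B K L2 s by (intro kop_weak_type) (auto simp: f1_def)
        then have "s * real (card Z) \<le> Cw * (\<Sum>n<NN. \<bar>f1 n\<bar>)" unfolding Z_def s_def Cw_def by simp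
        also have "\<dots> \<le> Cw * (5 * \<mu> * real h)" using f1 Cw by (intro mult_left_mono) auto
        finally have "(5 * Cw * \<mu>) * (16 * real (card Z)) \<le> (5 * Cw * \<mu>) * real h" unfolding s_def by (simp add: mult_ac)
        moreover have "0 < 5 * Cw * \<mu>" using Cw \<mu> by simp
        ultimately have "16 * real (card Z) \<le> real h" by (rule mult_left_le_imp_le)
        then show ?thesis unfolding h_def using of_nat_le_iff[of "16 * card Z" "2 ^ i", where 'a=real] by simp
      qed
      have "card {n\<in>dyad i k. A * \<mu> < \<bar>g n - c i k\<bar>} \<le> card Z"
        using sub unfolding Z_def by (intro card_mono) auto
      then show ?thesis using Z unfolding \<mu>_def by linarith
    qed
    \<comment> \<open>For the top interval no point is far, so the pairing inequality there concerns
      g itself.\<close>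
    have c0: "c L 0 = 0"
    proof -
      have "{m\<in>{..<NN}. real (2 * 2 ^ L) \<le> \<bar>real m - real (0 * 2 ^ L)\<bar>} = {}"
      proof -
        have "real m < 2 ^ L" if "m < 2 ^ L" for m
          using that of_nat_less_iff[of m "2 ^ L", where 'a=real] by simp
        then show ?thesis unfolding NN_def by fastforce
      qed
      then show ?thesis unfolding c_def by (simp only: sum.empty)
    qed
    have Wsub: "(\<Sum>n\<in>dyad i k. w n) \<le> C1 * (\<Sum>n\<in>E. w n)" if "E \<subseteq> dyad i k" "2 ^ i \<le> 2 * card E" for i k E
    proof -
      have "Suc k * 2 ^ i - 1 - k * 2 ^ i + 1 = 2 ^ i" by simp
      moreover have "k * 2 ^ i \<le> Suc k * 2 ^ i - 1" using dyad_nonempty[of i k] unfolding dyad_Icc by simp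
      ultimately show ?thesis using that unfolding dyad_Icc by (intro C1(2)) auto
    qed
    have pair: "(\<Sum>n<NN. \<bar>g n\<bar> * (h n * w n)) \<le> (2 * A * C1) * (\<Sum>n<NN. M n * maxf NN w h n * w n)" if h: "\<And>k. 0 \<le> h k" for h
    proof -
      have dL: "dyad L 0 = {..<NN}" unfolding NN_def by simp
      have "(\<Sum>n\<in>dyad L 0. (\<bar>g n - c L 0\<bar> + A * Min (M ` dyad L 0)) * (h n * w n))
          \<le> 2 * A * C1 * (\<Sum>n\<in>dyad L 0. M n * maxf NN w h n * w n)"
        using w h M A C1 Wsub osc by (intro dyadic_oscillation_pairing) (auto simp: NN_def)
      moreover have "(\<Sum>n<NN. \<bar>g n\<bar> * (h n * w n)) \<le> (\<Sum>n<NN. (\<bar>g n\<bar> + A * Min (M ` {..<NN})) * (h n * w n))"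
      proof -
        have "0 < NN" unfolding NN_def by simp
        then have "0 \<le> A * Min (M ` {..<NN})" using A M by (intro mult_nonneg_nonneg Min.boundedI) auto
        then show ?thesis using h w by (intro sum_mono mult_right_mono) (auto simp: less_imp_le)
      qed
      ultimately show ?thesis unfolding dL c0 by simp
    qed
    have "(\<Sum>n<N. \<bar>kop R K f n\<bar> powr p * w n) \<le> (\<Sum>n<NN. \<bar>g n\<bar> powr p * w n)"
      unfolding eqg using L(2) less_imp_le[OF w] unfolding NN_def by (intro sum_mono2) auto
    also have "\<dots> \<le> C3 * (2 * A * C1) powr p * (\<Sum>n<NN. M n powr p * w n)"
      using A C1 w M pair by (intro C3(2)) auto
    also have "\<dots> \<le> C3 * (2 * A * C1) powr p * (C2 * (\<Sum>n<NN. \<bar>f n\<bar> powr p * w n))"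
      unfolding M_def using C3 by (intro mult_left_mono C2(2)) auto
    also have "(\<Sum>n<NN. \<bar>f n\<bar> powr p * w n) = (\<Sum>n<R. \<bar>f n\<bar> powr p * w n)"
      unfolding NN_def using fR L(1) by (intro sum_lessThan_extend) auto
    finally show "(\<Sum>n<N. \<bar>kop R K f n\<bar> powr p * w n) \<le> ?C * (\<Sum>n<R. \<bar>f n\<bar> powr p * w n)"
      by (simp add: mult_ac)
  qed
qed

section \<open>Hardy operators on weighted spaces\<close>

definition hardy :: "nat \<Rightarrow> (nat \<Rightarrow> real) \<Rightarrow> nat \<Rightarrow> real" where
  "hardy R f n = (\<Sum>m<R. f m / (real n + real m + 1))"

definition hardy_adj :: "nat \<Rightarrow> (nat \<Rightarrow> real) \<Rightarrow> nat \<Rightarrow> real" where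
  "hardy_adj R f n = (\<Sum>m\<in>{n..<R}. f m / (real m + 1))"

text \<open>Split at m = n: for m < n the denominator is at least n + 1 and the sum is dominated by
  an average over [0, n]; for m \<ge> n it is at least m + 1.\<close>

lemma hardy_le:
  assumes f: "\<And>k. 0 \<le> f k" and n: "n < N"
  shows "hardy N f n \<le> hl N f n + hardy_adj N f n"
proof -
  have "hardy N f n = (\<Sum>m<n. f m / (real n + real m + 1)) + (\<Sum>m\<in>{n..<N}. f m / (real n + real m + 1))"
    unfolding hardy_def using n sum.atLeastLessThan_concat[of 0 n N "\<lambda>m. f m / (real n + real m + 1)"]
    by (simp add: lessThan_atLeast0)
  also have "\<dots> \<le> (\<Sum>m<n. f m / (real n + 1)) + (\<Sum>m\<in>{n..<N}. f m / (real m + 1))"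
    using f by (intro add_mono sum_mono divide_left_mono) auto
  also have "(\<Sum>m<n. f m / (real n + 1)) \<le> (\<Sum>m=0..n. f m) / (real n + 1)"
    unfolding sum_divide_distrib using f by (intro sum_mono2) auto
  also have "\<dots> \<le> hl N f n"
    using sum_le_hl[of f 0 n n N] f n by (simp add: divide_le_eq add.commute)
  finally show ?thesis unfolding hardy_adj_def by simp
qed

lemma hardy_adj_nonneg: "(\<And>k. 0 \<le> f k) \<Longrightarrow> 0 \<le> hardy_adj N f n"
  unfolding hardy_adj_def by (intro sum_nonneg) auto

text \<open>After pairing with h and exchanging sums, the range of m is cut into dyadic blocks [e,
  2e). A block is half of [0, 2e), so \<open>Ap_subset\<close> moves the w-mass of [0, 2e) onto the
  block; the blocks are disjoint, and their contributions add up.\<close>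

lemma hardy_adj_strong:
  assumes p: "1 < p" and Ap: "Ap_weight p w"
  obtains C where "0 < C" "\<And>N f. (\<And>k. 0 \<le> f k) \<Longrightarrow>
     (\<Sum>n<N. hardy_adj N f n powr p * w n) \<le> C * (\<Sum>n<N. f n powr p * w n)"
proof -
  note w = Ap_weight_pos[OF Ap]
  obtain C1 where C1: "0 < C1" "\<And>E a b. a \<le> b \<Longrightarrow> E \<subseteq> {a..b} \<Longrightarrow> b - a + 1 \<le> 2 * card E \<Longrightarrow>
     (\<Sum>k=a..b. w k) \<le> C1 * (\<Sum>k\<in>E. w k)"
    using Ap_subset[OF p Ap] by blast
  obtain C2 where C2: "0 < C2" "\<And>N f. (\<And>k. 0 \<le> f k) \<Longrightarrow>
     (\<Sum>n<N. hl N f n powr p * w n) \<le> C2 * (\<Sum>n<N. f n powr p * w n)"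
    using muckenhoupt[OF p Ap] by blast
  obtain C3 where C3: "0 < C3" 
    "\<And>K N w g M. 0 < K \<Longrightarrow> (\<And>k. 0 < w k) \<Longrightarrow> (\<And>n. n < N \<Longrightarrow> 0 \<le> M n) \<Longrightarrow> 
       (\<And>h. (\<And>k. 0 \<le> h k) \<Longrightarrow> (\<Sum>n<N. \<bar>g n\<bar> * (h n * w n)) \<le> K * (\<Sum>n<N. M n * maxf N w h n * w n)) \<Longrightarrow>
       (\<Sum>n<N. \<bar>g n\<bar> powr p * w n) \<le> C3 * K powr p * (\<Sum>n<N. M n powr p * w n)"
    using pairing_imp_strong[OF p] by blast
  show thesis
  proof
    define D where "D = 1 + 2 * C1"
    have D: "1 \<le> D" "2 * C1 \<le> D" unfolding D_def using C1 by auto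
    let ?C = "C3 * D powr p * C2"
    show "0 < ?C" using C1 C2 C3 unfolding D_def by simp
    fix N :: nat and f :: "nat \<Rightarrow> real" assume f: "\<And>k. 0 \<le> f k"
    define L where "L = N"
    define NN where "NN = (2::nat) ^ L"
    have N: "N \<le> NN" unfolding NN_def L_def by (rule less_imp_le[OF less_exp])
    define f' where "f' k = (if k < N then f k else 0)" for k
    have f': "0 \<le> f' k" for k unfolding f'_def using f by simp
    define M where "M = hl NN f'"
    have M: "0 \<le> M n" if "n < NN" for n unfolding M_def using that f' by (intro hl_nonneg) auto
    have block: "(\<Sum>m<2 ^ l. f' m / (real m + 1) * (\<Sum>n\<le>m. h n * w n)) \<le> D * (\<Sum>n<2 ^ l. M n * maxf NN w h n * w n)"
      if h: "\<And>k. 0 \<le> h k" and l: "l \<le> L" for h l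
      using l
    proof (induction l)
      case 0
      have "f' 0 \<le> M 0" using sum_le_hl[of f' 0 0 0 NN] f' unfolding M_def NN_def by simp
      moreover have "h 0 \<le> maxf NN w h 0" using sum_le_maxf[of w h 0 0 0 NN] w[of 0] w h unfolding NN_def by simp
      ultimately have "f' 0 * h 0 * w 0 \<le> M 0 * maxf NN w h 0 * w 0"
        using f' h w[of 0] M[of 0] by (intro mult_right_mono mult_mono) (auto simp: NN_def)
      also have "\<dots> \<le> D * (M 0 * maxf NN w h 0 * w 0)"
      proof -
        have "0 \<le> M 0 * maxf NN w h 0 * w 0" using M[of 0] w h maxf_nonneg[of w h 0 NN]
          by (intro mult_nonneg_nonneg) (auto simp: NN_def less_imp_le)
        then show ?thesis using mult_right_mono[OF D(1)] by fastforce
      qed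
      finally show ?case by (simp add: mult_ac)
    next
      case (Suc l)
      define e where "e = (2::nat) ^ l"
      have e: "1 \<le> e" "2 * e \<le> NN" unfolding e_def NN_def using Suc.prems power_increasing[of "Suc l" L "2::nat"] by auto
      have two: "{..<2 ^ Suc l} = {..<e} \<union> {e..<2 * e}" unfolding e_def by auto
      have I2: "{e..<2 * e} = {e..2 * e - 1}" using e by auto
      define W where "W = (\<Sum>k=0..2 * e - 1. w k)"
      \<comment> \<open>Divided by e and not by the length 2e: the result dominates the block sum of
        f' m / e directly, at the price of the factor 2 in \<open>sM\<close>.\<close>
      define s where "s = (\<Sum>m=0..2 * e - 1. f' m) / real e"
      define t where "t = (\<Sum>k=0..2 * e - 1. h k * w k) / W"
      have W: "0 < W" unfolding W_def using w by (intro sum_pos_Icc) auto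
      have s0: "0 \<le> s" unfolding s_def using f' by (intro divide_nonneg_nonneg sum_nonneg) auto
      have t0: "0 \<le> t" unfolding t_def using W h w by (intro divide_nonneg_pos sum_nonneg) (auto simp: less_imp_le)
      have sM: "s \<le> 2 * M n" if "n \<in> {e..<2 * e}" for n
      proof -
        have "(\<Sum>m=0..2 * e - 1. f' m) \<le> M n * real (2 * e - 1 - 0 + 1)"
          unfolding M_def using that e f' by (intro sum_le_hl) auto
        then show ?thesis unfolding s_def using e by (simp add: divide_le_eq)
      qed
      have tm: "t \<le> maxf NN w h n" if "n \<in> {e..<2 * e}" for n
      proof -
        have "(\<Sum>k=0..2 * e - 1. h k * w k) \<le> maxf NN w h n * W"
          unfolding W_def using that e w h by (intro sum_le_maxf) auto
        then show ?thesis unfolding t_def using W by (simp add: divide_le_eq)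
      qed
      have "(\<Sum>m\<in>{e..<2 * e}. f' m / (real m + 1) * (\<Sum>n\<le>m. h n * w n)) \<le> (\<Sum>m\<in>{e..<2 * e}. f' m / real e * (t * W))"
      proof (rule sum_mono)
        fix m assume m: "m \<in> {e..<2 * e}"
        have "(\<Sum>n\<le>m. h n * w n) \<le> (\<Sum>k=0..2 * e - 1. h k * w k)"
          using m h w by (intro sum_mono2) (auto simp: less_imp_le)
        also have "\<dots> = t * W" unfolding t_def using W by simp
        finally show "f' m / (real m + 1) * (\<Sum>n\<le>m. h n * w n) \<le> f' m / real e * (t * W)"
          using f' h w m e by (intro mult_mono divide_left_mono divide_nonneg_nonneg sum_nonneg) (auto simp: less_imp_le)
      qed
      also have "\<dots> = (\<Sum>m\<in>{e..<2 * e}. f' m) / real e * (t * W)" by (simp add: sum_distrib_right sum_divide_distrib)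
      also have "\<dots> \<le> s * (t * W)"
        unfolding s_def using f' t0 W by (intro mult_right_mono divide_right_mono sum_mono2) auto
      also have "\<dots> \<le> s * (t * (C1 * (\<Sum>k\<in>{e..<2 * e}. w k)))"
        unfolding W_def using s0 t0 e by (intro mult_left_mono C1(2)) auto
      also have "\<dots> = C1 * (\<Sum>k\<in>{e..<2 * e}. s * t * w k)" by (simp add: sum_distrib_left mult_ac)
      also have "\<dots> \<le> C1 * (\<Sum>k\<in>{e..<2 * e}. (2 * M k) * maxf NN w h k * w k)"
        using s0 t0 sM tm w C1(1) M e by (intro mult_left_mono sum_mono mult_right_mono mult_mono) (auto simp: less_imp_le)
      also have "\<dots> = 2 * C1 * (\<Sum>k\<in>{e..<2 * e}. M k * maxf NN w h k * w k)" by (simp add: sum_distrib_left mult_ac)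
      also have "\<dots> \<le> D * (\<Sum>k\<in>{e..<2 * e}. M k * maxf NN w h k * w k)"
        using e M w h by (intro mult_right_mono D(2) sum_nonneg mult_nonneg_nonneg maxf_nonneg) (auto simp: less_imp_le)
      finally have blk: "(\<Sum>m\<in>{e..<2 * e}. f' m / (real m + 1) * (\<Sum>n\<le>m. h n * w n))
        \<le> D * (\<Sum>k\<in>{e..<2 * e}. M k * maxf NN w h k * w k)" .
      have dis: "{..<e} \<inter> {e..<2 * e} = {}" by auto
      show ?case unfolding two using Suc.IH[folded e_def] Suc.prems blk
        by (simp add: sum.union_disjoint[OF _ _ dis] distrib_left)
    qed
    define g where "g = hardy_adj NN f'"
    have g0: "0 \<le> g n" for n unfolding g_def using f' by (rule hardy_adj_nonneg)
    have pair: "(\<Sum>n<NN. \<bar>g n\<bar> * (h n * w n)) \<le> D * (\<Sum>n<NN. M n * maxf NN w h n * w n)" if h: "\<And>k. 0 \<le> h k" for h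
    proof -
      have "(\<Sum>n<NN. \<bar>g n\<bar> * (h n * w n)) = (\<Sum>n<NN. \<Sum>m\<in>{m\<in>{..<NN}. n \<le> m}. f' m / (real m + 1) * (h n * w n))"
      proof (rule sum.cong)
        fix n
        have "{n..<NN} = {m\<in>{..<NN}. n \<le> m}" by auto
        then show "\<bar>g n\<bar> * (h n * w n) = (\<Sum>m\<in>{m\<in>{..<NN}. n \<le> m}. f' m / (real m + 1) * (h n * w n))"
          using g0[of n] unfolding g_def hardy_adj_def by (simp add: sum_distrib_right)
      qed simp
      also have "\<dots> = (\<Sum>m<NN. \<Sum>n\<in>{n\<in>{..<NN}. n \<le> m}. f' m / (real m + 1) * (h n * w n))"
        by (rule sum.swap_restrict) auto
      also have "\<dots> = (\<Sum>m<NN. f' m / (real m + 1) * (\<Sum>n\<le>m. h n * w n))"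
      proof (rule sum.cong)
        fix m assume "m \<in> {..<NN}"
        then have "{n\<in>{..<NN}. n \<le> m} = {..m}" by auto
        then show "(\<Sum>n\<in>{n\<in>{..<NN}. n \<le> m}. f' m / (real m + 1) * (h n * w n)) = f' m / (real m + 1) * (\<Sum>n\<le>m. h n * w n)"
          by (simp add: sum_distrib_left)
      qed simp
      also have "\<dots> \<le> D * (\<Sum>n<NN. M n * maxf NN w h n * w n)" 
        using block[OF h order_refl] unfolding NN_def[symmetric] .
      finally show ?thesis .
    qed
    have eqg: "hardy_adj N f n = g n" for n
      unfolding g_def hardy_adj_def f'_def using N by (intro sum.mono_neutral_cong_left) auto
    have "(\<Sum>n<N. hardy_adj N f n powr p * w n) \<le> (\<Sum>n<NN. \<bar>g n\<bar> powr p * w n)"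
      unfolding eqg using N less_imp_le[OF w] g0 by (simp, intro sum_mono2) auto
    also have "\<dots> \<le> C3 * D powr p * (\<Sum>n<NN. M n powr p * w n)"
      using D w M pair by (intro C3(2)) auto
    also have "\<dots> \<le> C3 * D powr p * (C2 * (\<Sum>n<NN. f' n powr p * w n))"
      unfolding M_def using C3 f' by (intro mult_left_mono C2(2)) auto
    also have "(\<Sum>n<NN. f' n powr p * w n) = (\<Sum>n<N. f n powr p * w n)"
      unfolding f'_def using N p by (intro sum.mono_neutral_cong_right) auto
    finally show "(\<Sum>n<N. hardy_adj N f n powr p * w n) \<le> ?C * (\<Sum>n<N. f n powr p * w n)"
      by (simp add: mult_ac)
  qed
qed

lemma hardy_kernel_bound:
  assumes C1: "0 \<le> C1" and K: "\<And>n m. \<bar>K n m\<bar> \<le> C1 / (real n + real m + 1)" and n: "n < N" "R \<le> N"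
    and fR: "\<And>k. R \<le> k \<Longrightarrow> f k = 0"
  shows "\<bar>kop R K f n\<bar> \<le> C1 * (hl N (\<lambda>k. \<bar>f k\<bar>) n + hardy_adj N (\<lambda>k. \<bar>f k\<bar>) n)"
proof -
  have "\<bar>kop R K f n\<bar> = \<bar>kop N K f n\<bar>" using fR n(2) by (subst kop_extend) auto
  also have "\<dots> \<le> (\<Sum>m<N. \<bar>K n m\<bar> * \<bar>f m\<bar>)" unfolding kop_def by (rule order_trans[OF sum_abs]) (simp add: abs_mult)
  also have "\<dots> \<le> (\<Sum>m<N. C1 / (real n + real m + 1) * \<bar>f m\<bar>)" using K by (intro sum_mono mult_right_mono) auto
  also have "\<dots> = C1 * hardy N (\<lambda>k. \<bar>f k\<bar>) n" unfolding hardy_def by (simp add: sum_distrib_left)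
  also have "\<dots> \<le> C1 * (hl N (\<lambda>k. \<bar>f k\<bar>) n + hardy_adj N (\<lambda>k. \<bar>f k\<bar>) n)"
    using C1 n by (intro mult_left_mono hardy_le) auto
  finally show ?thesis .
qed

lemma sum_powr_add_le:
  fixes w u v :: "'a \<Rightarrow> real"
  assumes "1 < p" "\<And>n. n \<in> X \<Longrightarrow> 0 \<le> w n" "\<And>n. n \<in> X \<Longrightarrow> 0 \<le> u n" "\<And>n. n \<in> X \<Longrightarrow> 0 \<le> v n"
  shows "(\<Sum>n\<in>X. (u n + v n) powr p * w n) \<le> 2 powr p * ((\<Sum>n\<in>X. u n powr p * w n) + (\<Sum>n\<in>X. v n powr p * w n))"
proof -
  have "(\<Sum>n\<in>X. (u n + v n) powr p * w n) \<le> (\<Sum>n\<in>X. 2 powr p * (u n powr p + v n powr p) * w n)"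
    using assms by (intro sum_mono mult_right_mono powr_add_le) auto
  also have "\<dots> = (\<Sum>n\<in>X. 2 powr p * (u n powr p * w n + v n powr p * w n))" by (simp add: algebra_simps)
  also have "\<dots> = 2 powr p * ((\<Sum>n\<in>X. u n powr p * w n) + (\<Sum>n\<in>X. v n powr p * w n))"
    by (simp only: sum.distrib flip: sum_distrib_left)
  finally show ?thesis .
qed

lemma hardy_kernel_strong:
  assumes p: "1 < p" and Ap: "Ap_weight p w" and C1: "0 \<le> C1"
  obtains C where "0 < C" "\<And>K f R (N::nat). (\<And>n m. \<bar>K n m\<bar> \<le> C1 / (real n + real m + 1)) \<Longrightarrow> (\<And>k. R \<le> k \<Longrightarrow> f k = 0) \<Longrightarrow>
     (\<Sum>n<N. \<bar>kop R K f n\<bar> powr p * w n) \<le> C * (\<Sum>n<R. \<bar>f n\<bar> powr p * w n)"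
proof -
  note w = Ap_weight_pos[OF Ap] note wl = less_imp_le[OF w]
  obtain C2 where C2: "0 < C2" "\<And>N f. (\<And>k. 0 \<le> f k) \<Longrightarrow>
     (\<Sum>n<N. hl N f n powr p * w n) \<le> C2 * (\<Sum>n<N. f n powr p * w n)"
    using muckenhoupt[OF p Ap] by blast
  obtain C3 where C3: "0 < C3" "\<And>N f. (\<And>k. 0 \<le> f k) \<Longrightarrow>
     (\<Sum>n<N. hardy_adj N f n powr p * w n) \<le> C3 * (\<Sum>n<N. f n powr p * w n)"
    using hardy_adj_strong[OF p Ap] by blast
  show thesis
  proof
    \<comment> \<open>C1 + 1 instead of C1 keeps the constant positive when C1 = 0.\<close>
    let ?C = "(C1 + 1) powr p * (2 powr p * (C2 + C3))"
    show "0 < ?C" using C1 C2 C3 by (intro mult_pos_pos) auto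
    fix K and f :: "nat \<Rightarrow> real" and R N :: nat
    assume K: "\<And>n m. \<bar>K n m\<bar> \<le> C1 / (real n + real m + 1)" and fR: "\<And>k. R \<le> k \<Longrightarrow> f k = 0"
    define NN where "NN = max R N"
    define F where "F k = \<bar>f k\<bar>" for k
    have F: "0 \<le> F k" for k unfolding F_def by simp
    have "(\<Sum>n<N. \<bar>kop R K f n\<bar> powr p * w n) \<le> (\<Sum>n<NN. \<bar>kop R K f n\<bar> powr p * w n)"
      using wl unfolding NN_def by (intro sum_mono2) auto
    also have "\<dots> \<le> (\<Sum>n<NN. (C1 + 1) powr p * ((hl NN F n + hardy_adj NN F n) powr p * w n))"
    proof (rule sum_mono)
      fix n assume "n \<in> {..<NN}"
      then have n: "n < NN" by simp
      have nn: "0 \<le> hl NN F n + hardy_adj NN F n"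
        using F n by (intro add_nonneg_nonneg hl_nonneg hardy_adj_nonneg) auto
      have "\<bar>kop R K f n\<bar> \<le> C1 * (hl NN F n + hardy_adj NN F n)"
        unfolding F_def by (rule hardy_kernel_bound[OF C1 K n _ fR]) (simp_all add: NN_def)
      also have "\<dots> \<le> (C1 + 1) * (hl NN F n + hardy_adj NN F n)" using nn by (intro mult_right_mono) auto
      finally have "\<bar>kop R K f n\<bar> powr p \<le> ((C1 + 1) * (hl NN F n + hardy_adj NN F n)) powr p"
        using p by (intro powr_mono2) auto
      also have "\<dots> = (C1 + 1) powr p * (hl NN F n + hardy_adj NN F n) powr p"
        using C1 nn by (intro powr_mult) 
      finally show "\<bar>kop R K f n\<bar> powr p * w n \<le> (C1 + 1) powr p * ((hl NN F n + hardy_adj NN F n) powr p * w n)"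
        using wl[of n] by (simp add: mult_right_mono flip: mult.assoc)
    qed
    also have "\<dots> = (C1 + 1) powr p * (\<Sum>n<NN. (hl NN F n + hardy_adj NN F n) powr p * w n)" by (simp add: sum_distrib_left)
    also have "\<dots> \<le> (C1 + 1) powr p * (2 powr p * ((\<Sum>n<NN. hl NN F n powr p * w n) + (\<Sum>n<NN. hardy_adj NN F n powr p * w n)))"
      using p wl F by (intro mult_left_mono sum_powr_add_le hl_nonneg hardy_adj_nonneg) auto
    also have "\<dots> \<le> (C1 + 1) powr p * (2 powr p * (C2 * (\<Sum>n<NN. F n powr p * w n) + C3 * (\<Sum>n<NN. F n powr p * w n)))"
      using F by (intro mult_left_mono add_mono C2(2) C3(2)) auto
    also have "(\<Sum>n<NN. F n powr p * w n) = (\<Sum>n<R. \<bar>f n\<bar> powr p * w n)"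
      unfolding F_def NN_def using fR by (intro sum_lessThan_extend) auto
    finally show "(\<Sum>n<N. \<bar>kop R K f n\<bar> powr p * w n) \<le> ?C * (\<Sum>n<R. \<bar>f n\<bar> powr p * w n)"
      by (simp add: algebra_simps)
  qed
qed

section \<open>Sums of a Hoelder kernel and a Hardy kernel\<close>

lemma kop_add: "kop R (\<lambda>n m. K1 n m + K2 n m) f n = kop R K1 f n + kop R K2 f n"
  unfolding kop_def by (simp add: distrib_right sum.distrib)

lemma kop_restrict: "kop R K (\<lambda>k. if k < R then f k else 0) n = kop R K f n"
  unfolding kop_def by simp

lemma Ap_weight_const: "Ap_weight 2 (\<lambda>_. 1)"
  unfolding Ap_weight_def by (auto intro!: exI[of _ 1] simp: Suc_diff_le power2_eq_square divide_le_eq)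

text \<open>The Hardy kernel is bounded on l^2 by its size alone, so subtracting it passes the l^2
  bound from the whole kernel to the Hoelder part.\<close>

theorem cz_l2_part:
  assumes C1: "0 \<le> C1" and B: "0 \<le> B"
  obtains B' where "0 \<le> B'" "\<And>K1 K2 f R (N::nat). (\<And>n m. \<bar>K2 n m\<bar> \<le> C1 / (real n + real m + 1)) \<Longrightarrow>
      (\<And>f R N. (\<Sum>n<N. (kop R (\<lambda>n m. K1 n m + K2 n m) f n)\<^sup>2) \<le> B * (\<Sum>n<R. (f n)\<^sup>2)) \<Longrightarrow>
      (\<Sum>n<N. (kop R K1 f n)\<^sup>2) \<le> B' * (\<Sum>n<R. (f n)\<^sup>2)"
proof -
  have two: "1 < (2::real)" by simp
  obtain C where C: "0 < C" "\<And>K f R (N::nat). (\<And>n m. \<bar>K n m\<bar> \<le> C1 / (real n + real m + 1)) \<Longrightarrow> (\<And>k. R \<le> k \<Longrightarrow> f k = 0) \<Longrightarrow>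
     (\<Sum>n<N. \<bar>kop R K f n\<bar> powr 2 * 1) \<le> C * (\<Sum>n<R. \<bar>f n\<bar> powr 2 * 1)"
    using hardy_kernel_strong[OF two Ap_weight_const C1] by blast
  show thesis
  proof
    show "0 \<le> 2 * B + 2 * C" using B C by simp
    fix K1 K2 and f :: "nat \<Rightarrow> real" and R N :: nat
    assume K2: "\<And>n m. \<bar>K2 n m\<bar> \<le> C1 / (real n + real m + 1)"
      and L2: "\<And>f R N. (\<Sum>n<N. (kop R (\<lambda>n m. K1 n m + K2 n m) f n)\<^sup>2) \<le> B * (\<Sum>n<R. (f n)\<^sup>2)"
    have h: "(\<Sum>n<N. (kop R K2 f n)\<^sup>2) \<le> C * (\<Sum>n<R. (f n)\<^sup>2)"
      using C(2)[OF K2, where R=R and N=N and f="\<lambda>k. if k < R then f k else 0"] by (simp add: kop_restrict)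
    have "(\<Sum>n<N. (kop R K1 f n)\<^sup>2) \<le> (\<Sum>n<N. 2 * (kop R (\<lambda>n m. K1 n m + K2 n m) f n)\<^sup>2 + 2 * (kop R K2 f n)\<^sup>2)"
    proof (rule sum_mono)
      fix n
      define a b where "a = kop R K1 f n" and "b = kop R K2 f n"
      have "a\<^sup>2 \<le> 2 * (a + b)\<^sup>2 + 2 * b\<^sup>2"
        using sum_squares_ge_zero[of "a + 2 * b" 0] by (simp add: power2_eq_square algebra_simps)
      then show "(kop R K1 f n)\<^sup>2 \<le> 2 * (kop R (\<lambda>n m. K1 n m + K2 n m) f n)\<^sup>2 + 2 * (kop R K2 f n)\<^sup>2"
        unfolding kop_add a_def b_def .
    qed
    also have "\<dots> = 2 * (\<Sum>n<N. (kop R (\<lambda>n m. K1 n m + K2 n m) f n)\<^sup>2) + 2 * (\<Sum>n<N. (kop R K2 f n)\<^sup>2)"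
      by (simp add: sum.distrib sum_distrib_left)
    also have "\<dots> \<le> 2 * (B * (\<Sum>n<R. (f n)\<^sup>2)) + 2 * (C * (\<Sum>n<R. (f n)\<^sup>2))"
      by (intro add_mono mult_left_mono L2 h) auto
    finally show "(\<Sum>n<N. (kop R K1 f n)\<^sup>2) \<le> (2 * B + 2 * C) * (\<Sum>n<R. (f n)\<^sup>2)" by (simp add: algebra_simps)
  qed
qed

text \<open>The l^2 bound is imposed on the sum because it comes from the spectral multiplier,
  whereas the splitting comes from a cutoff in (n, m) and has no spectral meaning.\<close>

definition cz_kernel :: "real \<Rightarrow> real \<Rightarrow> real \<Rightarrow> (nat \<Rightarrow> nat \<Rightarrow> real) \<Rightarrow> bool" where
  "cz_kernel C0 C1 B K \<longleftrightarrow> (\<exists>K1 K2. (\<forall>n m. K n m = K1 n m + K2 n m) \<and> hoelder_kernel C0 K1 \<and>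
     (\<forall>n m. \<bar>K2 n m\<bar> \<le> C1 / (real n + real m + 1))) \<and>
     (\<forall>f R N. (\<Sum>n<N. (kop R K f n)\<^sup>2) \<le> B * (\<Sum>n<R. (f n)\<^sup>2))"

theorem cz_strong:
  assumes p: "1 < p" and Ap: "Ap_weight p w" and C01: "0 \<le> C0" "0 \<le> C1" and B: "0 \<le> B"
  obtains C where "0 < C" "\<And>K f R N. cz_kernel C0 C1 B K \<Longrightarrow> (\<And>k. R \<le> k \<Longrightarrow> f k = 0) \<Longrightarrow>
      (\<Sum>n<N. \<bar>kop R K f n\<bar> powr p * w n) \<le> C * (\<Sum>n<R. \<bar>f n\<bar> powr p * w n)"
proof -
  note w = Ap_weight_pos[OF Ap] note wl = less_imp_le[OF w]
  obtain B' where B': "0 \<le> B'" "\<And>K1 K2 f R (N::nat). (\<And>n m. \<bar>K2 n m\<bar> \<le> C1 / (real n + real m + 1)) \<Longrightarrow>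
      (\<And>f R N. (\<Sum>n<N. (kop R (\<lambda>n m. K1 n m + K2 n m) f n)\<^sup>2) \<le> B * (\<Sum>n<R. (f n)\<^sup>2)) \<Longrightarrow>
      (\<Sum>n<N. (kop R K1 f n)\<^sup>2) \<le> B' * (\<Sum>n<R. (f n)\<^sup>2)"
    using cz_l2_part[OF C01(2) B] by blast
  obtain D1 where D1: "0 < D1" "\<And>K f R (N::nat). hoelder_kernel C0 K \<Longrightarrow> 
      (\<And>f R N. (\<Sum>n<N. (kop R K f n)\<^sup>2) \<le> B' * (\<Sum>n<R. (f n)\<^sup>2)) \<Longrightarrow> (\<And>k. R \<le> k \<Longrightarrow> f k = 0) \<Longrightarrow>
      (\<Sum>n<N. \<bar>kop R K f n\<bar> powr p * w n) \<le> D1 * (\<Sum>n<R. \<bar>f n\<bar> powr p * w n)"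
    using kop_strong_type[OF p Ap C01(1) B'(1)] by blast
  obtain D2 where D2: "0 < D2" "\<And>K f R (N::nat). (\<And>n m. \<bar>K n m\<bar> \<le> C1 / (real n + real m + 1)) \<Longrightarrow> (\<And>k. R \<le> k \<Longrightarrow> f k = 0) \<Longrightarrow>
     (\<Sum>n<N. \<bar>kop R K f n\<bar> powr p * w n) \<le> D2 * (\<Sum>n<R. \<bar>f n\<bar> powr p * w n)"
    using hardy_kernel_strong[OF p Ap C01(2)] by blast
  show thesis
  proof
    show "0 < 2 powr p * (D1 + D2)" using D1 D2 by simp
    fix K and f :: "nat \<Rightarrow> real" and R N :: nat
    assume K: "cz_kernel C0 C1 B K" and fR: "\<And>k. R \<le> k \<Longrightarrow> f k = 0"
    obtain K1 K2 where K12: "\<And>n m. K n m = K1 n m + K2 n m" "hoelder_kernel C0 K1" "\<And>n m. \<bar>K2 n m\<bar> \<le> C1 / (real n + real m + 1)"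
      using K unfolding cz_kernel_def by blast
    have Keq: "K = (\<lambda>n m. K1 n m + K2 n m)" using K12(1) by blast
    have L2: "(\<Sum>n<N. (kop R (\<lambda>n m. K1 n m + K2 n m) f n)\<^sup>2) \<le> B * (\<Sum>n<R. (f n)\<^sup>2)" for f R N
      using K unfolding cz_kernel_def Keq by blast
    have "(\<Sum>n<N. \<bar>kop R K f n\<bar> powr p * w n) \<le> (\<Sum>n<N. (\<bar>kop R K1 f n\<bar> + \<bar>kop R K2 f n\<bar>) powr p * w n)"
      unfolding Keq kop_add using p wl by (intro sum_mono mult_right_mono powr_mono2) auto
    also have "\<dots> \<le> 2 powr p * ((\<Sum>n<N. \<bar>kop R K1 f n\<bar> powr p * w n) + (\<Sum>n<N. \<bar>kop R K2 f n\<bar> powr p * w n))"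
      using p wl by (intro sum_powr_add_le) auto
    also have "\<dots> \<le> 2 powr p * (D1 * (\<Sum>n<R. \<bar>f n\<bar> powr p * w n) + D2 * (\<Sum>n<R. \<bar>f n\<bar> powr p * w n))"
      by (intro mult_left_mono add_mono D1(2)[OF K12(2) B'(2)[OF K12(3) L2] fR] D2(2)[OF K12(3) fR]) auto
    finally show "(\<Sum>n<N. \<bar>kop R K f n\<bar> powr p * w n) \<le> 2 powr p * (D1 + D2) * (\<Sum>n<R. \<bar>f n\<bar> powr p * w n)"
      by (simp add: algebra_simps)
  qed
qed

lemma A1_weight_bound:
  assumes "A1_weight w"
  obtains A where "1 \<le> A" "\<And>a b k. a \<le> k \<Longrightarrow> k \<le> b \<Longrightarrow> (\<Sum>k=a..b. w k) \<le> A * real (b - a + 1) * w k"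
proof -
  from assms obtain C where w: "\<And>k. 0 < w k" and C: "\<And>n m. n \<le> m \<Longrightarrow>
        (\<Sum>k=n..m. w k) * (MAX k\<in>{n..m}. 1 / w k) / real (m - n + 1) \<le> C"
    unfolding A1_weight_def by blast
  have bd: "(\<Sum>k=a..b. w k) \<le> C * real (b - a + 1) * w k" if k: "a \<le> k" "k \<le> b" for a b k
  proof -
    have "(\<Sum>k=a..b. w k) * (1 / w k) \<le> (\<Sum>k=a..b. w k) * (MAX k\<in>{a..b}. 1 / w k)"
      using k w by (intro mult_left_mono Max_ge sum_nonneg) (auto simp: less_imp_le)
    also have "\<dots> \<le> C * real (b - a + 1)" using C[of a b] k by (simp add: divide_le_eq)
    finally show ?thesis using w[of k] by (simp add: divide_le_eq)
  qed
  have "1 \<le> C" using bd[of 0 0 0] w[of 0] by simp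
  then show thesis using bd by (rule that)
qed

lemma A1_weight_pos: "A1_weight w \<Longrightarrow> 0 < w k"
  unfolding A1_weight_def by blast

text \<open>Together with \<open>kop_strong_type\<close> for p = 2 this supplies the w-weighted l^2
  bound that the good part in \<open>kop_weak_type\<close> requires.\<close>

lemma A1_imp_A2:
  assumes A1: "A1_weight w"
  shows "Ap_weight 2 w"
proof -
  note w = A1_weight_pos[OF A1]
  obtain A where A: "1 \<le> A" "\<And>a b k. a \<le> k \<Longrightarrow> k \<le> b \<Longrightarrow> (\<Sum>k=a..b. w k) \<le> A * real (b - a + 1) * w k"
    using A1_weight_bound[OF A1] by blast
  have "(\<Sum>k=n..m. w k) * (\<Sum>k=n..m. w k powr (-1 / (2 - 1))) powr (2 - 1) / real (m - n + 1) powr 2 \<le> A"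
    if nm: "n \<le> m" for n m
  proof -
    have "(\<Sum>k=n..m. w k) * (\<Sum>k=n..m. w k powr (-1 / (2 - 1))) powr (2 - 1) = (\<Sum>k=n..m. (\<Sum>k=n..m. w k) / w k)"
      using w by (simp add: powr_minus sum_nonneg less_imp_le divide_inverse sum_distrib_left)
    also have "\<dots> \<le> (\<Sum>k=n..m. A * real (m - n + 1))"
      using A(2) w by (intro sum_mono) (simp add: divide_le_eq)
    also have "\<dots> = A * (real (m - n + 1))\<^sup>2" using nm by (simp add: power2_eq_square Suc_diff_le)
    finally show ?thesis by (simp add: divide_le_eq)
  qed
  then show ?thesis unfolding Ap_weight_def using w by blast
qed

text \<open>For an A_1 weight an unweighted average is at most A times the w-average, so the weak
  type of the w-maximal function covers the unweighted one.\<close>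

lemma hl_le_maxf:
  assumes w: "\<And>k. 0 < w k" and f: "\<And>k. 0 \<le> f k" and A: "1 \<le> A"
    "\<And>a b k. a \<le> k \<Longrightarrow> k \<le> b \<Longrightarrow> (\<Sum>k=a..b. w k) \<le> A * real (b - a + 1) * w k" and n: "n < N"
  shows "hl N f n \<le> A * maxf N w f n"
proof -
  have av: "avg (\<lambda>_. 1) f a b \<le> A * avg w f a b" if ab: "a \<le> b" for a b
  proof -
    define W where "W = (\<Sum>k=a..b. w k)"
    define l where "l = real (b - a + 1)"
    have W: "0 < W" unfolding W_def using w ab by (intro sum_pos_Icc)
    have l: "0 < l" unfolding l_def by simp
    have "(\<Sum>k=a..b. f k) * W = (\<Sum>k=a..b. f k * W)" by (simp add: sum_distrib_right)
    also have "\<dots> \<le> (\<Sum>k=a..b. f k * (A * l * w k))"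
      unfolding W_def l_def using f by (intro sum_mono mult_left_mono A) auto
    also have "\<dots> = A * (\<Sum>k=a..b. f k * w k) * l" by (simp add: sum_distrib_left mult_ac)
    finally have "(\<Sum>k=a..b. f k) / l \<le> A * ((\<Sum>k=a..b. f k * w k) / W)" using W l by (simp add: field_simps)
    then show ?thesis unfolding avg_def W_def l_def using ab by (simp add: Suc_diff_le)
  qed
  obtain a where a: "a \<le> n" "maxl (\<lambda>_. 1) f n = avg (\<lambda>_. 1) f a n" using maxl_obtain by blast
  obtain b where b: "n \<le> b" "b < N" "maxr N (\<lambda>_. 1) f n = avg (\<lambda>_. 1) f n b" using maxr_obtain[OF n] by blast
  have "maxl (\<lambda>_. 1) f n \<le> A * maxl w f n" 
    unfolding a(2) using A(1) by (intro order_trans[OF av[OF a(1)]] mult_left_mono maxl_ge a) auto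
  moreover have "maxr N (\<lambda>_. 1) f n \<le> A * maxr N w f n" 
    unfolding b(3) using A(1) by (intro order_trans[OF av[OF b(1)]] mult_left_mono maxr_ge b) auto
  ultimately show ?thesis unfolding maxf_def by (simp add: distrib_left)
qed

text \<open>After exchanging sums, the inner sum is the mean of w over [0, m], and A_1 evaluated at
  the right endpoint m bounds it by A w m. The dual Hardy part is thus even of strong type on
  l^1.\<close>

lemma hardy_adj_l1:
  assumes w: "\<And>k. 0 < w k" and f: "\<And>k. 0 \<le> f k" and A: "1 \<le> A"
    "\<And>a b k. a \<le> k \<Longrightarrow> k \<le> b \<Longrightarrow> (\<Sum>k=a..b. w k) \<le> A * real (b - a + 1) * w k"
  shows "(\<Sum>n<N. hardy_adj N f n * w n) \<le> A * (\<Sum>n<N. f n * w n)"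
proof -
  have "(\<Sum>n<N. hardy_adj N f n * w n) = (\<Sum>n<N. \<Sum>m\<in>{m\<in>{..<N}. n \<le> m}. f m / (real m + 1) * w n)"
  proof (rule sum.cong)
    fix n
    have "{n..<N} = {m\<in>{..<N}. n \<le> m}" by auto
    then show "hardy_adj N f n * w n = (\<Sum>m\<in>{m\<in>{..<N}. n \<le> m}. f m / (real m + 1) * w n)"
      unfolding hardy_adj_def by (simp add: sum_distrib_right)
  qed simp
  also have "\<dots> = (\<Sum>m<N. \<Sum>n\<in>{n\<in>{..<N}. n \<le> m}. f m / (real m + 1) * w n)"
    by (rule sum.swap_restrict) auto
  also have "\<dots> \<le> (\<Sum>m<N. A * (f m * w m))"
  proof (rule sum_mono)
    fix m assume "m \<in> {..<N}"
    then have "{n\<in>{..<N}. n \<le> m} = {0..m}" by auto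
    then have "(\<Sum>n\<in>{n\<in>{..<N}. n \<le> m}. f m / (real m + 1) * w n) = f m / (real m + 1) * (\<Sum>n=0..m. w n)"
      by (simp add: sum_distrib_left)
    also have "\<dots> \<le> f m / (real m + 1) * (A * real (m - 0 + 1) * w m)"
      using f by (intro mult_left_mono A) auto
    also have "\<dots> = A * (f m * w m)" by (simp add: field_simps)
    finally show "(\<Sum>n\<in>{n\<in>{..<N}. n \<le> m}. f m / (real m + 1) * w n) \<le> A * (f m * w m)" .
  qed
  finally show ?thesis by (simp add: sum_distrib_left)
qed

theorem cz_weak:
  assumes A1: "A1_weight w" and C01: "0 \<le> C0" "0 \<le> C1" and B: "0 \<le> B"
  obtains C where "0 < C" "\<And>K f R N s. cz_kernel C0 C1 B K \<Longrightarrow> (\<And>k. R \<le> k \<Longrightarrow> f k = 0) \<Longrightarrow> 0 < s \<Longrightarrow>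
      s * (\<Sum>n\<in>{n\<in>{..<N}. s < \<bar>kop R K f n\<bar>}. w n) \<le> C * (\<Sum>n<R. \<bar>f n\<bar> * w n)"
proof -
  note w = A1_weight_pos[OF A1] note wl = less_imp_le[OF w]
  obtain A where A: "1 \<le> A" "\<And>a b k. a \<le> k \<Longrightarrow> k \<le> b \<Longrightarrow> (\<Sum>k=a..b. w k) \<le> A * real (b - a + 1) * w k"
    using A1_weight_bound[OF A1] by blast
  obtain B' where B': "0 \<le> B'" "\<And>K1 K2 f R (N::nat). (\<And>n m. \<bar>K2 n m\<bar> \<le> C1 / (real n + real m + 1)) \<Longrightarrow>
      (\<And>f R N. (\<Sum>n<N. (kop R (\<lambda>n m. K1 n m + K2 n m) f n)\<^sup>2) \<le> B * (\<Sum>n<R. (f n)\<^sup>2)) \<Longrightarrow>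
      (\<Sum>n<N. (kop R K1 f n)\<^sup>2) \<le> B' * (\<Sum>n<R. (f n)\<^sup>2)"
    using cz_l2_part[OF C01(2) B] by blast
  have two: "1 < (2::real)" by simp
  obtain D where D: "0 < D" "\<And>K f R (N::nat). hoelder_kernel C0 K \<Longrightarrow> 
      (\<And>f R N. (\<Sum>n<N. (kop R K f n)\<^sup>2) \<le> B' * (\<Sum>n<R. (f n)\<^sup>2)) \<Longrightarrow> (\<And>k. R \<le> k \<Longrightarrow> f k = 0) \<Longrightarrow>
      (\<Sum>n<N. \<bar>kop R K f n\<bar> powr 2 * w n) \<le> D * (\<Sum>n<R. \<bar>f n\<bar> powr 2 * w n)"
    using kop_strong_type[OF two A1_imp_A2[OF A1] C01(1) B'(1)] by blast
  define E where "E = 5 * A + 8 * D * A + 46 * A * C0 * (1 + A)"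
  define c where "c = C1 + 1"
  have c: "0 < c" unfolding c_def using C01 by simp
  show thesis
  proof
    have "0 \<le> E" "0 < 20 * c * A" unfolding E_def using A D C01 c by (auto intro!: add_nonneg_nonneg mult_nonneg_nonneg)
    then show "0 < 2 * E + 20 * c * A" by linarith
    fix K and f :: "nat \<Rightarrow> real" and R N :: nat and s :: real
    assume K: "cz_kernel C0 C1 B K" and fR: "\<And>k. R \<le> k \<Longrightarrow> f k = 0" and s: "0 < s"
    obtain K1 K2 where K12: "\<And>n m. K n m = K1 n m + K2 n m" "hoelder_kernel C0 K1" "\<And>n m. \<bar>K2 n m\<bar> \<le> C1 / (real n + real m + 1)"
      using K unfolding cz_kernel_def by blast
    have Keq: "K = (\<lambda>n m. K1 n m + K2 n m)" using K12(1) by blast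
    have L2: "(\<Sum>n<N. (kop R (\<lambda>n m. K1 n m + K2 n m) f n)\<^sup>2) \<le> B * (\<Sum>n<R. (f n)\<^sup>2)" for f R N
      using K unfolding cz_kernel_def Keq by blast
    have L2w: "(\<Sum>n<N. (kop R K1 f n)\<^sup>2 * w n) \<le> D * (\<Sum>n<R. (f n)\<^sup>2 * w n)" for f R and N :: nat
      using D(2)[OF K12(2) B'(2)[OF K12(3) L2], where R=R and N=N and f="\<lambda>k. if k < R then f k else 0"]
      by (simp add: kop_restrict)
    define NN where "NN = max R N"
    define F where "F k = \<bar>f k\<bar>" for k
    have F: "0 \<le> F k" for k unfolding F_def by simp
    define \<Phi> where "\<Phi> = (\<Sum>n<R. \<bar>f n\<bar> * w n)"
    have \<Phi>: "(\<Sum>n<NN. F n * w n) = \<Phi>"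
      unfolding \<Phi>_def F_def NN_def using fR by (intro sum_lessThan_extend) auto
    define X where "X = {n\<in>{..<NN}. s / 2 < \<bar>kop R K1 f n\<bar>}"
    \<comment> \<open>The levels leave s / 4 each to the maximal part and to the dual Hardy part of
      K2, after \<open>hl_le_maxf\<close> costs A and the kernel bound costs c; the other s / 2
      belongs to K1.\<close>
    define Y where "Y = {n\<in>{..<NN}. s / (4 * c * A) < maxf NN w F n}"
    define Z where "Z = {n\<in>{..<NN}. s / (4 * c) < hardy_adj NN F n}"
    have 1: "s * (\<Sum>n\<in>X. w n) \<le> 2 * E * \<Phi>"
    proof -
      have "s / 2 * (\<Sum>n\<in>X. w n) \<le> E * \<Phi>"
        unfolding X_def E_def \<Phi>_def using s D(1) C01
        by (intro kop_weak_type[OF _ _ w A(2) K12(2) L2w fR]) auto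
      then show ?thesis by simp
    qed
    have 2: "s * (\<Sum>n\<in>Y. w n) \<le> 16 * c * A * \<Phi>"
    proof -
      have "s / (4 * c * A) * (\<Sum>n\<in>Y. w n) \<le> 4 * \<Phi>"
        unfolding Y_def \<Phi>[symmetric] using s c A w F by (intro maxf_weak) auto
      then show ?thesis using c A by (simp add: field_simps)
    qed
    have 3: "s * (\<Sum>n\<in>Z. w n) \<le> 4 * c * A * \<Phi>"
    proof -
      have "s / (4 * c) * (\<Sum>n\<in>Z. w n) \<le> (\<Sum>n\<in>Z. hardy_adj NN F n * w n)"
        unfolding sum_distrib_left by (intro sum_mono mult_right_mono wl) (auto simp: Z_def)
      also have "\<dots> \<le> (\<Sum>n<NN. hardy_adj NN F n * w n)"
        unfolding Z_def using wl F by (intro sum_mono2 mult_nonneg_nonneg hardy_adj_nonneg) auto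
      also have "\<dots> \<le> A * \<Phi>" unfolding \<Phi>[symmetric] by (intro hardy_adj_l1 w F A)
      finally show ?thesis using c by (simp add: field_simps)
    qed
    have "{n\<in>{..<N}. s < \<bar>kop R K f n\<bar>} \<subseteq> X \<union> Y \<union> Z"
    proof
      fix n assume n: "n \<in> {n\<in>{..<N}. s < \<bar>kop R K f n\<bar>}"
      then have nN: "n < NN" unfolding NN_def by auto
      show "n \<in> X \<union> Y \<union> Z"
      proof (rule ccontr)
        assume "n \<notin> X \<union> Y \<union> Z"
        then have H: "\<bar>kop R K1 f n\<bar> \<le> s / 2" "maxf NN w F n \<le> s / (4 * c * A)" "hardy_adj NN F n \<le> s / (4 * c)"
          using nN unfolding X_def Y_def Z_def by auto
        have "hl NN F n \<le> A * maxf NN w F n" by (rule hl_le_maxf[OF w F A nN])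
        also have "\<dots> \<le> A * (s / (4 * c * A))" using H A by (intro mult_left_mono) auto
        also have "\<dots> = s / (4 * c)" using A by simp
        finally have h: "hl NN F n \<le> s / (4 * c)" .
        have "\<bar>kop R K2 f n\<bar> \<le> C1 * (hl NN F n + hardy_adj NN F n)"
          unfolding F_def by (rule hardy_kernel_bound[OF C01(2) K12(3) nN _ fR]) (simp_all add: NN_def)
        also have "\<dots> \<le> C1 * (s / (4 * c) + s / (4 * c))" using h H C01 by (intro mult_left_mono add_mono) auto
        also have "\<dots> \<le> c * (s / (4 * c) + s / (4 * c))" unfolding c_def using s C01 by (intro mult_right_mono) auto
        also have "\<dots> = s / 2" using c by (simp add: field_simps)
        finally have "\<bar>kop R K f n\<bar> \<le> s" using H(1) unfolding Keq kop_add by linarith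
        then show False using n by simp
      qed
    qed
    then have "(\<Sum>n\<in>{n\<in>{..<N}. s < \<bar>kop R K f n\<bar>}. w n) \<le> (\<Sum>n\<in>X \<union> Y \<union> Z. w n)"
      using wl by (intro sum_mono2) (auto simp: X_def Y_def Z_def)
    also have "\<dots> \<le> (\<Sum>n\<in>X. w n) + (\<Sum>n\<in>Y. w n) + (\<Sum>n\<in>Z. w n)"
    proof -
      have un: "(\<Sum>n\<in>U \<union> V. w n) \<le> (\<Sum>n\<in>U. w n) + (\<Sum>n\<in>V. w n)" if "finite U" "finite V" for U V
        using that wl by (subst sum_Un) (auto intro!: sum_nonneg)
      have fin: "finite X" "finite Y" "finite Z" unfolding X_def Y_def Z_def by auto
      show ?thesis using un[of "X \<union> Y" Z] un[of X Y] fin by auto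
    qed
    finally have "s * (\<Sum>n\<in>{n\<in>{..<N}. s < \<bar>kop R K f n\<bar>}. w n)
        \<le> s * ((\<Sum>n\<in>X. w n) + (\<Sum>n\<in>Y. w n) + (\<Sum>n\<in>Z. w n))" using s by (intro mult_left_mono) auto
    then show "s * (\<Sum>n\<in>{n\<in>{..<N}. s < \<bar>kop R K f n\<bar>}. w n) \<le> (2 * E + 20 * c * A) * (\<Sum>n<R. \<bar>f n\<bar> * w n)"
      using 1 2 3 unfolding \<Phi>_def[symmetric] by (simp add: distrib_left distrib_right)
  qed
qed

section \<open>Lacunary differences of the heat semigroup\<close>

lemma exp_minus_linear_bound:
  fixes z :: real
  assumes "\<bar>z\<bar> \<le> 1"
  shows "\<bar>exp z - 1 - z\<bar> \<le> z\<^sup>2"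
proof -
  have "1 + z \<le> exp z" by (rule exp_ge_add_one_self)
  moreover have "exp z \<le> 1 + z + z\<^sup>2"
  proof (cases "0 \<le> z")
    case True
    then show ?thesis using assms exp_bound[of z] by simp
  next
    case False
    define w where "w = - z"
    have w: "0 \<le> w" "w \<le> 1" unfolding w_def using False assms by auto
    have "exp z = 1 / exp w" unfolding w_def by (simp add: exp_minus field_simps)
    also have "\<dots> \<le> 1 / (1 + w)" using w by (intro divide_left_mono exp_ge_add_one_self) auto
    also have "\<dots> \<le> 1 - w + w\<^sup>2"
    proof -
      have "(1 - w + w\<^sup>2) * (1 + w) = 1 + w ^ 3" by (simp add: algebra_simps power2_eq_square power3_eq_cube)
      then have "1 \<le> (1 - w + w\<^sup>2) * (1 + w)" using w by simp
      then show ?thesis using w by (simp add: divide_le_eq)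
    qed
    finally show ?thesis unfolding w_def by simp
  qed
  moreover have "0 \<le> z\<^sup>2" by simp
  ultimately show ?thesis by linarith
qed

context jacobi_half
begin

abbreviation "hk \<equiv> jacobi_heat_kernel al be"

lemma hk_eq: "hk t n m = J (\<lambda>x. exp (- t * (1 - x)) * (p n x * p m x))"
  unfolding jacobi_heat_kernel_def jint_def by (simp add: mult_ac)

lemma hk_sym: "hk t n m = hk t m n"
  unfolding hk_eq by (simp add: mult_ac)

text \<open>Differentiation under the integral by a direct second-order estimate: 1 - x is at most
  2, so |h| \<le> 1/2 keeps the exponent in the range of \<open>exp_minus_linear_bound\<close> and
  the remainder is O(h^2). It holds for t = 0 too, where \<open>hk_decay\<close> starts.\<close>

lemma hk_deriv: "((\<lambda>t. hk t n m) has_real_derivative - ker t n m) (at t)"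
proof -
  define K where "K = J (\<lambda>x. 4 * exp (- t * (1 - x)) * \<bar>p n x * p m x\<bar>)"
  have K: "0 \<le> K" unfolding K_def by (intro jint_nonneg continuous_intros) auto
  have main: "\<bar>hk (t + h) n m - hk t n m + h * ker t n m\<bar> \<le> h\<^sup>2 * K" if h: "\<bar>h\<bar> \<le> 1 / 2" for h
  proof -
    have eq: "hk (t + h) n m - hk t n m + h * ker t n m
       = J (\<lambda>x. (exp (- (t + h) * (1 - x)) * (p n x * p m x) - exp (- t * (1 - x)) * (p n x * p m x))
            + h * ((1 - x) * exp (- t * (1 - x)) * (p n x * p m x)))"
    proof -
      have c: "continuous_on {-1..1} (\<lambda>x. exp (- u * (1 - x)) * (p n x * p m x))"
        "continuous_on {-1..1} (\<lambda>x. h * ((1 - x) * exp (- t * (1 - x)) * (p n x * p m x)))" for u :: real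
        by (intro continuous_intros)+
      show ?thesis unfolding jint_add[OF continuous_on_diff[OF c(1) c(1)] c(2)] jint_diff[OF c(1) c(1)] jint_cmult hk_eq ker_def ..
    qed
    have "\<bar>hk (t + h) n m - hk t n m + h * ker t n m\<bar> \<le> J (\<lambda>x. h\<^sup>2 * (4 * exp (- t * (1 - x)) * \<bar>p n x * p m x\<bar>))"
    unfolding eq
    proof (rule jint_abs)
      fix x :: real assume x: "-1 < x" "x < 1"
      define y where "y = 1 - x"
      have y: "0 \<le> y" "y \<le> 2" unfolding y_def using x by auto
      have hy: "\<bar>- h * y\<bar> \<le> 1" unfolding abs_mult using mult_mono[OF h y(2)] y by simp
      have "(exp (- (t + h) * y) * (p n x * p m x) - exp (- t * y) * (p n x * p m x)) + h * (y * exp (- t * y) * (p n x * p m x))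
          = exp (- t * y) * (p n x * p m x) * (exp (- h * y) - 1 - (- h * y))"
        by (simp add: algebra_simps exp_add[symmetric])
      then have "\<bar>(exp (- (t + h) * y) * (p n x * p m x) - exp (- t * y) * (p n x * p m x)) + h * (y * exp (- t * y) * (p n x * p m x))\<bar>
          = exp (- t * y) * \<bar>p n x * p m x\<bar> * \<bar>exp (- h * y) - 1 - (- h * y)\<bar>" by (simp only: abs_mult abs_exp_cancel)
      also have "\<dots> \<le> exp (- t * y) * \<bar>p n x * p m x\<bar> * (h\<^sup>2 * 4)"
      proof (intro mult_left_mono)
        have "\<bar>exp (- h * y) - 1 - (- h * y)\<bar> \<le> (- h * y)\<^sup>2" by (rule exp_minus_linear_bound[OF hy])
        also have "\<dots> = h\<^sup>2 * y\<^sup>2" by (simp add: power_mult_distrib)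
        also have "\<dots> \<le> h\<^sup>2 * 2\<^sup>2" using y by (intro mult_left_mono power_mono) auto
        finally show "\<bar>exp (- h * y) - 1 - (- h * y)\<bar> \<le> h\<^sup>2 * 4" by simp
      qed auto
      finally show "\<bar>exp (- (t + h) * (1 - x)) * (p n x * p m x) - exp (- t * (1 - x)) * (p n x * p m x)
            + h * ((1 - x) * exp (- t * (1 - x)) * (p n x * p m x))\<bar> \<le> h\<^sup>2 * (4 * exp (- t * (1 - x)) * \<bar>p n x * p m x\<bar>)"
        unfolding y_def by (simp add: mult_ac)
    qed (intro continuous_intros)+
    also have "\<dots> = h\<^sup>2 * K" unfolding K_def by (rule jint_cmult)
    finally show ?thesis .
  qed
  have "((\<lambda>h. (hk (t + h) n m - hk t n m) / h - (- ker t n m)) \<longlongrightarrow> 0) (at 0)"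
  proof (rule tendsto_0_le[where K=K])
    show "((\<lambda>h::real. h) \<longlongrightarrow> 0) (at 0)" by (rule tendsto_ident_at)
    show "\<forall>\<^sub>F h in at 0. norm ((hk (t + h) n m - hk t n m) / h - (- ker t n m)) \<le> norm h * K"
      unfolding eventually_at
    proof (intro exI[of _ "1/2"] conjI ballI impI)
      fix h :: real assume h: "h \<noteq> 0 \<and> dist h 0 < 1 / 2"
      have eq: "(hk (t + h) n m - hk t n m) / h - (- ker t n m) = (hk (t + h) n m - hk t n m + h * ker t n m) / h"
        using h by (simp add: field_simps)
      have "\<bar>(hk (t + h) n m - hk t n m) / h - (- ker t n m)\<bar> \<le> h\<^sup>2 * K / \<bar>h\<bar>"
        unfolding eq
        unfolding abs_divide using h main[of h] by (intro divide_right_mono) auto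
      also have "\<dots> = \<bar>h\<bar> * K" using h by (simp add: power2_eq_square field_simps abs_if)
      finally show "norm ((hk (t + h) n m - hk t n m) / h - (- ker t n m)) \<le> norm h * K" by simp
    qed auto
  qed
  then show ?thesis unfolding DERIV_def by (subst (asm) LIM_zero_iff)
qed

end

lemma sum_int_telescope:
  fixes g :: "int \<Rightarrow> real"
  assumes "N1 \<le> N2"
  shows "(\<Sum>j\<in>{N1..N2}. g (j + 1) - g j) = g (N2 + 1) - g N1"
  using assms
proof (induction N2 rule: int_ge_induct)
  case (step i)
  have "{N1..i + 1} = insert (i + 1) {N1..i}" using step by auto
  then show ?case using step by simp
qed simp

text \<open>Both \<Psi> - \<phi> and \<Psi> + \<phi> are nondecreasing, so increments of \<phi> are
  dominated by those of \<Psi>. The latter telescope along a, and the bound does not see the number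
  of terms.\<close>

lemma lacunary_sum_bound:
  fixes a b :: "int \<Rightarrow> real" and \<phi> \<Psi> :: "real \<Rightarrow> real"
  assumes a: "\<And>j. 0 < a j" "\<And>j. a j \<le> a (j + 1)" and b: "\<And>j. \<bar>b j\<bar> \<le> B" and N: "N1 \<le> N2"
    and \<phi>: "\<And>t. 0 < t \<Longrightarrow> (\<phi> has_real_derivative \<phi>' t) (at t)"
    and \<Psi>: "\<And>t. 0 < t \<Longrightarrow> (\<Psi> has_real_derivative \<Psi>' t) (at t)"
    and le: "\<And>t. 0 < t \<Longrightarrow> \<bar>\<phi>' t\<bar> \<le> \<Psi>' t"
    and M: "\<And>s t. 0 < s \<Longrightarrow> 0 < t \<Longrightarrow> \<Psi> t - \<Psi> s \<le> M"
  shows "\<bar>\<Sum>j\<in>{N1..N2}. b j * (\<phi> (a (j + 1)) - \<phi> (a j))\<bar> \<le> B * M"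
proof -
  have B: "0 \<le> B" using b[of 0] by linarith
  have var: "\<bar>\<phi> t - \<phi> s\<bar> \<le> \<Psi> t - \<Psi> s" if st: "0 < s" "s \<le> t" for s t
  proof -
    have "\<Psi> s - \<phi> s \<le> \<Psi> t - \<phi> t"
    proof (rule DERIV_nonneg_imp_nondecreasing[OF st(2)])
      fix x assume "s \<le> x" "x \<le> t"
      then have x: "0 < x" using st by simp
      show "\<exists>y. ((\<lambda>x. \<Psi> x - \<phi> x) has_real_derivative y) (at x) \<and> 0 \<le> y"
        using DERIV_diff[OF \<Psi>[OF x] \<phi>[OF x]] le[OF x] by (intro exI[of _ "\<Psi>' x - \<phi>' x"]) auto
    qed
    moreover have "\<Psi> s + \<phi> s \<le> \<Psi> t + \<phi> t"
    proof (rule DERIV_nonneg_imp_nondecreasing[OF st(2)])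
      fix x assume "s \<le> x" "x \<le> t"
      then have x: "0 < x" using st by simp
      show "\<exists>y. ((\<lambda>x. \<Psi> x + \<phi> x) has_real_derivative y) (at x) \<and> 0 \<le> y"
        using DERIV_add[OF \<Psi>[OF x] \<phi>[OF x]] le[OF x] by (intro exI[of _ "\<Psi>' x + \<phi>' x"]) auto
    qed
    ultimately show ?thesis by linarith
  qed
  have "\<bar>\<Sum>j\<in>{N1..N2}. b j * (\<phi> (a (j + 1)) - \<phi> (a j))\<bar> \<le> (\<Sum>j\<in>{N1..N2}. B * (\<Psi> (a (j + 1)) - \<Psi> (a j)))"
  proof (intro order_trans[OF sum_abs] sum_mono)
    fix j
    show "\<bar>b j * (\<phi> (a (j + 1)) - \<phi> (a j))\<bar> \<le> B * (\<Psi> (a (j + 1)) - \<Psi> (a j))"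
      unfolding abs_mult using var[OF a(1) a(2)] b B by (intro mult_mono) auto
  qed
  also have "\<dots> = B * (\<Psi> (a (N2 + 1)) - \<Psi> (a N1))"
    unfolding sum_distrib_left[symmetric] by (subst sum_int_telescope[OF N, of "\<lambda>j. \<Psi> (a j)"]) simp
  also have "\<dots> \<le> B * M" using a M B by (intro mult_left_mono) auto
  finally show ?thesis .
qed

section \<open>The kernel of the lacunary sums: size and regularity\<close>

context jacobi_half
begin

definition TK :: "(int \<Rightarrow> real) \<Rightarrow> (int \<Rightarrow> real) \<Rightarrow> int \<Rightarrow> int \<Rightarrow> nat \<Rightarrow> nat \<Rightarrow> real" where
  "TK a b N1 N2 n m = (\<Sum>j\<in>{N1..N2}. b j * (hk (a (j + 1)) n m - hk (a j) n m))"

lemma TK_sym: "TK a b N1 N2 n m = TK a b N1 N2 m n"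
  unfolding TK_def by (simp add: hk_sym[of _ n m])

lemma TK_size:
  obtains C where "0 < C" "\<And>a b B N1 N2 n m. (\<And>j. 0 < a j) \<Longrightarrow> (\<And>j. a j \<le> a (j + 1)) \<Longrightarrow> (\<And>j. \<bar>b j\<bar> \<le> B) \<Longrightarrow> N1 \<le> N2 \<Longrightarrow>
     n \<noteq> m \<Longrightarrow> \<bar>TK a b N1 N2 n m\<bar> \<le> B * C / \<bar>real n - real m\<bar>"
proof -
  obtain C where C: "0 < C" "\<And>t n m. 0 < t \<Longrightarrow> \<bar>ker t n m\<bar> * (t + (real n - real m)\<^sup>2) \<le> C / sqrt t"
    using ker_size by blast
  show thesis
  proof
    show "0 < C * pi * 2" using C by simp
    fix a b :: "int \<Rightarrow> real" and B :: real and N1 N2 :: int and n m :: nat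
    assume a: "\<And>j. 0 < a j" "\<And>j. a j \<le> a (j + 1)" and b: "\<And>j. \<bar>b j\<bar> \<le> B" and N: "N1 \<le> N2" and nm: "n \<noteq> m"
    define d where "d = \<bar>real n - real m\<bar>"
    have d: "0 < d" unfolding d_def using nm by simp
    \<comment> \<open>A primitive of C / (sqrt t (t + d^2)), the bound from \<open>ker_size\<close>.
      The arctangent ranges over an interval of length pi, so the variation is at most 2 pi C /
      d.\<close>
    define \<Psi> where "\<Psi> t = 2 * C / d * arctan (sqrt t / d)" for t
    have "\<bar>\<Sum>j\<in>{N1..N2}. b j * (hk (a (j + 1)) n m - hk (a j) n m)\<bar> \<le> B * (C * pi * 2 / d)"
    proof (rule lacunary_sum_bound[where a=a and b=b and \<phi>="\<lambda>t. hk t n m" and \<Psi>=\<Psi>, OF a b N])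
      fix t :: real assume t: "0 < t"
      show "((\<lambda>t. hk t n m) has_real_derivative - ker t n m) (at t)" by (rule hk_deriv)
      have "((\<lambda>t. sqrt t / d) has_real_derivative inverse (sqrt t) / 2 / d) (at t)"
        by (intro DERIV_cdivide DERIV_real_sqrt t)
      from DERIV_cmult[OF DERIV_chain2[OF DERIV_arctan this], of "2 * C / d"]
      show "(\<Psi> has_real_derivative 2 * C / d * (inverse (1 + (sqrt t / d)\<^sup>2) * (inverse (sqrt t) / 2 / d))) (at t)"
        unfolding \<Psi>_def[abs_def] .
      have pos: "0 < t + d\<^sup>2" using t by (simp add: add_pos_nonneg)
      have "2 * C / d * (inverse (1 + (sqrt t / d)\<^sup>2) * (inverse (sqrt t) / 2 / d)) = C / sqrt t / (t + d\<^sup>2)"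
      proof -
        have "1 + (sqrt t / d)\<^sup>2 = (t + d\<^sup>2) / d\<^sup>2" using t d by (simp add: power_divide field_simps)
        then have e: "inverse (1 + (sqrt t / d)\<^sup>2) = d\<^sup>2 / (t + d\<^sup>2)" by (simp add: inverse_eq_divide)
        show ?thesis unfolding e using d t by (simp add: power2_eq_square inverse_eq_divide)
      qed
      moreover have "\<bar>ker t n m\<bar> \<le> C / sqrt t / (t + d\<^sup>2)"
      proof -
        have "\<bar>ker t n m\<bar> * (t + d\<^sup>2) \<le> C / sqrt t" using C(2)[OF t, of n m] unfolding d_def by simp
        then show ?thesis using pos by (simp only: pos_le_divide_eq)
      qed
      ultimately show "\<bar>- ker t n m\<bar> \<le> 2 * C / d * (inverse (1 + (sqrt t / d)\<^sup>2) * (inverse (sqrt t) / 2 / d))" by simp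
    next
      fix s t :: real assume st: "0 < s" "0 < t"
      have "arctan (sqrt t / d) - arctan (sqrt s / d) \<le> pi"
        using arctan_ubound[of "sqrt t / d"] arctan_lbound[of "sqrt s / d"] by linarith
      then have "2 * C / d * (arctan (sqrt t / d) - arctan (sqrt s / d)) \<le> 2 * C / d * pi"
        using C d by (intro mult_left_mono) auto
      then show "\<Psi> t - \<Psi> s \<le> C * pi * 2 / d" unfolding \<Psi>_def by (simp add: algebra_simps)
    qed
    then show "\<bar>TK a b N1 N2 n m\<bar> \<le> B * (C * pi * 2) / \<bar>real n - real m\<bar>"
      unfolding TK_def d_def by simp
  qed
qed

text \<open>Unit steps along a segment that stays at distance at least d / 2 from m. The factor 16
  is 4 * 4: once for comparing t + (d/2)^2 with t + d^2, once for 1 / i \<le> 4 / d.\<close>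

lemma ker_range_diff:
  assumes C: "0 < C" "\<And>t n m. 0 < t \<Longrightarrow> 1 \<le> n \<Longrightarrow> n \<noteq> m \<Longrightarrow>
     \<bar>ker t (Suc n) m - ker t n m\<bar> * (t + (real n + 1 - real m)\<^sup>2) \<le> C / sqrt t * (1 / sqrt t + 1 / real n)"
    and t: "0 < t" and lo: "1 \<le> lo" "d \<le> 4 * real lo" and d: "0 < d"
    and far: "\<And>i. lo \<le> i \<Longrightarrow> i \<le> lo + r \<Longrightarrow> d / 2 \<le> \<bar>real i - real m\<bar>"
  shows "\<bar>ker t (lo + r) m - ker t lo m\<bar> \<le> real r * (16 * C / (sqrt t * (t + d\<^sup>2)) * (1 / sqrt t + 1 / d))"
  using far
proof (induction r)
  case (Suc r)
  define i where "i = lo + r"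
  have i: "lo \<le> i" "i \<le> lo + Suc r" "Suc i \<le> lo + Suc r" unfolding i_def by auto
  have pos: "0 < t + d\<^sup>2" using t by (simp add: add_pos_nonneg)
  have im: "i \<noteq> m" using Suc.prems[OF i(1,2)] d by auto
  have "d / 2 \<le> \<bar>real i + 1 - real m\<bar>" using Suc.prems[of "Suc i"] i by (simp add: add_ac)
  then have "(d / 2)\<^sup>2 \<le> \<bar>real i + 1 - real m\<bar>\<^sup>2" using d by (intro power_mono) auto
  then have q: "(t + d\<^sup>2) / 4 \<le> t + (real i + 1 - real m)\<^sup>2" using t by (simp add: power_divide)
  have "\<bar>ker t (Suc i) m - ker t i m\<bar> * ((t + d\<^sup>2) / 4) \<le> \<bar>ker t (Suc i) m - ker t i m\<bar> * (t + (real i + 1 - real m)\<^sup>2)"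
    using q by (intro mult_left_mono) auto
  also have "\<dots> \<le> C / sqrt t * (1 / sqrt t + 1 / real i)" using t lo i im by (intro C) auto
  also have "\<dots> \<le> C / sqrt t * (4 * (1 / sqrt t + 1 / d))"
  proof (intro mult_left_mono)
    have "d \<le> 4 * real i" using lo i by simp
    then have "1 / real i \<le> 4 / d" using d lo i by (simp add: field_simps)
    moreover have "1 / sqrt t \<le> 4 / sqrt t" using t by (intro divide_right_mono) auto
    ultimately show "1 / sqrt t + 1 / real i \<le> 4 * (1 / sqrt t + 1 / d)" by (simp add: distrib_left)
  qed (use C(1) t in auto)
  finally have "\<bar>ker t (Suc i) m - ker t i m\<bar> \<le> C / sqrt t * (4 * (1 / sqrt t + 1 / d)) / ((t + d\<^sup>2) / 4)"
    using pos by (simp only: pos_le_divide_eq divide_pos_pos zero_less_numeral)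
  also have "\<dots> = 16 * C / (sqrt t * (t + d\<^sup>2)) * (1 / sqrt t + 1 / d)" by simp
  finally have one: "\<bar>ker t (Suc i) m - ker t i m\<bar> \<le> 16 * C / (sqrt t * (t + d\<^sup>2)) * (1 / sqrt t + 1 / d)" .
  have IH: "\<bar>ker t i m - ker t lo m\<bar> \<le> real r * (16 * C / (sqrt t * (t + d\<^sup>2)) * (1 / sqrt t + 1 / d))"
    unfolding i_def using Suc.prems by (intro Suc.IH) auto
  have "\<bar>ker t (Suc i) m - ker t lo m\<bar> \<le> \<bar>ker t (Suc i) m - ker t i m\<bar> + \<bar>ker t i m - ker t lo m\<bar>" by linarith
  also have "\<dots> \<le> real (Suc r) * (16 * C / (sqrt t * (t + d\<^sup>2)) * (1 / sqrt t + 1 / d))"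
    using add_mono[OF one IH] by (simp only: of_nat_Suc distrib_right mult_1_left)
  finally show ?case unfolding i_def by simp
qed simp

text \<open>The geometric mean of two bounds on the same difference: the sizes of both kernels, 5 A
  together, and |n - n'| unit steps with constant 16 C. Taking the square root makes the singularity
  at t = 0 integrable and leaves the power 1/2 of |n - n'|.\<close>

lemma ker_hoelder:
  obtains C where "0 < C" "\<And>t n n' m. 0 < t \<Longrightarrow> n \<noteq> n' \<Longrightarrow> 2 * \<bar>real n - real n'\<bar> \<le> \<bar>real n - real m\<bar> \<Longrightarrow>
     1 \<le> min n n' \<Longrightarrow> \<bar>real n - real m\<bar> \<le> 4 * real (min n n') \<Longrightarrow>
     \<bar>ker t n m - ker t n' m\<bar> \<le> C * sqrt \<bar>real n - real n'\<bar> * 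
       (sqrt (1 / sqrt t + 1 / \<bar>real n - real m\<bar>) / (sqrt t * (t + (real n - real m)\<^sup>2)))"
proof -
  obtain C2 where C2: "0 < C2" "\<And>t n m. 0 < t \<Longrightarrow> \<bar>ker t n m\<bar> * (t + (real n - real m)\<^sup>2) \<le> C2 / sqrt t"
    using ker_size by blast
  obtain C where C: "0 < C" "\<And>t n m. 0 < t \<Longrightarrow> 1 \<le> n \<Longrightarrow> n \<noteq> m \<Longrightarrow>
     \<bar>ker t (Suc n) m - ker t n m\<bar> * (t + (real n + 1 - real m)\<^sup>2) \<le> C / sqrt t * (1 / sqrt t + 1 / real n)"
    using unit_diff by blast
  show thesis
  proof
    show "0 < sqrt (80 * C2 * C)" using C C2 by simp
    fix t :: real and n n' m :: nat
    assume t: "0 < t" and nn: "n \<noteq> n'" and far: "2 * \<bar>real n - real n'\<bar> \<le> \<bar>real n - real m\<bar>"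
      and lo: "1 \<le> min n n'" "\<bar>real n - real m\<bar> \<le> 4 * real (min n n')"
    define d where "d = \<bar>real n - real m\<bar>"
    define r where "r = \<bar>real n - real n'\<bar>"
    have r: "0 < r" "2 * r \<le> d" unfolding r_def d_def using nn far by auto
    have d: "0 < d" using r by linarith
    define q where "q = t + d\<^sup>2"
    have q: "0 < q" unfolding q_def using t by (simp add: add_pos_nonneg)
    define A where "A = C2 / (sqrt t * q)"
    have st: "0 < sqrt t" using t by simp
    have k1: "\<bar>ker t n m\<bar> \<le> A"
    proof -
      have "\<bar>ker t n m\<bar> * q \<le> C2 / sqrt t" using C2(2)[OF t, of n m] unfolding q_def d_def by simp
      then have "\<bar>ker t n m\<bar> \<le> C2 / sqrt t / q" using q by (simp only: pos_le_divide_eq)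
      then show ?thesis unfolding A_def by simp
    qed
    have k2: "\<bar>ker t n' m\<bar> \<le> 4 * A"
    proof -
      have "d / 2 \<le> \<bar>real n' - real m\<bar>" using far unfolding d_def by (simp add: abs_if split: if_splits)
      then have "(d / 2)\<^sup>2 \<le> \<bar>real n' - real m\<bar>\<^sup>2" using d by (intro power_mono) auto
      then have "q / 4 \<le> t + (real n' - real m)\<^sup>2" unfolding q_def using t by (simp add: power_divide)
      then have "\<bar>ker t n' m\<bar> * (q / 4) \<le> \<bar>ker t n' m\<bar> * (t + (real n' - real m)\<^sup>2)" by (intro mult_left_mono) auto
      also have "\<dots> \<le> C2 / sqrt t" by (rule C2(2)[OF t])
      finally have "\<bar>ker t n' m\<bar> \<le> C2 / sqrt t / (q / 4)" using q by (simp only: pos_le_divide_eq divide_pos_pos zero_less_numeral)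
      then show ?thesis unfolding A_def by (simp add: mult.commute)
    qed
    define z where "z = \<bar>ker t n m - ker t n' m\<bar>"
    have z1: "z \<le> 5 * A" unfolding z_def using k1 k2 by linarith
    define \<beta> where "\<beta> = 1 / sqrt t + 1 / d"
    have \<beta>: "0 < \<beta>" unfolding \<beta>_def using st d by (auto intro: add_pos_pos)
    have z2: "z \<le> r * (16 * C / (sqrt t * q) * \<beta>)"
    proof -
      define lo hi where "lo = min n n'" and "hi = max n n'"
      have hi: "hi = lo + (hi - lo)" "real (hi - lo) = r" unfolding lo_def hi_def r_def by (auto simp: min_def max_def)
      have "\<bar>ker t (lo + (hi - lo)) m - ker t lo m\<bar> \<le> real (hi - lo) * (16 * C / (sqrt t * (t + d\<^sup>2)) * (1 / sqrt t + 1 / d))"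
      proof (rule ker_range_diff[OF C t _ _ d])
        show "1 \<le> lo" "d \<le> 4 * real lo" unfolding lo_def d_def using lo by auto
        fix i assume "lo \<le> i" "i \<le> lo + (hi - lo)"
        then have "min (real n) (real n') \<le> real i" "real i \<le> max (real n) (real n')"
        unfolding lo_def hi_def by (auto simp: min_def max_def split: if_splits)
      then have "\<bar>real i - real n\<bar> \<le> r" unfolding r_def by (simp add: abs_if min_def max_def split: if_splits)
        then have "\<bar>real i - real n\<bar> + d / 2 \<le> d" using r by simp
        moreover have "d \<le> \<bar>real i - real n\<bar> + \<bar>real i - real m\<bar>" unfolding d_def by linarith
        ultimately show "d / 2 \<le> \<bar>real i - real m\<bar>" by linarith
      qed
      then have "\<bar>ker t hi m - ker t lo m\<bar> \<le> r * (16 * C / (sqrt t * q) * \<beta>)" unfolding hi(1)[symmetric] hi(2) q_def \<beta>_def .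
      moreover have "\<bar>ker t hi m - ker t lo m\<bar> = z" unfolding hi_def lo_def z_def by (auto simp: min_def max_def)
      ultimately show ?thesis by simp
    qed
    have "z\<^sup>2 \<le> (5 * A) * (r * (16 * C / (sqrt t * q) * \<beta>))"
      unfolding power2_eq_square using order_trans[OF abs_ge_zero k1] by (intro mult_mono z1 z2) (simp_all add: z_def)
    also have "\<dots> = (80 * C2 * C) * r * \<beta> / (sqrt t * q)\<^sup>2" unfolding A_def by (simp add: power2_eq_square)
    finally have "sqrt (z\<^sup>2) \<le> sqrt ((80 * C2 * C) * r * \<beta> / (sqrt t * q)\<^sup>2)" by (rule real_sqrt_le_mono)
    also have "\<dots> = sqrt (80 * C2 * C) * sqrt r * (sqrt \<beta> / (sqrt t * q))"
      using st q by (simp only: real_sqrt_divide real_sqrt_mult real_sqrt_abs abs_mult) simp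
    finally have "z \<le> sqrt (80 * C2 * C) * sqrt r * (sqrt \<beta> / (sqrt t * q))" unfolding z_def by simp
    then show "\<bar>ker t n m - ker t n' m\<bar> \<le> sqrt (80 * C2 * C) * sqrt \<bar>real n - real n'\<bar> * 
       (sqrt (1 / sqrt t + 1 / \<bar>real n - real m\<bar>) / (sqrt t * (t + (real n - real m)\<^sup>2)))"
      unfolding z_def r_def \<beta>_def q_def d_def by simp
  qed
qed

end

text \<open>With q the fourth root of t and e = sqrt d, the t-derivative of arctan (q / e) is e / (4
  q^3 (e^2 + q^2)). The claim then reduces to (q + e) e (e^2 + q^2) \<le> 3 (q^4 + e^4), and
  homogeneity dictates the prefactor d^(-3/2).\<close>

lemma arctan_fourth_root:
  fixes t d :: real
  assumes t: "0 < t" and d: "0 < d"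
  shows "\<exists>D. ((\<lambda>t. arctan (sqrt (sqrt t) / sqrt d)) has_real_derivative D) (at t) \<and>
    sqrt (1 / sqrt t + 1 / d) / (sqrt t * (t + d\<^sup>2)) \<le> 12 / (d * sqrt d) * D"
proof -
  define q e where "q = sqrt (sqrt t)" and "e = sqrt d"
  have qe: "0 < q" "0 < e" "sqrt t = q\<^sup>2" "d = e\<^sup>2" unfolding q_def e_def using t d by auto
  have t4: "t = q ^ 4"
  proof -
    have "t = (sqrt t)\<^sup>2" using t by simp
    then show ?thesis unfolding qe(3) by (simp add: power_mult[symmetric])
  qed
  define D where "D = inverse (1 + (q / e)\<^sup>2) * (inverse q / 2 * (inverse (sqrt t) / 2) / e)"
  have "((\<lambda>t. sqrt (sqrt t)) has_real_derivative inverse q / 2 * (inverse (sqrt t) / 2)) (at t)"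
    unfolding q_def using t by (intro DERIV_chain2[where f=sqrt and g=sqrt] DERIV_real_sqrt) auto
  then have "((\<lambda>t. sqrt (sqrt t) / e) has_real_derivative inverse q / 2 * (inverse (sqrt t) / 2) / e) (at t)"
    by (rule DERIV_cdivide)
  from DERIV_chain2[OF DERIV_arctan this]
  have 1: "((\<lambda>t. arctan (sqrt (sqrt t) / sqrt d)) has_real_derivative D) (at t)"
    unfolding D_def q_def e_def .
  have D: "D = e / (4 * q ^ 3 * (e\<^sup>2 + q\<^sup>2))"
  proof -
    have "1 + (q / e)\<^sup>2 = (e\<^sup>2 + q\<^sup>2) / e\<^sup>2" using qe by (simp add: power_divide field_simps)
    then have i: "inverse (1 + (q / e)\<^sup>2) = e\<^sup>2 / (e\<^sup>2 + q\<^sup>2)" by (simp add: inverse_eq_divide)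
    show ?thesis unfolding D_def i qe(3) using qe(1,2)
      by (simp add: inverse_eq_divide power2_eq_square power3_eq_cube)
  qed
  have "sqrt (1 / sqrt t + 1 / d) \<le> 1 / q + 1 / e"
  proof (rule real_le_lsqrt)
    have "1 / sqrt t + 1 / d = (1 / q)\<^sup>2 + (1 / e)\<^sup>2" unfolding qe(3,4) by (simp add: power_divide)
    also have "\<dots> \<le> (1 / q + 1 / e)\<^sup>2" using qe by (simp add: power2_sum)
    finally show "1 / sqrt t + 1 / d \<le> (1 / q + 1 / e)\<^sup>2" .
  qed (use qe in auto)
  then have "sqrt (1 / sqrt t + 1 / d) / (sqrt t * (t + d\<^sup>2)) \<le> (1 / q + 1 / e) / (sqrt t * (t + d\<^sup>2))"
    using t by (intro divide_right_mono) auto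
  also have "\<dots> = ((q + e) / (q * e)) / (q\<^sup>2 * (q ^ 4 + e ^ 4))"
  proof -
    have "1 / q + 1 / e = (q + e) / (q * e)" using qe(1,2) by (simp add: field_simps)
    moreover have "t + d\<^sup>2 = q ^ 4 + e ^ 4" unfolding t4 qe(4) by (simp add: power_mult[symmetric])
    ultimately show ?thesis unfolding qe(3) by simp
  qed
  also have "\<dots> \<le> 3 / (e\<^sup>2 * q ^ 3 * (e\<^sup>2 + q\<^sup>2))"
  proof -
    have pos: "0 < q ^ 4 + e ^ 4" "0 < e\<^sup>2 + q\<^sup>2" using qe by (auto intro: add_pos_pos)
    have "(q + e) * e * (e\<^sup>2 + q\<^sup>2) \<le> 3 * (q ^ 4 + e ^ 4)"
    proof -
      have "2 * q * e \<le> q\<^sup>2 + e\<^sup>2" by (rule sum_squares_bound)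
      then have "(q + e) * e \<le> 3 / 2 * (e\<^sup>2 + q\<^sup>2)"
      proof -
        assume h: "2 * q * e \<le> q\<^sup>2 + e\<^sup>2"
        have "(q + e) * e = q * e + e\<^sup>2" by (simp add: power2_eq_square algebra_simps)
        moreover have "0 \<le> q\<^sup>2" "0 \<le> e\<^sup>2" by simp_all
        moreover have "2 * (q * e) \<le> q\<^sup>2 + e\<^sup>2" using h by (simp add: mult.assoc)
        ultimately show ?thesis by argo
      qed
      then have "(q + e) * e * (e\<^sup>2 + q\<^sup>2) \<le> 3 / 2 * (e\<^sup>2 + q\<^sup>2) * (e\<^sup>2 + q\<^sup>2)" using pos by (intro mult_right_mono) auto
      also have "\<dots> = 3 / 2 * (e\<^sup>2 + q\<^sup>2)\<^sup>2" by (simp add: power2_eq_square)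
      also have "\<dots> \<le> 3 / 2 * (2 * (q ^ 4 + e ^ 4))"
      proof -
        have "2 * e\<^sup>2 * q\<^sup>2 \<le> (e\<^sup>2)\<^sup>2 + (q\<^sup>2)\<^sup>2" by (rule sum_squares_bound)
        then show ?thesis by (simp add: power2_sum power_mult[symmetric])
      qed
      finally show ?thesis by simp
    qed
    then have "(q + e) * (e * (e\<^sup>2 + q\<^sup>2)) \<le> 3 * (q ^ 4 + e ^ 4)" by (simp only: mult.assoc)
    then have "(q + e) / (q ^ 4 + e ^ 4) \<le> 3 / (e * (e\<^sup>2 + q\<^sup>2))"
      using pos(1) mult_pos_pos[OF qe(2) pos(2)]
      by (simp only: pos_divide_le_eq pos_le_divide_eq times_divide_eq_left)
    then have "(q + e) / (q ^ 4 + e ^ 4) * (1 / (q ^ 3 * e)) \<le> 3 / (e * (e\<^sup>2 + q\<^sup>2)) * (1 / (q ^ 3 * e))"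
      using qe by (intro mult_right_mono) auto
    moreover have "(q + e) / (q ^ 4 + e ^ 4) * (1 / (q ^ 3 * e)) = (q + e) / (q * e) / (q\<^sup>2 * (q ^ 4 + e ^ 4))"
      unfolding times_divide_times_eq divide_divide_eq_left power2_eq_square power3_eq_cube by (simp only: mult_ac mult_1_right mult_1_left)
    moreover have "3 / (e * (e\<^sup>2 + q\<^sup>2)) * (1 / (q ^ 3 * e)) = 3 / (e\<^sup>2 * q ^ 3 * (e\<^sup>2 + q\<^sup>2))"
      unfolding times_divide_times_eq power2_eq_square[of e] by (simp only: mult_ac mult_1_right)
    ultimately show ?thesis by (simp only:)
  qed
  also have "\<dots> = 12 / (d * sqrt d) * D"
  proof -
    have "sqrt d = e" unfolding e_def ..
    then show ?thesis unfolding D qe(4) using qe(1,2) by (simp add: divide_simps power2_eq_square)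
  qed
  finally show ?thesis using 1 by blast
qed

text \<open>\<open>cut\<close> is 1 where |n - m| \<le> (n + m + 1) / 16 and 0 where |n - m| \<ge>
  (n + m + 1) / 8. Its Lipschitz constant in n is of order 1 / (n + m + 1), so it preserves Hoelder
  continuity; 64 S is the 32 of \<open>cut_lip\<close> times the bound 2 S / d for the kernel at
  n'.\<close>

lemma truncated_kernel:
  fixes K :: "nat \<Rightarrow> nat \<Rightarrow> real"
  assumes sym: "\<And>n m. K n m = K m n" and S: "0 \<le> S" and H: "0 \<le> H"
    and size: "\<And>n m. n \<noteq> m \<Longrightarrow> \<bar>K n m\<bar> \<le> S / \<bar>real n - real m\<bar>"
    and hoelder: "\<And>n n' m. n \<noteq> n' \<Longrightarrow> 2 * \<bar>real n - real n'\<bar> \<le> \<bar>real n - real m\<bar> \<Longrightarrow>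
      1 \<le> min n n' \<Longrightarrow> \<bar>real n - real m\<bar> \<le> 4 * real (min n n') \<Longrightarrow>
      \<bar>K n m - K n' m\<bar> \<le> H * sqrt \<bar>real n - real n'\<bar> / (\<bar>real n - real m\<bar> * sqrt \<bar>real n - real m\<bar>)"
  obtains K1 K2 where "\<And>n m. K n m = K1 n m + K2 n m" "hoelder_kernel (H + 64 * S) K1"
    "\<And>n m. \<bar>K2 n m\<bar> \<le> 16 * S / (real n + real m + 1)"
proof -
  define u where "u n m = \<bar>real n - real m\<bar> / (real n + real m + 1)" for n m :: nat
  define cut where "cut n m = max 0 (min 1 (2 - 16 * u n m))" for n m :: nat
  have cut01: "0 \<le> cut n m" "cut n m \<le> 1" for n m unfolding cut_def by auto
  have u_sym: "u n m = u m n" for n m unfolding u_def by (simp add: abs_minus_commute add.commute)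
  have cut_sym: "cut n m = cut m n" for n m unfolding cut_def by (simp add: u_sym[of n m])
  have cut_nz: "8 * \<bar>real n - real m\<bar> \<le> real n + real m + 1" if "cut n m \<noteq> 0" for n m
  proof -
    have "u n m \<le> 1 / 8" using that unfolding cut_def by (auto simp: max_def min_def split: if_splits)
    then show ?thesis unfolding u_def by (simp add: divide_le_eq)
  qed
  have cut_no: "real n + real m + 1 \<le> 16 * \<bar>real n - real m\<bar>" if "cut n m \<noteq> 1" for n m
  proof -
    have "1 / 16 \<le> u n m" using that unfolding cut_def by (auto simp: max_def min_def split: if_splits)
    then show ?thesis unfolding u_def by (simp add: le_divide_eq)
  qed
  have cut_lip: "\<bar>cut n m - cut n' m\<bar> \<le> 32 * \<bar>real n - real n'\<bar> / (real n + real m + 1)" for n n' m :: nat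
  proof -
    define x y v v' r where "x = real n + real m + 1" and "y = real n' + real m + 1" and "v = \<bar>real n - real m\<bar>"
      and "v' = \<bar>real n' - real m\<bar>" and "r = \<bar>real n - real n'\<bar>"
    have xy: "0 < x" "0 < y" "v' \<le> y" "0 \<le> v'" "0 \<le> r" unfolding x_def y_def v'_def r_def by auto
    have r: "\<bar>v - v'\<bar> \<le> r" "\<bar>y - x\<bar> \<le> r" unfolding v_def v'_def r_def x_def y_def by auto
    have "v / x - v' / y = (v - v') / x + v' / y * ((y - x) / x)" using xy by (simp add: field_simps)
    then have "\<bar>v / x - v' / y\<bar> \<le> \<bar>(v - v') / x\<bar> + \<bar>v' / y * ((y - x) / x)\<bar>" by (simp only: abs_triangle_ineq)
    also have "\<dots> \<le> r / x + 1 * (r / x)"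
      unfolding abs_mult abs_divide using xy r by (intro add_mono mult_mono divide_right_mono) (auto simp: divide_le_eq)
    finally have "\<bar>u n m - u n' m\<bar> \<le> 2 * (r / x)" unfolding u_def v_def v'_def x_def y_def by simp
    moreover have "\<bar>cut n m - cut n' m\<bar> \<le> 16 * \<bar>u n m - u n' m\<bar>" unfolding cut_def by (auto simp: max_def min_def abs_if)
    ultimately have "\<bar>cut n m - cut n' m\<bar> \<le> 16 * (2 * (r / x))" by (meson mult_left_mono order_trans zero_le_numeral)
    then show ?thesis unfolding r_def x_def by simp
  qed
  show thesis
  proof
    show "K n m = K n m * cut n m + K n m * (1 - cut n m)" for n m by (simp add: algebra_simps)
    show "\<bar>K n m * (1 - cut n m)\<bar> \<le> 16 * S / (real n + real m + 1)" for n m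
    proof (cases "cut n m = 1")
      case False
      define d where "d = \<bar>real n - real m\<bar>"
      have x: "real n + real m + 1 \<le> 16 * d" unfolding d_def by (rule cut_no[OF False])
      then have d: "0 < d" by linarith
      have "\<bar>K n m * (1 - cut n m)\<bar> \<le> \<bar>K n m\<bar> * 1" unfolding abs_mult using cut01[of n m] by (intro mult_left_mono) auto
      also have "\<dots> \<le> S / d" using size[of n m] d unfolding d_def by auto
      also have "\<dots> = 16 * S / (16 * d)" by simp
      also have "\<dots> \<le> 16 * S / (real n + real m + 1)" using x S d by (intro divide_left_mono mult_pos_pos) auto
      finally show ?thesis .
    qed (use S in simp)
    show "hoelder_kernel (H + 64 * S) (\<lambda>n m. K n m * cut n m)"
      unfolding hoelder_kernel_def
    proof (intro conjI allI impI)
      show "K n m * cut n m = K m n * cut m n" for n m using sym[of n m] cut_sym[of n m] by simp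
      fix n n' m :: nat
      assume far: "2 * \<bar>real n - real n'\<bar> \<le> \<bar>real n - real m\<bar>"
      define d d' r where "d = \<bar>real n - real m\<bar>" and "d' = \<bar>real n' - real m\<bar>" and "r = \<bar>real n - real n'\<bar>"
      have d0: "0 \<le> d" "0 \<le> r" unfolding d_def r_def by auto
      have dr: "2 * r \<le> d" using far unfolding d_def r_def .
      have rhs: "0 \<le> (H + 64 * S) * sqrt r / (d * sqrt d)" using H S d0 by (intro divide_nonneg_nonneg mult_nonneg_nonneg) auto
      have "\<bar>K n m * cut n m - K n' m * cut n' m\<bar> \<le> (H + 64 * S) * sqrt r / (d * sqrt d)"
      proof (cases "n = n' \<or> (cut n m = 0 \<and> cut n' m = 0)")
        case True
        then show ?thesis using rhs by auto
      next
        case False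
        have nn: "n \<noteq> n'" using False by blast
        have r1: "1 \<le> r" unfolding r_def using nn by (simp add: abs_if split: if_splits)
        have tri: "d \<le> d' + r" unfolding d_def d'_def r_def by linarith
        have d'2: "d / 2 \<le> d'" using tri dr by linarith
        have nr: "real n \<le> real n' + r" "real n' \<le> real n + r" unfolding r_def by linarith+
        have md: "real m \<le> real n + d" "real m \<le> real n' + d'" unfolding d_def d'_def by linarith+
        \<comment> \<open>If one cutoff value is nonzero, its point n or n' is large compared with
          d, and r \<le> d / 2 passes this on to the other point. The restrictions in
          \<open>hoelder\<close> therefore hold whenever the difference does not vanish
          trivially.\<close>
        have lo: "1 \<le> real n \<and> 1 \<le> real n' \<and> d \<le> 4 * real n \<and> d \<le> 4 * real n'"
        proof (cases "cut n m = 0")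
          case True
          then have "8 * d' \<le> real n' + real m + 1" unfolding d'_def using False by (intro cut_nz) auto
          then have "7 * d' \<le> 2 * real n' + 1" using md by linarith
          then have "7 * d \<le> 4 * real n' + 2" using d'2 by linarith
          then show ?thesis using dr r1 nr by linarith
        next
          case False
          then have "8 * d \<le> real n + real m + 1" unfolding d_def by (rule cut_nz)
          then have "7 * d \<le> 2 * real n + 1" using md by linarith
          then show ?thesis using dr r1 nr by linarith
        qed
        have dpos: "0 < d" "0 < d'" using dr r1 d'2 by linarith+
        have nm: "n' \<noteq> m" using dpos unfolding d'_def by auto
        have h: "\<bar>K n m - K n' m\<bar> \<le> H * sqrt r / (d * sqrt d)"
          unfolding d_def r_def using lo by (intro hoelder nn far) (auto simp: min_def d_def)
        have "\<bar>K n' m\<bar> \<le> S / d'" using size[OF nm] unfolding d'_def .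
        also have "\<dots> \<le> S / (d / 2)" using d'2 dpos S by (intro divide_left_mono) auto
        finally have k': "\<bar>K n' m\<bar> \<le> 2 * S / d" by (simp add: mult.commute)
        have c: "\<bar>cut n m - cut n' m\<bar> \<le> 32 * r / d"
        proof -
          have "\<bar>cut n m - cut n' m\<bar> \<le> 32 * r / (real n + real m + 1)" unfolding r_def by (rule cut_lip)
          also have "\<dots> \<le> 32 * r / d" using dpos r1 unfolding d_def by (intro divide_left_mono mult_pos_pos) auto
          finally show ?thesis .
        qed
        have "K n m * cut n m - K n' m * cut n' m = (K n m - K n' m) * cut n m + (cut n m - cut n' m) * K n' m"
          by (simp add: algebra_simps)
        then have "\<bar>K n m * cut n m - K n' m * cut n' m\<bar> \<le> \<bar>(K n m - K n' m) * cut n m\<bar> + \<bar>(cut n m - cut n' m) * K n' m\<bar>"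
          by (simp only: abs_triangle_ineq)
        also have "\<dots> \<le> H * sqrt r / (d * sqrt d) * 1 + 32 * r / d * (2 * S / d)"
          unfolding abs_mult using cut01[of n m] h c k' r1 dpos by (intro add_mono mult_mono) auto
        also have "32 * r / d * (2 * S / d) \<le> 64 * S * sqrt r / (d * sqrt d)"
        proof -
          have "r / d = sqrt r * sqrt r / (sqrt d * sqrt d)" using d0 by simp
          also have "\<dots> = sqrt r / sqrt d * (sqrt r / sqrt d)" by (simp only: times_divide_times_eq)
          also have "\<dots> \<le> sqrt r / sqrt d * 1" using dr d0 dpos by (intro mult_left_mono) auto
          finally have "64 * S / d * (r / d) \<le> 64 * S / d * (sqrt r / sqrt d)" using S dpos by (intro mult_left_mono) auto
          then show ?thesis by (simp add: mult_ac)
        qed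
        finally show ?thesis by (simp add: distrib_right add_divide_distrib)
      qed
      then show "\<bar>K n m * cut n m - K n' m * cut n' m\<bar>
          \<le> (H + 64 * S) * sqrt \<bar>real n - real n'\<bar> / (\<bar>real n - real m\<bar> * sqrt \<bar>real n - real m\<bar>)"
        unfolding d_def r_def .
    qed
  qed
qed

context jacobi_half
begin

lemma TK_hoelder:
  obtains C where "0 < C" "\<And>a b B N1 N2 n n' m. (\<And>j. 0 < a j) \<Longrightarrow> (\<And>j. a j \<le> a (j + 1)) \<Longrightarrow> (\<And>j. \<bar>b j\<bar> \<le> B) \<Longrightarrow> N1 \<le> N2 \<Longrightarrow>
     n \<noteq> n' \<Longrightarrow> 2 * \<bar>real n - real n'\<bar> \<le> \<bar>real n - real m\<bar> \<Longrightarrow>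
     1 \<le> min n n' \<Longrightarrow> \<bar>real n - real m\<bar> \<le> 4 * real (min n n') \<Longrightarrow>
     \<bar>TK a b N1 N2 n m - TK a b N1 N2 n' m\<bar> \<le> B * C * sqrt \<bar>real n - real n'\<bar> / (\<bar>real n - real m\<bar> * sqrt \<bar>real n - real m\<bar>)"
proof -
  obtain C where C: "0 < C" "\<And>t n n' m. 0 < t \<Longrightarrow> n \<noteq> n' \<Longrightarrow> 2 * \<bar>real n - real n'\<bar> \<le> \<bar>real n - real m\<bar> \<Longrightarrow>
     1 \<le> min n n' \<Longrightarrow> \<bar>real n - real m\<bar> \<le> 4 * real (min n n') \<Longrightarrow>
     \<bar>ker t n m - ker t n' m\<bar> \<le> C * sqrt \<bar>real n - real n'\<bar> * 
       (sqrt (1 / sqrt t + 1 / \<bar>real n - real m\<bar>) / (sqrt t * (t + (real n - real m)\<^sup>2)))"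
    using ker_hoelder by blast
  show thesis
  proof
    show "0 < 12 * pi * C" using C by simp
    fix a b :: "int \<Rightarrow> real" and B :: real and N1 N2 :: int and n n' m :: nat
    assume a: "\<And>j. 0 < a j" "\<And>j. a j \<le> a (j + 1)" and b: "\<And>j. \<bar>b j\<bar> \<le> B" and N: "N1 \<le> N2"
      and nn: "n \<noteq> n'" and far: "2 * \<bar>real n - real n'\<bar> \<le> \<bar>real n - real m\<bar>"
      and lo: "1 \<le> min n n'" "\<bar>real n - real m\<bar> \<le> 4 * real (min n n')"
    define d r where "d = \<bar>real n - real m\<bar>" and "r = \<bar>real n - real n'\<bar>"
    have r0: "0 < r" unfolding r_def using nn by simp
    have "0 < 2 * r" using r0 by simp
    also have "2 * r \<le> d" using far unfolding d_def r_def .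
    finally have d: "0 < d" .
    obtain D where D: "\<And>t. 0 < t \<Longrightarrow> ((\<lambda>t. arctan (sqrt (sqrt t) / sqrt d)) has_real_derivative D t) (at t)"
      "\<And>t. 0 < t \<Longrightarrow> sqrt (1 / sqrt t + 1 / d) / (sqrt t * (t + d\<^sup>2)) \<le> 12 / (d * sqrt d) * D t"
      using arctan_fourth_root[OF _ d] by metis
    define E where "E = C * sqrt r * (12 / (d * sqrt d))"
    have E: "0 \<le> E" unfolding E_def using C(1) r0 d by (intro mult_nonneg_nonneg divide_nonneg_nonneg) auto
    have eq: "TK a b N1 N2 n m - TK a b N1 N2 n' m
        = (\<Sum>j\<in>{N1..N2}. b j * ((hk (a (j + 1)) n m - hk (a (j + 1)) n' m) - (hk (a j) n m - hk (a j) n' m)))"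
      unfolding TK_def sum_subtractf[symmetric] by (intro sum.cong) (auto simp: algebra_simps)
    have "\<bar>TK a b N1 N2 n m - TK a b N1 N2 n' m\<bar> \<le> B * (E * pi)"
      unfolding eq
    proof (rule lacunary_sum_bound[where a=a and b=b and \<phi>="\<lambda>t. hk t n m - hk t n' m"
          and \<Psi>="\<lambda>t. E * arctan (sqrt (sqrt t) / sqrt d)", OF a b N])
      fix t :: real assume t: "0 < t"
      show "((\<lambda>t. hk t n m - hk t n' m) has_real_derivative - ker t n m - - ker t n' m) (at t)"
        by (intro DERIV_diff hk_deriv)
      show "((\<lambda>t. E * arctan (sqrt (sqrt t) / sqrt d)) has_real_derivative E * D t) (at t)"
        by (intro DERIV_cmult D t)
      have "\<bar>- ker t n m - - ker t n' m\<bar> = \<bar>ker t n m - ker t n' m\<bar>" by linarith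
      also have "\<dots> \<le> C * sqrt r * (sqrt (1 / sqrt t + 1 / d) / (sqrt t * (t + d\<^sup>2)))"
        using C(2)[OF t nn far lo] unfolding d_def r_def by simp
      also have "\<dots> \<le> C * sqrt r * (12 / (d * sqrt d) * D t)" using C(1) r0 by (intro mult_left_mono D t) auto
      finally show "\<bar>- ker t n m - - ker t n' m\<bar> \<le> E * D t" unfolding E_def by (simp only: mult.assoc)
    next
      fix s t :: real
      have "arctan (sqrt (sqrt t) / sqrt d) - arctan (sqrt (sqrt s) / sqrt d) \<le> pi"
        using arctan_ubound[of "sqrt (sqrt t) / sqrt d"] arctan_lbound[of "sqrt (sqrt s) / sqrt d"] by linarith
      then have "E * (arctan (sqrt (sqrt t) / sqrt d) - arctan (sqrt (sqrt s) / sqrt d)) \<le> E * pi" using E by (rule mult_left_mono)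
      then show "E * arctan (sqrt (sqrt t) / sqrt d) - E * arctan (sqrt (sqrt s) / sqrt d) \<le> E * pi"
        by (simp only: right_diff_distrib)
    qed
    also have "B * (E * pi) = B * (12 * pi * C) * sqrt r / (d * sqrt d)" unfolding E_def by simp
    finally show "\<bar>TK a b N1 N2 n m - TK a b N1 N2 n' m\<bar>
        \<le> B * (12 * pi * C) * sqrt \<bar>real n - real n'\<bar> / (\<bar>real n - real m\<bar> * sqrt \<bar>real n - real m\<bar>)"
      unfolding d_def r_def .
  qed
qed

section \<open>The l^2 bound by orthonormal expansion\<close>

lemma jint_expansion:
  assumes "n < N"
  shows "J (\<lambda>x. (\<Sum>k<N. c k * p k x) * p n x) = c n"
proof -
  have "J (\<lambda>x. (\<Sum>k<N. c k * p k x) * p n x) = J (\<lambda>x. \<Sum>k<N. c k * (p k x * p n x))"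
    by (simp add: sum_distrib_right mult.assoc)
  also have "\<dots> = (\<Sum>k<N. c k * J (\<lambda>x. p k x * p n x))"
    by (subst jint_sum) (auto intro!: continuous_intros simp: jint_cmult)
  also have "\<dots> = c n" unfolding p_orthonormal using assms by (simp add: if_distrib sum.delta cong: if_cong)
  finally show ?thesis .
qed

lemma jint_expansion_sq: "J (\<lambda>x. (\<Sum>k<N. c k * p k x)\<^sup>2) = (\<Sum>k<N. (c k)\<^sup>2)"
proof -
  have "J (\<lambda>x. (\<Sum>k<N. c k * p k x)\<^sup>2) = J (\<lambda>x. \<Sum>n<N. c n * ((\<Sum>k<N. c k * p k x) * p n x))"
    by (simp add: power2_eq_square sum_distrib_left mult_ac)
  also have "\<dots> = (\<Sum>n<N. c n * J (\<lambda>x. (\<Sum>k<N. c k * p k x) * p n x))"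
    by (subst jint_sum) (auto intro!: continuous_intros simp: jint_cmult)
  also have "\<dots> = (\<Sum>k<N. (c k)\<^sup>2)" by (intro sum.cong) (auto simp: jint_expansion power2_eq_square)
  finally show ?thesis .
qed

lemma bessel:
  assumes h: "continuous_on {-1..1} h"
  shows "(\<Sum>n<N. (J (\<lambda>x. h x * p n x))\<^sup>2) \<le> J (\<lambda>x. (h x)\<^sup>2)"
proof -
  define c where "c n = J (\<lambda>x. h x * p n x)" for n
  define S where "S x = (\<Sum>n<N. c n * p n x)" for x
  have Sc: "continuous_on {-1..1} S" unfolding S_def by (intro continuous_intros)
  have "J (\<lambda>x. h x * S x) = J (\<lambda>x. \<Sum>n<N. c n * (h x * p n x))" unfolding S_def by (simp add: sum_distrib_left mult_ac)
  also have "\<dots> = (\<Sum>n<N. c n * J (\<lambda>x. h x * p n x))"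
    by (subst jint_sum) (auto intro!: continuous_intros h simp: jint_cmult)
  also have "\<dots> = (\<Sum>n<N. (c n)\<^sup>2)" by (simp add: c_def power2_eq_square)
  finally have hS: "J (\<lambda>x. h x * S x) = (\<Sum>n<N. (c n)\<^sup>2)" .
  have "0 \<le> J (\<lambda>x. (h x - S x)\<^sup>2)" by (intro jint_nonneg continuous_intros h Sc) auto
  also have "J (\<lambda>x. (h x - S x)\<^sup>2) = J (\<lambda>x. ((h x)\<^sup>2 + (S x)\<^sup>2) - 2 * (h x * S x))"
    by (simp add: power2_diff mult.assoc)
  also have "\<dots> = J (\<lambda>x. (h x)\<^sup>2) + J (\<lambda>x. (S x)\<^sup>2) - 2 * J (\<lambda>x. h x * S x)"
  proof -
    have c: "continuous_on {-1..1} (\<lambda>x. (h x)\<^sup>2)" "continuous_on {-1..1} (\<lambda>x. (S x)\<^sup>2)"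
      "continuous_on {-1..1} (\<lambda>x. 2 * (h x * S x))" by (intro continuous_intros h Sc)+
    show ?thesis unfolding jint_diff[OF continuous_on_add[OF c(1,2)] c(3)] jint_add[OF c(1,2)] jint_cmult ..
  qed
  also have "J (\<lambda>x. (S x)\<^sup>2) = (\<Sum>n<N. (c n)\<^sup>2)" unfolding S_def by (rule jint_expansion_sq)
  finally show ?thesis unfolding hS c_def by simp
qed

text \<open>\<open>TK\<close> is the matrix of multiplication by M in the system p_n. At each x the
  exponentials decrease along a, so their differences have one sign and telescope to |M x| \<le> B;
  Bessel's inequality concludes.\<close>

lemma TK_L2:
  assumes a: "\<And>j. 0 < a j" "\<And>j. a j \<le> a (j + 1)" and b: "\<And>j. \<bar>b j\<bar> \<le> B" and N12: "N1 \<le> N2"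
  shows "(\<Sum>n<N. (kop R (TK a b N1 N2) f n)\<^sup>2) \<le> B\<^sup>2 * (\<Sum>n<R. (f n)\<^sup>2)"
proof -
  have B: "0 \<le> B" using b[of 0] by linarith
  define M where "M x = (\<Sum>j\<in>{N1..N2}. b j * (exp (- a (j + 1) * (1 - x)) - exp (- a j * (1 - x))))" for x
  define g where "g x = (\<Sum>m<R. f m * p m x)" for x
  have Mc: "continuous_on S M" and gc: "continuous_on S g" for S unfolding M_def g_def by (intro continuous_intros)+
  have TK: "TK a b N1 N2 n m = J (\<lambda>x. M x * (p n x * p m x))" for n m
  proof -
    have "J (\<lambda>x. M x * (p n x * p m x)) = J (\<lambda>x. \<Sum>j\<in>{N1..N2}. b j * (exp (- a (j + 1) * (1 - x)) * (p n x * p m x) - exp (- a j * (1 - x)) * (p n x * p m x)))"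
      unfolding M_def by (simp add: sum_distrib_right left_diff_distrib mult.assoc)
    also have "\<dots> = (\<Sum>j\<in>{N1..N2}. b j * J (\<lambda>x. exp (- a (j + 1) * (1 - x)) * (p n x * p m x) - exp (- a j * (1 - x)) * (p n x * p m x)))"
      by (subst jint_sum) (auto intro!: continuous_intros simp: jint_cmult)
    also have "\<dots> = TK a b N1 N2 n m"
      unfolding TK_def hk_eq by (subst jint_diff) (auto intro!: continuous_intros)
    finally show ?thesis by simp
  qed
  have kop: "kop R (TK a b N1 N2) f n = J (\<lambda>x. (M x * g x) * p n x)" for n
  proof -
    have "J (\<lambda>x. (M x * g x) * p n x) = J (\<lambda>x. \<Sum>m<R. f m * (M x * (p n x * p m x)))"
      unfolding g_def by (simp add: sum_distrib_left sum_distrib_right mult_ac)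
    also have "\<dots> = (\<Sum>m<R. f m * J (\<lambda>x. M x * (p n x * p m x)))"
      by (subst jint_sum) (auto intro!: continuous_intros Mc simp: jint_cmult)
    finally show ?thesis unfolding kop_def TK by (simp add: mult.commute)
  qed
  have M: "\<bar>M x\<bar> \<le> B" if x: "-1 < x" "x < 1" for x
  proof -
    have y: "0 \<le> 1 - x" using x by simp
    have "\<bar>M x\<bar> \<le> (\<Sum>j\<in>{N1..N2}. B * (- exp (- a (j + 1) * (1 - x)) - - exp (- a j * (1 - x))))"
      unfolding M_def
    proof (intro order_trans[OF sum_abs] sum_mono)
      fix j
      have "exp (- a (j + 1) * (1 - x)) \<le> exp (- a j * (1 - x))" using mult_right_mono[OF a(2) y] by simp
      then show "\<bar>b j * (exp (- a (j + 1) * (1 - x)) - exp (- a j * (1 - x)))\<bar>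
          \<le> B * (- exp (- a (j + 1) * (1 - x)) - - exp (- a j * (1 - x)))"
        unfolding abs_mult using b B by (intro mult_mono) auto
    qed
    also have "\<dots> = B * (- exp (- a (N2 + 1) * (1 - x)) - - exp (- a N1 * (1 - x)))"
      unfolding sum_distrib_left[symmetric]
      by (subst sum_int_telescope[OF N12, of "\<lambda>j. - exp (- a j * (1 - x))"]) simp
    also have "\<dots> \<le> B * 1"
    proof (intro mult_left_mono B)
      have "exp (- a N1 * (1 - x)) \<le> 1" using mult_nonneg_nonneg[OF less_imp_le[OF a(1)] y] by simp
      then show "- exp (- a (N2 + 1) * (1 - x)) - - exp (- a N1 * (1 - x)) \<le> 1"
        using exp_gt_zero[of "- a (N2 + 1) * (1 - x)"] by linarith
    qed
    finally show ?thesis by simp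
  qed
  have "(\<Sum>n<N. (kop R (TK a b N1 N2) f n)\<^sup>2) \<le> J (\<lambda>x. (M x * g x)\<^sup>2)"
    unfolding kop by (intro bessel continuous_intros Mc gc)
  also have "\<dots> \<le> J (\<lambda>x. B\<^sup>2 * (g x)\<^sup>2)"
  proof (intro jint_mono continuous_intros Mc gc)
    fix x :: real assume "-1 < x" "x < 1"
    then have "\<bar>M x\<bar>\<^sup>2 \<le> B\<^sup>2" by (intro power_mono M) auto
    then show "(M x * g x)\<^sup>2 \<le> B\<^sup>2 * (g x)\<^sup>2" unfolding power_mult_distrib by (intro mult_right_mono) auto
  qed
  also have "\<dots> = B\<^sup>2 * (\<Sum>n<R. (f n)\<^sup>2)" unfolding jint_cmult g_def jint_expansion_sq ..
  finally show ?thesis .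
qed

theorem TK_cz:
  assumes B: "0 \<le> B"
  obtains C0 C1 where "0 \<le> C0" "0 \<le> C1"
    "\<And>a b N1 N2. (\<And>j. 0 < a j) \<Longrightarrow> (\<And>j. a j \<le> a (j + 1)) \<Longrightarrow> (\<And>j. \<bar>b j\<bar> \<le> B) \<Longrightarrow> N1 \<le> N2 \<Longrightarrow>
       cz_kernel C0 C1 (B\<^sup>2) (TK a b N1 N2)"
proof -
  obtain S where S: "0 < S" "\<And>a b B N1 N2 n m. (\<And>j. 0 < a j) \<Longrightarrow> (\<And>j. a j \<le> a (j + 1)) \<Longrightarrow> (\<And>j. \<bar>b j\<bar> \<le> B) \<Longrightarrow> N1 \<le> N2 \<Longrightarrow>
     n \<noteq> m \<Longrightarrow> \<bar>TK a b N1 N2 n m\<bar> \<le> B * S / \<bar>real n - real m\<bar>"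
    using TK_size by blast
  obtain H where H: "0 < H" "\<And>a b B N1 N2 n n' m. (\<And>j. 0 < a j) \<Longrightarrow> (\<And>j. a j \<le> a (j + 1)) \<Longrightarrow> (\<And>j. \<bar>b j\<bar> \<le> B) \<Longrightarrow> N1 \<le> N2 \<Longrightarrow>
     n \<noteq> n' \<Longrightarrow> 2 * \<bar>real n - real n'\<bar> \<le> \<bar>real n - real m\<bar> \<Longrightarrow>
     1 \<le> min n n' \<Longrightarrow> \<bar>real n - real m\<bar> \<le> 4 * real (min n n') \<Longrightarrow>
     \<bar>TK a b N1 N2 n m - TK a b N1 N2 n' m\<bar> \<le> B * H * sqrt \<bar>real n - real n'\<bar> / (\<bar>real n - real m\<bar> * sqrt \<bar>real n - real m\<bar>)"
    using TK_hoelder by blast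
  have BS: "0 \<le> B * S" and BH: "0 \<le> B * H" using B S(1) H(1) by auto
  show thesis
  proof
    show "0 \<le> B * H + 64 * (B * S)" "0 \<le> 16 * (B * S)" using BS BH by auto
    fix a b :: "int \<Rightarrow> real" and N1 N2 :: int
    assume A: "\<And>j. 0 < a j" "\<And>j. a j \<le> a (j + 1)" "\<And>j. \<bar>b j\<bar> \<le> B" "N1 \<le> N2"
    obtain K1 K2 where K: "\<And>n m. TK a b N1 N2 n m = K1 n m + K2 n m" "hoelder_kernel (B * H + 64 * (B * S)) K1"
      "\<And>n m. \<bar>K2 n m\<bar> \<le> 16 * (B * S) / (real n + real m + 1)"
      using truncated_kernel[OF TK_sym[of a b N1 N2] BS BH S(2)[where a=a and b=b, OF A] H(2)[where a=a and b=b, OF A]] by blast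
    show "cz_kernel (B * H + 64 * (B * S)) (16 * (B * S)) (B\<^sup>2) (TK a b N1 N2)"
      unfolding cz_kernel_def using K TK_L2[where a=a and b=b, OF A] by blast
  qed
qed

text \<open>Off the diagonal the kernel vanishes at t = 0 by orthogonality, and the bound for its
  derivative is integrated from there. The quadratic decay makes the series in
  \<open>jacobi_heat\<close> converge for f in the weighted spaces.\<close>

lemma hk_decay:
  obtains C where "0 < C" "\<And>t n m. 0 < t \<Longrightarrow> n \<noteq> m \<Longrightarrow> \<bar>hk t n m\<bar> \<le> C * sqrt t / (real n - real m)\<^sup>2"
proof -
  obtain C where C: "0 < C" "\<And>t n m. 0 < t \<Longrightarrow> \<bar>ker t n m\<bar> * (t + (real n - real m)\<^sup>2) \<le> C / sqrt t"
    using ker_size by blast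
  show thesis
  proof
    show "0 < 2 * C" using C by simp
    fix t :: real and n m :: nat
    assume t: "0 < t" and nm: "n \<noteq> m"
    define q where "q = (real n - real m)\<^sup>2"
    have q: "0 < q" unfolding q_def using nm by simp
    have hk0: "hk 0 n m = 0" using nm p_orthonormal[of n m] unfolding hk_eq by simp
    have cont: "continuous_on {0..t} (\<lambda>s. hk s n m)"
      by (rule DERIV_continuous_on[OF has_field_derivative_at_within[OF hk_deriv]])
    define \<psi> where "\<psi> s = 2 * C * sqrt s / q" for s
    have \<psi>c: "continuous_on {0..t} \<psi>" unfolding \<psi>_def using q by (intro continuous_intros) auto
    have deriv: "(\<psi> has_real_derivative C / sqrt s / q) (at s)" if s: "0 < s" for s
    proof -
      have "(\<psi> has_real_derivative 2 * C * (inverse (sqrt s) / 2) / q) (at s)"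
        unfolding \<psi>_def by (intro DERIV_cdivide DERIV_cmult DERIV_real_sqrt s)
      then show ?thesis by (simp add: inverse_eq_divide)
    qed
    have k: "\<bar>ker s n m\<bar> \<le> C / sqrt s / q" if s: "0 < s" for s
    proof -
      have "\<bar>ker s n m\<bar> * q \<le> \<bar>ker s n m\<bar> * (s + q)" using s by (intro mult_left_mono) auto
      also have "\<dots> \<le> C / sqrt s" unfolding q_def by (rule C(2)[OF s])
      finally show ?thesis using q by (simp only: pos_le_divide_eq)
    qed
    have "\<psi> 0 - hk 0 n m \<le> \<psi> t - hk t n m"
    \<comment> \<open>Derivatives are taken in the open interval only, since the square root in
      \<open>\<psi>\<close> is not differentiable at 0.\<close>
    proof (rule DERIV_nonneg_imp_increasing_open[OF less_imp_le[OF t]])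
      fix s assume s: "0 < s" "s < t"
      show "\<exists>y. ((\<lambda>s. \<psi> s - hk s n m) has_real_derivative y) (at s) \<and> 0 \<le> y"
        using DERIV_diff[OF deriv[OF s(1)] hk_deriv[of n m s]] k[OF s(1)]
        by (intro exI[of _ "C / sqrt s / q - - ker s n m"]) (auto simp: abs_le_iff)
    qed (intro continuous_intros cont \<psi>c)
    moreover have "\<psi> 0 + hk 0 n m \<le> \<psi> t + hk t n m"
    proof (rule DERIV_nonneg_imp_increasing_open[OF less_imp_le[OF t]])
      fix s assume s: "0 < s" "s < t"
      show "\<exists>y. ((\<lambda>s. \<psi> s + hk s n m) has_real_derivative y) (at s) \<and> 0 \<le> y"
        using DERIV_add[OF deriv[OF s(1)] hk_deriv[of n m s]] k[OF s(1)]
        by (intro exI[of _ "C / sqrt s / q + - ker s n m"]) (auto simp: abs_le_iff)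
    qed (intro continuous_intros cont \<psi>c)
    moreover have "\<psi> 0 = 0" unfolding \<psi>_def by simp
    ultimately have "\<bar>hk t n m\<bar> \<le> \<psi> t" unfolding hk0 by linarith
    then show "\<bar>hk t n m\<bar> \<le> 2 * C * sqrt t / (real n - real m)\<^sup>2" unfolding \<psi>_def q_def .
  qed
qed

end

section \<open>From truncated operators to the semigroup\<close>

definition avg_bounded :: "(nat \<Rightarrow> real) \<Rightarrow> nat \<Rightarrow> bool" where
  "avg_bounded f n \<longleftrightarrow> (\<exists>A. \<forall>j. (\<Sum>m=n-j..n+j. \<bar>f m\<bar>) \<le> A * (2 * real j + 1))"

text \<open>Hoelder's inequality against the dual weight on the interval of radius j, where the
  w-mass on the left is bounded below by the single value w n. The bound may depend on n, which is
  enough for pointwise convergence.\<close>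

lemma avg_bounded_Ap:
  assumes p: "1 < p" and Ap: "Ap_weight p w" and f: "in_lp p w f"
  shows "avg_bounded f n"
proof -
  note w = Ap_weight_pos[OF Ap]
  obtain A where A: "0 < A" "\<And>a b. a \<le> b \<Longrightarrow> (\<Sum>k=a..b. w k) * (\<Sum>k=a..b. w k powr (-1 / (p - 1))) powr (p - 1)
        \<le> A * real (b - a + 1) powr p"
    using Ap_weight_bound[OF Ap] by blast
  define F where "F = (\<Sum>n. \<bar>f n\<bar> powr p * w n)"
  have wn: "0 \<le> \<bar>f k\<bar> powr p * w k" for k using w[of k] by simp
  have F: "0 \<le> F" unfolding F_def using f wn unfolding in_lp_def by (intro suminf_nonneg) auto
  define E where "E = A * F / w n"
  have E: "0 \<le> E" unfolding E_def using A(1) F w[of n] by simp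
  have "(\<Sum>m=n-j..n+j. \<bar>f m\<bar>) \<le> E powr (1 / p) * (2 * real j + 1)" for j
  proof -
    define L where "L = real (n + j - (n - j) + 1)"
    have L: "0 < L" "L \<le> 2 * real j + 1" unfolding L_def by auto
    define x where "x = (\<Sum>m=n-j..n+j. \<bar>f m\<bar>)"
    have x: "0 \<le> x" unfolding x_def by (intro sum_nonneg) auto
    have "x powr p * w n \<le> x powr p * (\<Sum>k=n-j..n+j. w k)"
      using w by (intro mult_left_mono member_le_sum) (auto simp: less_imp_le)
    also have "\<dots> \<le> A * L powr p * (\<Sum>k=n-j..n+j. \<bar>f k\<bar> powr p * w k)"
      unfolding x_def L_def by (rule Ap_sum_powr_le[OF p w _ _ A(2)]) auto
    also have "\<dots> \<le> A * L powr p * F"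
      unfolding F_def using f wn A(1) L unfolding in_lp_def by (intro mult_left_mono sum_le_suminf) auto
    finally have "x powr p \<le> E * L powr p"
      unfolding E_def using w[of n] by (simp add: pos_le_divide_eq mult_ac)
    then have "(x powr p) powr (1 / p) \<le> (E * L powr p) powr (1 / p)" using p by (intro powr_mono2) auto
    also have "\<dots> = E powr (1 / p) * L" using E L p by (simp add: powr_mult powr_powr)
    finally have "x \<le> E powr (1 / p) * L" using x p by (simp add: powr_powr)
    also have "\<dots> \<le> E powr (1 / p) * (2 * real j + 1)" using L by (intro mult_left_mono) auto
    finally show ?thesis unfolding x_def .
  qed
  then show ?thesis unfolding avg_bounded_def by blast
qed

lemma avg_bounded_A1:
  assumes A1: "A1_weight w" and f: "in_lp 1 w f"
  shows "avg_bounded f n"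
proof -
  note w = A1_weight_pos[OF A1]
  obtain A where A: "1 \<le> A" "\<And>a b k. a \<le> k \<Longrightarrow> k \<le> b \<Longrightarrow> (\<Sum>k=a..b. w k) \<le> A * real (b - a + 1) * w k"
    using A1_weight_bound[OF A1] by blast
  define F where "F = (\<Sum>n. \<bar>f n\<bar> powr 1 * w n)"
  have wn: "0 \<le> \<bar>f k\<bar> powr 1 * w k" for k using w[of k] by simp
  have F: "0 \<le> F" unfolding F_def using f wn unfolding in_lp_def by (intro suminf_nonneg) auto
  have "(\<Sum>m=n-j..n+j. \<bar>f m\<bar>) \<le> A * F / w n * (2 * real j + 1)" for j
  proof -
    define L where "L = real (n + j - (n - j) + 1)"
    have L: "0 < L" "L \<le> 2 * real j + 1" unfolding L_def by auto
    have "(\<Sum>m=n-j..n+j. \<bar>f m\<bar>) * w n = (\<Sum>m=n-j..n+j. \<bar>f m\<bar> * w n)" by (rule sum_distrib_right)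
    also have "\<dots> \<le> (\<Sum>m=n-j..n+j. A * L * (\<bar>f m\<bar> powr 1 * w m))"
    proof (rule sum_mono)
      fix m assume m: "m \<in> {n-j..n+j}"
      have "w n \<le> (\<Sum>k=n-j..n+j. w k)" using w by (intro member_le_sum) (auto simp: less_imp_le)
      also have "\<dots> \<le> A * L * w m" unfolding L_def using m by (intro A) auto
      finally have "\<bar>f m\<bar> * w n \<le> \<bar>f m\<bar> * (A * L * w m)" by (intro mult_left_mono) auto
      then show "\<bar>f m\<bar> * w n \<le> A * L * (\<bar>f m\<bar> powr 1 * w m)" by (simp add: mult_ac)
    qed
    also have "\<dots> = A * L * (\<Sum>m=n-j..n+j. \<bar>f m\<bar> powr 1 * w m)" by (simp only: sum_distrib_left)
    also have "\<dots> \<le> A * L * F"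
      unfolding F_def using f wn A(1) L unfolding in_lp_def by (intro mult_left_mono sum_le_suminf) auto
    also have "\<dots> \<le> A * (2 * real j + 1) * F" using A(1) L F by (intro mult_right_mono mult_left_mono) auto
    finally show ?thesis using w[of n] by (simp add: pos_le_divide_eq mult_ac)
  qed
  then show ?thesis unfolding avg_bounded_def by blast
qed

text \<open>Bounded averages of |f| around n are summable against d^(-3/2) by
  \<open>tail_sum\<close>, and d^(-2) is smaller for d \<ge> 1. The term m = n is treated
  separately.\<close>

lemma summable_avg_bounded:
  fixes f k :: "nat \<Rightarrow> real"
  assumes f: "avg_bounded f n" and C: "0 \<le> C" and k: "\<And>m. n \<noteq> m \<Longrightarrow> \<bar>k m\<bar> \<le> C / (real n - real m)\<^sup>2"
  shows "summable (\<lambda>m. f m * k m)"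
proof -
  obtain A where A: "\<And>j. (\<Sum>m=n-j..n+j. \<bar>f m\<bar>) \<le> A * (2 * real j + 1)"
    using f unfolding avg_bounded_def by blast
  define d where "d m = \<bar>real m - real n\<bar>" for m
  have bounded: "(\<Sum>m<M. \<bar>f m * k m\<bar>) \<le> \<bar>f n * k n\<bar> + C * (23 * A / sqrt (real 1))" for M
  proof -
    have "(\<Sum>m<M. \<bar>f m * k m\<bar>) \<le> (\<Sum>m<M. (if m = n then \<bar>f n * k n\<bar> else 0) + (if 1 \<le> d m then C * (\<bar>f m\<bar> / (d m * sqrt (d m))) else 0))"
    proof (rule sum_mono)
      fix m
      show "\<bar>f m * k m\<bar> \<le> (if m = n then \<bar>f n * k n\<bar> else 0) + (if 1 \<le> d m then C * (\<bar>f m\<bar> / (d m * sqrt (d m))) else 0)"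
      proof (cases "m = n")
        case False
        then have d1: "1 \<le> d m" unfolding d_def by (auto simp: abs_if)
        have "(real n - real m)\<^sup>2 = (d m)\<^sup>2" unfolding d_def by (simp add: power2_commute)
        then have "\<bar>k m\<bar> \<le> C / (d m)\<^sup>2" using k[of m] False by simp
        also have "\<dots> \<le> C / (d m * sqrt (d m))"
        proof (intro divide_left_mono C mult_pos_pos)
          have "sqrt (d m) \<le> d m" using d1 by (simp add: real_le_lsqrt power2_eq_square)
          then show "d m * sqrt (d m) \<le> (d m)\<^sup>2" unfolding power2_eq_square using d1 by (intro mult_left_mono) auto
        qed (use d1 in auto)
        finally have "\<bar>f m\<bar> * \<bar>k m\<bar> \<le> \<bar>f m\<bar> * (C / (d m * sqrt (d m)))" by (intro mult_left_mono) auto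
        then show ?thesis using d1 False by (simp add: abs_mult mult_ac)
      qed (simp add: d_def)
    qed
    also have "\<dots> \<le> \<bar>f n * k n\<bar> + C * (23 * A / sqrt (real 1))"
      unfolding sum.distrib
    proof (intro add_mono)
      show "(\<Sum>m<M. if m = n then \<bar>f n * k n\<bar> else 0) \<le> \<bar>f n * k n\<bar>" by (simp add: sum.delta)
      have "(\<Sum>m<M. if 1 \<le> d m then C * (\<bar>f m\<bar> / (d m * sqrt (d m))) else 0)
          = C * (\<Sum>m\<in>{m\<in>{..<M}. real 1 \<le> \<bar>real m - real n\<bar>}. \<bar>f m\<bar> / (\<bar>real m - real n\<bar> * sqrt \<bar>real m - real n\<bar>))"
        unfolding d_def by (subst sum.inter_filter[symmetric]) (auto simp: sum_distrib_left)
      also have "\<dots> \<le> C * (23 * A / sqrt (real 1))"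
      proof (intro mult_left_mono C tail_sum)
        fix j :: nat
        have "{m \<in> {..<M}. \<bar>real m - real n\<bar> \<le> real j} \<subseteq> {n-j..n+j}" by (auto simp: abs_le_iff)
        then have "(\<Sum>m\<in>{m \<in> {..<M}. \<bar>real m - real n\<bar> \<le> real j}. \<bar>f m\<bar>) \<le> (\<Sum>m=n-j..n+j. \<bar>f m\<bar>)" by (intro sum_mono2) auto
        then show "(\<Sum>m\<in>{m \<in> {..<M}. \<bar>real m - real n\<bar> \<le> real j}. \<bar>f m\<bar>) \<le> A * (2 * real j + 1)" using A[of j] by linarith
      qed auto
      finally show "(\<Sum>m<M. if 1 \<le> d m then C * (\<bar>f m\<bar> / (d m * sqrt (d m))) else 0) \<le> C * (23 * A / sqrt (real 1))" .
    qed
    finally show ?thesis .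
  qed
  show ?thesis by (rule summable_rabs_cancel, rule summableI_nonneg_bounded[OF abs_ge_zero bounded])
qed

context jacobi_half
begin

text \<open>The sum over j is finite, so exchanging it with the sum over m < R leaves finitely many
  series. Their summability ensures that the \<open>suminf\<close> in \<open>jacobi_heat\<close> is
  a genuine limit and not a default value.\<close>

lemma TK_tendsto:
  assumes a: "\<And>j. 0 < a j" and f: "avg_bounded f n"
  shows "(\<lambda>R. kop R (TK a b N1 N2) f n) \<longlonglongrightarrow> S_op al be a b N1 N2 f n"
proof -
  obtain C where C: "0 < C" "\<And>t n m. 0 < t \<Longrightarrow> n \<noteq> m \<Longrightarrow> \<bar>hk t n m\<bar> \<le> C * sqrt t / (real n - real m)\<^sup>2"
    using hk_decay by blast
  have sm: "summable (\<lambda>m. f m * hk t n m)" if t: "0 < t" for t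
    using C(1) t by (intro summable_avg_bounded[OF f, of "C * sqrt t"] C(2)) auto
  have "kop R (TK a b N1 N2) f n
      = (\<Sum>j\<in>{N1..N2}. b j * ((\<Sum>m<R. f m * hk (a (j + 1)) n m) - (\<Sum>m<R. f m * hk (a j) n m)))" for R
    unfolding kop_def TK_def sum_subtractf[symmetric] sum_distrib_left sum_distrib_right
    by (subst sum.swap) (simp add: algebra_simps)
  moreover have "(\<lambda>R. \<Sum>j\<in>{N1..N2}. b j * ((\<Sum>m<R. f m * hk (a (j + 1)) n m) - (\<Sum>m<R. f m * hk (a j) n m)))
      \<longlonglongrightarrow> S_op al be a b N1 N2 f n"
    unfolding S_op_def jacobi_heat_def
    by (intro tendsto_sum tendsto_mult tendsto_diff tendsto_const summable_LIMSEQ sm a)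
  ultimately show ?thesis by simp
qed

text \<open>The constant is fixed before a, b, N1 and N2, which is the claimed uniformity. For fixed
  N the bound on n < N passes to the limit in R; as it is independent of N, it gives both membership
  and the norm estimate.\<close>

theorem S_strong:
  assumes q: "1 < q" and Ap: "Ap_weight q w" and B: "0 \<le> B"
  obtains C where "\<And>a b N1 N2 f. (\<And>j. 0 < a j) \<Longrightarrow> (\<And>j. a j \<le> a (j + 1)) \<Longrightarrow> (\<And>j. \<bar>b j\<bar> \<le> B) \<Longrightarrow> N1 \<le> N2 \<Longrightarrow> in_lp q w f \<Longrightarrow>
    in_lp q w (S_op al be a b N1 N2 f) \<and> lp_norm q w (S_op al be a b N1 N2 f) \<le> C * lp_norm q w f"
proof -
  note w = Ap_weight_pos[OF Ap]
  obtain C0 C1 where C01: "0 \<le> C0" "0 \<le> C1"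
    "\<And>a b N1 N2. (\<And>j. 0 < a j) \<Longrightarrow> (\<And>j. a j \<le> a (j + 1)) \<Longrightarrow> (\<And>j. \<bar>b j\<bar> \<le> B) \<Longrightarrow> N1 \<le> N2 \<Longrightarrow>
       cz_kernel C0 C1 (B\<^sup>2) (TK a b N1 N2)"
    using TK_cz[OF B] by blast
  obtain C where C: "0 < C" "\<And>K f R N. cz_kernel C0 C1 (B\<^sup>2) K \<Longrightarrow> (\<And>k. R \<le> k \<Longrightarrow> f k = 0) \<Longrightarrow>
      (\<Sum>n<N. \<bar>kop R K f n\<bar> powr q * w n) \<le> C * (\<Sum>n<R. \<bar>f n\<bar> powr q * w n)"
    using cz_strong[OF q Ap C01(1,2) zero_le_power2] by blast
  show thesis
  proof (rule that[of "C powr (1 / q)"])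
    fix a b :: "int \<Rightarrow> real" and N1 N2 :: int and f :: "nat \<Rightarrow> real"
    assume A: "\<And>j. 0 < a j" "\<And>j. a j \<le> a (j + 1)" "\<And>j. \<bar>b j\<bar> \<le> B" "N1 \<le> N2" and f: "in_lp q w f"
    define K where "K = TK a b N1 N2"
    define S where "S = S_op al be a b N1 N2 f"
    have cz: "cz_kernel C0 C1 (B\<^sup>2) K" unfolding K_def by (rule C01(3)[where a=a and b=b, OF A])
    define F where "F = (\<Sum>n. \<bar>f n\<bar> powr q * w n)"
    have wn: "0 \<le> \<bar>g k\<bar> powr q * w k" for g :: "nat \<Rightarrow> real" and k using w[of k] by simp
    have F: "0 \<le> F" unfolding F_def using f wn unfolding in_lp_def by (intro suminf_nonneg) auto
    have lim: "(\<lambda>R. kop R K f n) \<longlonglongrightarrow> S n" for n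
      unfolding K_def S_def by (intro TK_tendsto A avg_bounded_Ap[OF q Ap f])
    have part: "(\<Sum>n<N. \<bar>S n\<bar> powr q * w n) \<le> C * F" for N
    proof (rule LIMSEQ_le_const2)
      show "(\<lambda>R. \<Sum>n<N. \<bar>kop R K f n\<bar> powr q * w n) \<longlonglongrightarrow> (\<Sum>n<N. \<bar>S n\<bar> powr q * w n)"
        using q by (intro tendsto_sum tendsto_mult tendsto_const tendsto_powr' tendsto_rabs lim) auto
      have "(\<Sum>n<N. \<bar>kop R K f n\<bar> powr q * w n) \<le> C * F" for R
      proof -
        have "(\<Sum>n<N. \<bar>kop R K f n\<bar> powr q * w n) \<le> C * (\<Sum>n<R. \<bar>if n < R then f n else 0\<bar> powr q * w n)"
          using C(2)[OF cz, of R "\<lambda>k. if k < R then f k else 0" N] unfolding kop_restrict by simp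
        also have "\<dots> \<le> C * F"
          unfolding F_def using f wn C(1) unfolding in_lp_def by (intro mult_left_mono) (auto intro!: sum_le_suminf)
        finally show ?thesis .
      qed
      then show "\<exists>M. \<forall>R\<ge>M. (\<Sum>n<N. \<bar>kop R K f n\<bar> powr q * w n) \<le> C * F" by blast
    qed
    have sm: "summable (\<lambda>n. \<bar>S n\<bar> powr q * w n)" by (rule summableI_nonneg_bounded[OF wn[of S] part])
    have "(\<Sum>n. \<bar>S n\<bar> powr q * w n) \<le> C * F" by (rule suminf_le_const[OF sm part])
    then have "lp_norm q w S \<le> (C * F) powr (1 / q)"
      using q suminf_nonneg[OF sm wn[of S]] unfolding lp_norm_def by (intro powr_mono2) auto
    also have "\<dots> = C powr (1 / q) * lp_norm q w f" unfolding lp_norm_def F_def[symmetric] using C(1) F by (simp add: powr_mult)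
    finally show "in_lp q w (S_op al be a b N1 N2 f) \<and> lp_norm q w (S_op al be a b N1 N2 f) \<le> C powr (1 / q) * lp_norm q w f"
      using sm unfolding in_lp_def S_def by blast
  qed
qed

theorem S_weak:
  assumes A1: "A1_weight w" and B: "0 \<le> B"
  obtains C where "\<And>a b N1 N2 f. (\<And>j. 0 < a j) \<Longrightarrow> (\<And>j. a j \<le> a (j + 1)) \<Longrightarrow> (\<And>j. \<bar>b j\<bar> \<le> B) \<Longrightarrow> N1 \<le> N2 \<Longrightarrow> in_lp 1 w f \<Longrightarrow>
    weak_l1_norm w (S_op al be a b N1 N2 f) \<le> ennreal (C * lp_norm 1 w f)"
proof -
  note w = A1_weight_pos[OF A1]
  obtain C0 C1 where C01: "0 \<le> C0" "0 \<le> C1"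
    "\<And>a b N1 N2. (\<And>j. 0 < a j) \<Longrightarrow> (\<And>j. a j \<le> a (j + 1)) \<Longrightarrow> (\<And>j. \<bar>b j\<bar> \<le> B) \<Longrightarrow> N1 \<le> N2 \<Longrightarrow>
       cz_kernel C0 C1 (B\<^sup>2) (TK a b N1 N2)"
    using TK_cz[OF B] by blast
  obtain C where C: "0 < C" "\<And>K f R N s. cz_kernel C0 C1 (B\<^sup>2) K \<Longrightarrow> (\<And>k. R \<le> k \<Longrightarrow> f k = 0) \<Longrightarrow> 0 < s \<Longrightarrow>
      s * (\<Sum>n\<in>{n\<in>{..<N}. s < \<bar>kop R K f n\<bar>}. w n) \<le> C * (\<Sum>n<R. \<bar>f n\<bar> * w n)"
    using cz_weak[OF A1 C01(1,2) zero_le_power2] by blast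
  show thesis
  proof (rule that[of C])
    fix a b :: "int \<Rightarrow> real" and N1 N2 :: int and f :: "nat \<Rightarrow> real"
    assume A: "\<And>j. 0 < a j" "\<And>j. a j \<le> a (j + 1)" "\<And>j. \<bar>b j\<bar> \<le> B" "N1 \<le> N2" and f: "in_lp 1 w f"
    define K where "K = TK a b N1 N2"
    define S where "S = S_op al be a b N1 N2 f"
    have cz: "cz_kernel C0 C1 (B\<^sup>2) K" unfolding K_def by (rule C01(3)[where a=a and b=b, OF A])
    define F where "F = (\<Sum>n. \<bar>f n\<bar> * w n)"
    have wn: "0 \<le> \<bar>g k\<bar> * w k" for g :: "nat \<Rightarrow> real" and k using w[of k] by simp
    have sf: "summable (\<lambda>n. \<bar>f n\<bar> * w n)" using f unfolding in_lp_def by simp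
    have F: "0 \<le> F" unfolding F_def by (rule suminf_nonneg[OF sf wn[of f]])
    have nF: "lp_norm 1 w f = F" unfolding lp_norm_def using F by (simp add: F_def)
    have lim: "(\<lambda>R. kop R K f n) \<longlonglongrightarrow> S n" for n
      unfolding K_def S_def by (intro TK_tendsto A avg_bounded_A1[OF A1 f])
    \<comment> \<open>Strict inequalities at finitely many points n < N persist for large R, so the
      level set of the limit is contained in that of a truncated operator.\<close>
    have part: "(\<Sum>n\<in>{n\<in>{..<N}. s < \<bar>S n\<bar>}. w n) \<le> C * F / s" if s: "0 < s" for N s
    proof -
      have "\<forall>\<^sub>F R in sequentially. \<forall>n\<in>{n\<in>{..<N}. s < \<bar>S n\<bar>}. s < \<bar>kop R K f n\<bar>"
        by (intro eventually_ball_finite ballI order_tendstoD(1)[OF tendsto_rabs[OF lim]]) auto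
      then obtain R where R: "\<And>n. n \<in> {n\<in>{..<N}. s < \<bar>S n\<bar>} \<Longrightarrow> s < \<bar>kop R K f n\<bar>"
        unfolding eventually_sequentially by blast
      have "s * (\<Sum>n\<in>{n\<in>{..<N}. s < \<bar>S n\<bar>}. w n) \<le> s * (\<Sum>n\<in>{n\<in>{..<N}. s < \<bar>kop R K f n\<bar>}. w n)"
        using s w R by (intro mult_left_mono sum_mono2) (auto simp: less_imp_le)
      also have "\<dots> \<le> C * (\<Sum>n<R. \<bar>if n < R then f n else 0\<bar> * w n)"
        using C(2)[OF cz _ s, of R "\<lambda>k. if k < R then f k else 0" N] unfolding kop_restrict by simp
      also have "\<dots> \<le> C * F"
        unfolding F_def using sf wn C(1) by (intro mult_left_mono) (auto intro!: sum_le_suminf)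
      finally show ?thesis using s by (simp add: pos_le_divide_eq mult.commute)
    qed
    have "weak_l1_norm w S \<le> ennreal (C * F)"
      unfolding weak_l1_norm_def
    proof (rule SUP_least)
      fix s :: real assume "s \<in> {0<..}"
      then have s: "0 < s" by simp
      have "(\<Sum>\<^sub>\<infinity>n\<in>{n. s < \<bar>S n\<bar>}. ennreal (w n)) \<le> ennreal (C * F / s)"
      proof (rule infsum_le_finite_sums)
        show "(\<lambda>n. ennreal (w n)) summable_on {n. s < \<bar>S n\<bar>}" by (rule nonneg_summable_on_complete) simp
        fix X assume X: "finite X" "X \<subseteq> {n. s < \<bar>S n\<bar>}"
        obtain N where "X \<subseteq> {..<N}" using finite_nat_iff_bounded X(1) by blast
        then have "(\<Sum>n\<in>X. w n) \<le> (\<Sum>n\<in>{n\<in>{..<N}. s < \<bar>S n\<bar>}. w n)"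
          using X w by (intro sum_mono2) (auto simp: less_imp_le)
        also have "\<dots> \<le> C * F / s" by (rule part[OF s])
        finally show "(\<Sum>n\<in>X. ennreal (w n)) \<le> ennreal (C * F / s)"
          using w by (simp add: less_imp_le ennreal_leI)
      qed
      then have "ennreal s * (\<Sum>\<^sub>\<infinity>n\<in>{n. s < \<bar>S n\<bar>}. ennreal (w n)) \<le> ennreal s * ennreal (C * F / s)"
        by (rule mult_left_mono) simp
      also have "\<dots> = ennreal (C * F)" using s by (simp flip: ennreal_mult')
      finally show "ennreal s * (\<Sum>\<^sub>\<infinity>n\<in>{n. s < \<bar>S n\<bar>}. ennreal (w n)) \<le> ennreal (C * F)" .
    qed
    then show "weak_l1_norm w (S_op al be a b N1 N2 f) \<le> ennreal (C * lp_norm 1 w f)" unfolding S_def nF .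
  qed
qed

end

theorem theorem3p1:
  fixes al be \<rho> :: real and a b :: "int \<Rightarrow> real"
  assumes "al \<ge> -1/2" and "be \<ge> -1/2"
    and "\<rho> > 1" and "\<forall>j. a j > 0" and "lacunary \<rho> a"
    and "\<exists>B. \<forall>j. \<bar>b j\<bar> \<le> B"
  shows
    "(\<forall>N1 N2 p w. N1 < N2 \<and> 1 < p \<and> Ap_weight p w \<longrightarrow>
        (\<exists>C. \<forall>f. in_lp p w f \<longrightarrow>
           in_lp p w (S_op al be a b N1 N2 f) \<and>
           lp_norm p w (S_op al be a b N1 N2 f) \<le> C * lp_norm p w f))
   \<and> (\<forall>N1 N2 w. N1 < N2 \<and> A1_weight w \<longrightarrow>
        (\<exists>C. \<forall>f. in_lp 1 w f \<longrightarrow>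
           weak_l1_norm w (S_op al be a b N1 N2 f) \<le> ennreal (C * lp_norm 1 w f)))
   \<and> (\<forall>p w. 1 < p \<and> Ap_weight p w \<longrightarrow>
        (\<exists>C. \<forall>N1 N2 f. N1 < N2 \<and> in_lp p w f \<longrightarrow>
           in_lp p w (S_op al be a b N1 N2 f) \<and>
           lp_norm p w (S_op al be a b N1 N2 f) \<le> C * lp_norm p w f))
   \<and> (\<forall>w. A1_weight w \<longrightarrow>
        (\<exists>C. \<forall>N1 N2 f. N1 < N2 \<and> in_lp 1 w f \<longrightarrow>
           weak_l1_norm w (S_op al be a b N1 N2 f) \<le> ennreal (C * lp_norm 1 w f)))"
proof -
  interpret jacobi_half al be by unfold_locales (use assms in auto)
  obtain B where b: "\<And>j. \<bar>b j\<bar> \<le> B" using assms(6) by blast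
  have B: "0 \<le> B" using b[of 0] by linarith
  have a: "\<And>j. 0 < a j" using assms(4) by blast
  have mono: "a j \<le> a (j + 1)" for j
  proof -
    have "1 * a j \<le> \<rho> * a j" using assms(3) a[of j] by (intro mult_right_mono) auto
    also have "\<dots> \<le> a (j + 1)" using assms(5)[unfolded lacunary_def, THEN spec, of j] a[of j] by (simp only: pos_le_divide_eq)
    finally show ?thesis by simp
  qed
  have strong: "\<exists>C. \<forall>N1 N2 f. N1 < N2 \<and> in_lp p w f \<longrightarrow>
      in_lp p w (S_op al be a b N1 N2 f) \<and> lp_norm p w (S_op al be a b N1 N2 f) \<le> C * lp_norm p w f"
    if p: "1 < p" "Ap_weight p w" for p w
  proof -
    obtain C where "\<And>a b N1 N2 f. (\<And>j. 0 < a j) \<Longrightarrow> (\<And>j. a j \<le> a (j + 1)) \<Longrightarrow> (\<And>j. \<bar>b j\<bar> \<le> B) \<Longrightarrow> N1 \<le> N2 \<Longrightarrow> in_lp p w f \<Longrightarrow>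
        in_lp p w (S_op al be a b N1 N2 f) \<and> lp_norm p w (S_op al be a b N1 N2 f) \<le> C * lp_norm p w f"
      using S_strong[OF p B] by blast
    from this[where a=a and b=b, OF a mono b] show ?thesis by (intro exI[of _ C]) auto
  qed
  have weak: "\<exists>C. \<forall>N1 N2 f. N1 < N2 \<and> in_lp 1 w f \<longrightarrow>
      weak_l1_norm w (S_op al be a b N1 N2 f) \<le> ennreal (C * lp_norm 1 w f)"
    if w: "A1_weight w" for w
  proof -
    obtain C where "\<And>a b N1 N2 f. (\<And>j. 0 < a j) \<Longrightarrow> (\<And>j. a j \<le> a (j + 1)) \<Longrightarrow> (\<And>j. \<bar>b j\<bar> \<le> B) \<Longrightarrow> N1 \<le> N2 \<Longrightarrow> in_lp 1 w f \<Longrightarrow>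
        weak_l1_norm w (S_op al be a b N1 N2 f) \<le> ennreal (C * lp_norm 1 w f)"
      using S_weak[OF w B] by blast
    from this[where a=a and b=b, OF a mono b] show ?thesis by (intro exI[of _ C]) auto
  qed
  \<comment> \<open>The bounds for a fixed pair N1, N2 are instances of the uniform ones.\<close>
  show ?thesis using strong weak by meson
qed

end
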